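(* Let $H$ be a quasitriangular quasi-Hopf algebra, let $(A,\mathrm{d})$ be a differential calculus in ${}^{H}\mathscr{M}$ and let $V,W$ be two objects in ${}^{H}_{A}\mathscr{M}^{\mathrm{sym}}_{A}$. Then $\mathrm{ad}_\bullet$ induces an ${}^{H}\mathscr{M}$-morphism $$\mathrm{ad}_\bullet:\ \mathrm{con}(W)\times_{I[1]}\mathrm{con}(V)\longrightarrow\mathrm{con}(\hom_A(V,W)),$$ i.e. for every $((L',c),(L,c))\in\mathrm{con}(W)\times_{I[1]}\mathrm{con}(V)$ the $k$-linear map $\mathscr{L}(L')-\mathscr{R}(L)$ on $\hom(V,W)$ restricts to $\hom_A(V,W)$, the restricted map together with $c$ is an element of $\mathrm{con}(\hom_A(V,W))$, and the resulting assignment is an ${}^{H}\mathscr{M}$-morphism.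
   Context: BASIC SETTING. $k$ is a commutative associative ring with unit. $H$ is a quasitriangular quasi-Hopf algebra over $k$, placed in degree $0$, with coproduct $\Delta(h)=h_{(1)}\otimes h_{(2)}$, counit $\epsilon$, invertible associator $\phi=\phi^{(1)}\otimes\phi^{(2)}\otimes\phi^{(3)}$ with inverse $\phi^{-1}=\phi^{(-1)}\otimes\phi^{(-2)}\otimes\phi^{(-3)}$, quasi-antipode $(S,\alpha,\beta)$ and universal $R$-matrix $R=R^{(1)}\otimes R^{(2)}$ (summations understood). Conventions: $(\mathrm{id}\otimes\Delta)\Delta(h)=\phi\,(\Delta\otimes\mathrm{id})\Delta(h)\,\phi^{-1}$; $S(h_{(1)})\alpha h_{(2)}=\epsilon(h)\alpha$; $h_{(1)}\beta S(h_{(2)})=\epsilon(h)\beta$; $\phi^{(1)}\beta S(\phi^{(2)})\alpha\phi^{(3)}=1=S(\phi^{(-1)})\alpha\phi^{(-2)}\beta S(\phi^{(-3)})$; $\Delta^{\mathrm{op}}(h)=R\,\Delta(h)\,R^{-1}$; the remaining axioms (pentagon, counit normalization, hexagons) are the ones making the following a braided monoidal category. ${}^{H}\mathscr{M}$: objects are bounded $\mathbb{Z}$-graded left $H$-modules $V=\bigoplus_n V_n$ ($V_n=0$ for all but finitely many $n$; action $\triangleright$ degree-preserving); morphisms are degree-preserving $H$-equivariant $k$-linear maps. $V\otimes W$ is the graded tensor product over $k$ with $h\triangleright(v\otimes w)=(h_{(1)}\triangleright v)\otimes(h_{(2)}\triangleright w)$; unit $I=k$ (degree $0$, action by $\epsilon$);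 associator $\Phi((v\otimes w)\otimes x)=(\phi^{(1)}\triangleright v)\otimes((\phi^{(2)}\triangleright w)\otimes(\phi^{(3)}\triangleright x))$; braiding $\tau(v\otimes w)=(-1)^{|v||w|}(R^{(2)}\triangleright w)\otimes(R^{(1)}\triangleright v)$. Internal hom: $\hom(V,W)=\bigoplus_n\bigoplus_{l-m=n}\mathrm{Hom}_k(V_m,W_l)$ with $h\triangleright L=(h_{(1)}\triangleright\cdot)\circ L\circ(S(h_{(2)})\triangleright\cdot)$. Currying bijection: for $f:V\otimes W\to X$, $\zeta(f)(v)=f((\phi^{(-1)}\triangleright v)\otimes((\phi^{(-2)}\beta S(\phi^{(-3)}))\triangleright(\cdot)))$; inverse: for $g:V\to\hom(W,X)$, $\zeta^{-1}(g)(v\otimes w)=\phi^{(1)}\triangleright(g(v)((S(\phi^{(2)})\alpha\phi^{(3)})\triangleright w))$. Evaluation $\mathrm{ev}=\zeta^{-1}(\mathrm{id}):\hom(V,W)\otimes V\to W$; internal composition $\bullet=\zeta(\mathrm{ev}\circ(\mathrm{id}\otimes\mathrm{ev})\circ\Phi):\hom(W,X)\otimes\hom(V,W)\to\hom(V,X)$. $\mathrm{end}(V)=\hom(V,V)$, unit $1=(\beta\triangleright\cdot)$. Commutator on $\mathrm{end}(V)$: $[L,L']=L\bullet L'-(-1)^{|L||L'|}(R^{(2)}\triangleright L')\bullet(R^{(1)}\triangleright L)$. ALGEBRAS AND BIMODULES. An algebra in ${}^{H}\mathscr{M}$ is an object $A$ with ${}^{H}\mathscr{M}$-morphisms product $\mu:A\otimes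 A\to A$ and unit $I\to A$, with $(aa')a''=(\phi^{(1)}\triangleright a)((\phi^{(2)}\triangleright a')(\phi^{(3)}\triangleright a''))$ and $1a=a=a1$; it is braided commutative (an object of ${}^{H}\mathscr{A}^{\mathrm{com}}$) if $\mu\circ\tau=\mu$. An $A$-bimodule $V$ in ${}^{H}\mathscr{M}$ has ${}^{H}\mathscr{M}$-morphisms $l:A\otimes V\to V$, $r:V\otimes A\to V$ (written by juxtaposition) that are unital and satisfy the module and bimodule axioms with brackets changed by $\Phi$; it is symmetric if $r\circ\tau=l$ and $l\circ\tau=r$. ${}^{H}_{A}\mathscr{M}^{\mathrm{sym}}_{A}$ is the category of symmetric $A$-bimodules. $\hat l=\zeta(l):A\to\mathrm{end}(V)$, and $[L,a]:=[L,\hat l(a)]$ for $L\in\mathrm{end}(V)$, $a\in A$. INTERNAL HOM OVER $A$. For $V,W$ in ${}^{H}_{A}\mathscr{M}^{\mathrm{sym}}_{A}$ and $L\in\hom(V,W)$, $a\in A$ put $[L,a]=L\bullet\hat l(a)-(-1)^{|L||a|}\,\hat l(R^{(2)}\triangleright a)\bullet(R^{(1)}\triangleright L)$. Then $\hom_A(V,W)=\mathrm{Ker}(\zeta([\cdot,\cdot]))\subseteq\hom(V,W)$, where $[\cdot,\cdot]:\hom(V,W)\otimes A\to\hom(V,W)$; it is an object of ${}^{H}_{A}\mathscr{M}^{\mathrm{sym}}_{A}$ with left action $l=\bullet\circ(\hat l\otimes\mathrm{id})$ and right action $r=\bullet\circ(\mathrm{id}\otimes\hat l)$. DIFFERENTIAL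 CALCULUS AND CONNECTIONS. $I[1]$ is $k$ placed in degree $1$ with $H$ acting by $\epsilon$. Derivations: $\mathrm{der}(A)=\mathrm{Ker}\,\zeta([\cdot,\cdot]-\hat l\circ\mathrm{ev})\subseteq\mathrm{end}(A)$, where $[\cdot,\cdot]-\hat l\circ\mathrm{ev}:\mathrm{end}(A)\otimes A\to\mathrm{end}(A)$, $L\otimes a\mapsto[L,a]-\hat l(\mathrm{ev}(L\otimes a))$. A differential calculus $(A,\mathrm{d})$ in ${}^{H}\mathscr{M}$ is an object $A$ of ${}^{H}\mathscr{A}^{\mathrm{com}}$ with an ${}^{H}\mathscr{M}$-morphism $\mathrm{d}:I[1]\to\mathrm{der}(A)$ such that $\mathrm{d}(c)\bullet\mathrm{d}(c')=0$ for all $c,c'$. With $\times$ the categorical product in ${}^{H}\mathscr{M}$, $\mathrm{con}(V)=\mathrm{Ker}\,\zeta(f)\subseteq\mathrm{end}(V)\times I[1]$, where $f:(\mathrm{end}(V)\times I[1])\otimes A\to\mathrm{end}(V)$, $f((L,c)\otimes a)=[L,a]-\hat l(\mathrm{ev}(\mathrm{d}(c)\otimes a))$. ADJOINT. $\mathscr{L}=\zeta(\bullet):\mathrm{end}(W)\to\mathrm{end}(\hom(V,W))$ and $\mathscr{R}=\zeta(\bullet\circ\tau):\mathrm{end}(V)\to\mathrm{end}(\hom(V,W))$. $\mathrm{ad}_\bullet:(\mathrm{end}(W)\times I[1])\times(\mathrm{end}(V)\times I[1])\to\mathrm{end}(\hom(V,W))\times I[1]$, $((L',c'),(L,c))\mapsto(\mathscr{L}(L')-\mathscr{R}(L),c')$.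 $\mathrm{con}(W)\times_{I[1]}\mathrm{con}(V)$ is the fibred product over the projections to $I[1]$: pairs $((L',c'),(L,c))$ with $c'=c$. *)

theory Defs
  imports "HOL-Algebra.Generated_Groups" "HOL-Algebra.Free_Abelian_Groups" "HOL-Algebra.Module"
begin

section \<open>Tensor products over a commutative ring\<close>

text \<open>
  \<open>V \<otimes> W\<close> is the free abelian group on \<open>carrier V \<times> carrier W\<close> modulo the biadditivity
  and \<open>k\<close>-balancedness relations; its elements are cosets.
\<close>

type_synonym ('v, 'w) tens = "('v \<times> 'w \<Rightarrow>\<^sub>0 int) set"

definition tensor_rels ::
  "'k ring \<Rightarrow> ('k, 'v, 'm) module_scheme \<Rightarrow> ('k, 'w, 'n) module_scheme \<Rightarrow> ('v \<times> 'w \<Rightarrow>\<^sub>0 int) set" where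
  "tensor_rels k V W =
     {frag_of (v \<oplus>\<^bsub>V\<^esub> v', w) - (frag_of (v, w) + frag_of (v', w)) | v v' w.
        v \<in> carrier V \<and> v' \<in> carrier V \<and> w \<in> carrier W}
   \<union> {frag_of (v, w \<oplus>\<^bsub>W\<^esub> w') - (frag_of (v, w) + frag_of (v, w')) | v w w'.
        v \<in> carrier V \<and> w \<in> carrier W \<and> w' \<in> carrier W}
   \<union> {frag_of (c \<odot>\<^bsub>V\<^esub> v, w) - frag_of (v, c \<odot>\<^bsub>W\<^esub> w) | c v w.
        c \<in> carrier k \<and> v \<in> carrier V \<and> w \<in> carrier W}"

definition tensor_null ::
  "'k ring \<Rightarrow> ('k, 'v, 'm) module_scheme \<Rightarrow> ('k, 'w, 'n) module_scheme \<Rightarrow> ('v \<times> 'w \<Rightarrow>\<^sub>0 int) set" where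
  "tensor_null k V W =
     generate (free_Abelian_group (carrier V \<times> carrier W)) (tensor_rels k V W)"

definition tpure ::
  "'k ring \<Rightarrow> ('k, 'v, 'm) module_scheme \<Rightarrow> ('k, 'w, 'n) module_scheme \<Rightarrow> 'v \<Rightarrow> 'w \<Rightarrow> ('v, 'w) tens" where
  "tpure k V W v w =
     tensor_null k V W #>\<^bsub>free_Abelian_group (carrier V \<times> carrier W)\<^esub> frag_of (v, w)"

text \<open>
  The additive map \<open>v \<otimes> w \<mapsto> b v w\<close> into \<open>X\<close> induced by a \<open>k\<close>-balanced biadditive \<open>b\<close>.
  It also renders summations over components: \<open>tlift X b (comul H h)\<close> is the sum of
  \<open>b a c\<close> over the components \<open>a \<otimes> c\<close> of the coproduct of \<open>h\<close>.
\<close>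

definition tlift ::
  "('x, 'm) ring_scheme \<Rightarrow> ('v \<Rightarrow> 'w \<Rightarrow> 'x) \<Rightarrow> ('v, 'w) tens \<Rightarrow> 'x" where
  "tlift X b T =
     the_elem ((\<lambda>t. \<Oplus>\<^bsub>X\<^esub>p\<in>Poly_Mapping.keys t. [Poly_Mapping.lookup t p] \<cdot>\<^bsub>X\<^esub> b (fst p) (snd p)) ` T)"

definition tlift3 ::
  "('x, 'm) ring_scheme \<Rightarrow> ('u \<Rightarrow> 'v \<Rightarrow> 'w \<Rightarrow> 'x) \<Rightarrow> (('u, 'v) tens, 'w) tens \<Rightarrow> 'x" where
  "tlift3 X b T = tlift X (\<lambda>s w. tlift X (\<lambda>u v. b u v w) s) T"

definition tensor_group ::
  "'k ring \<Rightarrow> ('k, 'v, 'm) module_scheme \<Rightarrow> ('k, 'w, 'n) module_scheme \<Rightarrow> ('v, 'w) tens ring" where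
  "tensor_group k V W =
     (let Q = free_Abelian_group (carrier V \<times> carrier W) Mod tensor_null k V W
      in \<lparr>carrier = carrier Q, mult = undefined, one = undefined,
          zero = one Q, add = monoid.mult Q\<rparr>)"

text \<open>
  The fields \<open>mult\<close> and \<open>one\<close> are the algebra structure \<open>(v \<otimes> w)(v' \<otimes> w') = vv' \<otimes> ww'\<close>;
  they are meaningful only if both factors are \<open>k\<close>-algebras.
\<close>

definition tensor ::
  "'k ring \<Rightarrow> ('k, 'v, 'm) module_scheme \<Rightarrow> ('k, 'w, 'n) module_scheme \<Rightarrow> ('k, ('v, 'w) tens) module" where
  "tensor k V W =
     (let G = tensor_group k V W
      in \<lparr>carrier = carrier G,
          mult = (\<lambda>S T. tlift G (\<lambda>v w. tlift G (\<lambda>v' w'.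
                    tpure k V W (v \<otimes>\<^bsub>V\<^esub> v') (w \<otimes>\<^bsub>W\<^esub> w')) T) S),
          one = tpure k V W \<one>\<^bsub>V\<^esub> \<one>\<^bsub>W\<^esub>,
          zero = zero G, add = add G,
          smult = (\<lambda>c. tlift G (\<lambda>v w. tpure k V W (c \<odot>\<^bsub>V\<^esub> v) w))\<rparr>)"

definition tmap ::
  "'k ring \<Rightarrow> ('k, 'x, 'm) module_scheme \<Rightarrow> ('k, 'y, 'n) module_scheme \<Rightarrow>
   ('v \<Rightarrow> 'x) \<Rightarrow> ('w \<Rightarrow> 'y) \<Rightarrow> ('v, 'w) tens \<Rightarrow> ('x, 'y) tens" where
  "tmap k X Y f g = tlift (tensor k X Y) (\<lambda>v w. tpure k X Y (f v) (g w))"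

text \<open>The canonical identification \<open>U \<otimes> (V \<otimes> W) \<rightarrow> (U \<otimes> V) \<otimes> W\<close>.\<close>

definition tassoc ::
  "'k ring \<Rightarrow> ('k, 'u, 'l) module_scheme \<Rightarrow> ('k, 'v, 'm) module_scheme \<Rightarrow> ('k, 'w, 'n) module_scheme \<Rightarrow>
   ('u, ('v, 'w) tens) tens \<Rightarrow> (('u, 'v) tens, 'w) tens" where
  "tassoc k U V W =
     (let X = tensor k (tensor k U V) W
      in tlift X (\<lambda>u s. tlift X (\<lambda>v w. tpure k (tensor k U V) W (tpure k U V u v) w) s))"

definition k_linear ::
  "'k ring \<Rightarrow> ('k, 'v, 'm) module_scheme \<Rightarrow> ('k, 'w, 'n) module_scheme \<Rightarrow> ('v \<Rightarrow> 'w) \<Rightarrow> bool" where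
  "k_linear k V W f \<longleftrightarrow>
     f \<in> carrier V \<rightarrow> carrier W \<and>
     (\<forall>v\<in>carrier V. \<forall>v'\<in>carrier V. f (v \<oplus>\<^bsub>V\<^esub> v') = f v \<oplus>\<^bsub>W\<^esub> f v') \<and>
     (\<forall>c\<in>carrier k. \<forall>v\<in>carrier V. f (c \<odot>\<^bsub>V\<^esub> v) = c \<odot>\<^bsub>W\<^esub> f v)"


section \<open>Quasitriangular quasi-Hopf algebras\<close>

text \<open>Higher tensor powers of \<open>H\<close> are bracketed to the left.\<close>

record ('k, 'h) qhopf = "('k, 'h) module" +
  comul :: "'h \<Rightarrow> ('h, 'h) tens"
  counit :: "'h \<Rightarrow> 'k"
  phi :: "(('h, 'h) tens, 'h) tens"
  antip :: "'h \<Rightarrow> 'h"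
  alpha :: 'h
  beta :: 'h
  rmat :: "('h, 'h) tens"

abbreviation tensor2 :: "'k ring \<Rightarrow> ('k, 'h) qhopf \<Rightarrow> ('k, ('h, 'h) tens) module" where
  "tensor2 k H \<equiv> tensor k H H"

abbreviation tensor3 :: "'k ring \<Rightarrow> ('k, 'h) qhopf \<Rightarrow> ('k, (('h, 'h) tens, 'h) tens) module" where
  "tensor3 k H \<equiv> tensor k (tensor2 k H) H"

abbreviation tensor4 :: "'k ring \<Rightarrow> ('k, 'h) qhopf \<Rightarrow> ('k, ((('h, 'h) tens, 'h) tens, 'h) tens) module" where
  "tensor4 k H \<equiv> tensor k (tensor3 k H) H"

abbreviation pure2 :: "'k ring \<Rightarrow> ('k, 'h) qhopf \<Rightarrow> 'h \<Rightarrow> 'h \<Rightarrow> ('h, 'h) tens" where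
  "pure2 k H \<equiv> tpure k H H"

abbreviation pure3 :: "'k ring \<Rightarrow> ('k, 'h) qhopf \<Rightarrow> 'h \<Rightarrow> 'h \<Rightarrow> 'h \<Rightarrow> (('h, 'h) tens, 'h) tens" where
  "pure3 k H a b c \<equiv> tpure k (tensor2 k H) H (pure2 k H a b) c"

definition phi_inv :: "'k ring \<Rightarrow> ('k, 'h) qhopf \<Rightarrow> (('h, 'h) tens, 'h) tens" where
  "phi_inv k H = inv\<^bsub>tensor3 k H\<^esub> (phi H)"

text \<open>\<open>comul_left\<close> is \<open>\<Delta> \<otimes> id\<close> and \<open>comul_right\<close> is \<open>id \<otimes> \<Delta>\<close>, both from \<open>H\<otimes>H\<close> to \<open>(H\<otimes>H)\<otimes>H\<close>.\<close>

definition comul_left :: "'k ring \<Rightarrow> ('k, 'h) qhopf \<Rightarrow> ('h, 'h) tens \<Rightarrow> (('h, 'h) tens, 'h) tens" where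
  "comul_left k H = tmap k (tensor2 k H) H (comul H) id"

definition comul_right :: "'k ring \<Rightarrow> ('k, 'h) qhopf \<Rightarrow> ('h, 'h) tens \<Rightarrow> (('h, 'h) tens, 'h) tens" where
  "comul_right k H t = tassoc k H H H (tmap k H (tensor2 k H) id (comul H) t)"

locale quasi_bialgebra = module k H + ring H
  for k :: "'k ring" and H :: "('k, 'h) qhopf" +
  assumes smult_mult_left:
      "\<lbrakk>c \<in> carrier k; g \<in> carrier H; h \<in> carrier H\<rbrakk>
        \<Longrightarrow> (c \<odot>\<^bsub>H\<^esub> g) \<otimes>\<^bsub>H\<^esub> h = c \<odot>\<^bsub>H\<^esub> (g \<otimes>\<^bsub>H\<^esub> h)"
    and smult_mult_right:
      "\<lbrakk>c \<in> carrier k; g \<in> carrier H; h \<in> carrier H\<rbrakk>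
        \<Longrightarrow> g \<otimes>\<^bsub>H\<^esub> (c \<odot>\<^bsub>H\<^esub> h) = c \<odot>\<^bsub>H\<^esub> (g \<otimes>\<^bsub>H\<^esub> h)"
    and comul_hom: "comul H \<in> ring_hom H (tensor2 k H)"
    and comul_linear: "k_linear k H (tensor2 k H) (comul H)"
    and counit_hom: "counit H \<in> ring_hom H k"
    and counit_smult:
      "\<lbrakk>c \<in> carrier k; h \<in> carrier H\<rbrakk> \<Longrightarrow> counit H (c \<odot>\<^bsub>H\<^esub> h) = c \<otimes>\<^bsub>k\<^esub> counit H h"
    and counit_left: "h \<in> carrier H \<Longrightarrow> tlift H (\<lambda>a b. counit H a \<odot>\<^bsub>H\<^esub> b) (comul H h) = h"
    and counit_right: "h \<in> carrier H \<Longrightarrow> tlift H (\<lambda>a b. counit H b \<odot>\<^bsub>H\<^esub> a) (comul H h) = h"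
    and phi_unit: "phi H \<in> Units (tensor3 k H)"
    and quasi_coassoc: "h \<in> carrier H \<Longrightarrow>
      comul_right k H (comul H h) =
      phi H \<otimes>\<^bsub>tensor3 k H\<^esub> comul_left k H (comul H h) \<otimes>\<^bsub>tensor3 k H\<^esub> phi_inv k H"
    \<comment> \<open>\<open>(id \<otimes> id \<otimes> \<Delta>)(\<phi>) (\<Delta> \<otimes> id \<otimes> id)(\<phi>) = (1 \<otimes> \<phi>) (id \<otimes> \<Delta> \<otimes> id)(\<phi>) (\<phi> \<otimes> 1)\<close>\<close>
    and pentagon:
      "tassoc k (tensor2 k H) H H (tmap k (tensor2 k H) (tensor2 k H) id (comul H) (phi H))
         \<otimes>\<^bsub>tensor4 k H\<^esub> tmap k (tensor3 k H) H (comul_left k H) id (phi H) =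
       tmap k (tensor3 k H) H (tmap k (tensor2 k H) H (pure2 k H \<one>\<^bsub>H\<^esub>) id) id (phi H)
         \<otimes>\<^bsub>tensor4 k H\<^esub> tmap k (tensor3 k H) H (comul_right k H) id (phi H)
         \<otimes>\<^bsub>tensor4 k H\<^esub> tpure k (tensor3 k H) H (phi H) \<one>\<^bsub>H\<^esub>"
    and phi_counit:
      "tlift3 (tensor2 k H) (\<lambda>a b c. pure2 k H a (counit H b \<odot>\<^bsub>H\<^esub> c)) (phi H) = \<one>\<^bsub>tensor2 k H\<^esub>"

locale quasi_hopf_algebra = quasi_bialgebra k H
  for k :: "'k ring" and H :: "('k, 'h) qhopf" +
  assumes antip_bij: "bij_betw (antip H) (carrier H) (carrier H)"
    and antip_linear: "k_linear k H H (antip H)"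
    and antip_one: "antip H \<one>\<^bsub>H\<^esub> = \<one>\<^bsub>H\<^esub>"
    and antip_mult:
      "\<lbrakk>g \<in> carrier H; h \<in> carrier H\<rbrakk> \<Longrightarrow> antip H (g \<otimes>\<^bsub>H\<^esub> h) = antip H h \<otimes>\<^bsub>H\<^esub> antip H g"
    and alpha_closed: "alpha H \<in> carrier H"
    and beta_closed: "beta H \<in> carrier H"
    and antip_alpha: "h \<in> carrier H \<Longrightarrow>
      tlift H (\<lambda>a b. antip H a \<otimes>\<^bsub>H\<^esub> alpha H \<otimes>\<^bsub>H\<^esub> b) (comul H h) = counit H h \<odot>\<^bsub>H\<^esub> alpha H"
    and antip_beta: "h \<in> carrier H \<Longrightarrow>
      tlift H (\<lambda>a b. a \<otimes>\<^bsub>H\<^esub> beta H \<otimes>\<^bsub>H\<^esub> antip H b) (comul H h) = counit H h \<odot>\<^bsub>H\<^esub> beta H"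
    and antip_phi:
      "tlift3 H (\<lambda>a b c. a \<otimes>\<^bsub>H\<^esub> beta H \<otimes>\<^bsub>H\<^esub> antip H b \<otimes>\<^bsub>H\<^esub> alpha H \<otimes>\<^bsub>H\<^esub> c) (phi H) = \<one>\<^bsub>H\<^esub>"
    and antip_phi_inv:
      "tlift3 H (\<lambda>a b c. antip H a \<otimes>\<^bsub>H\<^esub> alpha H \<otimes>\<^bsub>H\<^esub> b \<otimes>\<^bsub>H\<^esub> beta H \<otimes>\<^bsub>H\<^esub> antip H c) (phi_inv k H) = \<one>\<^bsub>H\<^esub>"

text \<open>
  \<open>leg\<close> rewrites the three components of an element of \<open>H\<otimes>H\<otimes>H\<close>, \<open>rleg\<close> places the two
  components of \<open>R\<close>. The hexagon conditions are
  \<open>(\<phi>\<^sup>3\<otimes>\<phi>\<^sup>1\<otimes>\<phi>\<^sup>2) (id\<otimes>\<Delta>)(R) \<phi> = R\<^sub>1\<^sub>3 (\<phi>\<^sup>2\<otimes>\<phi>\<^sup>1\<otimes>\<phi>\<^sup>3) R\<^sub>1\<^sub>2\<close> and, with \<open>\<psi> = \<phi>\<^sup>-\<^sup>1\<close>,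
  \<open>(\<psi>\<^sup>2\<otimes>\<psi>\<^sup>3\<otimes>\<psi>\<^sup>1) (\<Delta>\<otimes>id)(R) \<psi> = R\<^sub>1\<^sub>3 (\<psi>\<^sup>1\<otimes>\<psi>\<^sup>3\<otimes>\<psi>\<^sup>2) R\<^sub>2\<^sub>3\<close>; they are obtained by
  evaluating the two hexagon diagrams of the associator and braiding defined below.
\<close>

definition leg ::
  "'k ring \<Rightarrow> ('k, 'h) qhopf \<Rightarrow> ('h \<Rightarrow> 'h \<Rightarrow> 'h \<Rightarrow> (('h, 'h) tens, 'h) tens) \<Rightarrow>
   (('h, 'h) tens, 'h) tens \<Rightarrow> (('h, 'h) tens, 'h) tens" where
  "leg k H = tlift3 (tensor3 k H)"

definition rleg ::
  "'k ring \<Rightarrow> ('k, 'h) qhopf \<Rightarrow> ('h \<Rightarrow> 'h \<Rightarrow> (('h, 'h) tens, 'h) tens) \<Rightarrow> (('h, 'h) tens, 'h) tens" where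
  "rleg k H b = tlift (tensor3 k H) b (rmat H)"

locale quasitriangular_quasi_hopf = quasi_hopf_algebra k H
  for k :: "'k ring" and H :: "('k, 'h) qhopf" +
  assumes rmat_unit: "rmat H \<in> Units (tensor2 k H)"
    and rmat_comul: "h \<in> carrier H \<Longrightarrow>
      tlift (tensor2 k H) (\<lambda>a b. pure2 k H b a) (comul H h) =
      rmat H \<otimes>\<^bsub>tensor2 k H\<^esub> comul H h \<otimes>\<^bsub>tensor2 k H\<^esub> inv\<^bsub>tensor2 k H\<^esub> (rmat H)"
    and hexagon_right:
      "leg k H (\<lambda>a b c. pure3 k H c a b) (phi H)
         \<otimes>\<^bsub>tensor3 k H\<^esub> comul_right k H (rmat H) \<otimes>\<^bsub>tensor3 k H\<^esub> phi H =
       rleg k H (\<lambda>a b. pure3 k H a \<one>\<^bsub>H\<^esub> b)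
         \<otimes>\<^bsub>tensor3 k H\<^esub> leg k H (\<lambda>a b c. pure3 k H b a c) (phi H)
         \<otimes>\<^bsub>tensor3 k H\<^esub> rleg k H (\<lambda>a b. pure3 k H a b \<one>\<^bsub>H\<^esub>)"
    and hexagon_left:
      "leg k H (\<lambda>a b c. pure3 k H b c a) (phi_inv k H)
         \<otimes>\<^bsub>tensor3 k H\<^esub> comul_left k H (rmat H) \<otimes>\<^bsub>tensor3 k H\<^esub> phi_inv k H =
       rleg k H (\<lambda>a b. pure3 k H a \<one>\<^bsub>H\<^esub> b)
         \<otimes>\<^bsub>tensor3 k H\<^esub> leg k H (\<lambda>a b c. pure3 k H a c b) (phi_inv k H)
         \<otimes>\<^bsub>tensor3 k H\<^esub> rleg k H (\<lambda>a b. pure3 k H \<one>\<^bsub>H\<^esub> a b)"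


section \<open>The category of bounded graded left modules\<close>

text \<open>The inherited fields \<open>mult\<close> and \<open>one\<close> of an object carry no meaning.\<close>

record ('k, 'h, 'v) gmod = "('k, 'v) module" +
  act :: "'h \<Rightarrow> 'v \<Rightarrow> 'v"
  grade :: "int \<Rightarrow> 'v set"

definition gsupp :: "('k, 'h, 'v, 'm) gmod_scheme \<Rightarrow> int set" where
  "gsupp V = {n. grade V n \<noteq> {\<zero>\<^bsub>V\<^esub>}}"

locale hmod = module k V
  for k :: "'k ring" and H :: "('k, 'h) qhopf" and V :: "('k, 'h, 'v, 'm) gmod_scheme" +
  assumes act_linear: "h \<in> carrier H \<Longrightarrow> k_linear k V V (act V h)"
    and act_add:
      "\<lbrakk>g \<in> carrier H; h \<in> carrier H; v \<in> carrier V\<rbrakk> \<Longrightarrow> act V (g \<oplus>\<^bsub>H\<^esub> h) v = act V g v \<oplus>\<^bsub>V\<^esub> act V h v"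
    and act_smult:
      "\<lbrakk>c \<in> carrier k; h \<in> carrier H; v \<in> carrier V\<rbrakk> \<Longrightarrow> act V (c \<odot>\<^bsub>H\<^esub> h) v = c \<odot>\<^bsub>V\<^esub> act V h v"
    and act_mult:
      "\<lbrakk>g \<in> carrier H; h \<in> carrier H; v \<in> carrier V\<rbrakk> \<Longrightarrow> act V (g \<otimes>\<^bsub>H\<^esub> h) v = act V g (act V h v)"
    and act_one: "v \<in> carrier V \<Longrightarrow> act V \<one>\<^bsub>H\<^esub> v = v"
    and grade_submodule: "submodule (grade V n) k V"
    and grade_act: "\<lbrakk>h \<in> carrier H; v \<in> grade V n\<rbrakk> \<Longrightarrow> act V h v \<in> grade V n"
    and grade_bounded: "finite (gsupp V)"
    and grade_direct_sum:
      "v \<in> carrier V \<Longrightarrow> \<exists>!c. (\<forall>n. c n \<in> grade V n) \<and> v = (\<Oplus>\<^bsub>V\<^esub>n\<in>gsupp V. c n)"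

definition gproj :: "('k, 'h, 'v, 'm) gmod_scheme \<Rightarrow> 'v \<Rightarrow> int \<Rightarrow> 'v" where
  "gproj V v = (THE c. (\<forall>n. c n \<in> grade V n) \<and> v = (\<Oplus>\<^bsub>V\<^esub>n\<in>gsupp V. c n))"

definition hmorph ::
  "'k ring \<Rightarrow> ('k, 'h) qhopf \<Rightarrow> ('k, 'h, 'v, 'm) gmod_scheme \<Rightarrow> ('k, 'h, 'w, 'n) gmod_scheme \<Rightarrow>
   ('v \<Rightarrow> 'w) \<Rightarrow> bool" where
  "hmorph k H V W f \<longleftrightarrow>
     k_linear k V W f \<and>
     (\<forall>h\<in>carrier H. \<forall>v\<in>carrier V. f (act V h v) = act W h (f v)) \<and>
     (\<forall>n. f ` grade V n \<subseteq> grade W n)"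

text \<open>\<open>shifted_unit k H n\<close> is \<open>k\<close> placed in degree \<open>n\<close>.\<close>

definition shifted_unit :: "'k ring \<Rightarrow> ('k, 'h) qhopf \<Rightarrow> int \<Rightarrow> ('k, 'h, 'k) gmod" where
  "shifted_unit k H n =
     \<lparr>carrier = carrier k, mult = monoid.mult k, one = one k, zero = zero k, add = add k,
      smult = monoid.mult k,
      act = (\<lambda>h c. counit H h \<otimes>\<^bsub>k\<^esub> c),
      grade = (\<lambda>m. if m = n then carrier k else {\<zero>\<^bsub>k\<^esub>})\<rparr>"

definition gtensor ::
  "'k ring \<Rightarrow> ('k, 'h) qhopf \<Rightarrow> ('k, 'h, 'v, 'm) gmod_scheme \<Rightarrow> ('k, 'h, 'w, 'n) gmod_scheme \<Rightarrow>
   ('k, 'h, ('v, 'w) tens) gmod" where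
  "gtensor k H V W =
     module.extend (tensor k V W)
       (gmod.fields
         (\<lambda>h. tlift (tensor k V W) (\<lambda>v w.
            tlift (tensor k V W) (\<lambda>a b. tpure k V W (act V a v) (act W b w)) (comul H h)))
         (\<lambda>n. generate (add_monoid (tensor k V W))
            {tpure k V W v w | v w p q. v \<in> grade V p \<and> w \<in> grade W q \<and> p + q = n}))"

definition gprod ::
  "('k, 'h, 'v, 'm) gmod_scheme \<Rightarrow> ('k, 'h, 'w, 'n) gmod_scheme \<Rightarrow> ('k, 'h, 'v \<times> 'w) gmod" where
  "gprod V W =
     \<lparr>carrier = carrier V \<times> carrier W, mult = undefined, one = undefined,
      zero = (\<zero>\<^bsub>V\<^esub>, \<zero>\<^bsub>W\<^esub>),
      add = (\<lambda>x y. (fst x \<oplus>\<^bsub>V\<^esub> fst y, snd x \<oplus>\<^bsub>W\<^esub> snd y)),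
      smult = (\<lambda>c x. (c \<odot>\<^bsub>V\<^esub> fst x, c \<odot>\<^bsub>W\<^esub> snd x)),
      act = (\<lambda>h x. (act V h (fst x), act W h (snd x))),
      grade = (\<lambda>n. grade V n \<times> grade W n)\<rparr>"

definition subobj :: "('k, 'h, 'v) gmod \<Rightarrow> ('v \<Rightarrow> bool) \<Rightarrow> ('k, 'h, 'v) gmod" where
  "subobj V P = V\<lparr>carrier := {v \<in> carrier V. P v}, grade := (\<lambda>n. {v \<in> grade V n. P v})\<rparr>"

definition ker_obj ::
  "('k, 'h, 'v) gmod \<Rightarrow> ('k, 'h, 'x, 'm) gmod_scheme \<Rightarrow> ('v \<Rightarrow> 'x) \<Rightarrow> ('k, 'h, 'v) gmod" where
  "ker_obj V X f = subobj V (\<lambda>v. f v = \<zero>\<^bsub>X\<^esub>)"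


subsection \<open>Associator and braiding\<close>

definition assoc ::
  "'k ring \<Rightarrow> ('k, 'h) qhopf \<Rightarrow> ('k, 'h, 'v, 'l) gmod_scheme \<Rightarrow> ('k, 'h, 'w, 'm) gmod_scheme \<Rightarrow>
   ('k, 'h, 'x, 'n) gmod_scheme \<Rightarrow> (('v, 'w) tens, 'x) tens \<Rightarrow> ('v, ('w, 'x) tens) tens" where
  "assoc k H V W X =
     (let WX = gtensor k H W X; T = gtensor k H V WX
      in tlift3 T (\<lambda>v w x.
           tlift3 T (\<lambda>a b c. tpure k V WX (act V a v) (tpure k W X (act W b w) (act X c x))) (phi H)))"

definition koszul :: "int \<Rightarrow> int \<Rightarrow> int" where
  "koszul p q = (if odd p \<and> odd q then - 1 else 1)"

definition braid ::
  "'k ring \<Rightarrow> ('k, 'h) qhopf \<Rightarrow> ('k, 'h, 'v, 'm) gmod_scheme \<Rightarrow> ('k, 'h, 'w, 'n) gmod_scheme \<Rightarrow>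
   ('v, 'w) tens \<Rightarrow> ('w, 'v) tens" where
  "braid k H V W =
     (let T = gtensor k H W V
      in tlift T (\<lambda>v w. \<Oplus>\<^bsub>T\<^esub>p\<in>gsupp V. \<Oplus>\<^bsub>T\<^esub>q\<in>gsupp W.
           [koszul p q] \<cdot>\<^bsub>T\<^esub>
             tlift T (\<lambda>a b. tpure k W V (act W b (gproj W w q)) (act V a (gproj V v p))) (rmat H)))"


subsection \<open>Internal hom, evaluation and composition\<close>

text \<open>
  Since \<open>V\<close> and \<open>W\<close> are bounded, the direct sum of all \<open>Hom\<^sub>k(V\<^sub>m, W\<^sub>l)\<close> is the module of all
  \<open>k\<close>-linear maps; degree \<open>n\<close> consists of the maps raising degrees by \<open>n\<close>. Elements are
  extensional functions, so that equality is equality on \<open>carrier V\<close>.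
\<close>

definition ihom ::
  "'k ring \<Rightarrow> ('k, 'h) qhopf \<Rightarrow> ('k, 'h, 'v, 'm) gmod_scheme \<Rightarrow> ('k, 'h, 'w, 'n) gmod_scheme \<Rightarrow>
   ('k, 'h, 'v \<Rightarrow> 'w) gmod" where
  "ihom k H V W =
     (let C = {L \<in> extensional (carrier V). k_linear k V W L}
      in \<lparr>carrier = C, mult = undefined, one = undefined,
          zero = (\<lambda>v\<in>carrier V. \<zero>\<^bsub>W\<^esub>),
          add = (\<lambda>L L'. \<lambda>v\<in>carrier V. L v \<oplus>\<^bsub>W\<^esub> L' v),
          smult = (\<lambda>c L. \<lambda>v\<in>carrier V. c \<odot>\<^bsub>W\<^esub> L v),
          act = (\<lambda>h L. \<lambda>v\<in>carrier V.
                   tlift W (\<lambda>a b. act W a (L (act V (antip H b) v))) (comul H h)),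
          grade = (\<lambda>n. {L \<in> C. \<forall>m. L ` grade V m \<subseteq> grade W (m + n)})\<rparr>)"

abbreviation iend ::
  "'k ring \<Rightarrow> ('k, 'h) qhopf \<Rightarrow> ('k, 'h, 'v, 'm) gmod_scheme \<Rightarrow> ('k, 'h, 'v \<Rightarrow> 'v) gmod" where
  "iend k H V \<equiv> ihom k H V V"

text \<open>Currying of \<open>f : V \<otimes> W \<rightarrow> X\<close> and its inverse.\<close>

definition zeta ::
  "'k ring \<Rightarrow> ('k, 'h) qhopf \<Rightarrow> ('k, 'h, 'v, 'l) gmod_scheme \<Rightarrow> ('k, 'h, 'w, 'm) gmod_scheme \<Rightarrow>
   ('k, 'h, 'x, 'n) gmod_scheme \<Rightarrow> (('v, 'w) tens \<Rightarrow> 'x) \<Rightarrow> 'v \<Rightarrow> 'w \<Rightarrow> 'x" where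
  "zeta k H V W X f v = (\<lambda>w\<in>carrier W.
     tlift3 X (\<lambda>a b c. f (tpure k V W (act V a v)
                             (act W (b \<otimes>\<^bsub>H\<^esub> beta H \<otimes>\<^bsub>H\<^esub> antip H c) w))) (phi_inv k H))"

definition zeta_inv ::
  "'k ring \<Rightarrow> ('k, 'h) qhopf \<Rightarrow> ('k, 'h, 'v, 'l) gmod_scheme \<Rightarrow> ('k, 'h, 'w, 'm) gmod_scheme \<Rightarrow>
   ('k, 'h, 'x, 'n) gmod_scheme \<Rightarrow> ('v \<Rightarrow> 'w \<Rightarrow> 'x) \<Rightarrow> ('v, 'w) tens \<Rightarrow> 'x" where
  "zeta_inv k H V W X g = tlift X (\<lambda>v w.
     tlift3 X (\<lambda>a b c. act X a (g v (act W (antip H b \<otimes>\<^bsub>H\<^esub> alpha H \<otimes>\<^bsub>H\<^esub> c) w))) (phi H))"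

definition iev ::
  "'k ring \<Rightarrow> ('k, 'h) qhopf \<Rightarrow> ('k, 'h, 'v, 'm) gmod_scheme \<Rightarrow> ('k, 'h, 'w, 'n) gmod_scheme \<Rightarrow>
   ('v \<Rightarrow> 'w, 'v) tens \<Rightarrow> 'w" where
  "iev k H V W = zeta_inv k H (ihom k H V W) V W id"

definition icomp ::
  "'k ring \<Rightarrow> ('k, 'h) qhopf \<Rightarrow> ('k, 'h, 'v, 'l) gmod_scheme \<Rightarrow> ('k, 'h, 'w, 'm) gmod_scheme \<Rightarrow>
   ('k, 'h, 'x, 'n) gmod_scheme \<Rightarrow> ('w \<Rightarrow> 'x, 'v \<Rightarrow> 'w) tens \<Rightarrow> 'v \<Rightarrow> 'x" where
  "icomp k H V W X =
     zeta k H (gtensor k H (ihom k H W X) (ihom k H V W)) V X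
       (\<lambda>t. iev k H W X (tmap k (ihom k H W X) W id (iev k H V W)
              (assoc k H (ihom k H W X) (ihom k H V W) V t)))"

definition icommutator ::
  "'k ring \<Rightarrow> ('k, 'h) qhopf \<Rightarrow> ('k, 'h, 'v, 'm) gmod_scheme \<Rightarrow> ('v \<Rightarrow> 'v, 'v \<Rightarrow> 'v) tens \<Rightarrow> 'v \<Rightarrow> 'v" where
  "icommutator k H V t =
     icomp k H V V V t \<ominus>\<^bsub>iend k H V\<^esub> icomp k H V V V (braid k H (iend k H V) (iend k H V) t)"


section \<open>Algebras and symmetric bimodules\<close>

text \<open>
  The product of an algebra is \<open>mu\<close>, its unit is \<open>eta : I \<rightarrow> A\<close>; they are unrelated to the
  inherited fields \<open>mult\<close> and \<open>one\<close>.
\<close>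

record ('k, 'h, 'a) halg = "('k, 'h, 'a) gmod" +
  mu :: "('a, 'a) tens \<Rightarrow> 'a"
  eta :: "'k \<Rightarrow> 'a"

locale hm_algebra = hmod k H A
  for k :: "'k ring" and H :: "('k, 'h) qhopf" and A :: "('k, 'h, 'a) halg" +
  assumes mu_morph: "hmorph k H (gtensor k H A A) A (mu A)"
    and eta_morph: "hmorph k H (shifted_unit k H 0) A (eta A)"
    and mu_assoc: "\<And>t. t \<in> carrier (gtensor k H (gtensor k H A A) A) \<Longrightarrow>
      mu A (tmap k A A (mu A) id t) = mu A (tmap k A A id (mu A) (assoc k H A A A t))"
    and mu_unit_left: "a \<in> carrier A \<Longrightarrow> mu A (tpure k A A (eta A \<one>\<^bsub>k\<^esub>) a) = a"
    and mu_unit_right: "a \<in> carrier A \<Longrightarrow> mu A (tpure k A A a (eta A \<one>\<^bsub>k\<^esub>)) = a"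

locale hm_comm_algebra = hm_algebra k H A
  for k :: "'k ring" and H :: "('k, 'h) qhopf" and A :: "('k, 'h, 'a) halg" +
  assumes mu_comm: "\<And>t. t \<in> carrier (gtensor k H A A) \<Longrightarrow> mu A (braid k H A A t) = mu A t"

record ('k, 'h, 'a, 'v) hbimod = "('k, 'h, 'v) gmod" +
  lact :: "('a, 'v) tens \<Rightarrow> 'v"
  ract :: "('v, 'a) tens \<Rightarrow> 'v"

locale hm_bimodule = hmod k H V
  for k :: "'k ring" and H :: "('k, 'h) qhopf" and A :: "('k, 'h, 'a) halg"
    and V :: "('k, 'h, 'a, 'v) hbimod" +
  assumes lact_morph: "hmorph k H (gtensor k H A V) V (lact V)"
    and ract_morph: "hmorph k H (gtensor k H V A) V (ract V)"
    and lact_unit: "v \<in> carrier V \<Longrightarrow> lact V (tpure k A V (eta A \<one>\<^bsub>k\<^esub>) v) = v"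
    and ract_unit: "v \<in> carrier V \<Longrightarrow> ract V (tpure k V A v (eta A \<one>\<^bsub>k\<^esub>)) = v"
    and lact_assoc: "\<And>t. t \<in> carrier (gtensor k H (gtensor k H A A) V) \<Longrightarrow>
      lact V (tmap k A V (mu A) id t) = lact V (tmap k A V id (lact V) (assoc k H A A V t))"
    and ract_assoc: "\<And>t. t \<in> carrier (gtensor k H (gtensor k H V A) A) \<Longrightarrow>
      ract V (tmap k V A (ract V) id t) = ract V (tmap k V A id (mu A) (assoc k H V A A t))"
    and lact_ract: "\<And>t. t \<in> carrier (gtensor k H (gtensor k H A V) A) \<Longrightarrow>
      ract V (tmap k V A (lact V) id t) = lact V (tmap k A V id (ract V) (assoc k H A V A t))"

locale hm_sym_bimodule = hm_bimodule k H A V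
  for k :: "'k ring" and H :: "('k, 'h) qhopf" and A :: "('k, 'h, 'a) halg"
    and V :: "('k, 'h, 'a, 'v) hbimod" +
  assumes ract_braid: "\<And>t. t \<in> carrier (gtensor k H A V) \<Longrightarrow> ract V (braid k H A V t) = lact V t"
    and lact_braid: "\<And>t. t \<in> carrier (gtensor k H V A) \<Longrightarrow> lact V (braid k H V A t) = ract V t"

definition regular :: "('k, 'h, 'a) halg \<Rightarrow> ('k, 'h, 'a, 'a) hbimod" where
  "regular A = gmod.extend (gmod.truncate A) (hbimod.fields (mu A) (mu A))"

definition lhat ::
  "'k ring \<Rightarrow> ('k, 'h) qhopf \<Rightarrow> ('k, 'h, 'a) halg \<Rightarrow> ('k, 'h, 'a, 'v) hbimod \<Rightarrow> 'a \<Rightarrow> 'v \<Rightarrow> 'v" where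
  "lhat k H A V = zeta k H A V V (lact V)"

text \<open>\<open>L \<otimes> a \<mapsto> [L, a]\<close> on \<open>end(V) \<otimes> A\<close>.\<close>

definition end_bracket ::
  "'k ring \<Rightarrow> ('k, 'h) qhopf \<Rightarrow> ('k, 'h, 'a) halg \<Rightarrow> ('k, 'h, 'a, 'v) hbimod \<Rightarrow>
   ('v \<Rightarrow> 'v, 'a) tens \<Rightarrow> 'v \<Rightarrow> 'v" where
  "end_bracket k H A V t =
     icommutator k H V (tmap k (iend k H V) (iend k H V) id (lhat k H A V) t)"


subsection \<open>Internal hom over the algebra\<close>

text \<open>
  \<open>L \<otimes> a \<mapsto> L \<bullet> l\<^sub>V(a) - (-1)\<^bsup>|L||a|\<^esup> l\<^sub>W(R\<^sup>2 \<rhd> a) \<bullet> (R\<^sup>1 \<rhd> L)\<close> on \<open>hom(V, W) \<otimes> A\<close>, where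
  \<open>l\<^sub>V\<close> is \<open>lhat k H A V\<close>.
\<close>

definition hom_bracket ::
  "'k ring \<Rightarrow> ('k, 'h) qhopf \<Rightarrow> ('k, 'h, 'a) halg \<Rightarrow> ('k, 'h, 'a, 'v) hbimod \<Rightarrow>
   ('k, 'h, 'a, 'w) hbimod \<Rightarrow> ('v \<Rightarrow> 'w, 'a) tens \<Rightarrow> 'v \<Rightarrow> 'w" where
  "hom_bracket k H A V W t =
     icomp k H V V W (tmap k (ihom k H V W) (iend k H V) id (lhat k H A V) t)
     \<ominus>\<^bsub>ihom k H V W\<^esub>
     icomp k H V W W (tmap k (iend k H W) (ihom k H V W) (lhat k H A W) id
       (braid k H (ihom k H V W) A t))"

definition hom_over ::
  "'k ring \<Rightarrow> ('k, 'h) qhopf \<Rightarrow> ('k, 'h, 'a) halg \<Rightarrow> ('k, 'h, 'a, 'v) hbimod \<Rightarrow>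
   ('k, 'h, 'a, 'w) hbimod \<Rightarrow> ('k, 'h, 'a, 'v \<Rightarrow> 'w) hbimod" where
  "hom_over k H A V W =
     gmod.extend
       (ker_obj (ihom k H V W) (ihom k H A (ihom k H V W))
         (zeta k H (ihom k H V W) A (ihom k H V W) (hom_bracket k H A V W)))
       (hbimod.fields
         (\<lambda>t. icomp k H V W W (tmap k (iend k H W) (ihom k H V W) (lhat k H A W) id t))
         (\<lambda>t. icomp k H V V W (tmap k (ihom k H V W) (iend k H V) id (lhat k H A V) t)))"


section \<open>Differential calculi and connections\<close>

definition der ::
  "'k ring \<Rightarrow> ('k, 'h) qhopf \<Rightarrow> ('k, 'h, 'a) halg \<Rightarrow> ('k, 'h, 'a \<Rightarrow> 'a) gmod" where
  "der k H A =
     ker_obj (iend k H A) (ihom k H A (iend k H A))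
       (zeta k H (iend k H A) A (iend k H A)
         (\<lambda>t. end_bracket k H A (regular A) t \<ominus>\<^bsub>iend k H A\<^esub> lhat k H A (regular A) (iev k H A A t)))"

locale differential_calculus = hm_comm_algebra k H A
  for k :: "'k ring" and H :: "('k, 'h) qhopf" and A :: "('k, 'h, 'a) halg"
    and d :: "'k \<Rightarrow> 'a \<Rightarrow> 'a" +
  assumes d_morph: "hmorph k H (shifted_unit k H 1) (der k H A) d"
    and d_square: "\<lbrakk>c \<in> carrier k; c' \<in> carrier k\<rbrakk> \<Longrightarrow>
      icomp k H A A A (tpure k (iend k H A) (iend k H A) (d c) (d c')) = \<zero>\<^bsub>iend k H A\<^esub>"

definition con_ambient ::
  "'k ring \<Rightarrow> ('k, 'h) qhopf \<Rightarrow> ('k, 'h, 'v, 'm) gmod_scheme \<Rightarrow> ('k, 'h, ('v \<Rightarrow> 'v) \<times> 'k) gmod" where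
  "con_ambient k H V = gprod (iend k H V) (shifted_unit k H 1)"

definition con_map ::
  "'k ring \<Rightarrow> ('k, 'h) qhopf \<Rightarrow> ('k, 'h, 'a) halg \<Rightarrow> ('k \<Rightarrow> 'a \<Rightarrow> 'a) \<Rightarrow> ('k, 'h, 'a, 'v) hbimod \<Rightarrow>
   (('v \<Rightarrow> 'v) \<times> 'k, 'a) tens \<Rightarrow> 'v \<Rightarrow> 'v" where
  "con_map k H A d V =
     tlift (iend k H V) (\<lambda>(L, c) a.
       end_bracket k H A V (tpure k (iend k H V) A L a)
       \<ominus>\<^bsub>iend k H V\<^esub> lhat k H A V (iev k H A A (tpure k (iend k H A) A (d c) a)))"

definition con ::
  "'k ring \<Rightarrow> ('k, 'h) qhopf \<Rightarrow> ('k, 'h, 'a) halg \<Rightarrow> ('k \<Rightarrow> 'a \<Rightarrow> 'a) \<Rightarrow> ('k, 'h, 'a, 'v) hbimod \<Rightarrow>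
   ('k, 'h, ('v \<Rightarrow> 'v) \<times> 'k) gmod" where
  "con k H A d V =
     ker_obj (con_ambient k H V) (ihom k H A (iend k H V))
       (zeta k H (con_ambient k H V) A (iend k H V) (con_map k H A d V))"

definition con_fibre_prod ::
  "'k ring \<Rightarrow> ('k, 'h) qhopf \<Rightarrow> ('k, 'h, 'a) halg \<Rightarrow> ('k \<Rightarrow> 'a \<Rightarrow> 'a) \<Rightarrow>
   ('k, 'h, 'a, 'w) hbimod \<Rightarrow> ('k, 'h, 'a, 'v) hbimod \<Rightarrow>
   ('k, 'h, (('w \<Rightarrow> 'w) \<times> 'k) \<times> (('v \<Rightarrow> 'v) \<times> 'k)) gmod" where
  "con_fibre_prod k H A d W V =
     subobj (gprod (con k H A d W) (con k H A d V)) (\<lambda>x. snd (fst x) = snd (snd x))"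


subsection \<open>The adjoint map\<close>

definition Lmult ::
  "'k ring \<Rightarrow> ('k, 'h) qhopf \<Rightarrow> ('k, 'h, 'v, 'm) gmod_scheme \<Rightarrow> ('k, 'h, 'w, 'n) gmod_scheme \<Rightarrow>
   ('w \<Rightarrow> 'w) \<Rightarrow> ('v \<Rightarrow> 'w) \<Rightarrow> 'v \<Rightarrow> 'w" where
  "Lmult k H V W =
     zeta k H (iend k H W) (ihom k H V W) (ihom k H V W) (icomp k H V W W)"

definition Rmult ::
  "'k ring \<Rightarrow> ('k, 'h) qhopf \<Rightarrow> ('k, 'h, 'v, 'm) gmod_scheme \<Rightarrow> ('k, 'h, 'w, 'n) gmod_scheme \<Rightarrow>
   ('v \<Rightarrow> 'v) \<Rightarrow> ('v \<Rightarrow> 'w) \<Rightarrow> 'v \<Rightarrow> 'w" where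
  "Rmult k H V W =
     zeta k H (iend k H V) (ihom k H V W) (ihom k H V W)
       (\<lambda>t. icomp k H V V W (braid k H (iend k H V) (ihom k H V W) t))"

definition ad ::
  "'k ring \<Rightarrow> ('k, 'h) qhopf \<Rightarrow> ('k, 'h, 'v, 'm) gmod_scheme \<Rightarrow> ('k, 'h, 'w, 'n) gmod_scheme \<Rightarrow>
   (('w \<Rightarrow> 'w) \<times> 'k) \<times> (('v \<Rightarrow> 'v) \<times> 'k) \<Rightarrow> (('v \<Rightarrow> 'w) \<Rightarrow> 'v \<Rightarrow> 'w) \<times> 'k" where
  "ad k H V W = (\<lambda>((L', c'), (L, c)).
     (Lmult k H V W L' \<ominus>\<^bsub>iend k H (ihom k H V W)\<^esub> Rmult k H V W L, c'))"

definition ad_induced ::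
  "'k ring \<Rightarrow> ('k, 'h) qhopf \<Rightarrow> ('k, 'h, 'a) halg \<Rightarrow> ('k, 'h, 'a, 'v) hbimod \<Rightarrow>
   ('k, 'h, 'a, 'w) hbimod \<Rightarrow>
   (('w \<Rightarrow> 'w) \<times> 'k) \<times> (('v \<Rightarrow> 'v) \<times> 'k) \<Rightarrow> (('v \<Rightarrow> 'w) \<Rightarrow> 'v \<Rightarrow> 'w) \<times> 'k" where
  "ad_induced k H A V W x =
     (restrict (fst (ad k H V W x)) (carrier (hom_over k H A V W)), snd (ad k H V W x))"

end

theory Submission
  imports Defs
begin

text \<open>
  Everything is expressed through bilinear maps. Precomposition with the associator, its inverse and
  the braiding turns into operators \<open>Fi\<close>, \<open>Fv\<close>, \<open>Br\<close> on multilinear maps, and two elements of an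
  internal hom agree as soon as all their \<open>H\<close>-translates have the same evaluations.

  Let \<open>((L', c), (L, c))\<close> be an element of the fibred product and \<open>K\<close> an element of \<open>hom\<^sub>A(V, W)\<close>. By
  a hexagon and the associativity of the internal composition, \<open>[L' \<bullet> K, a]\<close> is computed by moving \<open>a\<close>
  past \<open>K\<close> and then past \<open>L'\<close>; only the inhomogeneous term \<open>l(d(c) a)\<close> of \<open>L'\<close> survives. The same
  hexagon gives the term \<open>K \<bullet> l(d(c) a)\<close> for \<open>[K \<bullet> L, a]\<close>. Since \<open>H\<close> acts on \<open>c\<close> through the counit,
  all legs of \<open>\<phi>\<close> and \<open>R\<close> that hit \<open>c\<close> disappear, and after braiding the two terms coincide. Hence
  \<open>L' \<bullet> K\<close> minus the braided \<open>K \<bullet> L\<close> lies in \<open>hom\<^sub>A(V, W)\<close>. With \<open>L' = l(a')\<close> and \<open>c = 0\<close> the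
  same computation shows that \<open>hom\<^sub>A(V, W)\<close> is stable under \<open>A\<close>. Finally, the connection property of the
  adjoint map is checked on evaluations at \<open>K\<close>: the part \<open>L'\<close> contributes \<open>l(d(c) a) \<bullet> K\<close>, and the part
  \<open>L\<close> braided commutes with the left action by the other hexagon.
\<close>

section \<open>Finite sums and tensor products\<close>

text \<open>Braiding and reassociation replace an element by its \<open>H\<close>-translates and
  homogeneous components, so a commutation rule known for a single endomorphism cannot be braided.
  The rules are therefore stated for an equivariant family \<open>g\<close> on a graded module
  \<open>X\<close>: the fibred product with its two projections in the main argument,
  \<open>A\<close> with \<open>lhat\<close> for the stability of the internal hom over
  \<open>A\<close>. Membership in a kernel of \<open>zeta\<close> then becomes the vanishing of a
  bilinear map on the whole family. No coherence theorem is used. An identity in a tensor power of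
  \<open>H\<close> is applied to an arbitrary multilinear map on \<open>H\<close>, which later lets
  the legs act on vectors; each use of the pentagon or of a hexagon is one such instance. The
  normalizations of \<phi> in its outer legs and of the R-matrix are not among the axioms. They have
  to be derived, because the comparison of the inhomogeneous terms depends on all legs at the degree
  one constant becoming trivial.\<close>

definition frag_eval :: "('x, 'm) ring_scheme \<Rightarrow> ('i \<Rightarrow> 'x) \<Rightarrow> ('i \<Rightarrow>\<^sub>0 int) \<Rightarrow> 'x" where
  "frag_eval X f t = (\<Oplus>\<^bsub>X\<^esub>p\<in>Poly_Mapping.keys t. [Poly_Mapping.lookup t p] \<cdot>\<^bsub>X\<^esub> f p)"

context abelian_group
begin

text \<open>Formal sums with different supports can be combined only over a common index set; keys
  added to the support carry coefficient zero and contribute nothing.\<close>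

lemma frag_eval_superset:
  assumes "finite F" "Poly_Mapping.keys t \<subseteq> F" "f \<in> F \<rightarrow> carrier G"
  shows "frag_eval G f t = (\<Oplus>p\<in>F. [Poly_Mapping.lookup t p] \<cdot> f p)"
  unfolding frag_eval_def
  by (rule add.finprod_mono_neutral_cong_left)
     (use assms in \<open>auto simp: in_keys_iff Pi_iff add_pow_def intro!: add.int_pow_closed[unfolded add_pow_def]\<close>)

lemma frag_eval_closed:
  assumes "f \<in> Poly_Mapping.keys t \<rightarrow> carrier G"
  shows "frag_eval G f t \<in> carrier G"
  unfolding frag_eval_def using assms by (auto intro!: add.finprod_closed add.int_pow_closed)

lemma frag_eval_frag_of: "f p \<in> carrier G \<Longrightarrow> frag_eval G f (frag_of p) = f p"
  by (simp add: frag_eval_def add.int_pow_1)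

lemma frag_eval_add:
  assumes "Poly_Mapping.keys s \<subseteq> S" "Poly_Mapping.keys t \<subseteq> S" "f \<in> S \<rightarrow> carrier G"
  shows "frag_eval G f (s + t) = frag_eval G f s \<oplus> frag_eval G f t"
proof -
  let ?F = "Poly_Mapping.keys s \<union> Poly_Mapping.keys t"
  have c: "f \<in> ?F \<rightarrow> carrier G" using assms by auto
  have 1: "Poly_Mapping.keys (s + t) \<subseteq> ?F" by (rule keys_add)
  have "frag_eval G f (s + t) = (\<Oplus>p\<in>?F. [Poly_Mapping.lookup s p] \<cdot> f p \<oplus> [Poly_Mapping.lookup t p] \<cdot> f p)"
    using c 1 by (simp add: frag_eval_superset[of ?F] Poly_Mapping.lookup_add)
      (auto intro!: add.finprod_cong' add.int_pow_closed add.m_closed simp: Pi_iff add.int_pow_mult)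
  also have "\<dots> = frag_eval G f s \<oplus> frag_eval G f t"
    using c by (subst (1 2) frag_eval_superset[of ?F]) (auto intro!: add.finprod_multf add.int_pow_closed)
  finally show ?thesis .
qed

text \<open>Subtraction is reduced to addition by writing \<open>s\<close> as
  \<open>(s - t) + t\<close>.\<close>

lemma frag_eval_diff:
  assumes "Poly_Mapping.keys s \<subseteq> S" "Poly_Mapping.keys t \<subseteq> S" "f \<in> S \<rightarrow> carrier G"
  shows "frag_eval G f (s - t) = frag_eval G f s \<ominus> frag_eval G f t"
proof -
  have "Poly_Mapping.keys (s - t) \<subseteq> S" using keys_diff[of s t] assms by auto
  then have "frag_eval G f (s - t) \<oplus> frag_eval G f t = frag_eval G f s"
    using frag_eval_add[of "s - t" S t f] assms by simp
  moreover have "frag_eval G f (s - t) \<in> carrier G" "frag_eval G f t \<in> carrier G"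
    "frag_eval G f s \<in> carrier G"
    using assms \<open>Poly_Mapping.keys (s - t) \<subseteq> S\<close> by (auto intro!: frag_eval_closed)
  ultimately show ?thesis
    by (metis a_minus_def add.inv_solve_right)
qed

end

text \<open>Lists instead of finite sets: a decomposition of a tensor may repeat a summand, and
  linear maps pass through a \<open>foldr\<close> without injectivity or finiteness
  conditions.\<close>

definition lsum :: "('x, 'm) ring_scheme \<Rightarrow> 'i list \<Rightarrow> ('i \<Rightarrow> 'x) \<Rightarrow> 'x" where
  "lsum X ps f = foldr (\<lambda>p s. f p \<oplus>\<^bsub>X\<^esub> s) ps \<zero>\<^bsub>X\<^esub>"

lemma lsum_Nil [simp]: "lsum X [] f = \<zero>\<^bsub>X\<^esub>"
  and lsum_Cons [simp]: "lsum X (p # ps) f = f p \<oplus>\<^bsub>X\<^esub> lsum X ps f"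
  by (simp_all add: lsum_def)

lemma lsum_cong: "(\<And>p. p \<in> set ps \<Longrightarrow> f p = g p) \<Longrightarrow> lsum X ps f = lsum X ps g"
  by (induction ps) auto

lemma lsum_map: "lsum X (map h ps) f = lsum X ps (\<lambda>p. f (h p))"
  by (induction ps) auto

context abelian_group
begin

lemma lsum_closed: "(\<And>p. p \<in> set ps \<Longrightarrow> f p \<in> carrier G) \<Longrightarrow> lsum G ps f \<in> carrier G"
  by (induction ps) auto

lemma lsum_append:
  "(\<And>p. p \<in> set ps \<union> set qs \<Longrightarrow> f p \<in> carrier G) \<Longrightarrow> lsum G (ps @ qs) f = lsum G ps f \<oplus> lsum G qs f"
  by (induction ps) (auto simp: lsum_closed a_assoc)

lemma lsum_add:
  "(\<And>p. p \<in> set ps \<Longrightarrow> f p \<in> carrier G) \<Longrightarrow> (\<And>p. p \<in> set ps \<Longrightarrow> g p \<in> carrier G) \<Longrightarrow>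
   lsum G ps (\<lambda>p. f p \<oplus> g p) = lsum G ps f \<oplus> lsum G ps g"
  by (induction ps) (auto simp: lsum_closed a_ac)

lemma lsum_zero: "(\<And>p. p \<in> set ps \<Longrightarrow> f p = \<zero>) \<Longrightarrow> lsum G ps f = \<zero>"
  by (induction ps) auto

lemma lsum_swap:
  "(\<And>p q. p \<in> set ps \<Longrightarrow> q \<in> set qs \<Longrightarrow> f p q \<in> carrier G) \<Longrightarrow>
   lsum G ps (\<lambda>p. lsum G qs (f p)) = lsum G qs (\<lambda>q. lsum G ps (\<lambda>p. f p q))"
proof (induction ps)
  case Nil then show ?case by (simp add: lsum_zero)
next
  case (Cons p ps)
  then show ?case by (subst lsum_Cons, subst Cons.IH) (auto simp: lsum_add lsum_closed)
qed

end

section \<open>Linear, bilinear and balanced maps over the base ring\<close>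

locale base_ring = cring k for k :: "'k ring"
begin

abbreviation lin where "lin \<equiv> k_linear k"

definition bil where
  "bil V W X b \<longleftrightarrow> (\<forall>v\<in>carrier V. lin W X (b v)) \<and> (\<forall>w\<in>carrier W. lin V X (\<lambda>v. b v w))"

text \<open>Weaker than bilinearity in that the target needs no scalars. The construction of
  \<open>tensor\<close> forces this: its scalar action is itself a \<open>tlift\<close> into
  \<open>tensor_group\<close>, which carries only an addition at that point.\<close>

definition balanced where
  "balanced V W X b \<longleftrightarrow>
     (\<forall>v\<in>carrier V. \<forall>w\<in>carrier W. b v w \<in> carrier X) \<and>
     (\<forall>v\<in>carrier V. \<forall>v'\<in>carrier V. \<forall>w\<in>carrier W. b (v \<oplus>\<^bsub>V\<^esub> v') w = b v w \<oplus>\<^bsub>X\<^esub> b v' w) \<and>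
     (\<forall>v\<in>carrier V. \<forall>w\<in>carrier W. \<forall>w'\<in>carrier W. b v (w \<oplus>\<^bsub>W\<^esub> w') = b v w \<oplus>\<^bsub>X\<^esub> b v w') \<and>
     (\<forall>c\<in>carrier k. \<forall>v\<in>carrier V. \<forall>w\<in>carrier W. b (c \<odot>\<^bsub>V\<^esub> v) w = b v (c \<odot>\<^bsub>W\<^esub> w))"

lemma balancedD:
  assumes "balanced V W X b" "v \<in> carrier V" "w \<in> carrier W"
  shows "b v w \<in> carrier X"
    and "v' \<in> carrier V \<Longrightarrow> b (v \<oplus>\<^bsub>V\<^esub> v') w = b v w \<oplus>\<^bsub>X\<^esub> b v' w"
    and "w' \<in> carrier W \<Longrightarrow> b v (w \<oplus>\<^bsub>W\<^esub> w') = b v w \<oplus>\<^bsub>X\<^esub> b v w'"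
    and "c \<in> carrier k \<Longrightarrow> b (c \<odot>\<^bsub>V\<^esub> v) w = b v (c \<odot>\<^bsub>W\<^esub> w)"
  using assms unfolding balanced_def by auto

lemma linI:
  assumes "\<And>v. v \<in> carrier V \<Longrightarrow> f v \<in> carrier W"
    and "\<And>v v'. v \<in> carrier V \<Longrightarrow> v' \<in> carrier V \<Longrightarrow> f (v \<oplus>\<^bsub>V\<^esub> v') = f v \<oplus>\<^bsub>W\<^esub> f v'"
    and "\<And>c v. c \<in> carrier k \<Longrightarrow> v \<in> carrier V \<Longrightarrow> f (c \<odot>\<^bsub>V\<^esub> v) = c \<odot>\<^bsub>W\<^esub> f v"
  shows "lin V W f"
  using assms unfolding k_linear_def by auto

lemma linD:
  assumes "lin V W f" "v \<in> carrier V"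
  shows "f v \<in> carrier W"
    and "v' \<in> carrier V \<Longrightarrow> f (v \<oplus>\<^bsub>V\<^esub> v') = f v \<oplus>\<^bsub>W\<^esub> f v'"
    and "c \<in> carrier k \<Longrightarrow> f (c \<odot>\<^bsub>V\<^esub> v) = c \<odot>\<^bsub>W\<^esub> f v"
  using assms unfolding k_linear_def by auto

lemma lin_comp: "lin V W g \<Longrightarrow> lin W X f \<Longrightarrow> lin V X (\<lambda>v. f (g v))"
  by (auto intro!: linI simp: linD)

lemma lin_cong:
  "module k V \<Longrightarrow> (\<And>v. v \<in> carrier V \<Longrightarrow> f v = g v) \<Longrightarrow> lin V W f = lin V W g"
  unfolding k_linear_def
  by (auto simp: Pi_iff module.smult_closed abelian_groupE(1) module_def)

lemma bilI:
  assumes "\<And>v. v \<in> carrier V \<Longrightarrow> lin W X (b v)" "\<And>w. w \<in> carrier W \<Longrightarrow> lin V X (\<lambda>v. b v w)"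
  shows "bil V W X b"
  using assms unfolding bil_def by auto

lemma bilD:
  assumes "bil V W X b"
  shows bil_lin2: "v \<in> carrier V \<Longrightarrow> lin W X (b v)"
    and bil_lin1: "w \<in> carrier W \<Longrightarrow> lin V X (\<lambda>v. b v w)"
    and bil_closed: "v \<in> carrier V \<Longrightarrow> w \<in> carrier W \<Longrightarrow> b v w \<in> carrier X"
  using assms unfolding bil_def by (auto simp: linD)

lemma bil_balanced:
  assumes b: "bil V W X b"
  shows "balanced V W X b"
  unfolding balanced_def
  using bil_closed[OF b] linD(2)[OF bil_lin1[OF b]] linD(2)[OF bil_lin2[OF b]]
    linD(3)[OF bil_lin1[OF b]] linD(3)[OF bil_lin2[OF b]]
  by simp

end

section \<open>The tensor product as a quotient of a free abelian group\<close>

locale module_pair = base_ring k + V: module k V + W: module k W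
  for k :: "'k ring" and V :: "('k, 'v, 'm) module_scheme" and W :: "('k, 'w, 'n) module_scheme"
begin

abbreviation F where "F \<equiv> free_Abelian_group (carrier V \<times> carrier W)"
abbreviation N where "N \<equiv> tensor_null k V W"
abbreviation cls where "cls t \<equiv> N #>\<^bsub>F\<^esub> t"

sublocale F: comm_group F
  by (rule abelian_free_Abelian_group)

lemma keys_frag_of_subset: "Poly_Mapping.keys (frag_of p) \<subseteq> S \<longleftrightarrow> p \<in> S"
  by simp

lemma keys_add_subset:
  "Poly_Mapping.keys p \<subseteq> S \<Longrightarrow> Poly_Mapping.keys q \<subseteq> S \<Longrightarrow> Poly_Mapping.keys (p + q) \<subseteq> S"
  by (rule order_trans[OF keys_add]) simp

lemma keys_diff_subset:
  "Poly_Mapping.keys p \<subseteq> S \<Longrightarrow> Poly_Mapping.keys q \<subseteq> S \<Longrightarrow> Poly_Mapping.keys (p - q) \<subseteq> S"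
  by (rule order_trans[OF keys_diff]) simp

lemmas keys_subset = keys_add_subset keys_diff_subset iffD2[OF keys_frag_of_subset]

lemma tensor_rels_closed: "r \<in> tensor_rels k V W \<Longrightarrow> Poly_Mapping.keys r \<subseteq> carrier V \<times> carrier W"
  unfolding tensor_rels_def
  by (elim UnE CollectE exE conjE; simp only:; intro keys_subset) auto

lemma N_normal: "N \<lhd> F"
proof -
  have "tensor_rels k V W \<subseteq> carrier F" using tensor_rels_closed by auto
  then show ?thesis
    unfolding tensor_null_def using F.generate_is_subgroup F.normal_iff_subgroup by blast
qed

sublocale N: normal N F
  by (rule N_normal)

sublocale Q: comm_group "F Mod N"
  by (rule F.abelian_FactGroup) (rule N.is_subgroup)

abbreviation G where "G \<equiv> tensor_group k V W"
abbreviation T where "T \<equiv> tensor k V W"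
abbreviation pure where "pure \<equiv> tpure k V W"

lemma G_simps:
  "carrier G = cls ` carrier F"
  "\<zero>\<^bsub>G\<^esub> = N"
  "s \<in> carrier F \<Longrightarrow> t \<in> carrier F \<Longrightarrow> cls s \<oplus>\<^bsub>G\<^esub> cls t = cls (s + t)"
  by (auto simp: tensor_group_def Let_def FactGroup_def RCOSETS_def N.rcos_sum simp del: carrier_free_Abelian_group_iff)

lemma G_abelian: "abelian_group G"
  by (intro abelian_groupI; simp only: tensor_group_def Let_def ring.simps partial_object.simps)
     (rule Q.m_closed Q.one_closed Q.m_assoc Q.m_comm Q.l_one Q.l_inv_ex; assumption)+

lemma T_simps [simp]: "carrier T = carrier G" "\<zero>\<^bsub>T\<^esub> = \<zero>\<^bsub>G\<^esub>" "add T = add G"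
  by (simp_all add: tensor_def Let_def)

lemma T_abelian: "abelian_group T"
proof -
  interpret G: abelian_group G by (rule G_abelian)
  show ?thesis
    using G.a_closed G.a_assoc G.a_comm G.l_zero G.zero_closed G.l_neg G.a_inv_closed
    by (intro abelian_groupI) auto
qed

sublocale G: abelian_group G by (rule G_abelian)
sublocale T: abelian_group T by (rule T_abelian)

lemma pure_cls: "pure v w = cls (frag_of (v, w))"
  by (simp add: tpure_def)

lemma pure_closed [simp]: "v \<in> carrier V \<Longrightarrow> w \<in> carrier W \<Longrightarrow> pure v w \<in> carrier G"
  by (auto simp: pure_cls G_simps)

lemma cls_rel:
  assumes "s - t \<in> tensor_rels k V W" "s \<in> carrier F" "t \<in> carrier F"
  shows "cls s = cls t"
proof -
  have n: "s - t \<in> N" using assms(1) unfolding tensor_null_def by (rule generate.incl)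
  then have c: "s - t \<in> carrier F" using N.subset by blast
  have "cls s = cls ((s - t) \<otimes>\<^bsub>F\<^esub> t)" by simp
  also have "\<dots> = cls (s - t) #>\<^bsub>F\<^esub> t" by (rule F.coset_mult_assoc[symmetric, OF N.subset c assms(3)])
  also have "cls (s - t) = N" by (rule F.coset_join2[OF c N.is_subgroup n])
  finally show ?thesis .
qed

lemma pure_balanced: "balanced V W G pure"
proof -
  have f: "frag_of (v, w) \<in> carrier F" if "v \<in> carrier V" "w \<in> carrier W" for v w
    using that by simp
  have ff: "frag_of p + frag_of q \<in> carrier F" if "frag_of p \<in> carrier F" "frag_of q \<in> carrier F" for p q
    using F.m_closed[OF that] by simp
  have 1: "pure (v \<oplus>\<^bsub>V\<^esub> v') w = pure v w \<oplus>\<^bsub>G\<^esub> pure v' w"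
    if v: "v \<in> carrier V" "v' \<in> carrier V" "w \<in> carrier W" for v v' w
  proof -
    have "frag_of (v \<oplus>\<^bsub>V\<^esub> v', w) - (frag_of (v, w) + frag_of (v', w)) \<in> tensor_rels k V W"
      unfolding tensor_rels_def using v by blast
    from cls_rel[OF this f[OF V.M.a_closed[OF v(1,2)] v(3)] ff[OF f[OF v(1,3)] f[OF v(2,3)]]]
    show ?thesis by (simp only: pure_cls G_simps(3)[OF f[OF v(1,3)] f[OF v(2,3)]])
  qed
  have 2: "pure v (w \<oplus>\<^bsub>W\<^esub> w') = pure v w \<oplus>\<^bsub>G\<^esub> pure v w'"
    if v: "v \<in> carrier V" "w \<in> carrier W" "w' \<in> carrier W" for v w w'
  proof -
    have "frag_of (v, w \<oplus>\<^bsub>W\<^esub> w') - (frag_of (v, w) + frag_of (v, w')) \<in> tensor_rels k V W"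
      unfolding tensor_rels_def using v by blast
    from cls_rel[OF this f[OF v(1) W.M.a_closed[OF v(2,3)]] ff[OF f[OF v(1,2)] f[OF v(1,3)]]]
    show ?thesis by (simp only: pure_cls G_simps(3)[OF f[OF v(1,2)] f[OF v(1,3)]])
  qed
  have 3: "pure (c \<odot>\<^bsub>V\<^esub> v) w = pure v (c \<odot>\<^bsub>W\<^esub> w)"
    if v: "v \<in> carrier V" "c \<in> carrier k" "w \<in> carrier W" for c v w
  proof -
    have "frag_of (c \<odot>\<^bsub>V\<^esub> v, w) - frag_of (v, c \<odot>\<^bsub>W\<^esub> w) \<in> tensor_rels k V W"
      unfolding tensor_rels_def using v by blast
    from cls_rel[OF this f[OF V.smult_closed[OF v(2,1)] v(3)] f[OF v(1) W.smult_closed[OF v(2,3)]]]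
    show ?thesis by (simp only: pure_cls)
  qed
  show ?thesis
    unfolding balanced_def using 1 2 3 by simp
qed

text \<open>No integer coefficients are needed in the list. The induction on the free abelian group
  passes through differences, and a subtracted \<open>pure v w\<close> is rewritten as an added
  \<open>pure\<close> with \<open>v\<close> negated.\<close>

lemma tensor_rep:
  assumes "t \<in> carrier G"
  shows "\<exists>ps. set ps \<subseteq> carrier V \<times> carrier W \<and> t = lsum G ps (\<lambda>p. pure (fst p) (snd p))"
proof -
  let ?P = "\<lambda>t. \<exists>ps. set ps \<subseteq> carrier V \<times> carrier W \<and> cls t = lsum G ps (\<lambda>p. pure (fst p) (snd p))"
  have "?P x" if "Poly_Mapping.keys x \<subseteq> carrier V \<times> carrier W" for x
  proof (rule free_Abelian_group_induct[where P = ?P, OF that])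
    have "cls 0 = N" using F.coset_mult_one[OF N.subset] by simp
    then show "?P 0" by (intro exI[of _ "[]"]) (simp add: G_simps(2))
  next
    fix x y
    assume 3: "Poly_Mapping.keys x \<subseteq> carrier V \<times> carrier W"
      "Poly_Mapping.keys y \<subseteq> carrier V \<times> carrier W" "?P x" "?P y"
    then obtain ps qs where ps: "set ps \<subseteq> carrier V \<times> carrier W" "cls x = lsum G ps (\<lambda>p. pure (fst p) (snd p))"
      and qs: "set qs \<subseteq> carrier V \<times> carrier W" "cls y = lsum G qs (\<lambda>p. pure (fst p) (snd p))"
      by blast
    let ?m = "\<lambda>p. (\<ominus>\<^bsub>V\<^esub> fst p, snd p)"
    let ?rs = "ps @ map ?m qs"
    have inv: "pure v w \<oplus>\<^bsub>G\<^esub> pure (\<ominus>\<^bsub>V\<^esub> v) w = \<zero>\<^bsub>G\<^esub>" if "v \<in> carrier V" "w \<in> carrier W" for v w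
    proof -
      \<comment> \<open>A pure tensor with a zero entry equals its own double by biadditivity, hence
        vanishes.\<close>
      have "pure \<zero>\<^bsub>V\<^esub> w \<oplus>\<^bsub>G\<^esub> pure \<zero>\<^bsub>V\<^esub> w = pure \<zero>\<^bsub>V\<^esub> w"
        using balancedD(2)[OF pure_balanced, of "\<zero>\<^bsub>V\<^esub>" w "\<zero>\<^bsub>V\<^esub>"] that by simp
      then have "pure \<zero>\<^bsub>V\<^esub> w = \<zero>\<^bsub>G\<^esub>" using that by (metis G.add.r_cancel_one' V.M.zero_closed pure_closed)
      then show ?thesis
        using balancedD(2)[OF pure_balanced, of v w "\<ominus>\<^bsub>V\<^esub> v"] that by (simp add: V.M.r_neg)
    qed
    have qc: "\<And>p. p \<in> set qs \<Longrightarrow> fst p \<in> carrier V \<and> snd p \<in> carrier W" using qs by auto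
    have pc: "\<And>p. p \<in> set ps \<Longrightarrow> fst p \<in> carrier V \<and> snd p \<in> carrier W" using ps by auto
    have cx: "cls x \<in> carrier G" "cls y \<in> carrier G" "cls (x - y) \<in> carrier G"
      using 3(1,2) keys_diff_subset[OF 3(1,2)] by (auto simp: G_simps)
    let ?s = "lsum G qs (\<lambda>p. pure (\<ominus>\<^bsub>V\<^esub> fst p) (snd p))"
    have sc: "?s \<in> carrier G" using qc by (intro G.lsum_closed) simp
    have "cls y \<oplus>\<^bsub>G\<^esub> ?s = \<zero>\<^bsub>G\<^esub>"
      unfolding qs(2) using qc by (subst G.lsum_add[symmetric]) (simp_all add: inv G.lsum_zero)
    then have "?s \<oplus>\<^bsub>G\<^esub> cls y = \<zero>\<^bsub>G\<^esub>" by (subst G.a_comm[OF sc cx(2)])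
    then have s: "?s = \<ominus>\<^bsub>G\<^esub> cls y" by (rule G.minus_equality[symmetric, OF _ cx(2) sc])
    have e: "cls (x - y) \<oplus>\<^bsub>G\<^esub> cls y = cls x" using 3(1,2) keys_diff_subset[OF 3(1,2)] by (simp only: G_simps(3) carrier_free_Abelian_group_iff diff_add_cancel)
    have "cls (x - y) = cls x \<oplus>\<^bsub>G\<^esub> ?s"
      unfolding s by (rule iffD2[OF G.add.inv_solve_right[OF cx(3,1,2)] e[symmetric]])
    also have "\<dots> = lsum G ?rs (\<lambda>p. pure (fst p) (snd p))"
      unfolding ps(2) using pc qc by (subst G.lsum_append) (auto simp: lsum_map)
    finally show "?P (x - y)"
      using ps qs qc by (intro exI[of _ ?rs]) auto
  next
    fix a assume "a \<in> carrier V \<times> carrier W"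
    then show "?P (frag_of a)"
      by (intro exI[of _ "[a]"]) (auto simp: pure_cls[symmetric])
  qed
  moreover obtain x where "x \<in> carrier F" "t = cls x" using assms by (auto simp: G_simps)
  ultimately show ?thesis by auto
qed

context
  fixes X :: "('x, 'l) ring_scheme" and b
  assumes X: "abelian_group X" and b: "balanced V W X b"
begin

interpretation X: abelian_group X by (rule X)

abbreviation (input) "bb \<equiv> \<lambda>p. b (fst p) (snd p)"

lemma bb: "bb \<in> carrier V \<times> carrier W \<rightarrow> carrier X"
  using b by (auto simp: balancedD)

text \<open>The reason why \<open>tlift\<close> is well defined: a balanced map annihilates the
  three kinds of relations, hence the subgroup generated by them.\<close>

lemma frag_eval_null: "t \<in> N \<Longrightarrow> frag_eval X bb t = \<zero>\<^bsub>X\<^esub>"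
  unfolding tensor_null_def
proof (induction rule: generate.induct)
  case one
  show ?case by (simp add: frag_eval_def)
next
  have gen: "frag_eval X bb r = \<zero>\<^bsub>X\<^esub>" if r: "r \<in> tensor_rels k V W" for r
  proof -
    have d: "frag_eval X bb (frag_of p - (frag_of q + frag_of q')) = \<zero>\<^bsub>X\<^esub>"
      if "p \<in> carrier V \<times> carrier W" "q \<in> carrier V \<times> carrier W" "q' \<in> carrier V \<times> carrier W"
        "bb p = bb q \<oplus>\<^bsub>X\<^esub> bb q'" for p q q'
    proof -
      have "bb p \<in> carrier X" "bb q \<in> carrier X" "bb q' \<in> carrier X"
        using that(1-3) b by (auto simp: balancedD)
      then show ?thesis
        using that by (simp only: X.frag_eval_diff[OF _ _ bb] X.frag_eval_add[OF _ _ bb] keys_subset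
          X.frag_eval_frag_of X.r_neg a_minus_def)
    qed
    have d': "frag_eval X bb (frag_of p - frag_of q) = \<zero>\<^bsub>X\<^esub>"
      if "p \<in> carrier V \<times> carrier W" "q \<in> carrier V \<times> carrier W" "bb p = bb q" for p q
    proof -
      have "bb p \<in> carrier X" "bb q \<in> carrier X"
        using that(1-2) b by (auto simp: balancedD)
      then show ?thesis
        using that by (simp only: X.frag_eval_diff[OF _ _ bb] keys_subset
          X.frag_eval_frag_of X.r_neg a_minus_def)
    qed
    from r show ?thesis
      unfolding tensor_rels_def
      by (elim UnE CollectE exE conjE; simp only:; intro d d') (auto simp: balancedD[OF b])
  qed
  case (incl h) then show ?case by (rule gen)
  case (inv h)
  then have h: "Poly_Mapping.keys h \<subseteq> carrier V \<times> carrier W" by (rule tensor_rels_closed)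
  then have "frag_eval X bb (0 - h) = frag_eval X bb 0 \<ominus>\<^bsub>X\<^esub> frag_eval X bb h"
    by (intro X.frag_eval_diff[OF _ _ bb]) auto
  then show ?case using gen[OF inv] h by (simp add: frag_eval_def a_minus_def)
next
  case (eng h1 h2)
  have "tensor_rels k V W \<subseteq> carrier F" using tensor_rels_closed by auto
  then have "h1 \<in> carrier F" "h2 \<in> carrier F"
    using F.generate_in_carrier eng by blast+
  then show ?case using eng by (simp add: X.frag_eval_add[OF _ _ bb])
qed

lemma frag_eval_closed': "t \<in> carrier F \<Longrightarrow> frag_eval X bb t \<in> carrier X"
  by (rule X.frag_eval_closed) (use bb in \<open>fastforce simp: Pi_iff\<close>)

text \<open>\<open>tlift\<close> takes \<open>the_elem\<close> of the image of a coset. That image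
  is a singleton because two representatives differ by an element of \<open>N\<close>, which
  evaluates to zero.\<close>

lemma tlift_cls:
  assumes "t \<in> carrier F" shows "tlift X b (cls t) = frag_eval X bb t"
proof -
  have h1: "frag_eval X bb u = frag_eval X bb t" if u: "u \<in> cls t" for u
  proof -
    from u obtain n where n: "n \<in> N" "u = n + t" by (auto simp: r_coset_def)
    then have "n \<in> carrier F" using N.subset by blast
    then have "frag_eval X bb u = frag_eval X bb n \<oplus>\<^bsub>X\<^esub> frag_eval X bb t"
      using n assms by (simp add: X.frag_eval_add[OF _ _ bb])
    also have "\<dots> = frag_eval X bb t"
      using frag_eval_null[OF n(1)] frag_eval_closed'[OF assms] by simp
    finally show ?thesis .
  qed
  have h2: "t \<in> cls t" by (rule F.rcos_self[OF assms N.is_subgroup])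
  have "frag_eval X bb ` cls t = {frag_eval X bb t}"
  proof (rule equalityI)
    show "frag_eval X bb ` cls t \<subseteq> {frag_eval X bb t}"
      by (rule image_subsetI) (simp only: singleton_iff h1)
    show "{frag_eval X bb t} \<subseteq> frag_eval X bb ` cls t"
      by (simp only: insert_subset empty_subsetI simp_thms) (rule imageI[OF h2])
  qed
  then show ?thesis unfolding tlift_def frag_eval_def[abs_def] by (simp only: the_elem_eq)
qed

lemma tlift_closed: "t \<in> carrier G \<Longrightarrow> tlift X b t \<in> carrier X"
  unfolding G_simps by (elim imageE) (simp only: tlift_cls frag_eval_closed')

lemma tlift_add:
  assumes "s \<in> carrier G" "t \<in> carrier G"
  shows "tlift X b (s \<oplus>\<^bsub>G\<^esub> t) = tlift X b s \<oplus>\<^bsub>X\<^esub> tlift X b t"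
proof -
  obtain x y where xy: "s = cls x" "t = cls y" "x \<in> carrier F" "y \<in> carrier F"
    using assms unfolding G_simps by blast
  then have "x + y \<in> carrier F" using F.m_closed[of x y] by simp
  then show ?thesis
    using xy by (simp only: G_simps tlift_cls) (rule X.frag_eval_add[OF _ _ bb]; simp)
qed

lemma tlift_pure [simp]:
  "v \<in> carrier V \<Longrightarrow> w \<in> carrier W \<Longrightarrow> tlift X b (pure v w) = b v w"
  unfolding pure_cls by (subst tlift_cls) (simp_all add: X.frag_eval_frag_of balancedD[OF b])

lemma tlift_lsum:
  "(\<And>p. p \<in> set ps \<Longrightarrow> f p \<in> carrier G) \<Longrightarrow>
    tlift X b (lsum G ps f) = lsum X ps (\<lambda>p. tlift X b (f p))"
proof (induction ps)
  case Nil
  have "tlift X b (\<zero>\<^bsub>G\<^esub> \<oplus>\<^bsub>G\<^esub> \<zero>\<^bsub>G\<^esub>) = tlift X b \<zero>\<^bsub>G\<^esub> \<oplus>\<^bsub>X\<^esub> tlift X b \<zero>\<^bsub>G\<^esub>" by (rule tlift_add) auto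
  moreover have "tlift X b \<zero>\<^bsub>G\<^esub> \<in> carrier X" by (simp add: tlift_closed)
  ultimately show ?case by (simp del: T_simps)
next
  case (Cons p ps)
  then show ?case by (simp add: tlift_add G.lsum_closed)
qed

end

end

section \<open>Linear and bilinear maps on tensor products\<close>

context base_ring
begin

lemma module_abelian_group: "module k V \<Longrightarrow> abelian_group V"
  by (simp add: module_def)

lemma module_closed [simp]:
  assumes "module k V"
  shows "\<zero>\<^bsub>V\<^esub> \<in> carrier V"
    and "x \<in> carrier V \<Longrightarrow> y \<in> carrier V \<Longrightarrow> x \<oplus>\<^bsub>V\<^esub> y \<in> carrier V"
    and "x \<in> carrier V \<Longrightarrow> y \<in> carrier V \<Longrightarrow> x \<ominus>\<^bsub>V\<^esub> y \<in> carrier V"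
    and "x \<in> carrier V \<Longrightarrow> \<ominus>\<^bsub>V\<^esub> x \<in> carrier V"
    and "c \<in> carrier k \<Longrightarrow> x \<in> carrier V \<Longrightarrow> c \<odot>\<^bsub>V\<^esub> x \<in> carrier V"
  using module.smult_closed[OF assms] module_abelian_group[OF assms]
  by (auto simp: abelian_group.minus_closed abelian_group.a_inv_closed abelian_groupE)

lemma module_lsum_closed [simp]:
  "module k V \<Longrightarrow> (\<And>p. p \<in> set ps \<Longrightarrow> f p \<in> carrier V) \<Longrightarrow> lsum V ps f \<in> carrier V"
  by (rule abelian_group.lsum_closed[OF module_abelian_group])

lemma lin_closed: "lin V W f \<Longrightarrow> v \<in> carrier V \<Longrightarrow> f v \<in> carrier W"
  by (rule linD)

lemma lin_zero:
  assumes "module k V" "module k W" "lin V W f"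
  shows "f \<zero>\<^bsub>V\<^esub> = \<zero>\<^bsub>W\<^esub>"
proof -
  interpret V: module k V by fact
  interpret W: module k W by fact
  have "f (\<zero>\<^bsub>k\<^esub> \<odot>\<^bsub>V\<^esub> \<zero>\<^bsub>V\<^esub>) = \<zero>\<^bsub>k\<^esub> \<odot>\<^bsub>W\<^esub> f \<zero>\<^bsub>V\<^esub>" by (rule linD(3)[OF assms(3)]) simp_all
  then show ?thesis using linD(1)[OF assms(3), of "\<zero>\<^bsub>V\<^esub>"] by simp
qed

lemma lin_minus:
  assumes "module k V" "module k W" "lin V W f" "v \<in> carrier V"
  shows "f (\<ominus>\<^bsub>V\<^esub> v) = \<ominus>\<^bsub>W\<^esub> f v"
proof -
  interpret V: module k V by fact
  interpret W: module k W by fact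
  have "f (\<ominus>\<^bsub>V\<^esub> v) \<oplus>\<^bsub>W\<^esub> f v = \<zero>\<^bsub>W\<^esub>"
    using linD(2)[OF assms(3), of "\<ominus>\<^bsub>V\<^esub> v" v] assms(4) lin_zero[OF assms(1-3)]
    by (simp add: V.M.l_neg)
  then show ?thesis
    using W.M.minus_equality linD(1)[OF assms(3)] assms(4) V.M.a_inv_closed by metis
qed

lemma lin_diff:
  assumes "module k V" "module k W" "lin V W f" "v \<in> carrier V" "w \<in> carrier V"
  shows "f (v \<ominus>\<^bsub>V\<^esub> w) = f v \<ominus>\<^bsub>W\<^esub> f w"
  using assms by (simp add: a_minus_def linD(2)[OF assms(3)] lin_minus[OF assms(1-3)])

lemma lin_lsum_push:
  assumes "module k V" "module k W" "lin V W f" "\<And>p. p \<in> set ps \<Longrightarrow> g p \<in> carrier V"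
  shows "f (lsum V ps g) = lsum W ps (\<lambda>p. f (g p))"
  using assms(4) by (induction ps) (simp_all add: lin_zero[OF assms(1-3)] linD(2)[OF assms(3)] assms(1))

lemma lin_add:
  assumes X: "module k X" and f: "lin V X f" and g: "lin V X g"
  shows "lin V X (\<lambda>v. f v \<oplus>\<^bsub>X\<^esub> g v)"
proof -
  interpret X: module k X by fact
  show ?thesis
    by (rule linI) (simp_all add: linD[OF f] linD[OF g] X.M.a_ac X.smult_r_distr)
qed

lemma lin_uminus:
  assumes X: "module k X" and f: "lin V X f"
  shows "lin V X (\<lambda>v. \<ominus>\<^bsub>X\<^esub> f v)"
proof -
  interpret X: module k X by fact
  show ?thesis
    by (rule linI) (simp_all add: linD[OF f] X.M.minus_add X.smult_r_minus)
qed

lemma lin_sub: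
  "module k X \<Longrightarrow> lin V X f \<Longrightarrow> lin V X g \<Longrightarrow> lin V X (\<lambda>v. f v \<ominus>\<^bsub>X\<^esub> g v)"
  unfolding a_minus_def by (intro lin_add lin_uminus)

lemma lin_smult:
  assumes X: "module k X" and f: "lin V X f" and c: "c \<in> carrier k"
  shows "lin V X (\<lambda>v. c \<odot>\<^bsub>X\<^esub> f v)"
proof -
  interpret X: module k X by fact
  show ?thesis
    using c by (intro linI) (simp_all add: linD[OF f] X.smult_r_distr X.smult_assoc1[symmetric] m_comm)
qed

lemma lin_const_zero:
  assumes X: "module k X"
  shows "lin V X (\<lambda>v. \<zero>\<^bsub>X\<^esub>)"
proof -
  interpret X: module k X by fact
  show ?thesis by (rule linI) simp_all
qed

lemma lin_id: "lin V V (\<lambda>v. v)"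
  by (rule linI) simp_all

lemma lin_lsum:
  "module k X \<Longrightarrow> (\<And>p. p \<in> set ps \<Longrightarrow> lin V X (\<lambda>v. f v p)) \<Longrightarrow> lin V X (\<lambda>v. lsum X ps (f v))"
  by (induction ps) (simp_all add: lin_const_zero lin_add)

lemma module_pairI: "module k V \<Longrightarrow> module k W \<Longrightarrow> module_pair k V W"
  by (simp add: module_pair_def base_ring_axioms)

end

context module_pair
begin

lemma smult_balanced: "c \<in> carrier k \<Longrightarrow> balanced V W G (\<lambda>v w. pure (c \<odot>\<^bsub>V\<^esub> v) w)"
  using balancedD[OF pure_balanced]
  by (simp add: balanced_def V.smult_r_distr V.smult_assoc1[symmetric] W.smult_assoc1[symmetric] m_comm)

lemma smult_T: "c \<odot>\<^bsub>T\<^esub> t = tlift G (\<lambda>v w. pure (c \<odot>\<^bsub>V\<^esub> v) w) t"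
  by (simp add: tensor_def Let_def)

lemma smult_closed_T: "c \<in> carrier k \<Longrightarrow> t \<in> carrier G \<Longrightarrow> c \<odot>\<^bsub>T\<^esub> t \<in> carrier G"
  unfolding smult_T by (rule tlift_closed[OF G_abelian smult_balanced])

lemma smult_add_T:
  "c \<in> carrier k \<Longrightarrow> s \<in> carrier G \<Longrightarrow> t \<in> carrier G \<Longrightarrow>
   c \<odot>\<^bsub>T\<^esub> (s \<oplus>\<^bsub>G\<^esub> t) = c \<odot>\<^bsub>T\<^esub> s \<oplus>\<^bsub>G\<^esub> c \<odot>\<^bsub>T\<^esub> t"
  unfolding smult_T by (rule tlift_add[OF G_abelian smult_balanced])

lemma smult_pure:
  "c \<in> carrier k \<Longrightarrow> v \<in> carrier V \<Longrightarrow> w \<in> carrier W \<Longrightarrow> c \<odot>\<^bsub>T\<^esub> pure v w = pure (c \<odot>\<^bsub>V\<^esub> v) w"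
  unfolding smult_T by (rule tlift_pure[OF G_abelian smult_balanced])

lemma tensor_induct [consumes 1, case_names zero pure add]:
  assumes "t \<in> carrier T"
    and "P \<zero>\<^bsub>T\<^esub>" "\<And>v w. v \<in> carrier V \<Longrightarrow> w \<in> carrier W \<Longrightarrow> P (pure v w)"
    and "\<And>s t. s \<in> carrier T \<Longrightarrow> t \<in> carrier T \<Longrightarrow> P s \<Longrightarrow> P t \<Longrightarrow> P (s \<oplus>\<^bsub>T\<^esub> t)"
  shows "P t"
proof -
  obtain ps where ps: "set ps \<subseteq> carrier V \<times> carrier W" "t = lsum G ps (\<lambda>p. pure (fst p) (snd p))"
    using tensor_rep assms(1) by auto
  have "P (lsum G ps (\<lambda>p. pure (fst p) (snd p))) \<and> lsum G ps (\<lambda>p. pure (fst p) (snd p)) \<in> carrier G"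
    using ps(1)
  proof (induction ps)
    case Nil then show ?case using assms(2) by simp
  next
    case (Cons p ps)
    then show ?case using assms(3,4) by (auto simp: mem_Times_iff)
  qed
  then show ?thesis by (simp add: ps(2))
qed

lemma T_module: "module k T"
proof (rule moduleI)
  fix c c' s t assume c: "c \<in> carrier k" "c' \<in> carrier k" and s: "s \<in> carrier T" "t \<in> carrier T"
  show "c \<odot>\<^bsub>T\<^esub> s \<in> carrier T" using c s by (simp add: smult_closed_T)
  show "c \<odot>\<^bsub>T\<^esub> (s \<oplus>\<^bsub>T\<^esub> t) = c \<odot>\<^bsub>T\<^esub> s \<oplus>\<^bsub>T\<^esub> c \<odot>\<^bsub>T\<^esub> t" using c s by (simp add: smult_add_T)
  \<comment> \<open>The zero tensor is a case of its own in \<open>tensor_induct\<close>; that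
    scalars fix it follows from additivity by cancellation.\<close>
  have z: "c \<odot>\<^bsub>T\<^esub> \<zero>\<^bsub>G\<^esub> = \<zero>\<^bsub>G\<^esub>" if "c \<in> carrier k" for c
  proof -
    have "c \<odot>\<^bsub>T\<^esub> \<zero>\<^bsub>G\<^esub> \<oplus>\<^bsub>G\<^esub> c \<odot>\<^bsub>T\<^esub> \<zero>\<^bsub>G\<^esub> = c \<odot>\<^bsub>T\<^esub> \<zero>\<^bsub>G\<^esub>"
      using smult_add_T[of c "\<zero>\<^bsub>G\<^esub>" "\<zero>\<^bsub>G\<^esub>"] that by simp
    then show ?thesis using G.add.r_cancel_one' that smult_closed_T by simp
  qed
  show "(c \<oplus>\<^bsub>k\<^esub> c') \<odot>\<^bsub>T\<^esub> s = c \<odot>\<^bsub>T\<^esub> s \<oplus>\<^bsub>T\<^esub> c' \<odot>\<^bsub>T\<^esub> s"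
    using s(1)
  proof (induction s rule: tensor_induct)
    case (pure v w)
    then show ?case using c balancedD(2)[OF pure_balanced] by (simp add: smult_pure V.smult_l_distr)
  next
    case (add s t)
    then show ?case using c by (simp add: smult_add_T smult_closed_T G.a_ac)
  qed (use c z in simp)
  show "(c \<otimes>\<^bsub>k\<^esub> c') \<odot>\<^bsub>T\<^esub> s = c \<odot>\<^bsub>T\<^esub> (c' \<odot>\<^bsub>T\<^esub> s)"
    using s(1)
  proof (induction s rule: tensor_induct)
    case (pure v w)
    then show ?case using c by (simp add: smult_pure V.smult_assoc1)
  next
    case (add s t)
    then show ?case using c by (simp add: smult_add_T smult_closed_T)
  qed (use c z in simp)
next
  fix s assume s: "s \<in> carrier T"
  show "\<one>\<^bsub>k\<^esub> \<odot>\<^bsub>T\<^esub> s = s"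
    using s
  proof (induction s rule: tensor_induct)
    case zero
    have "\<one>\<^bsub>k\<^esub> \<odot>\<^bsub>T\<^esub> \<zero>\<^bsub>G\<^esub> \<oplus>\<^bsub>G\<^esub> \<one>\<^bsub>k\<^esub> \<odot>\<^bsub>T\<^esub> \<zero>\<^bsub>G\<^esub> = \<one>\<^bsub>k\<^esub> \<odot>\<^bsub>T\<^esub> \<zero>\<^bsub>G\<^esub>"
      using smult_add_T[of "\<one>\<^bsub>k\<^esub>" "\<zero>\<^bsub>G\<^esub>" "\<zero>\<^bsub>G\<^esub>"] by simp
    then show ?case using G.add.r_cancel_one' smult_closed_T by simp
  next
    case (pure v w)
    then show ?case by (simp add: smult_pure)
  next
    case (add s t)
    then show ?case by (simp add: smult_add_T smult_closed_T)
  qed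
qed (rule is_cring T_abelian)+

lemma pure_bil: "bil V W T pure"
  using balancedD(4)[OF pure_balanced]
  by (intro bilI linI) (simp_all only: T_simps pure_closed balancedD(2,3)[OF pure_balanced] smult_pure)

lemma lin_ext:
  assumes X: "module k X" and f: "lin T X f" and g: "lin T X g"
    and "\<And>v w. v \<in> carrier V \<Longrightarrow> w \<in> carrier W \<Longrightarrow> f (pure v w) = g (pure v w)"
    and "t \<in> carrier T"
  shows "f t = g t"
  using assms(5)
proof (induction t rule: tensor_induct)
  case zero show ?case by (simp only: lin_zero[OF T_module X f] lin_zero[OF T_module X g])
next
  case (add s t) then show ?case by (simp only: linD(2)[OF f] linD(2)[OF g])
qed (rule assms(4))

lemma lin_tlift:
  assumes X: "module k X" and b: "bil V W X b"
  shows "lin T X (tlift X b)"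
proof (rule linI)
  note b' = module_abelian_group[OF X] bil_balanced[OF b]
  interpret X: module k X by fact
  fix c s assume c: "c \<in> carrier k" and st: "s \<in> carrier T"
  show "tlift X b (c \<odot>\<^bsub>T\<^esub> s) = c \<odot>\<^bsub>X\<^esub> tlift X b s"
    using st
  proof (induction s rule: tensor_induct)
    case zero
    have "tlift X b (lsum G [] (\<lambda>_. \<zero>\<^bsub>G\<^esub>)) = lsum X [] (\<lambda>_. \<zero>\<^bsub>X\<^esub>)"
      by (subst tlift_lsum[OF b']) simp_all
    then show ?case using c module.smult_r_null[OF T_module c] by simp
  next
    case (pure v w)
    then show ?case using c by (simp add: smult_pure tlift_pure[OF b'] linD(3)[OF bil_lin1[OF b]])
  next
    case (add s t)
    then show ?case using c by (simp add: smult_add_T smult_closed_T tlift_add[OF b'] tlift_closed[OF b'] X.smult_r_distr)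
  qed
next
  note b' = module_abelian_group[OF X] bil_balanced[OF b]
  show "t \<in> carrier T \<Longrightarrow> tlift X b t \<in> carrier X" for t using tlift_closed[OF b'] by simp
  show "s \<in> carrier T \<Longrightarrow> t \<in> carrier T \<Longrightarrow> tlift X b (s \<oplus>\<^bsub>T\<^esub> t) = tlift X b s \<oplus>\<^bsub>X\<^esub> tlift X b t" for s t
    using tlift_add[OF b'] by simp
qed

lemma tlift_pure': "module k X \<Longrightarrow> bil V W X b \<Longrightarrow> v \<in> carrier V \<Longrightarrow> w \<in> carrier W \<Longrightarrow> tlift X b (pure v w) = b v w"
  by (rule tlift_pure[OF module_abelian_group bil_balanced])

lemma tensor_list:
  assumes "t \<in> carrier T"
  obtains ps where "set ps \<subseteq> carrier V \<times> carrier W" "t = lsum T ps (\<lambda>p. pure (fst p) (snd p))"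
proof -
  obtain ps where "set ps \<subseteq> carrier V \<times> carrier W" "t = lsum G ps (\<lambda>p. pure (fst p) (snd p))"
    using tensor_rep assms by auto
  then show thesis by (intro that[of ps]) (simp_all add: lsum_def)
qed

lemma tlift_list:
  assumes "module k X" "bil V W X b" "set ps \<subseteq> carrier V \<times> carrier W"
  shows "tlift X b (lsum T ps (\<lambda>p. pure (fst p) (snd p))) = lsum X ps (\<lambda>p. b (fst p) (snd p))"
  using assms(3)
  by (subst lin_lsum_push[OF T_module assms(1) lin_tlift[OF assms(1,2)]])
     (auto intro!: lsum_cong simp: tlift_pure'[OF assms(1,2)] mem_Times_iff subset_iff)

text \<open>A decomposition of the fixed tensor \<open>t\<close> turns the map into a finite sum of
  maps that are linear in the parameter.\<close>

lemma lin_tlift_param: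
  assumes X: "module k X" and b: "\<And>u. u \<in> carrier U \<Longrightarrow> bil V W X (b u)"
    and l: "\<And>v w. v \<in> carrier V \<Longrightarrow> w \<in> carrier W \<Longrightarrow> lin U X (\<lambda>u. b u v w)"
    and t: "t \<in> carrier T" and U: "module k U"
  shows "lin U X (\<lambda>u. tlift X (b u) t)"
proof -
  obtain ps where ps: "set ps \<subseteq> carrier V \<times> carrier W" "t = lsum T ps (\<lambda>p. pure (fst p) (snd p))"
    using tensor_list[OF t] .
  have "lin U X (\<lambda>u. lsum X ps (\<lambda>p. b u (fst p) (snd p)))"
    by (rule lin_lsum[OF X]) (use ps l in auto)
  then show ?thesis
    by (subst lin_cong[OF U, of _ "\<lambda>u. lsum X ps (\<lambda>p. b u (fst p) (snd p))"])
       (simp_all add: ps(2) tlift_list[OF X b ps(1)] del: T_simps)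
qed

text \<open>The product of \<open>tensor\<close> is built from lifts into the bare group
  \<open>G\<close>, while the calculus of linear maps needs the module \<open>T\<close>. Both have
  the same carrier, zero and addition, so the lifts agree.\<close>

lemma tlift_G_T:
  assumes b: "bil V' W' T b" and V': "module k V'" and W': "module k W'" and "t \<in> carrier (tensor k V' W')"
  shows "tlift G b t = tlift T b t"
proof -
  interpret P: module_pair k V' W' by (rule module_pairI[OF V' W'])
  have b': "balanced V' W' G b" using bil_balanced[OF b] unfolding balanced_def by simp
  obtain ps where ps: "set ps \<subseteq> carrier V' \<times> carrier W'" "t = lsum P.T ps (\<lambda>p. P.pure (fst p) (snd p))"
    using P.tensor_list[OF assms(4)] .
  have e: "lsum P.T ps f = lsum P.G ps f" "lsum T ps g = lsum G ps g" for f and g :: "_ \<Rightarrow> ('v, 'w) tens"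
    by (simp_all add: lsum_def)
  have "tlift G b (lsum P.G ps (\<lambda>p. P.pure (fst p) (snd p))) = lsum G ps (\<lambda>p. tlift G b (P.pure (fst p) (snd p)))"
    by (rule P.tlift_lsum[OF G_abelian b']) (use ps in auto)
  also have "\<dots> = lsum G ps (\<lambda>p. b (fst p) (snd p))"
    by (rule lsum_cong, rule P.tlift_pure[OF G_abelian b']) (use ps in auto)
  finally show ?thesis
    using P.tlift_list[OF T_module b ps(1)] by (simp add: ps(2) e)
qed

end

context base_ring
begin

lemma tensor_module [simp]: "module k V \<Longrightarrow> module k W \<Longrightarrow> module k (tensor k V W)"
  by (rule module_pair.T_module[OF module_pairI])

lemma tpure_bil: "module k V \<Longrightarrow> module k W \<Longrightarrow> bil V W (tensor k V W) (tpure k V W)"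
  by (rule module_pair.pure_bil[OF module_pairI])

lemma tpure_closed [simp]:
  "module k V \<Longrightarrow> module k W \<Longrightarrow> v \<in> carrier V \<Longrightarrow> w \<in> carrier W \<Longrightarrow> tpure k V W v w \<in> carrier (tensor k V W)"
  by (rule bil_closed[OF tpure_bil])

lemma tlift_tpure [simp]:
  "module k V \<Longrightarrow> module k W \<Longrightarrow> module k X \<Longrightarrow> bil V W X b \<Longrightarrow> v \<in> carrier V \<Longrightarrow> w \<in> carrier W \<Longrightarrow>
   tlift X b (tpure k V W v w) = b v w"
  by (rule module_pair.tlift_pure'[OF module_pairI])

lemmas lin_tlift = module_pair.lin_tlift[OF module_pairI]
  and lin_ext = module_pair.lin_ext[OF module_pairI]
  and lin_tlift_param = module_pair.lin_tlift_param[OF module_pairI]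
  and tensor_list = module_pair.tensor_list[OF module_pairI]
  and tlift_list = module_pair.tlift_list[OF module_pairI]

lemma bil_comp_lin:
  "bil V W X b \<Longrightarrow> lin X Y f \<Longrightarrow> bil V W Y (\<lambda>v w. f (b v w))"
  by (intro bilI) (erule lin_comp[OF bil_lin2] lin_comp[OF bil_lin1], assumption+)+

lemma bil_comp_lin1: "bil V W X b \<Longrightarrow> lin U V f \<Longrightarrow> bil U W X (\<lambda>u w. b (f u) w)"
  by (intro bilI) (auto intro: bil_lin2 simp: linD intro: lin_comp[OF _ bil_lin1])

lemma bil_comp_lin2: "bil V W X b \<Longrightarrow> lin U W f \<Longrightarrow> bil V U X (\<lambda>v u. b v (f u))"
  by (intro bilI) (auto intro: bil_lin1 simp: linD intro: lin_comp[OF _ bil_lin2])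

lemma bil_cong:
  assumes "module k V" "module k W" "\<And>v w. v \<in> carrier V \<Longrightarrow> w \<in> carrier W \<Longrightarrow> b v w = b' v w"
  shows "bil V W X b \<longleftrightarrow> bil V W X b'"
  unfolding bil_def
  by (intro arg_cong2[of _ _ _ _ "(\<and>)"] ball_cong refl lin_cong[OF assms(1)] lin_cong[OF assms(2)] assms(3))

section \<open>Algebra structure on tensor products\<close>

definition alg where
  "alg V \<longleftrightarrow> module k V \<and> ring V \<and> bil V V V (\<lambda>a b. a \<otimes>\<^bsub>V\<^esub> b)"

lemma algD:
  assumes "alg V"
  shows "module k V" "ring V" "bil V V V (\<lambda>a b. a \<otimes>\<^bsub>V\<^esub> b)"
  using assms by (simp_all add: alg_def)

lemma alg_closed [simp]:
  assumes "alg V"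
  shows "\<one>\<^bsub>V\<^esub> \<in> carrier V"
    and "a \<in> carrier V \<Longrightarrow> b \<in> carrier V \<Longrightarrow> a \<otimes>\<^bsub>V\<^esub> b \<in> carrier V"
  using assms by (simp_all add: alg_def ring.ring_simprules)

definition khom where
  "khom V W f \<longleftrightarrow> lin V W f \<and> f \<one>\<^bsub>V\<^esub> = \<one>\<^bsub>W\<^esub> \<and>
     (\<forall>a\<in>carrier V. \<forall>b\<in>carrier V. f (a \<otimes>\<^bsub>V\<^esub> b) = f a \<otimes>\<^bsub>W\<^esub> f b)"

lemma khomD:
  assumes "khom V W f"
  shows "lin V W f" "f \<one>\<^bsub>V\<^esub> = \<one>\<^bsub>W\<^esub>"
    and "a \<in> carrier V \<Longrightarrow> b \<in> carrier V \<Longrightarrow> f (a \<otimes>\<^bsub>V\<^esub> b) = f a \<otimes>\<^bsub>W\<^esub> f b"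
  using assms by (simp_all add: khom_def)

lemma khom_comp: "khom V W f \<Longrightarrow> khom W X g \<Longrightarrow> khom V X (\<lambda>v. g (f v))"
  unfolding khom_def using lin_comp[of V W f X g] linD(1)[of V W f] by simp

lemma khom_id: "khom V V (\<lambda>v. v)" "khom V V id"
  by (simp_all add: khom_def lin_id id_def)

lemma tensor_one: "\<one>\<^bsub>tensor k V W\<^esub> = tpure k V W \<one>\<^bsub>V\<^esub> \<one>\<^bsub>W\<^esub>"
  by (simp add: tensor_def Let_def)

context
  fixes V :: "('k, 'v, 'm) module_scheme" and W :: "('k, 'w, 'n) module_scheme"
  assumes V: "alg V" and W: "alg W"
begin

private lemma mods: "module k V" "module k W" using V W by (simp_all add: alg_def)

interpretation P: module_pair k V W using mods by (rule module_pairI)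

private abbreviation "ten \<equiv> tensor k V W"

lemma inner_bil:
  assumes "v \<in> carrier V" "w \<in> carrier W"
  shows "bil V W ten (\<lambda>v' w'. tpure k V W (v \<otimes>\<^bsub>V\<^esub> v') (w \<otimes>\<^bsub>W\<^esub> w'))"
  by (rule bil_comp_lin1[OF bil_comp_lin2[OF tpure_bil[OF mods] bil_lin2[OF algD(3)[OF W] assms(2)]]
      bil_lin2[OF algD(3)[OF V] assms(1)]])

lemma outer_bil:
  assumes t: "t \<in> carrier ten"
  shows "bil V W ten (\<lambda>v w. tlift ten (\<lambda>v' w'. tpure k V W (v \<otimes>\<^bsub>V\<^esub> v') (w \<otimes>\<^bsub>W\<^esub> w')) t)"
proof (rule bilI)
  fix v assume v: "v \<in> carrier V"
  show "lin W ten (\<lambda>w. tlift ten (\<lambda>v' w'. tpure k V W (v \<otimes>\<^bsub>V\<^esub> v') (w \<otimes>\<^bsub>W\<^esub> w')) t)"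
  proof (rule lin_tlift_param[OF mods P.T_module _ _ t mods(2)])
    fix v' w' assume "v' \<in> carrier V" "w' \<in> carrier W"
    then show "lin W ten (\<lambda>w. tpure k V W (v \<otimes>\<^bsub>V\<^esub> v') (w \<otimes>\<^bsub>W\<^esub> w'))"
      using v V by (intro lin_comp[OF bil_lin1[OF algD(3)[OF W]] bil_lin2[OF tpure_bil[OF mods]]]) simp_all
  qed (rule inner_bil[OF v])
next
  fix w assume w: "w \<in> carrier W"
  show "lin V ten (\<lambda>v. tlift ten (\<lambda>v' w'. tpure k V W (v \<otimes>\<^bsub>V\<^esub> v') (w \<otimes>\<^bsub>W\<^esub> w')) t)"
  proof (rule lin_tlift_param[OF mods P.T_module _ _ t mods(1)])
    fix v' w' assume "v' \<in> carrier V" "w' \<in> carrier W"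
    then show "lin V ten (\<lambda>v. tpure k V W (v \<otimes>\<^bsub>V\<^esub> v') (w \<otimes>\<^bsub>W\<^esub> w'))"
      using w W by (intro lin_comp[OF bil_lin1[OF algD(3)[OF V]] bil_lin1[OF tpure_bil[OF mods]]]) simp_all
  qed (rule inner_bil[OF _ w])
qed

text \<open>Exchanges the lifts into the bare group in the definition of the product for lifts into
  the module, for which linearity is available.\<close>

lemma tensor_mult_eq:
  assumes s: "s \<in> carrier ten" and t: "t \<in> carrier ten"
  shows "s \<otimes>\<^bsub>ten\<^esub> t =
    tlift ten (\<lambda>v w. tlift ten (\<lambda>v' w'. tpure k V W (v \<otimes>\<^bsub>V\<^esub> v') (w \<otimes>\<^bsub>W\<^esub> w')) t) s"
proof -
  obtain ps where ps: "set ps \<subseteq> carrier V \<times> carrier W" "s = lsum ten ps (\<lambda>p. tpure k V W (fst p) (snd p))"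
    using tensor_list[OF mods s] .
  let ?i = "\<lambda>X v w. tlift X (\<lambda>v' w'. tpure k V W (v \<otimes>\<^bsub>V\<^esub> v') (w \<otimes>\<^bsub>W\<^esub> w')) t"
  have eq: "?i P.G v w = ?i ten v w" if "v \<in> carrier V" "w \<in> carrier W" for v w
    by (rule P.tlift_G_T[OF inner_bil[OF that] mods t])
  have b: "bil V W ten (?i P.G)"
    by (rule iffD2[OF bil_cong[OF mods eq] outer_bil[OF t]])
  have "s \<otimes>\<^bsub>ten\<^esub> t = tlift P.G (?i P.G) s" by (simp add: tensor_def Let_def)
  also have "\<dots> = tlift ten (?i P.G) s" by (rule P.tlift_G_T[OF b mods s])
  also have "\<dots> = tlift ten (?i ten) s"
    unfolding ps(2) tlift_list[OF mods P.T_module b ps(1)] tlift_list[OF mods P.T_module outer_bil[OF t] ps(1)]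
    by (rule lsum_cong) (use ps eq in auto)
  finally show ?thesis .
qed

lemma tensor_mult_pure:
  assumes "v \<in> carrier V" "w \<in> carrier W" "v' \<in> carrier V" "w' \<in> carrier W"
  shows "tpure k V W v w \<otimes>\<^bsub>ten\<^esub> tpure k V W v' w' = tpure k V W (v \<otimes>\<^bsub>V\<^esub> v') (w \<otimes>\<^bsub>W\<^esub> w')"
  using assms mods
  by (simp add: tensor_mult_eq outer_bil inner_bil del: P.T_simps)

lemma tensor_mult_bil: "bil ten ten ten (\<lambda>s t. s \<otimes>\<^bsub>ten\<^esub> t)"
proof (rule bilI)
  fix s assume s: "s \<in> carrier ten"
  show "lin ten ten (\<lambda>t. s \<otimes>\<^bsub>ten\<^esub> t)"
    by (subst lin_cong[OF P.T_module tensor_mult_eq[OF s]], assumption)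
      (rule lin_tlift_param[OF mods P.T_module outer_bil _ s P.T_module], assumption,
        rule lin_tlift[OF mods P.T_module inner_bil])
next
  fix t assume t: "t \<in> carrier ten"
  show "lin ten ten (\<lambda>s. s \<otimes>\<^bsub>ten\<^esub> t)"
    by (subst lin_cong[OF P.T_module tensor_mult_eq[OF _ t]], assumption)
      (rule lin_tlift[OF mods P.T_module outer_bil[OF t]])
qed

text \<open>Both sides of the associativity law are linear in each of the three factors, so three
  nested uses of \<open>lin_ext\<close> reduce it to pure tensors.\<close>

lemma tensor_alg: "alg ten"
proof -
  note l1 = bil_lin1[OF tensor_mult_bil] and l2 = bil_lin2[OF tensor_mult_bil]
  interpret V: ring V using V by (simp add: alg_def)
  interpret W: ring W using W by (simp add: alg_def)
  note cl = bil_closed[OF tensor_mult_bil]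
  have assoc: "(s \<otimes>\<^bsub>ten\<^esub> t) \<otimes>\<^bsub>ten\<^esub> u = s \<otimes>\<^bsub>ten\<^esub> (t \<otimes>\<^bsub>ten\<^esub> u)"
    if s: "s \<in> carrier ten" and t: "t \<in> carrier ten" and u: "u \<in> carrier ten" for s t u
  proof (rule lin_ext[OF mods P.T_module _ _ _ s])
    show "lin ten ten (\<lambda>s. s \<otimes>\<^bsub>ten\<^esub> t \<otimes>\<^bsub>ten\<^esub> u)" by (rule lin_comp[OF l1[OF t] l1[OF u]])
    show "lin ten ten (\<lambda>s. s \<otimes>\<^bsub>ten\<^esub> (t \<otimes>\<^bsub>ten\<^esub> u))" by (rule l1[OF cl[OF t u]])
    fix v w assume vw: "v \<in> carrier V" "w \<in> carrier W"
    then have p: "tpure k V W v w \<in> carrier ten" using mods by (rule_tac tpure_closed)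
    show "tpure k V W v w \<otimes>\<^bsub>ten\<^esub> t \<otimes>\<^bsub>ten\<^esub> u = tpure k V W v w \<otimes>\<^bsub>ten\<^esub> (t \<otimes>\<^bsub>ten\<^esub> u)"
    proof (rule lin_ext[OF mods P.T_module _ _ _ t])
      show "lin ten ten (\<lambda>t. tpure k V W v w \<otimes>\<^bsub>ten\<^esub> t \<otimes>\<^bsub>ten\<^esub> u)" by (rule lin_comp[OF l2[OF p] l1[OF u]])
      show "lin ten ten (\<lambda>t. tpure k V W v w \<otimes>\<^bsub>ten\<^esub> (t \<otimes>\<^bsub>ten\<^esub> u))" by (rule lin_comp[OF l1[OF u] l2[OF p]])
      fix v' w' assume vw': "v' \<in> carrier V" "w' \<in> carrier W"
      then have p': "tpure k V W v' w' \<in> carrier ten" using mods by (rule_tac tpure_closed)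
      show "tpure k V W v w \<otimes>\<^bsub>ten\<^esub> tpure k V W v' w' \<otimes>\<^bsub>ten\<^esub> u
          = tpure k V W v w \<otimes>\<^bsub>ten\<^esub> (tpure k V W v' w' \<otimes>\<^bsub>ten\<^esub> u)"
      proof (rule lin_ext[OF mods P.T_module _ _ _ u])
        show "lin ten ten (\<lambda>u. tpure k V W v w \<otimes>\<^bsub>ten\<^esub> tpure k V W v' w' \<otimes>\<^bsub>ten\<^esub> u)" by (rule l2[OF cl[OF p p']])
        show "lin ten ten (\<lambda>u. tpure k V W v w \<otimes>\<^bsub>ten\<^esub> (tpure k V W v' w' \<otimes>\<^bsub>ten\<^esub> u))"
          by (rule lin_comp[OF l2[OF p'] l2[OF p]])
      qed (use vw vw' in \<open>simp add: tensor_mult_pure V.m_assoc W.m_assoc\<close>)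
    qed
  qed
  have one: "\<one>\<^bsub>ten\<^esub> \<in> carrier ten" unfolding tensor_one using mods by (intro tpure_closed) simp_all
  have l_one: "\<one>\<^bsub>ten\<^esub> \<otimes>\<^bsub>ten\<^esub> s = s" and r_one: "s \<otimes>\<^bsub>ten\<^esub> \<one>\<^bsub>ten\<^esub> = s" if s: "s \<in> carrier ten" for s
  proof -
    show "\<one>\<^bsub>ten\<^esub> \<otimes>\<^bsub>ten\<^esub> s = s"
      by (rule lin_ext[OF mods P.T_module l2[OF one] lin_id _ s]) (simp add: tensor_one tensor_mult_pure)
    show "s \<otimes>\<^bsub>ten\<^esub> \<one>\<^bsub>ten\<^esub> = s"
      by (rule lin_ext[OF mods P.T_module l1[OF one] lin_id _ s]) (simp add: tensor_one tensor_mult_pure)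
  qed
  have "ring ten"
    by (rule ringI[OF P.T_abelian monoidI]; (rule cl one assoc l_one r_one linD(2)[OF l1] linD(2)[OF l2]; assumption)?)
  then show ?thesis unfolding alg_def using tensor_mult_bil P.T_module by blast
qed

end

text \<open>Multiplicativity is an equality between maps that are linear in each of the two factors,
  hence may be tested on pure tensors.\<close>

lemma khom_ext_tensor:
  assumes V: "alg V" and W: "alg W" and X: "alg X" and f: "lin (tensor k V W) X f"
    and one: "f (tpure k V W \<one>\<^bsub>V\<^esub> \<one>\<^bsub>W\<^esub>) = \<one>\<^bsub>X\<^esub>"
    and mult: "\<And>v w v' w'. v \<in> carrier V \<Longrightarrow> w \<in> carrier W \<Longrightarrow> v' \<in> carrier V \<Longrightarrow> w' \<in> carrier W \<Longrightarrow>
      f (tpure k V W (v \<otimes>\<^bsub>V\<^esub> v') (w \<otimes>\<^bsub>W\<^esub> w')) = f (tpure k V W v w) \<otimes>\<^bsub>X\<^esub> f (tpure k V W v' w')"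
  shows "khom (tensor k V W) X f"
proof -
  let ?T = "tensor k V W"
  note m = algD(1)[OF V] algD(1)[OF W] and x = algD(1)[OF X]
  note T = tensor_mult_bil[OF V W]
  have "f (s \<otimes>\<^bsub>?T\<^esub> t) = f s \<otimes>\<^bsub>X\<^esub> f t" if s: "s \<in> carrier ?T" and t: "t \<in> carrier ?T" for s t
  proof (rule lin_ext[OF m x _ _ _ s])
    show "lin ?T X (\<lambda>s. f (s \<otimes>\<^bsub>?T\<^esub> t))" by (rule lin_comp[OF bil_lin1[OF T t] f])
    show "lin ?T X (\<lambda>s. f s \<otimes>\<^bsub>X\<^esub> f t)" by (rule lin_comp[OF f bil_lin1[OF algD(3)[OF X] lin_closed[OF f t]]])
    fix v w assume vw: "v \<in> carrier V" "w \<in> carrier W"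
    then have p: "tpure k V W v w \<in> carrier ?T" using m by (rule_tac tpure_closed)
    show "f (tpure k V W v w \<otimes>\<^bsub>?T\<^esub> t) = f (tpure k V W v w) \<otimes>\<^bsub>X\<^esub> f t"
      by (rule lin_ext[OF m x lin_comp[OF bil_lin2[OF T p] f]
            lin_comp[OF f bil_lin2[OF algD(3)[OF X] lin_closed[OF f p]]] _ t])
         (use vw in \<open>simp add: tensor_mult_pure[OF V W] mult\<close>)
  qed
  then show ?thesis using f one by (simp add: khom_def tensor_one)
qed

lemma tmap_bil:
  assumes "module k V" "module k W" "module k X" "module k Y" "lin V X f" "lin W Y g"
  shows "bil V W (tensor k X Y) (\<lambda>v w. tpure k X Y (f v) (g w))"
  by (rule bil_comp_lin1[OF bil_comp_lin2[OF tpure_bil[OF assms(3,4)] assms(6)] assms(5)])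

lemma tmap_lin:
  assumes "module k V" "module k W" "module k X" "module k Y" "lin V X f" "lin W Y g"
  shows "lin (tensor k V W) (tensor k X Y) (tmap k X Y f g)"
  unfolding tmap_def by (rule lin_tlift[OF assms(1,2) tensor_module[OF assms(3,4)] tmap_bil[OF assms]])

lemma tmap_pure:
  assumes "module k V" "module k W" "module k X" "module k Y" "lin V X f" "lin W Y g"
    "v \<in> carrier V" "w \<in> carrier W"
  shows "tmap k X Y f g (tpure k V W v w) = tpure k X Y (f v) (g w)"
  unfolding tmap_def by (rule tlift_tpure[OF assms(1,2) tensor_module[OF assms(3,4)] tmap_bil[OF assms(1-6)] assms(7,8)])

lemma tmap_khom:
  assumes V: "alg V" and W: "alg W" and X: "alg X" and Y: "alg Y" and f: "khom V X f" and g: "khom W Y g"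
  shows "khom (tensor k V W) (tensor k X Y) (tmap k X Y f g)"
proof -
  note m = algD(1)[OF V] algD(1)[OF W] algD(1)[OF X] algD(1)[OF Y] khomD(1)[OF f] khomD(1)[OF g]
  show ?thesis
    by (rule khom_ext_tensor[OF V W tensor_alg[OF X Y] tmap_lin[OF m]])
       (simp_all add: tmap_pure[OF m] V W tensor_one khomD(2)[OF f] khomD(2)[OF g] khomD(3)[OF f] khomD(3)[OF g]
         tensor_mult_pure[OF X Y] lin_closed[OF m(5)] lin_closed[OF m(6)])
qed

lemma khom_tpure_left: "alg V \<Longrightarrow> alg W \<Longrightarrow> khom V (tensor k V W) (\<lambda>v. tpure k V W v \<one>\<^bsub>W\<^esub>)"
  unfolding khom_def
  by (simp add: tensor_one tensor_mult_pure bil_lin1[OF tpure_bil] algD(1) ring.ring_simprules(12)[OF algD(2)]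
    monoid.l_one ring.is_monoid algD(2))

lemma khom_tpure_right: "alg V \<Longrightarrow> alg W \<Longrightarrow> khom W (tensor k V W) (\<lambda>w. tpure k V W \<one>\<^bsub>V\<^esub> w)"
  unfolding khom_def
  by (simp add: tensor_one tensor_mult_pure bil_lin2[OF tpure_bil] algD(1) monoid.l_one ring.is_monoid algD(2))

context
  fixes U :: "('k, 'u, 'l) module_scheme" and V :: "('k, 'v, 'm) module_scheme"
    and W :: "('k, 'w, 'n) module_scheme"
  assumes mU: "module k U" and mV: "module k V" and mW: "module k W"
begin

private abbreviation "UV \<equiv> tensor k U V"
private abbreviation "VW \<equiv> tensor k V W"
private abbreviation "X \<equiv> tensor k UV W"

private lemma mods3: "module k UV" "module k VW" "module k X" "module k (tensor k U VW)"
  using mU mV mW by simp_all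

lemma tassoc_inner_bil:
  "u \<in> carrier U \<Longrightarrow> bil V W X (\<lambda>v w. tpure k UV W (tpure k U V u v) w)"
  by (rule bil_comp_lin1[OF tpure_bil[OF mods3(1) mW] bil_lin2[OF tpure_bil[OF mU mV]]])

lemma tassoc_outer_bil:
  "bil U VW X (\<lambda>u s. tlift X (\<lambda>v w. tpure k UV W (tpure k U V u v) w) s)"
proof (rule bilI)
  fix u assume u: "u \<in> carrier U"
  show "lin VW X (tlift X (\<lambda>v w. tpure k UV W (tpure k U V u v) w))"
    by (rule lin_tlift[OF mV mW mods3(3) tassoc_inner_bil[OF u]])
next
  fix s assume s: "s \<in> carrier VW"
  show "lin U X (\<lambda>u. tlift X (\<lambda>v w. tpure k UV W (tpure k U V u v) w) s)"
    by (rule lin_tlift_param[OF mV mW mods3(3) tassoc_inner_bil _ s mU])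
       (assumption, rule lin_comp[OF bil_lin1[OF tpure_bil[OF mU mV]] bil_lin1[OF tpure_bil[OF mods3(1) mW]]])
qed

lemma tassoc_lin: "lin (tensor k U VW) X (tassoc k U V W)"
  unfolding tassoc_def Let_def by (rule lin_tlift[OF mU mods3(2,3) tassoc_outer_bil])

lemma tassoc_pure:
  "u \<in> carrier U \<Longrightarrow> v \<in> carrier V \<Longrightarrow> w \<in> carrier W \<Longrightarrow>
   tassoc k U V W (tpure k U VW u (tpure k V W v w)) = tpure k UV W (tpure k U V u v) w"
  unfolding tassoc_def Let_def
  by (simp add: tlift_tpure[OF mU mods3(2,3) tassoc_outer_bil] tlift_tpure[OF mV mW mods3(3) tassoc_inner_bil] mV mW)

end

text \<open>Needed because the pentagon will be solved for inverses: \<open>comul_right\<close> and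
  \<open>pent1\<close> are composites with \<open>tassoc\<close> and have to carry \<phi> and its
  inverse to mutually inverse elements.\<close>

lemma tassoc_khom:
  assumes U: "alg U" and V: "alg V" and W: "alg W"
  shows "khom (tensor k U (tensor k V W)) (tensor k (tensor k U V) W) (tassoc k U V W)"
proof -
  let ?VW = "tensor k V W" and ?UV = "tensor k U V"
  let ?X = "tensor k ?UV W" and ?Y = "tensor k U ?VW"
  note m = algD(1)[OF U] algD(1)[OF V] algD(1)[OF W]
  note VW = tensor_alg[OF V W] and UV = tensor_alg[OF U V]
  note X = tensor_alg[OF UV W]
  let ?f = "tassoc k U V W"
  note f = tassoc_lin[OF m]
  show ?thesis
  proof (rule khom_ext_tensor[OF U VW X f])
    show "?f (tpure k U ?VW \<one>\<^bsub>U\<^esub> \<one>\<^bsub>?VW\<^esub>) = \<one>\<^bsub>?X\<^esub>"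
      unfolding tensor_one by (simp add: tassoc_pure m U V W)
    fix u s u' s' assume u: "u \<in> carrier U" "u' \<in> carrier U" and s: "s \<in> carrier ?VW" and s': "s' \<in> carrier ?VW"
    have uu: "u \<otimes>\<^bsub>U\<^esub> u' \<in> carrier U" using u U by simp
    note pl = bil_lin2[OF tpure_bil[OF m(1) algD(1)[OF VW]]]
    note f1 = lin_comp[OF pl f, OF u(1)] and f2 = lin_comp[OF pl f, OF u(2)] and f3 = lin_comp[OF pl f, OF uu]
    show "?f (tpure k U ?VW (u \<otimes>\<^bsub>U\<^esub> u') (s \<otimes>\<^bsub>?VW\<^esub> s')) =
        ?f (tpure k U ?VW u s) \<otimes>\<^bsub>?X\<^esub> ?f (tpure k U ?VW u' s')"
    proof (rule lin_ext[OF m(2,3) algD(1)[OF X] _ _ _ s])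
      show "lin ?VW ?X (\<lambda>s. ?f (tpure k U ?VW (u \<otimes>\<^bsub>U\<^esub> u') (s \<otimes>\<^bsub>?VW\<^esub> s')))"
        by (rule lin_comp[OF bil_lin1[OF algD(3)[OF VW] s'] f3])
      show "lin ?VW ?X (\<lambda>s. ?f (tpure k U ?VW u s) \<otimes>\<^bsub>?X\<^esub> ?f (tpure k U ?VW u' s'))"
        by (rule lin_comp[OF f1 bil_lin1[OF algD(3)[OF X] lin_closed[OF f2 s']]])
      fix v w assume vw: "v \<in> carrier V" "w \<in> carrier W"
      then have p: "tpure k V W v w \<in> carrier ?VW" using m by (rule_tac tpure_closed)
      show "?f (tpure k U ?VW (u \<otimes>\<^bsub>U\<^esub> u') (tpure k V W v w \<otimes>\<^bsub>?VW\<^esub> s')) =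
          ?f (tpure k U ?VW u (tpure k V W v w)) \<otimes>\<^bsub>?X\<^esub> ?f (tpure k U ?VW u' s')"
        by (rule lin_ext[OF m(2,3) algD(1)[OF X] lin_comp[OF bil_lin2[OF algD(3)[OF VW] p] f3]
              lin_comp[OF f2 bil_lin2[OF algD(3)[OF X] lin_closed[OF f1 p]]] _ s'])
           (use u vw in \<open>simp add: tensor_mult_pure[OF V W] tassoc_pure[OF m] tensor_mult_pure[OF U V]
             tensor_mult_pure[OF UV W] U V W m\<close>)
    qed
  qed
qed

end

section \<open>Sums over the components of tensors\<close>

named_theorems lin_rules

sublocale quasi_bialgebra \<subseteq> base_ring k
  by (rule base_ring.intro) (rule R.is_cring)

context quasi_bialgebra
begin

abbreviation hmult (infixl "\<cdot>" 70) where "g \<cdot> h \<equiv> g \<otimes>\<^bsub>H\<^esub> h"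

text \<open>Restricting to components in \<open>carrier H\<close> makes the congruence and closure rules below unconditional.\<close>

definition s2 :: "('x, 'm) ring_scheme \<Rightarrow> ('h \<times> 'h) list \<Rightarrow> ('h \<Rightarrow> 'h \<Rightarrow> 'x) \<Rightarrow> 'x" where
  "s2 X ps T = lsum X (filter (\<lambda>p. p \<in> carrier H \<times> carrier H) ps) (\<lambda>p. T (fst p) (snd p))"

definition s3 :: "('x, 'm) ring_scheme \<Rightarrow> ('h \<times> 'h \<times> 'h) list \<Rightarrow> ('h \<Rightarrow> 'h \<Rightarrow> 'h \<Rightarrow> 'x) \<Rightarrow> 'x" where
  "s3 X ps T = lsum X (filter (\<lambda>p. p \<in> carrier H \<times> carrier H \<times> carrier H) ps)
     (\<lambda>p. T (fst p) (fst (snd p)) (snd (snd p)))"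

lemma s2_cong [cong]:
  "ps = qs \<Longrightarrow> (\<And>a b. a \<in> carrier H \<Longrightarrow> b \<in> carrier H \<Longrightarrow> T a b = T' a b) \<Longrightarrow> s2 X ps T = s2 X qs T'"
  unfolding s2_def by (auto intro!: lsum_cong)

lemma s3_cong [cong]:
  "ps = qs \<Longrightarrow> (\<And>a b c. a \<in> carrier H \<Longrightarrow> b \<in> carrier H \<Longrightarrow> c \<in> carrier H \<Longrightarrow> T a b c = T' a b c) \<Longrightarrow>
   s3 X ps T = s3 X qs T'"
  unfolding s3_def by (auto intro!: lsum_cong)

lemma s2_closed [simp]:
  "module k X \<Longrightarrow> (\<And>a b. a \<in> carrier H \<Longrightarrow> b \<in> carrier H \<Longrightarrow> T a b \<in> carrier X) \<Longrightarrow> s2 X ps T \<in> carrier X"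
  unfolding s2_def by (rule module_lsum_closed) auto

lemma s3_closed [simp]:
  "module k X \<Longrightarrow> (\<And>a b c. a \<in> carrier H \<Longrightarrow> b \<in> carrier H \<Longrightarrow> c \<in> carrier H \<Longrightarrow> T a b c \<in> carrier X) \<Longrightarrow>
   s3 X ps T \<in> carrier X"
  unfolding s3_def by (rule module_lsum_closed) auto

lemma s2_push:
  "lin V W g \<Longrightarrow> module k V \<Longrightarrow> module k W \<Longrightarrow>
   (\<And>a b. a \<in> carrier H \<Longrightarrow> b \<in> carrier H \<Longrightarrow> T a b \<in> carrier V) \<Longrightarrow>
   g (s2 V ps T) = s2 W ps (\<lambda>a b. g (T a b))"
  unfolding s2_def by (rule lin_lsum_push) auto

lemma s3_push:
  "lin V W g \<Longrightarrow> module k V \<Longrightarrow> module k W \<Longrightarrow>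
   (\<And>a b c. a \<in> carrier H \<Longrightarrow> b \<in> carrier H \<Longrightarrow> c \<in> carrier H \<Longrightarrow> T a b c \<in> carrier V) \<Longrightarrow>
   g (s3 V ps T) = s3 W ps (\<lambda>a b c. g (T a b c))"
  unfolding s3_def by (rule lin_lsum_push) auto

lemma lin_s2 [lin_rules]:
  "module k X \<Longrightarrow> (\<And>a b. a \<in> carrier H \<Longrightarrow> b \<in> carrier H \<Longrightarrow> lin V X (\<lambda>v. T v a b)) \<Longrightarrow>
   lin V X (\<lambda>v. s2 X ps (T v))"
  unfolding s2_def by (rule lin_lsum) auto

lemma lin_s3 [lin_rules]:
  "module k X \<Longrightarrow> (\<And>a b c. a \<in> carrier H \<Longrightarrow> b \<in> carrier H \<Longrightarrow> c \<in> carrier H \<Longrightarrow> lin V X (\<lambda>v. T v a b c)) \<Longrightarrow>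
   lin V X (\<lambda>v. s3 X ps (T v))"
  unfolding s3_def by (rule lin_lsum) auto

lemma s2_s2_swap:
  "module k X \<Longrightarrow> (\<And>a b c d. a \<in> carrier H \<Longrightarrow> b \<in> carrier H \<Longrightarrow> c \<in> carrier H \<Longrightarrow> d \<in> carrier H \<Longrightarrow> T a b c d \<in> carrier X) \<Longrightarrow>
   s2 X ps (\<lambda>a b. s2 X qs (T a b)) = s2 X qs (\<lambda>c d. s2 X ps (\<lambda>a b. T a b c d))"
  unfolding s2_def by (rule abelian_group.lsum_swap[OF module_abelian_group]) auto

lemma s2_s3_swap:
  "module k X \<Longrightarrow> (\<And>a b c d e. a \<in> carrier H \<Longrightarrow> b \<in> carrier H \<Longrightarrow> c \<in> carrier H \<Longrightarrow> d \<in> carrier H \<Longrightarrow> e \<in> carrier H \<Longrightarrow>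
     T a b c d e \<in> carrier X) \<Longrightarrow>
   s2 X ps (\<lambda>a b. s3 X qs (T a b)) = s3 X qs (\<lambda>c d e. s2 X ps (\<lambda>a b. T a b c d e))"
  unfolding s2_def s3_def by (rule abelian_group.lsum_swap[OF module_abelian_group]) auto

lemma s3_s3_swap:
  "module k X \<Longrightarrow> (\<And>a b c d e f. a \<in> carrier H \<Longrightarrow> b \<in> carrier H \<Longrightarrow> c \<in> carrier H \<Longrightarrow> d \<in> carrier H \<Longrightarrow> e \<in> carrier H \<Longrightarrow>
     f \<in> carrier H \<Longrightarrow> T a b c d e f \<in> carrier X) \<Longrightarrow>
   s3 X ps (\<lambda>a b c. s3 X qs (T a b c)) = s3 X qs (\<lambda>d e f. s3 X ps (\<lambda>a b c. T a b c d e f))"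
  unfolding s3_def by (rule abelian_group.lsum_swap[OF module_abelian_group]) auto

lemma s2_add:
  "module k X \<Longrightarrow> (\<And>a b. a \<in> carrier H \<Longrightarrow> b \<in> carrier H \<Longrightarrow> T a b \<in> carrier X \<and> T' a b \<in> carrier X) \<Longrightarrow>
   s2 X ps (\<lambda>a b. T a b \<oplus>\<^bsub>X\<^esub> T' a b) = s2 X ps T \<oplus>\<^bsub>X\<^esub> s2 X ps T'"
  unfolding s2_def by (rule abelian_group.lsum_add[OF module_abelian_group]) auto

lemma s3_add:
  "module k X \<Longrightarrow> (\<And>a b c. a \<in> carrier H \<Longrightarrow> b \<in> carrier H \<Longrightarrow> c \<in> carrier H \<Longrightarrow> T a b c \<in> carrier X \<and> T' a b c \<in> carrier X) \<Longrightarrow>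
   s3 X ps (\<lambda>a b c. T a b c \<oplus>\<^bsub>X\<^esub> T' a b c) = s3 X ps T \<oplus>\<^bsub>X\<^esub> s3 X ps T'"
  unfolding s3_def by (rule abelian_group.lsum_add[OF module_abelian_group]) auto

lemma s2_zero: "module k X \<Longrightarrow> (\<And>a b. a \<in> carrier H \<Longrightarrow> b \<in> carrier H \<Longrightarrow> T a b = \<zero>\<^bsub>X\<^esub>) \<Longrightarrow> s2 X ps T = \<zero>\<^bsub>X\<^esub>"
  unfolding s2_def by (rule abelian_group.lsum_zero[OF module_abelian_group]) auto

lemma s3_zero: "module k X \<Longrightarrow> (\<And>a b c. a \<in> carrier H \<Longrightarrow> b \<in> carrier H \<Longrightarrow> c \<in> carrier H \<Longrightarrow> T a b c = \<zero>\<^bsub>X\<^esub>) \<Longrightarrow> s3 X ps T = \<zero>\<^bsub>X\<^esub>"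
  unfolding s3_def by (rule abelian_group.lsum_zero[OF module_abelian_group]) auto

lemma H_module [simp]: "module k H"
  by (rule module_axioms)

lemma H_alg [simp]: "alg H"
  unfolding alg_def
  by (intro conjI H_module ring_axioms bilI linI)
     (simp_all add: smult_mult_left smult_mult_right r_distr l_distr)

lemma T2_alg [simp]: "alg (tensor2 k H)" and T3_alg [simp]: "alg (tensor3 k H)" and T4_alg [simp]: "alg (tensor4 k H)"
  by (simp_all add: tensor_alg)

lemma pure_closed [simp]:
  "a \<in> carrier H \<Longrightarrow> b \<in> carrier H \<Longrightarrow> pure2 k H a b \<in> carrier (tensor2 k H)"
  "s \<in> carrier (tensor2 k H) \<Longrightarrow> b \<in> carrier H \<Longrightarrow> tpure k (tensor2 k H) H s b \<in> carrier (tensor3 k H)"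
  "u \<in> carrier (tensor3 k H) \<Longrightarrow> b \<in> carrier H \<Longrightarrow> tpure k (tensor3 k H) H u b \<in> carrier (tensor4 k H)"
  by simp_all

lemma hmult_lin [lin_rules]:
  "lin V H g \<Longrightarrow> h \<in> carrier H \<Longrightarrow> lin V H (\<lambda>v. g v \<cdot> h)"
  "lin V H g \<Longrightarrow> h \<in> carrier H \<Longrightarrow> lin V H (\<lambda>v. h \<cdot> g v)"
  by (erule lin_comp[OF _ bil_lin1[OF algD(3)[OF H_alg]]], assumption)
     (erule lin_comp[OF _ bil_lin2[OF algD(3)[OF H_alg]]], assumption)

lemmas [lin_rules] = lin_id

section \<open>Multilinear functionals on tensor powers of \<open>H\<close>\<close>

definition tril where
  "tril X T \<longleftrightarrow> (\<forall>a\<in>carrier H. \<forall>b\<in>carrier H. lin H X (T a b)) \<and>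
     (\<forall>a\<in>carrier H. \<forall>c\<in>carrier H. lin H X (\<lambda>b. T a b c)) \<and>
     (\<forall>b\<in>carrier H. \<forall>c\<in>carrier H. lin H X (\<lambda>a. T a b c))"

definition quad where
  "quad X T \<longleftrightarrow> (\<forall>a\<in>carrier H. tril X (T a)) \<and>
     (\<forall>b\<in>carrier H. \<forall>c\<in>carrier H. \<forall>d\<in>carrier H. lin H X (\<lambda>a. T a b c d))"

lemma trilI [lin_rules]:
  assumes "\<And>a b. a \<in> carrier H \<Longrightarrow> b \<in> carrier H \<Longrightarrow> lin H X (\<lambda>c. T a b c)"
    "\<And>a c. a \<in> carrier H \<Longrightarrow> c \<in> carrier H \<Longrightarrow> lin H X (\<lambda>b. T a b c)"
    "\<And>b c. b \<in> carrier H \<Longrightarrow> c \<in> carrier H \<Longrightarrow> lin H X (\<lambda>a. T a b c)"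
  shows "tril X T"
  using assms by (simp add: tril_def)

lemma quadI [lin_rules]:
  assumes "\<And>a. a \<in> carrier H \<Longrightarrow> tril X (\<lambda>b c d. T a b c d)"
    "\<And>b c d. b \<in> carrier H \<Longrightarrow> c \<in> carrier H \<Longrightarrow> d \<in> carrier H \<Longrightarrow> lin H X (\<lambda>a. T a b c d)"
  shows "quad X T"
  using assms by (simp add: quad_def)

lemmas [lin_rules] = bilI

lemma bil_linr:
  assumes "bil V W X b"
  shows "lin U V g \<Longrightarrow> w \<in> carrier W \<Longrightarrow> lin U X (\<lambda>u. b (g u) w)"
    and "lin U W g' \<Longrightarrow> v \<in> carrier V \<Longrightarrow> lin U X (\<lambda>u. b v (g' u))"
  using lin_comp[OF _ bil_lin1[OF assms]] lin_comp[OF _ bil_lin2[OF assms]] by auto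

lemma tril_linr:
  assumes "tril X T"
  shows "lin V H g \<Longrightarrow> b \<in> carrier H \<Longrightarrow> c \<in> carrier H \<Longrightarrow> lin V X (\<lambda>v. T (g v) b c)"
    and "lin V H g' \<Longrightarrow> a \<in> carrier H \<Longrightarrow> c \<in> carrier H \<Longrightarrow> lin V X (\<lambda>v. T a (g' v) c)"
    and "lin V H g'' \<Longrightarrow> a \<in> carrier H \<Longrightarrow> b \<in> carrier H \<Longrightarrow> lin V X (\<lambda>v. T a b (g'' v))"
proof -
  show "lin V H g \<Longrightarrow> b \<in> carrier H \<Longrightarrow> c \<in> carrier H \<Longrightarrow> lin V X (\<lambda>v. T (g v) b c)"
    by (rule lin_comp[of V H g X "\<lambda>a. T a b c"]) (use assms in \<open>simp_all add: tril_def\<close>)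
  show "lin V H g' \<Longrightarrow> a \<in> carrier H \<Longrightarrow> c \<in> carrier H \<Longrightarrow> lin V X (\<lambda>v. T a (g' v) c)"
    by (rule lin_comp[of V H g' X "\<lambda>b. T a b c"]) (use assms in \<open>simp_all add: tril_def\<close>)
  show "lin V H g'' \<Longrightarrow> a \<in> carrier H \<Longrightarrow> b \<in> carrier H \<Longrightarrow> lin V X (\<lambda>v. T a b (g'' v))"
    by (rule lin_comp[of V H g'' X "T a b"]) (use assms in \<open>simp_all add: tril_def\<close>)
qed

lemma tril_closed: "tril X T \<Longrightarrow> a \<in> carrier H \<Longrightarrow> b \<in> carrier H \<Longrightarrow> c \<in> carrier H \<Longrightarrow> T a b c \<in> carrier X"
  by (rule lin_closed[of H X "T a b"]) (simp_all add: tril_def)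

lemma quad_linr:
  assumes "quad X T"
  shows "lin V H g \<Longrightarrow> b \<in> carrier H \<Longrightarrow> c \<in> carrier H \<Longrightarrow> d \<in> carrier H \<Longrightarrow> lin V X (\<lambda>v. T (g v) b c d)"
    and "lin V H g1 \<Longrightarrow> a \<in> carrier H \<Longrightarrow> c \<in> carrier H \<Longrightarrow> d \<in> carrier H \<Longrightarrow> lin V X (\<lambda>v. T a (g1 v) c d)"
    and "lin V H g2 \<Longrightarrow> a \<in> carrier H \<Longrightarrow> b \<in> carrier H \<Longrightarrow> d \<in> carrier H \<Longrightarrow> lin V X (\<lambda>v. T a b (g2 v) d)"
    and "lin V H g3 \<Longrightarrow> a \<in> carrier H \<Longrightarrow> b \<in> carrier H \<Longrightarrow> c \<in> carrier H \<Longrightarrow> lin V X (\<lambda>v. T a b c (g3 v))"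
proof -
  have t: "tril X (T a)" if "a \<in> carrier H" for a using assms that by (simp add: quad_def)
  have l: "lin H X (\<lambda>a. T a b c d)" if "b \<in> carrier H" "c \<in> carrier H" "d \<in> carrier H" for b c d
    using assms that by (simp add: quad_def)
  show "lin V H g \<Longrightarrow> b \<in> carrier H \<Longrightarrow> c \<in> carrier H \<Longrightarrow> d \<in> carrier H \<Longrightarrow> lin V X (\<lambda>v. T (g v) b c d)"
    by (rule lin_comp[of V H g X "\<lambda>a. T a b c d"]) (simp_all add: l)
  show "lin V H g1 \<Longrightarrow> a \<in> carrier H \<Longrightarrow> c \<in> carrier H \<Longrightarrow> d \<in> carrier H \<Longrightarrow> lin V X (\<lambda>v. T a (g1 v) c d)"
    by (rule tril_linr(1)[OF t])
  show "lin V H g2 \<Longrightarrow> a \<in> carrier H \<Longrightarrow> b \<in> carrier H \<Longrightarrow> d \<in> carrier H \<Longrightarrow> lin V X (\<lambda>v. T a b (g2 v) d)"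
    by (rule tril_linr(2)[OF t])
  show "lin V H g3 \<Longrightarrow> a \<in> carrier H \<Longrightarrow> b \<in> carrier H \<Longrightarrow> c \<in> carrier H \<Longrightarrow> lin V X (\<lambda>v. T a b c (g3 v))"
    by (rule tril_linr(3)[OF t])
qed

lemma pure_linr [lin_rules]:
  "lin V H g \<Longrightarrow> b \<in> carrier H \<Longrightarrow> lin V (tensor2 k H) (\<lambda>v. pure2 k H (g v) b)"
  "lin V H g \<Longrightarrow> a \<in> carrier H \<Longrightarrow> lin V (tensor2 k H) (\<lambda>v. pure2 k H a (g v))"
  "lin V (tensor2 k H) g2 \<Longrightarrow> b \<in> carrier H \<Longrightarrow> lin V (tensor3 k H) (\<lambda>v. tpure k (tensor2 k H) H (g2 v) b)"
  "lin V H g \<Longrightarrow> s \<in> carrier (tensor2 k H) \<Longrightarrow> lin V (tensor3 k H) (\<lambda>v. tpure k (tensor2 k H) H s (g v))"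
  "lin V (tensor3 k H) g3 \<Longrightarrow> b \<in> carrier H \<Longrightarrow> lin V (tensor4 k H) (\<lambda>v. tpure k (tensor3 k H) H (g3 v) b)"
  "lin V H g \<Longrightarrow> u \<in> carrier (tensor3 k H) \<Longrightarrow> lin V (tensor4 k H) (\<lambda>v. tpure k (tensor3 k H) H u (g v))"
  by (rule bil_linr[OF tpure_bil]; simp)+

text \<open>Chosen decompositions into pure tensors: a \<open>tlift\<close> becomes a finite sum over a list, and such sums
  can be interchanged and pushed through linear maps by rewriting.\<close>

definition rep2 :: "('h, 'h) tens \<Rightarrow> ('h \<times> 'h) list" where
  "rep2 t = (SOME ps. t = s2 (tensor2 k H) ps (pure2 k H))"

definition rep3 :: "(('h, 'h) tens, 'h) tens \<Rightarrow> ('h \<times> 'h \<times> 'h) list" where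
  "rep3 t = (SOME ps. t = s3 (tensor3 k H) ps (pure3 k H))"

lemma rep2:
  assumes "t \<in> carrier (tensor2 k H)"
  shows "s2 (tensor2 k H) (rep2 t) (pure2 k H) = t"
proof -
  obtain ps where ps: "set ps \<subseteq> carrier H \<times> carrier H" "t = lsum (tensor2 k H) ps (\<lambda>p. pure2 k H (fst p) (snd p))"
    using tensor_list[OF H_module H_module assms] .
  have f: "filter (\<lambda>p. p \<in> carrier H \<times> carrier H) ps = ps"
    by (rule filter_True) (use ps(1) in blast)
  have "\<exists>ps. t = s2 (tensor2 k H) ps (pure2 k H)" by (rule exI[of _ ps], unfold s2_def f, rule ps(2))
  from someI_ex[OF this] show ?thesis unfolding rep2_def by simp
qed

lemma tlift_rep2:
  assumes "t \<in> carrier (tensor2 k H)" "module k X" "bil H H X T"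
  shows "tlift X T t = s2 X (rep2 t) T"
  by (subst rep2[OF assms(1), symmetric], subst s2_push[OF lin_tlift[OF H_module H_module assms(2,3)]])
     (simp_all add: assms)

lemma tlift3_bil:
  assumes X: "module k X" and T: "tril X T"
  shows "bil (tensor2 k H) H X (\<lambda>s w. tlift X (\<lambda>u v. T u v w) s)"
proof -
  note [lin_rules] = tril_linr[OF T]
  have b: "bil H H X (\<lambda>u v. T u v w)" if "w \<in> carrier H" for w
    using that by (intro lin_rules)
  show ?thesis
    by (intro bilI lin_tlift lin_tlift_param b) (simp_all add: X, (intro lin_rules; simp)+)
qed

lemma tlift3_lin: "module k X \<Longrightarrow> tril X T \<Longrightarrow> lin (tensor3 k H) X (tlift3 X T)"
  unfolding tlift3_def by (rule lin_tlift) (simp_all add: tlift3_bil)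

lemma tlift3_pure:
  assumes X: "module k X" and T: "tril X T" and "a \<in> carrier H" "b \<in> carrier H" "c \<in> carrier H"
  shows "tlift3 X T (pure3 k H a b c) = T a b c"
proof -
  note [lin_rules] = tril_linr[OF T]
  have b: "bil H H X (\<lambda>u v. T u v c)" using assms by (intro lin_rules)
  show ?thesis
    unfolding tlift3_def using assms by (simp add: tlift3_bil b)
qed

lemma rep3:
  assumes "t \<in> carrier (tensor3 k H)"
  shows "s3 (tensor3 k H) (rep3 t) (pure3 k H) = t"
proof -
  interpret P: module_pair k "tensor2 k H" H by (rule module_pairI) simp_all
  let ?S = "carrier H \<times> carrier H \<times> carrier H"
  let ?p = "\<lambda>p. pure3 k H (fst p) (fst (snd p)) (snd (snd p))"
  have "\<exists>ps. set ps \<subseteq> ?S \<and> t = lsum (tensor3 k H) ps ?p"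
    using assms
  proof (induction t rule: P.tensor_induct)
    case zero show ?case by (intro exI[of _ "[]"]) simp
  next
    case (pure s w)
    obtain ps where ps: "set ps \<subseteq> carrier H \<times> carrier H" "s = lsum (tensor2 k H) ps (\<lambda>p. pure2 k H (fst p) (snd p))"
      using tensor_list[OF H_module H_module pure(1)] .
    have "tpure k (tensor2 k H) H s w = lsum (tensor3 k H) ps (\<lambda>p. pure3 k H (fst p) (snd p) w)"
      unfolding ps(2)
      by (rule lin_lsum_push[OF _ _ bil_lin1[OF tpure_bil _]]) (use ps pure in auto)
    then show ?case using ps(1) pure(2)
      by (intro exI[of _ "map (\<lambda>p. (fst p, snd p, w)) ps"]) (auto simp: lsum_map)
  next
    case (add s t)
    then obtain ps qs where "set ps \<subseteq> ?S" "s = lsum (tensor3 k H) ps ?p" "set qs \<subseteq> ?S" "t = lsum (tensor3 k H) qs ?p"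
      by blast
    moreover from this have "lsum (tensor3 k H) (ps @ qs) ?p = lsum (tensor3 k H) ps ?p \<oplus>\<^bsub>tensor3 k H\<^esub> lsum (tensor3 k H) qs ?p"
      by (intro abelian_group.lsum_append module_abelian_group) (auto simp: subset_iff)
    ultimately show ?case by (intro exI[of _ "ps @ qs"]) auto
  qed
  then obtain ps where ps: "set ps \<subseteq> ?S" "t = lsum (tensor3 k H) ps ?p" by blast
  have f: "filter (\<lambda>p. p \<in> ?S) ps = ps"
    by (rule filter_True) (use ps(1) in blast)
  have "\<exists>ps. t = s3 (tensor3 k H) ps (pure3 k H)" by (rule exI[of _ ps], unfold s3_def f, rule ps(2))
  from someI_ex[OF this] show ?thesis unfolding rep3_def by simp
qed

lemma tlift3_rep3:
  assumes "t \<in> carrier (tensor3 k H)" "module k X" "tril X T"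
  shows "tlift3 X T t = s3 X (rep3 t) T"
  by (subst rep3[OF assms(1), symmetric], subst s3_push[OF tlift3_lin[OF assms(2,3)]])
     (simp_all add: assms tlift3_pure)

text \<open>The pentagon lives in the fourth tensor power; this is the functional against which it
  is tested.\<close>

definition tlift4 :: "('k, 'x, 'm) module_scheme \<Rightarrow> ('h \<Rightarrow> 'h \<Rightarrow> 'h \<Rightarrow> 'h \<Rightarrow> 'x) \<Rightarrow> ((('h, 'h) tens, 'h) tens, 'h) tens \<Rightarrow> 'x" where
  "tlift4 X T = tlift X (\<lambda>s d. tlift3 X (\<lambda>a b c. T a b c d) s)"

lemma tlift4_bil:
  assumes X: "module k X" and T: "quad X T"
  shows "bil (tensor3 k H) H X (\<lambda>s d. tlift3 X (\<lambda>a b c. T a b c d) s)"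
proof (rule bilI)
  note [lin_rules] = quad_linr[OF T]
  have t: "tril X (\<lambda>a b c. T a b c d)" if "d \<in> carrier H" for d using that by (intro lin_rules)
  show "w \<in> carrier H \<Longrightarrow> lin (tensor3 k H) X (tlift3 X (\<lambda>a b c. T a b c w))" for w
    by (rule tlift3_lin[OF X t])
  fix s assume s: "s \<in> carrier (tensor3 k H)"
  have "lin H X (\<lambda>d. s3 X (rep3 s) (\<lambda>a b c. T a b c d))" by (intro lin_rules X)
  then show "lin H X (\<lambda>d. tlift3 X (\<lambda>a b c. T a b c d) s)"
    by (subst lin_cong[OF H_module]) (auto simp: tlift3_rep3[OF s X t])
qed

lemma tlift4_lin: "module k X \<Longrightarrow> quad X T \<Longrightarrow> lin (tensor4 k H) X (tlift4 X T)"
  unfolding tlift4_def by (rule lin_tlift) (simp_all add: tlift4_bil)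

abbreviation "pure4 a b c d \<equiv> tpure k (tensor3 k H) H (pure3 k H a b c) d"

lemma tlift4_pure:
  assumes X: "module k X" and T: "quad X T" and "a \<in> carrier H" "b \<in> carrier H" "c \<in> carrier H" "d \<in> carrier H"
  shows "tlift4 X T (pure4 a b c d) = T a b c d"
proof -
  note [lin_rules] = quad_linr[OF T]
  have t: "tril X (\<lambda>a b c. T a b c d)" using assms by (intro lin_rules)
  show ?thesis
    unfolding tlift4_def using assms by (simp add: tlift4_bil tlift3_pure[OF X t])
qed

text \<open>A substitute for Sweedler notation: \<open>s2 X (Dl h)\<close> sums over the two
  components of the coproduct of \<open>h\<close>, \<open>s3 X Ph\<close> and \<open>s3 X Ps\<close>
  over the three components of \<phi> and of its inverse.\<close>

definition "Dl h = rep2 (comul H h)"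
definition "Ph = rep3 (phi H)"
definition "Ps = rep3 (phi_inv k H)"

lemma comul_khom: "khom H (tensor2 k H) (comul H)"
  using comul_linear comul_hom unfolding khom_def ring_hom_def by simp

lemma comul_closed [simp]: "h \<in> carrier H \<Longrightarrow> comul H h \<in> carrier (tensor2 k H)"
  by (rule lin_closed[OF comul_linear])

lemma tlift_comul: "h \<in> carrier H \<Longrightarrow> module k X \<Longrightarrow> bil H H X T \<Longrightarrow> tlift X T (comul H h) = s2 X (Dl h) T"
  unfolding Dl_def by (rule tlift_rep2) simp_all

lemma comul_Dl: "h \<in> carrier H \<Longrightarrow> comul H h = s2 (tensor2 k H) (Dl h) (pure2 k H)"
  by (simp add: Dl_def rep2)

text \<open>The list \<open>Dl h\<close> is an arbitrary choice for each \<open>h\<close> and is not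
  itself linear in \<open>h\<close>. The sum over it is, because it equals a \<open>tlift\<close>
  composed with the linear coproduct.\<close>

lemma lin_Dl [lin_rules]:
  assumes "module k X" "bil H H X T" "lin V H g"
  shows "lin V X (\<lambda>v. s2 X (Dl (g v)) T)"
proof -
  have "lin H X (\<lambda>h. tlift X T (comul H h))"
    by (rule lin_comp[OF comul_linear lin_tlift]) (simp_all add: assms)
  then have "lin H X (\<lambda>h. s2 X (Dl h) T)"
    by (subst (asm) lin_cong[OF H_module]) (simp_all add: tlift_comul assms)
  then show ?thesis by (rule lin_comp[OF assms(3)])
qed

lemma T3_ring: "ring (tensor3 k H)" by (rule algD) simp
lemma T4_ring: "ring (tensor4 k H)" by (rule algD) simp

sublocale T3: ring "tensor3 k H" by (rule T3_ring)
sublocale T4: ring "tensor4 k H" by (rule T4_ring)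

lemma phi_closed [simp]: "phi H \<in> carrier (tensor3 k H)" "phi_inv k H \<in> carrier (tensor3 k H)"
  using phi_unit by (simp_all add: phi_inv_def T3.Units_closed)

lemma phi_phi_inv: "phi H \<otimes>\<^bsub>tensor3 k H\<^esub> phi_inv k H = \<one>\<^bsub>tensor3 k H\<^esub>"
    "phi_inv k H \<otimes>\<^bsub>tensor3 k H\<^esub> phi H = \<one>\<^bsub>tensor3 k H\<^esub>"
  using phi_unit by (simp_all add: phi_inv_def T3.Units_r_inv T3.Units_l_inv)

lemma phi_Ph: "phi H = s3 (tensor3 k H) Ph (pure3 k H)" and phi_inv_Ps: "phi_inv k H = s3 (tensor3 k H) Ps (pure3 k H)"
  by (simp_all add: rep3 Ph_def Ps_def)

lemma alg_mult_s:
  assumes "alg B"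
  shows "u \<in> carrier B \<Longrightarrow> (\<And>a b. a \<in> carrier H \<Longrightarrow> b \<in> carrier H \<Longrightarrow> T a b \<in> carrier B) \<Longrightarrow>
      s2 B ps T \<otimes>\<^bsub>B\<^esub> u = s2 B ps (\<lambda>a b. T a b \<otimes>\<^bsub>B\<^esub> u)"
    and "u \<in> carrier B \<Longrightarrow> (\<And>a b. a \<in> carrier H \<Longrightarrow> b \<in> carrier H \<Longrightarrow> T a b \<in> carrier B) \<Longrightarrow>
      u \<otimes>\<^bsub>B\<^esub> s2 B ps T = s2 B ps (\<lambda>a b. u \<otimes>\<^bsub>B\<^esub> T a b)"
    and "u \<in> carrier B \<Longrightarrow> (\<And>a b c. a \<in> carrier H \<Longrightarrow> b \<in> carrier H \<Longrightarrow> c \<in> carrier H \<Longrightarrow> T' a b c \<in> carrier B) \<Longrightarrow>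
      s3 B qs T' \<otimes>\<^bsub>B\<^esub> u = s3 B qs (\<lambda>a b c. T' a b c \<otimes>\<^bsub>B\<^esub> u)"
    and "u \<in> carrier B \<Longrightarrow> (\<And>a b c. a \<in> carrier H \<Longrightarrow> b \<in> carrier H \<Longrightarrow> c \<in> carrier H \<Longrightarrow> T' a b c \<in> carrier B) \<Longrightarrow>
      u \<otimes>\<^bsub>B\<^esub> s3 B qs T' = s3 B qs (\<lambda>a b c. u \<otimes>\<^bsub>B\<^esub> T' a b c)"
  using algD[OF assms]
  by (auto intro!: s2_push[of B B "\<lambda>t. t \<otimes>\<^bsub>B\<^esub> u"] s2_push[of B B "\<lambda>t. u \<otimes>\<^bsub>B\<^esub> t"]
    s3_push[of B B "\<lambda>t. t \<otimes>\<^bsub>B\<^esub> u"] s3_push[of B B "\<lambda>t. u \<otimes>\<^bsub>B\<^esub> t"] bil_lin1 bil_lin2[of B B B "\<lambda>s t. s \<otimes>\<^bsub>B\<^esub> t"])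

lemma pure_mult:
  "a \<in> carrier H \<Longrightarrow> b \<in> carrier H \<Longrightarrow> c \<in> carrier H \<Longrightarrow> d \<in> carrier H \<Longrightarrow>
    pure2 k H a b \<otimes>\<^bsub>tensor2 k H\<^esub> pure2 k H c d = pure2 k H (a \<cdot> c) (b \<cdot> d)"
  "s \<in> carrier (tensor2 k H) \<Longrightarrow> b \<in> carrier H \<Longrightarrow> t \<in> carrier (tensor2 k H) \<Longrightarrow> d \<in> carrier H \<Longrightarrow>
    tpure k (tensor2 k H) H s b \<otimes>\<^bsub>tensor3 k H\<^esub> tpure k (tensor2 k H) H t d = tpure k (tensor2 k H) H (s \<otimes>\<^bsub>tensor2 k H\<^esub> t) (b \<cdot> d)"
  "u \<in> carrier (tensor3 k H) \<Longrightarrow> b \<in> carrier H \<Longrightarrow> v \<in> carrier (tensor3 k H) \<Longrightarrow> d \<in> carrier H \<Longrightarrow>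
    tpure k (tensor3 k H) H u b \<otimes>\<^bsub>tensor4 k H\<^esub> tpure k (tensor3 k H) H v d = tpure k (tensor3 k H) H (u \<otimes>\<^bsub>tensor3 k H\<^esub> v) (b \<cdot> d)"
  by (simp_all add: tensor_mult_pure)

lemma tlift_s:
  assumes X: "module k X"
  shows "bil H H X T2 \<Longrightarrow> (\<And>a b. a \<in> carrier H \<Longrightarrow> b \<in> carrier H \<Longrightarrow> f a b \<in> carrier (tensor2 k H)) \<Longrightarrow>
      tlift X T2 (s2 (tensor2 k H) ps f) = s2 X ps (\<lambda>a b. tlift X T2 (f a b))"
    and "tril X T3 \<Longrightarrow> (\<And>a b. a \<in> carrier H \<Longrightarrow> b \<in> carrier H \<Longrightarrow> g a b \<in> carrier (tensor3 k H)) \<Longrightarrow>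
      tlift3 X T3 (s2 (tensor3 k H) ps g) = s2 X ps (\<lambda>a b. tlift3 X T3 (g a b))"
    and "tril X T3 \<Longrightarrow> (\<And>a b c. a \<in> carrier H \<Longrightarrow> b \<in> carrier H \<Longrightarrow> c \<in> carrier H \<Longrightarrow> g' a b c \<in> carrier (tensor3 k H)) \<Longrightarrow>
      tlift3 X T3 (s3 (tensor3 k H) qs g') = s3 X qs (\<lambda>a b c. tlift3 X T3 (g' a b c))"
    and "quad X T4 \<Longrightarrow> (\<And>a b. a \<in> carrier H \<Longrightarrow> b \<in> carrier H \<Longrightarrow> h a b \<in> carrier (tensor4 k H)) \<Longrightarrow>
      tlift4 X T4 (s2 (tensor4 k H) ps h) = s2 X ps (\<lambda>a b. tlift4 X T4 (h a b))"
    and "quad X T4 \<Longrightarrow> (\<And>a b c. a \<in> carrier H \<Longrightarrow> b \<in> carrier H \<Longrightarrow> c \<in> carrier H \<Longrightarrow> h' a b c \<in> carrier (tensor4 k H)) \<Longrightarrow>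
      tlift4 X T4 (s3 (tensor4 k H) qs h') = s3 X qs (\<lambda>a b c. tlift4 X T4 (h' a b c))"
  using X by (auto intro!: s2_push[OF lin_tlift] s2_push[OF tlift3_lin] s3_push[OF tlift3_lin] s2_push[OF tlift4_lin]
      s3_push[OF tlift4_lin])

lemma lin_id_id: "lin V V id" by (simp add: id_def lin_id)

lemma comul_left_khom: "khom (tensor2 k H) (tensor3 k H) (comul_left k H)"
  unfolding comul_left_def by (rule tmap_khom) (simp_all add: comul_khom khom_id)

lemma comul_right_khom: "khom (tensor2 k H) (tensor3 k H) (comul_right k H)"
  unfolding comul_right_def[abs_def]
  by (rule khom_comp[OF tmap_khom tassoc_khom]) (simp_all add: comul_khom khom_id)

lemma comul_left_pure:
  assumes "a \<in> carrier H" "b \<in> carrier H"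
  shows "comul_left k H (pure2 k H a b) = s2 (tensor3 k H) (Dl a) (\<lambda>c d. pure3 k H c d b)"
proof -
  have "comul_left k H (pure2 k H a b) = tpure k (tensor2 k H) H (s2 (tensor2 k H) (Dl a) (pure2 k H)) b"
    unfolding comul_left_def using assms
    by (subst tmap_pure) (simp_all add: comul_linear lin_id_id comul_Dl[symmetric])
  also have "\<dots> = s2 (tensor3 k H) (Dl a) (\<lambda>c d. pure3 k H c d b)"
    by (rule s2_push) (use assms in \<open>simp_all add: lin_rules\<close>)
  finally show ?thesis .
qed

lemma comul_right_pure:
  assumes "a \<in> carrier H" "b \<in> carrier H"
  shows "comul_right k H (pure2 k H a b) = s2 (tensor3 k H) (Dl b) (\<lambda>c d. pure3 k H a c d)"
proof -
  have "comul_right k H (pure2 k H a b) = tassoc k H H H (tpure k H (tensor2 k H) a (s2 (tensor2 k H) (Dl b) (pure2 k H)))"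
    unfolding comul_right_def using assms
    by (subst tmap_pure) (simp_all add: comul_linear lin_id_id comul_Dl[symmetric])
  also have "\<dots> = s2 (tensor3 k H) (Dl b) (\<lambda>c d. tassoc k H H H (tpure k H (tensor2 k H) a (pure2 k H c d)))"
    by (rule s2_push[OF lin_comp[OF bil_lin2[OF tpure_bil] tassoc_lin]]) (use assms in simp_all)
  also have "\<dots> = s2 (tensor3 k H) (Dl b) (\<lambda>c d. pure3 k H a c d)"
    using assms by (simp add: tassoc_pure)
  finally show ?thesis .
qed

text \<open>The five factors of the pentagon identity, in the order in which they occur in it.\<close>

definition "pent1 t = tassoc k (tensor2 k H) H H (tmap k (tensor2 k H) (tensor2 k H) id (comul H) t)"
definition "pent2 = tmap k (tensor3 k H) H (comul_left k H) id"
definition "pent4 = tmap k (tensor3 k H) H (comul_right k H) id"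
definition "pent3 = tmap k (tensor3 k H) H (tmap k (tensor2 k H) H (pure2 k H \<one>\<^bsub>H\<^esub>) id) id"
definition "pent5 t = tpure k (tensor3 k H) H t \<one>\<^bsub>H\<^esub>"

lemma khom4:
  "khom (tensor3 k H) (tensor4 k H) pent1" "khom (tensor3 k H) (tensor4 k H) pent2"
  "khom (tensor3 k H) (tensor4 k H) pent4" "khom (tensor3 k H) (tensor4 k H) pent3"
  "khom (tensor3 k H) (tensor4 k H) pent5"
proof -
  show "khom (tensor3 k H) (tensor4 k H) pent1" unfolding pent1_def[abs_def]
    by (rule khom_comp[OF tmap_khom tassoc_khom]) (simp_all add: comul_khom khom_id)
  show "khom (tensor3 k H) (tensor4 k H) pent2" unfolding pent2_def
    by (rule tmap_khom) (simp_all add: comul_left_khom khom_id)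
  show "khom (tensor3 k H) (tensor4 k H) pent4" unfolding pent4_def
    by (rule tmap_khom) (simp_all add: comul_right_khom khom_id)
  show "khom (tensor3 k H) (tensor4 k H) pent3" unfolding pent3_def
    by (intro tmap_khom khom_tpure_right[of H H, unfolded eta_contract_eq]) (simp_all add: khom_id khom_tpure_right)
  show "khom (tensor3 k H) (tensor4 k H) pent5" unfolding pent5_def[abs_def]
    by (rule khom_tpure_left) simp_all
qed

lemma pent1_pure:
  assumes "a \<in> carrier H" "b \<in> carrier H" "c \<in> carrier H"
  shows "pent1 (pure3 k H a b c) = s2 (tensor4 k H) (Dl c) (\<lambda>d e. pure4 a b d e)"
proof -
  have "pent1 (pure3 k H a b c) = tassoc k (tensor2 k H) H H (tpure k (tensor2 k H) (tensor2 k H) (pure2 k H a b) (s2 (tensor2 k H) (Dl c) (pure2 k H)))"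
    unfolding pent1_def using assms by (subst tmap_pure) (simp_all add: comul_linear lin_id_id comul_Dl[symmetric])
  also have "\<dots> = s2 (tensor4 k H) (Dl c) (\<lambda>d e. tassoc k (tensor2 k H) H H (tpure k (tensor2 k H) (tensor2 k H) (pure2 k H a b) (pure2 k H d e)))"
    by (rule s2_push[OF lin_comp[OF bil_lin2[OF tpure_bil] tassoc_lin]]) (use assms in simp_all)
  also have "\<dots> = s2 (tensor4 k H) (Dl c) (\<lambda>d e. pure4 a b d e)"
    using assms by (simp add: tassoc_pure)
  finally show ?thesis .
qed

lemma pent2_pure:
  assumes "a \<in> carrier H" "b \<in> carrier H" "c \<in> carrier H"
  shows "pent2 (pure3 k H a b c) = s2 (tensor4 k H) (Dl a) (\<lambda>d e. pure4 d e b c)"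
proof -
  have "pent2 (pure3 k H a b c) = tpure k (tensor3 k H) H (s2 (tensor3 k H) (Dl a) (\<lambda>d e. pure3 k H d e b)) c"
    unfolding pent2_def using assms by (subst tmap_pure) (simp_all add: khomD(1)[OF comul_left_khom] lin_id_id comul_left_pure)
  also have "\<dots> = s2 (tensor4 k H) (Dl a) (\<lambda>d e. pure4 d e b c)"
    by (rule s2_push) (use assms in \<open>simp_all add: lin_rules\<close>)
  finally show ?thesis .
qed

lemma pent4_pure:
  assumes "a \<in> carrier H" "b \<in> carrier H" "c \<in> carrier H"
  shows "pent4 (pure3 k H a b c) = s2 (tensor4 k H) (Dl b) (\<lambda>d e. pure4 a d e c)"
proof -
  have "pent4 (pure3 k H a b c) = tpure k (tensor3 k H) H (s2 (tensor3 k H) (Dl b) (\<lambda>d e. pure3 k H a d e)) c"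
    unfolding pent4_def using assms by (subst tmap_pure) (simp_all add: khomD(1)[OF comul_right_khom] lin_id_id comul_right_pure)
  also have "\<dots> = s2 (tensor4 k H) (Dl b) (\<lambda>d e. pure4 a d e c)"
    by (rule s2_push) (use assms in \<open>simp_all add: lin_rules\<close>)
  finally show ?thesis .
qed

lemma pent3_pure:
  assumes "a \<in> carrier H" "b \<in> carrier H" "c \<in> carrier H"
  shows "pent3 (pure3 k H a b c) = pure4 \<one>\<^bsub>H\<^esub> a b c"
proof -
  have l: "lin H (tensor2 k H) (pure2 k H \<one>\<^bsub>H\<^esub>)" by (rule bil_lin2[OF tpure_bil]) simp_all
  then have l2: "lin (tensor2 k H) (tensor3 k H) (tmap k (tensor2 k H) H (pure2 k H \<one>\<^bsub>H\<^esub>) id)"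
    by (intro tmap_lin) (simp_all add: lin_id_id)
  show ?thesis unfolding pent3_def using assms l l2 by (simp add: tmap_pure lin_id_id)
qed

lemma pent5_pure: "pent5 (pure3 k H a b c) = pure4 a b c \<one>\<^bsub>H\<^esub>"
  by (simp add: pent5_def)

lemma khom4_s3:
  "pent1 (s3 (tensor3 k H) ps (pure3 k H)) = s3 (tensor4 k H) ps (\<lambda>a b c. s2 (tensor4 k H) (Dl c) (\<lambda>d e. pure4 a b d e))"
  "pent2 (s3 (tensor3 k H) ps (pure3 k H)) = s3 (tensor4 k H) ps (\<lambda>a b c. s2 (tensor4 k H) (Dl a) (\<lambda>d e. pure4 d e b c))"
  "pent4 (s3 (tensor3 k H) ps (pure3 k H)) = s3 (tensor4 k H) ps (\<lambda>a b c. s2 (tensor4 k H) (Dl b) (\<lambda>d e. pure4 a d e c))"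
  "pent3 (s3 (tensor3 k H) ps (pure3 k H)) = s3 (tensor4 k H) ps (\<lambda>a b c. pure4 \<one>\<^bsub>H\<^esub> a b c)"
  "pent5 (s3 (tensor3 k H) ps (pure3 k H)) = s3 (tensor4 k H) ps (\<lambda>a b c. pure4 a b c \<one>\<^bsub>H\<^esub>)"
  by (subst s3_push[OF khomD(1)[OF khom4(1)]] s3_push[OF khomD(1)[OF khom4(2)]] s3_push[OF khomD(1)[OF khom4(3)]]
      s3_push[OF khomD(1)[OF khom4(4)]] s3_push[OF khomD(1)[OF khom4(5)]];
      simp add: pent1_pure pent2_pure pent4_pure pent3_pure pent5_pure)+

lemma pentagon4: "pent1 (phi H) \<otimes>\<^bsub>tensor4 k H\<^esub> pent2 (phi H) = pent3 (phi H) \<otimes>\<^bsub>tensor4 k H\<^esub> pent4 (phi H) \<otimes>\<^bsub>tensor4 k H\<^esub> pent5 (phi H)"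
  using pentagon unfolding pent1_def pent2_def pent3_def pent4_def pent5_def .

end

section \<open>Quasi-bialgebra identities\<close>

context quasi_bialgebra
begin

section \<open>The pentagon solved for inverses and tested on components\<close>

lemma khom4_closed [simp]:
  "t \<in> carrier (tensor3 k H) \<Longrightarrow> pent1 t \<in> carrier (tensor4 k H)"
  "t \<in> carrier (tensor3 k H) \<Longrightarrow> pent2 t \<in> carrier (tensor4 k H)"
  "t \<in> carrier (tensor3 k H) \<Longrightarrow> pent3 t \<in> carrier (tensor4 k H)"
  "t \<in> carrier (tensor3 k H) \<Longrightarrow> pent4 t \<in> carrier (tensor4 k H)"
  "t \<in> carrier (tensor3 k H) \<Longrightarrow> pent5 t \<in> carrier (tensor4 k H)"
  "u \<in> carrier (tensor2 k H) \<Longrightarrow> comul_left k H u \<in> carrier (tensor3 k H)"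
  "u \<in> carrier (tensor2 k H) \<Longrightarrow> comul_right k H u \<in> carrier (tensor3 k H)"
  by (simp_all add: khom4(1-5)[THEN khomD(1), THEN lin_closed] comul_left_khom[THEN khomD(1), THEN lin_closed]
    comul_right_khom[THEN khomD(1), THEN lin_closed])

text \<open>The product on the left arises when a curried map is evaluated: \<phi> comes from the
  evaluation, split by the coproduct in its first leg, and the inverse of \<phi> comes from the
  currying. See \<open>eval_curry_sum\<close>.\<close>

lemma pentagon4_left:
  "pent2 (phi H) \<otimes>\<^bsub>tensor4 k H\<^esub> pent5 (phi_inv k H) = pent1 (phi_inv k H) \<otimes>\<^bsub>tensor4 k H\<^esub> pent3 (phi H) \<otimes>\<^bsub>tensor4 k H\<^esub> pent4 (phi H)"
proof -
  let ?m = "\<lambda>s t. s \<otimes>\<^bsub>tensor4 k H\<^esub> t"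
  have P: "?m (pent1 (phi_inv k H)) (pent1 (phi H)) = \<one>\<^bsub>tensor4 k H\<^esub>"
    by (simp add: khomD(2)[OF khom4(1)] khomD(3)[OF khom4(1), symmetric] phi_phi_inv)
  have C: "?m (pent5 (phi H)) (pent5 (phi_inv k H)) = \<one>\<^bsub>tensor4 k H\<^esub>"
    by (simp add: khomD(2)[OF khom4(5)] khomD(3)[OF khom4(5), symmetric] phi_phi_inv)
  have "?m (pent2 (phi H)) (pent5 (phi_inv k H)) = ?m (pent1 (phi_inv k H)) (?m (?m (pent1 (phi H)) (pent2 (phi H))) (pent5 (phi_inv k H)))"
    using P by (simp add: T4.m_assoc[symmetric])
  also have "\<dots> = ?m (?m (pent1 (phi_inv k H)) (?m (pent3 (phi H)) (pent4 (phi H)))) (?m (pent5 (phi H)) (pent5 (phi_inv k H)))"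
    unfolding pentagon4 by (simp add: T4.m_assoc)
  finally show ?thesis unfolding C by (simp add: T4.m_assoc)
qed

text \<open>The opposite situation, in which an evaluation is curried back and the coproduct splits
  the inverse of \<phi>. See \<open>curry_eval_sum\<close>.\<close>

lemma pentagon4_right:
  "pent5 (phi H) \<otimes>\<^bsub>tensor4 k H\<^esub> pent2 (phi_inv k H) = pent4 (phi_inv k H) \<otimes>\<^bsub>tensor4 k H\<^esub> pent3 (phi_inv k H) \<otimes>\<^bsub>tensor4 k H\<^esub> pent1 (phi H)"
proof -
  let ?m = "\<lambda>s t. s \<otimes>\<^bsub>tensor4 k H\<^esub> t"
  have A: "?m (pent3 (phi_inv k H)) (pent3 (phi H)) = \<one>\<^bsub>tensor4 k H\<^esub>"
    by (simp add: khomD(2)[OF khom4(4)] khomD(3)[OF khom4(4), symmetric] phi_phi_inv)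
  have B: "?m (pent4 (phi_inv k H)) (pent4 (phi H)) = \<one>\<^bsub>tensor4 k H\<^esub>"
    by (simp add: khomD(2)[OF khom4(3)] khomD(3)[OF khom4(3), symmetric] phi_phi_inv)
  have D: "?m (pent2 (phi H)) (pent2 (phi_inv k H)) = \<one>\<^bsub>tensor4 k H\<^esub>"
    by (simp add: khomD(2)[OF khom4(2)] khomD(3)[OF khom4(2), symmetric] phi_phi_inv)
  have "?m (?m (pent4 (phi_inv k H)) (pent3 (phi_inv k H))) (pent1 (phi H))
    = ?m (?m (?m (pent4 (phi_inv k H)) (pent3 (phi_inv k H))) (pent1 (phi H))) (?m (pent2 (phi H)) (pent2 (phi_inv k H)))"
    unfolding D by simp
  also have "\<dots> = ?m (?m (pent4 (phi_inv k H)) (pent3 (phi_inv k H))) (?m (?m (pent1 (phi H)) (pent2 (phi H))) (pent2 (phi_inv k H)))"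
    by (simp add: T4.m_assoc)
  also have "\<dots> = ?m (?m (?m (pent4 (phi_inv k H)) (?m (?m (pent3 (phi_inv k H)) (pent3 (phi H))) (pent4 (phi H)))) (pent5 (phi H))) (pent2 (phi_inv k H))"
    unfolding pentagon4 by (simp add: T4.m_assoc)
  also have "\<dots> = ?m (pent5 (phi H)) (pent2 (phi_inv k H))"
    unfolding A by (simp add: B)
  finally show ?thesis by simp
qed

lemma khom4_expand:
  "pent1 (phi H) = s3 (tensor4 k H) Ph (\<lambda>a b c. s2 (tensor4 k H) (Dl c) (\<lambda>d e. pure4 a b d e))"
  "pent2 (phi H) = s3 (tensor4 k H) Ph (\<lambda>a b c. s2 (tensor4 k H) (Dl a) (\<lambda>d e. pure4 d e b c))"
  "pent4 (phi H) = s3 (tensor4 k H) Ph (\<lambda>a b c. s2 (tensor4 k H) (Dl b) (\<lambda>d e. pure4 a d e c))"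
  "pent3 (phi H) = s3 (tensor4 k H) Ph (\<lambda>a b c. pure4 \<one>\<^bsub>H\<^esub> a b c)"
  "pent5 (phi H) = s3 (tensor4 k H) Ph (\<lambda>a b c. pure4 a b c \<one>\<^bsub>H\<^esub>)"
  "pent1 (phi_inv k H) = s3 (tensor4 k H) Ps (\<lambda>a b c. s2 (tensor4 k H) (Dl c) (\<lambda>d e. pure4 a b d e))"
  "pent2 (phi_inv k H) = s3 (tensor4 k H) Ps (\<lambda>a b c. s2 (tensor4 k H) (Dl a) (\<lambda>d e. pure4 d e b c))"
  "pent4 (phi_inv k H) = s3 (tensor4 k H) Ps (\<lambda>a b c. s2 (tensor4 k H) (Dl b) (\<lambda>d e. pure4 a d e c))"
  "pent3 (phi_inv k H) = s3 (tensor4 k H) Ps (\<lambda>a b c. pure4 \<one>\<^bsub>H\<^esub> a b c)"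
  "pent5 (phi_inv k H) = s3 (tensor4 k H) Ps (\<lambda>a b c. pure4 a b c \<one>\<^bsub>H\<^esub>)"
  by (simp_all only: phi_Ph phi_inv_Ps khom4_s3)

lemma comul_left_comul: "h \<in> carrier H \<Longrightarrow>
    comul_left k H (comul H h) = s2 (tensor3 k H) (Dl h) (\<lambda>a b. s2 (tensor3 k H) (Dl a) (\<lambda>c d. pure3 k H c d b))"
  and comul_right_comul: "h \<in> carrier H \<Longrightarrow>
    comul_right k H (comul H h) = s2 (tensor3 k H) (Dl h) (\<lambda>a b. s2 (tensor3 k H) (Dl b) (\<lambda>c d. pure3 k H a c d))"
  by (simp_all add: comul_Dl s2_push[OF khomD(1)[OF comul_left_khom]] s2_push[OF khomD(1)[OF comul_right_khom]]
      comul_left_pure comul_right_pure)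

lemma counit_closed [simp]: "h \<in> carrier H \<Longrightarrow> counit H h \<in> carrier k"
  using counit_hom by (auto simp: ring_hom_def)

lemma counit_mult [simp]: "g \<in> carrier H \<Longrightarrow> h \<in> carrier H \<Longrightarrow> counit H (g \<cdot> h) = counit H g \<otimes>\<^bsub>k\<^esub> counit H h"
  and counit_add: "g \<in> carrier H \<Longrightarrow> h \<in> carrier H \<Longrightarrow> counit H (g \<oplus>\<^bsub>H\<^esub> h) = counit H g \<oplus>\<^bsub>k\<^esub> counit H h"
  and counit_one [simp]: "counit H \<one>\<^bsub>H\<^esub> = \<one>\<^bsub>k\<^esub>"
  using counit_hom by (auto simp: ring_hom_def)

context
  fixes X :: "('k, 'x, 'm) module_scheme"
  assumes X [simp]: "module k X"
begin

context
  fixes T assumes T [simp]: "tril X T"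
begin

text \<open>An equation in a tensor power of \<open>H\<close> is applied to an arbitrary trilinear
  \<open>T\<close>. Later \<open>T\<close> is the expression in which the three legs act on three
  vectors, and factors multiplied on the left or right stand for actions performed after or
  before.\<close>

lemma phi_cancel: 
  "s3 X Ph (\<lambda>a b c. s3 X Ps (\<lambda>x y z. T (a \<cdot> x) (b \<cdot> y) (c \<cdot> z))) = T \<one>\<^bsub>H\<^esub> \<one>\<^bsub>H\<^esub> \<one>\<^bsub>H\<^esub>"
  "s3 X Ps (\<lambda>a b c. s3 X Ph (\<lambda>x y z. T (a \<cdot> x) (b \<cdot> y) (c \<cdot> z))) = T \<one>\<^bsub>H\<^esub> \<one>\<^bsub>H\<^esub> \<one>\<^bsub>H\<^esub>"
proof -
  note e = arg_cong[where f = "tlift3 X T"]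
  have o: "tlift3 X T \<one>\<^bsub>tensor3 k H\<^esub> = T \<one>\<^bsub>H\<^esub> \<one>\<^bsub>H\<^esub> \<one>\<^bsub>H\<^esub>" by (simp add: tensor_one tlift3_pure)
  show "s3 X Ph (\<lambda>a b c. s3 X Ps (\<lambda>x y z. T (a \<cdot> x) (b \<cdot> y) (c \<cdot> z))) = T \<one>\<^bsub>H\<^esub> \<one>\<^bsub>H\<^esub> \<one>\<^bsub>H\<^esub>"
    using e[OF phi_phi_inv(1)] unfolding o
    by (simp add: phi_Ph alg_mult_s tlift_s) (simp add: phi_inv_Ps alg_mult_s tlift_s pure_mult tlift3_pure)
  show "s3 X Ps (\<lambda>a b c. s3 X Ph (\<lambda>x y z. T (a \<cdot> x) (b \<cdot> y) (c \<cdot> z))) = T \<one>\<^bsub>H\<^esub> \<one>\<^bsub>H\<^esub> \<one>\<^bsub>H\<^esub>"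
    using e[OF phi_phi_inv(2)] unfolding o
    by (simp add: phi_inv_Ps alg_mult_s tlift_s) (simp add: phi_Ph alg_mult_s tlift_s pure_mult tlift3_pure)
qed

lemma coassoc_phi:
  assumes "h \<in> carrier H"
  shows "s2 X (Dl h) (\<lambda>a b. s2 X (Dl b) (\<lambda>c d. s3 X Ph (\<lambda>x y z. T (a \<cdot> x) (c \<cdot> y) (d \<cdot> z)))) =
    s3 X Ph (\<lambda>x y z. s2 X (Dl h) (\<lambda>a b. s2 X (Dl a) (\<lambda>c d. T (x \<cdot> c) (y \<cdot> d) (z \<cdot> b))))"
proof -
  \<comment> \<open>Quasi-coassociativity is multiplied through by \<phi>, so that a conjugation
    becomes an intertwining relation with a single associator on each side.\<close>
  have "comul_right k H (comul H h) \<otimes>\<^bsub>tensor3 k H\<^esub> phi H = phi H \<otimes>\<^bsub>tensor3 k H\<^esub> comul_left k H (comul H h)"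
    using assms by (simp add: quasi_coassoc T3.m_assoc phi_phi_inv)
  from arg_cong[where f = "tlift3 X T", OF this] show ?thesis using assms
    by (simp add: phi_Ph comul_right_comul comul_left_comul alg_mult_s(1,3) tlift_s)
       (simp add: alg_mult_s tlift_s pure_mult tlift3_pure)
qed

lemma coassoc_phi_inv:
  assumes "h \<in> carrier H"
  shows "s3 X Ps (\<lambda>x y z. s2 X (Dl h) (\<lambda>a b. s2 X (Dl b) (\<lambda>c d. T (x \<cdot> a) (y \<cdot> c) (z \<cdot> d)))) =
    s2 X (Dl h) (\<lambda>a b. s2 X (Dl a) (\<lambda>c d. s3 X Ps (\<lambda>x y z. T (c \<cdot> x) (d \<cdot> y) (b \<cdot> z))))"
proof -
  have "phi_inv k H \<otimes>\<^bsub>tensor3 k H\<^esub> comul_right k H (comul H h) = comul_left k H (comul H h) \<otimes>\<^bsub>tensor3 k H\<^esub> phi_inv k H"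
    using assms by (simp add: quasi_coassoc T3.m_assoc[symmetric] phi_phi_inv)
  from arg_cong[where f = "tlift3 X T", OF this] show ?thesis using assms
    by (simp add: phi_inv_Ps comul_right_comul comul_left_comul alg_mult_s(1,3) tlift_s)
       (simp add: alg_mult_s tlift_s pure_mult tlift3_pure)
qed

end

context
  fixes T assumes T [simp]: "quad X T"
begin

text \<open>The summations are nested in the order of the factors of the two products. Expressions
  coming from compositions of maps are brought into this order by interchanging sums before the rule
  is used.\<close>

lemma pentagon_sum:
  "s3 X Ph (\<lambda>x y z. s2 X (Dl z) (\<lambda>z1 z2. s3 X Ph (\<lambda>a b c. s2 X (Dl a) (\<lambda>a1 a2.
      T (x \<cdot> a1) (y \<cdot> a2) (z1 \<cdot> b) (z2 \<cdot> c))))) =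
   s3 X Ph (\<lambda>x y z. s3 X Ph (\<lambda>a b c. s2 X (Dl b) (\<lambda>b1 b2. s3 X Ph (\<lambda>u v w.
      T (a \<cdot> u) (x \<cdot> b1 \<cdot> v) (y \<cdot> b2 \<cdot> w) (z \<cdot> c)))))"
proof -
  have "tlift4 X T (pent1 (phi H) \<otimes>\<^bsub>tensor4 k H\<^esub> pent2 (phi H)) =
      s3 X Ph (\<lambda>x y z. s2 X (Dl z) (\<lambda>z1 z2. s3 X Ph (\<lambda>a b c. s2 X (Dl a) (\<lambda>a1 a2.
      T (x \<cdot> a1) (y \<cdot> a2) (z1 \<cdot> b) (z2 \<cdot> c)))))"
    by (simp add: khom4_expand(1) alg_mult_s tlift_s)
       (simp add: khom4_expand(2) alg_mult_s tlift_s pure_mult tlift4_pure)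
  moreover have "tlift4 X T (pent3 (phi H) \<otimes>\<^bsub>tensor4 k H\<^esub> pent4 (phi H) \<otimes>\<^bsub>tensor4 k H\<^esub> pent5 (phi H)) =
      s3 X Ph (\<lambda>x y z. s3 X Ph (\<lambda>a b c. s2 X (Dl b) (\<lambda>b1 b2. s3 X Ph (\<lambda>u v w.
      T (a \<cdot> u) (x \<cdot> b1 \<cdot> v) (y \<cdot> b2 \<cdot> w) (z \<cdot> c)))))"
    by (simp add: khom4_expand(4) alg_mult_s tlift_s)
       (simp add: khom4_expand(3) alg_mult_s tlift_s pure_mult,
         simp add: khom4_expand(5) alg_mult_s tlift_s pure_mult tlift4_pure)
  ultimately show ?thesis using pentagon4 by simp
qed

lemma pentagon_left_sum:
  "s3 X Ph (\<lambda>a b c. s2 X (Dl a) (\<lambda>a1 a2. s3 X Ps (\<lambda>x y z.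
      T (a1 \<cdot> x) (a2 \<cdot> y) (b \<cdot> z) c))) =
   s3 X Ps (\<lambda>p q r. s2 X (Dl r) (\<lambda>r1 r2. s3 X Ph (\<lambda>x y z. s3 X Ph (\<lambda>a b c. s2 X (Dl b) (\<lambda>b1 b2.
      T (p \<cdot> a) (q \<cdot> x \<cdot> b1) (r1 \<cdot> y \<cdot> b2) (r2 \<cdot> z \<cdot> c))))))"
proof -
  have "tlift4 X T (pent2 (phi H) \<otimes>\<^bsub>tensor4 k H\<^esub> pent5 (phi_inv k H)) =
      s3 X Ph (\<lambda>a b c. s2 X (Dl a) (\<lambda>a1 a2. s3 X Ps (\<lambda>x y z.
      T (a1 \<cdot> x) (a2 \<cdot> y) (b \<cdot> z) c)))"
    by (simp add: khom4_expand(2) alg_mult_s tlift_s)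
       (simp add: khom4_expand(10) alg_mult_s tlift_s pure_mult tlift4_pure)
  moreover have "tlift4 X T (pent1 (phi_inv k H) \<otimes>\<^bsub>tensor4 k H\<^esub> pent3 (phi H) \<otimes>\<^bsub>tensor4 k H\<^esub> pent4 (phi H)) =
      s3 X Ps (\<lambda>p q r. s2 X (Dl r) (\<lambda>r1 r2. s3 X Ph (\<lambda>x y z. s3 X Ph (\<lambda>a b c. s2 X (Dl b) (\<lambda>b1 b2.
      T (p \<cdot> a) (q \<cdot> x \<cdot> b1) (r1 \<cdot> y \<cdot> b2) (r2 \<cdot> z \<cdot> c))))))"
    by (simp add: khom4_expand(6) alg_mult_s tlift_s)
       (simp add: khom4_expand(4) alg_mult_s tlift_s pure_mult,
         simp add: khom4_expand(3) alg_mult_s tlift_s pure_mult tlift4_pure)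
  ultimately show ?thesis using pentagon4_left by simp
qed

lemma pentagon_right_sum:
  "s3 X Ph (\<lambda>x y z. s3 X Ps (\<lambda>a b c. s2 X (Dl a) (\<lambda>a1 a2.
      T (x \<cdot> a1) (y \<cdot> a2) (z \<cdot> b) c))) =
   s3 X Ps (\<lambda>a b c. s2 X (Dl b) (\<lambda>b1 b2. s3 X Ps (\<lambda>p q r. s3 X Ph (\<lambda>x y z. s2 X (Dl z) (\<lambda>z1 z2.
      T (a \<cdot> x) (b1 \<cdot> p \<cdot> y) (b2 \<cdot> q \<cdot> z1) (c \<cdot> r \<cdot> z2))))))"
proof -
  have "tlift4 X T (pent5 (phi H) \<otimes>\<^bsub>tensor4 k H\<^esub> pent2 (phi_inv k H)) =
      s3 X Ph (\<lambda>x y z. s3 X Ps (\<lambda>a b c. s2 X (Dl a) (\<lambda>a1 a2.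
      T (x \<cdot> a1) (y \<cdot> a2) (z \<cdot> b) c)))"
    by (simp add: khom4_expand(5) alg_mult_s tlift_s)
       (simp add: khom4_expand(7) alg_mult_s tlift_s pure_mult tlift4_pure)
  moreover have "tlift4 X T (pent4 (phi_inv k H) \<otimes>\<^bsub>tensor4 k H\<^esub> pent3 (phi_inv k H) \<otimes>\<^bsub>tensor4 k H\<^esub> pent1 (phi H)) =
      s3 X Ps (\<lambda>a b c. s2 X (Dl b) (\<lambda>b1 b2. s3 X Ps (\<lambda>p q r. s3 X Ph (\<lambda>x y z. s2 X (Dl z) (\<lambda>z1 z2.
      T (a \<cdot> x) (b1 \<cdot> p \<cdot> y) (b2 \<cdot> q \<cdot> z1) (c \<cdot> r \<cdot> z2))))))"
    by (simp add: khom4_expand(8) alg_mult_s tlift_s)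
       (simp add: khom4_expand(9) alg_mult_s tlift_s pure_mult,
         simp add: khom4_expand(1) alg_mult_s tlift_s pure_mult tlift4_pure)
  ultimately show ?thesis using pentagon4_right by simp
qed

end

lemma comul_mult_sum:
  assumes "g \<in> carrier H" "h \<in> carrier H" and T: "bil H H X T"
  shows "s2 X (Dl (g \<cdot> h)) T = s2 X (Dl g) (\<lambda>a b. s2 X (Dl h) (\<lambda>c d. T (a \<cdot> c) (b \<cdot> d)))"
proof -
  have "s2 X (Dl (g \<cdot> h)) T = tlift X T (comul H g \<otimes>\<^bsub>tensor2 k H\<^esub> comul H h)"
    using assms by (simp add: tlift_comul[symmetric] khomD(3)[OF comul_khom])
  also have "\<dots> = s2 X (Dl g) (\<lambda>a b. tlift X T (pure2 k H a b \<otimes>\<^bsub>tensor2 k H\<^esub> comul H h))"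
    using assms by (subst comul_Dl[of g]) (simp_all add: alg_mult_s tlift_s)
  also have "\<dots> = s2 X (Dl g) (\<lambda>a b. s2 X (Dl h) (\<lambda>c d. T (a \<cdot> c) (b \<cdot> d)))"
    using assms by (simp add: comul_Dl alg_mult_s tlift_s pure_mult)
  finally show ?thesis .
qed

lemma comul_one_sum: "bil H H X T \<Longrightarrow> s2 X (Dl \<one>\<^bsub>H\<^esub>) T = T \<one>\<^bsub>H\<^esub> \<one>\<^bsub>H\<^esub>"
  by (simp add: tlift_comul[symmetric] khomD(2)[OF comul_khom] tensor_one)

lemma smult_expand: "c \<in> carrier k \<Longrightarrow> d \<in> carrier k \<Longrightarrow> x \<in> carrier X \<Longrightarrow> (c \<otimes>\<^bsub>k\<^esub> d) \<odot>\<^bsub>X\<^esub> x = c \<odot>\<^bsub>X\<^esub> (d \<odot>\<^bsub>X\<^esub> x)"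
  by (rule module.smult_assoc1[OF X])

lemma lin_counit [lin_rules]: "x \<in> carrier X \<Longrightarrow> lin V H g \<Longrightarrow> lin V X (\<lambda>v. counit H (g v) \<odot>\<^bsub>X\<^esub> x)"
  by (rule lin_comp[of V H g X "\<lambda>h. counit H h \<odot>\<^bsub>X\<^esub> x"], assumption, rule linI)
     (simp_all add: counit_add counit_smult module.smult_l_distr[OF X] module.smult_assoc1[OF X])

lemma lin_smultr [lin_rules]: "c \<in> carrier k \<Longrightarrow> lin V X g \<Longrightarrow> lin V X (\<lambda>v. c \<odot>\<^bsub>X\<^esub> g v)"
  by (rule lin_smult[OF X])

lemma smult_one' [simp]: "x \<in> carrier X \<Longrightarrow> \<one>\<^bsub>k\<^esub> \<odot>\<^bsub>X\<^esub> x = x"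
  by (rule module.smult_one[OF X])

lemma s_smult_push:
  "c \<in> carrier k \<Longrightarrow> (\<And>a b. a \<in> carrier H \<Longrightarrow> b \<in> carrier H \<Longrightarrow> T2 a b \<in> carrier X) \<Longrightarrow>
    s2 X ps (\<lambda>a b. c \<odot>\<^bsub>X\<^esub> T2 a b) = c \<odot>\<^bsub>X\<^esub> s2 X ps T2"
  "c \<in> carrier k \<Longrightarrow> (\<And>a b d. a \<in> carrier H \<Longrightarrow> b \<in> carrier H \<Longrightarrow> d \<in> carrier H \<Longrightarrow> T3 a b d \<in> carrier X) \<Longrightarrow>
    s3 X qs (\<lambda>a b d. c \<odot>\<^bsub>X\<^esub> T3 a b d) = c \<odot>\<^bsub>X\<^esub> s3 X qs T3"
  by (rule s2_push[OF lin_smult[OF X lin_id], symmetric] s3_push[OF lin_smult[OF X lin_id], symmetric]; simp)+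

section \<open>Counit normalization of the associator in all three legs\<close>

lemma counit_left_sum:
  assumes "h \<in> carrier H" "lin H X f"
  shows "s2 X (Dl h) (\<lambda>a b. counit H a \<odot>\<^bsub>X\<^esub> f b) = f h"
proof -
  have b: "bil H H H (\<lambda>a b. counit H a \<odot>\<^bsub>H\<^esub> b)"
    by (intro bilI linI) (simp_all add: counit_add counit_smult smult_l_distr smult_r_distr smult_assoc1[symmetric] m_comm)
  have "f h = f (tlift H (\<lambda>a b. counit H a \<odot>\<^bsub>H\<^esub> b) (comul H h))" using assms by (simp add: counit_left)
  also have "\<dots> = s2 X (Dl h) (\<lambda>a b. f (counit H a \<odot>\<^bsub>H\<^esub> b))"
    using assms by (simp add: tlift_comul b s2_push[OF assms(2)])
  finally show ?thesis using linD(3)[OF assms(2)] by simp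
qed

lemma counit_right_sum:
  assumes "h \<in> carrier H" "lin H X f"
  shows "s2 X (Dl h) (\<lambda>a b. counit H b \<odot>\<^bsub>X\<^esub> f a) = f h"
proof -
  have b: "bil H H H (\<lambda>a b. counit H b \<odot>\<^bsub>H\<^esub> a)"
    by (intro bilI linI) (simp_all add: counit_add counit_smult smult_l_distr smult_r_distr smult_assoc1[symmetric] m_comm)
  have "f h = f (tlift H (\<lambda>a b. counit H b \<odot>\<^bsub>H\<^esub> a) (comul H h))" using assms by (simp add: counit_right)
  also have "\<dots> = s2 X (Dl h) (\<lambda>a b. f (counit H b \<odot>\<^bsub>H\<^esub> a))"
    using assms by (simp add: tlift_comul b s2_push[OF assms(2)])
  finally show ?thesis using linD(3)[OF assms(2)] by simp
qed

lemma phi_counit2: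
  assumes G: "bil H H X G"
  shows "s3 X Ph (\<lambda>a b c. counit H b \<odot>\<^bsub>X\<^esub> G a c) = G \<one>\<^bsub>H\<^esub> \<one>\<^bsub>H\<^esub>"
proof -
  note [lin_rules] = bil_linr[OF G]
  have t: "tril (tensor2 k H) (\<lambda>a b c. pure2 k H a (counit H b \<odot>\<^bsub>H\<^esub> c))"
    unfolding tril_def
    by (intro conjI ballI bil_linr[OF tpure_bil] lin_id)
       (simp_all add: k_linear_def Pi_iff counit_add counit_smult smult_l_distr smult_r_distr smult_assoc1[symmetric] m_comm)
  have "tlift X G (tlift3 (tensor2 k H) (\<lambda>a b c. pure2 k H a (counit H b \<odot>\<^bsub>H\<^esub> c)) (phi H)) = G \<one>\<^bsub>H\<^esub> \<one>\<^bsub>H\<^esub>"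
    unfolding phi_counit by (simp add: tensor_one G)
  then show ?thesis
    using linD(3)[OF bil_lin2[OF G]] by (simp add: tlift3_rep3[OF _ _ t] Ph_def s3_push[OF lin_tlift[OF _ _ X G]] G)
qed

text \<open>The counit is applied to the third, respectively the second leg of the pentagon. With
  the normalization of the middle leg this leaves \<phi> = \<phi> (q \<otimes> 1), where q arises
  from \<phi> by the counit in its third leg, respectively \<phi> = (1 \<otimes> q') \<phi>, where
  q' arises by the counit in its first leg.\<close>

lemma phi_counit_step:
  assumes T: "tril X T"
  shows "s3 X Ph T = s3 X Ph (\<lambda>a b c. s3 X Ph (\<lambda>u v w. counit H w \<odot>\<^bsub>X\<^esub> T (a \<cdot> u) (b \<cdot> v) c))" (is ?A)
    and "s3 X Ph T = s3 X Ph (\<lambda>x y z. s3 X Ph (\<lambda>a b c. counit H x \<odot>\<^bsub>X\<^esub> T a (y \<cdot> b) (z \<cdot> c)))" (is ?B)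
proof -
  note [lin_rules] = tril_linr[OF T]
  note [simp] = tril_closed[OF T]
  let ?e = "\<lambda>h x. counit H h \<odot>\<^bsub>X\<^esub> x"
  \<comment> \<open>On the left side of the pentagon the third leg contains the middle leg of the
    second factor, so the assumed normalization removes that factor.\<close>
  have 1: "s3 X Ph (\<lambda>a b c. s2 X (Dl a) (\<lambda>a1 a2. ?e (z1 \<cdot> b) (T (x \<cdot> a1) (y \<cdot> a2) (z2 \<cdot> c)))) = ?e z1 (T x y z2)"
    if m [simp]: "x \<in> carrier H" "y \<in> carrier H" "z1 \<in> carrier H" "z2 \<in> carrier H" for x y z1 z2
  proof -
    have b: "bil H H X (\<lambda>a c. s2 X (Dl a) (\<lambda>a1 a2. T (x \<cdot> a1) (y \<cdot> a2) (z2 \<cdot> c)))"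
      by (intro lin_rules) simp_all
    have b': "bil H H X (\<lambda>a1 a2. T (x \<cdot> a1) (y \<cdot> a2) z2)"
      by (intro lin_rules) simp_all
    show ?thesis
      using phi_counit2[OF b] by (simp add: smult_expand s_smult_push comul_one_sum[OF b'])
  qed
  have c1: "s3 X Ph (\<lambda>x y z. s2 X (Dl z) (\<lambda>z1 z2. s3 X Ph (\<lambda>a b c. s2 X (Dl a) (\<lambda>a1 a2.
      ?e (z1 \<cdot> b) (T (x \<cdot> a1) (y \<cdot> a2) (z2 \<cdot> c)))))) = s3 X Ph T"
  proof (rule s3_cong[OF refl])
    fix x y z assume m [simp]: "x \<in> carrier H" "y \<in> carrier H" "z \<in> carrier H"
    have "s2 X (Dl z) (\<lambda>z1 z2. s3 X Ph (\<lambda>a b c. s2 X (Dl a) (\<lambda>a1 a2.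
      ?e (z1 \<cdot> b) (T (x \<cdot> a1) (y \<cdot> a2) (z2 \<cdot> c))))) = s2 X (Dl z) (\<lambda>z1 z2. ?e z1 (T x y z2))"
      by (intro s2_cong refl 1 m)
    also have "\<dots> = T x y z" by (rule counit_left_sum) (simp, intro lin_rules, simp_all)
    finally show "s2 X (Dl z) (\<lambda>z1 z2. s3 X Ph (\<lambda>a b c. s2 X (Dl a) (\<lambda>a1 a2.
      ?e (z1 \<cdot> b) (T (x \<cdot> a1) (y \<cdot> a2) (z2 \<cdot> c))))) = T x y z" .
  qed
  \<comment> \<open>On the right side the third leg contains the middle leg of the factor 1
    \<otimes> \<phi>, which disappears for the same reason.\<close>
  have 2: "s3 X Ph (\<lambda>x y z. s3 X Ph (\<lambda>a b c. s2 X (Dl b) (\<lambda>b1 b2. s3 X Ph (\<lambda>u v w.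
      ?e (y \<cdot> b2 \<cdot> w) (T (a \<cdot> u) (x \<cdot> b1 \<cdot> v) (z \<cdot> c)))))) =
     s3 X Ph (\<lambda>a b c. s2 X (Dl b) (\<lambda>b1 b2. ?e b2 (s3 X Ph (\<lambda>u v w. ?e w (T (a \<cdot> u) (b1 \<cdot> v) c)))))"
  proof -
    have b: "bil H H X (\<lambda>x z. s3 X Ph (\<lambda>a b c. s2 X (Dl b) (\<lambda>b1 b2. ?e b2 (s3 X Ph (\<lambda>u v w.
      ?e w (T (a \<cdot> u) (x \<cdot> b1 \<cdot> v) (z \<cdot> c)))))))"
      by (intro lin_rules) simp_all
    show ?thesis using phi_counit2[OF b] by (simp add: smult_expand s_smult_push)
  qed
  have 3: "s2 X (Dl b) (\<lambda>b1 b2. ?e b2 (s3 X Ph (\<lambda>u v w. ?e w (T (a \<cdot> u) (b1 \<cdot> v) c)))) =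
      s3 X Ph (\<lambda>u v w. ?e w (T (a \<cdot> u) (b \<cdot> v) c))"
    if [simp]: "a \<in> carrier H" "b \<in> carrier H" "c \<in> carrier H" for a b c
    by (rule counit_right_sum) (simp, intro lin_rules, simp_all)
  \<comment> \<open>The counit sits in the third leg of the pentagon.\<close>
  have q: "quad X (\<lambda>a b c d. ?e c (T a b d))"
    by (intro lin_rules) simp_all
  show ?A
    using pentagon_sum[OF q] unfolding c1 2 using 3 by (simp cong: s3_cong)
  have 1: "s3 X Ph (\<lambda>x y z. s2 X (Dl z) (\<lambda>z1 z2. ?e y (T (x \<cdot> a) (z1 \<cdot> b) (z2 \<cdot> c)))) = T a b c"
    if m [simp]: "a \<in> carrier H" "b \<in> carrier H" "c \<in> carrier H" for a b c
  proof -
    have b: "bil H H X (\<lambda>x z. s2 X (Dl z) (\<lambda>z1 z2. T (x \<cdot> a) (z1 \<cdot> b) (z2 \<cdot> c)))"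
      by (intro lin_rules) simp_all
    have b': "bil H H X (\<lambda>z1 z2. T a (z1 \<cdot> b) (z2 \<cdot> c))"
      by (intro lin_rules) simp_all
    show ?thesis
      using phi_counit2[OF b] by (simp add: smult_expand s_smult_push comul_one_sum[OF b'])
  qed
  have 2: "s2 X (Dl a) (\<lambda>a1 a2. ?e (y \<cdot> a2) (T (x \<cdot> a1) (z1 \<cdot> b) (z2 \<cdot> c)))
    = ?e y (T (x \<cdot> a) (z1 \<cdot> b) (z2 \<cdot> c))"
    if m [simp]: "a \<in> carrier H" "b \<in> carrier H" "c \<in> carrier H" "x \<in> carrier H" "y \<in> carrier H" "z1 \<in> carrier H" "z2 \<in> carrier H"
    for a b c x y z1 z2
  proof -
    have l: "lin H X (\<lambda>a. T (x \<cdot> a) (z1 \<cdot> b) (z2 \<cdot> c))" by (intro lin_rules) simp_all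
    show ?thesis using counit_right_sum[OF _ l, of a] by (simp add: smult_expand s_smult_push)
  qed
  have c1: "s3 X Ph (\<lambda>x y z. s2 X (Dl z) (\<lambda>z1 z2. s3 X Ph (\<lambda>a b c. s2 X (Dl a) (\<lambda>a1 a2.
      ?e (y \<cdot> a2) (T (x \<cdot> a1) (z1 \<cdot> b) (z2 \<cdot> c)))))) = s3 X Ph T" (is "?l = _")
  proof -
    have "?l = s3 X Ph (\<lambda>x y z. s2 X (Dl z) (\<lambda>z1 z2. s3 X Ph (\<lambda>a b c. ?e y (T (x \<cdot> a) (z1 \<cdot> b) (z2 \<cdot> c)))))"
      by (intro s3_cong s2_cong refl 2)
    also have "\<dots> = s3 X Ph (\<lambda>a b c. s3 X Ph (\<lambda>x y z. s2 X (Dl z) (\<lambda>z1 z2. ?e y (T (x \<cdot> a) (z1 \<cdot> b) (z2 \<cdot> c)))))"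
      by (subst s3_s3_swap) (simp_all add: s2_s3_swap)
    also have "\<dots> = s3 X Ph T" by (intro s3_cong refl 1)
    finally show ?thesis .
  qed
  have 3: "s3 X Ph (\<lambda>u v w. ?e (x \<cdot> b1 \<cdot> v) (T (a \<cdot> u) (y \<cdot> b2 \<cdot> w) (z \<cdot> c))) =
      ?e b1 (?e x (T a (y \<cdot> b2) (z \<cdot> c)))"
    if m [simp]: "a \<in> carrier H" "b1 \<in> carrier H" "b2 \<in> carrier H" "c \<in> carrier H" "x \<in> carrier H" "y \<in> carrier H" "z \<in> carrier H"
    for a b1 b2 c x y z
  proof -
    have b: "bil H H X (\<lambda>u w. T (a \<cdot> u) (y \<cdot> b2 \<cdot> w) (z \<cdot> c))"
      by (intro lin_rules) simp_all
    have e: "?e (x \<cdot> b1 \<cdot> v) t = ?e b1 (?e x (?e v t))" if "v \<in> carrier H" "t \<in> carrier X" for v t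
      using that by (simp add: smult_expand[symmetric] R.m_assoc R.m_comm R.m_lcomm)
    show ?thesis
      using phi_counit2[OF b] by (simp add: e s_smult_push del: counit_mult)
  qed
  have 4: "s2 X (Dl b) (\<lambda>b1 b2. s3 X Ph (\<lambda>u v w. ?e (x \<cdot> b1 \<cdot> v) (T (a \<cdot> u) (y \<cdot> b2 \<cdot> w) (z \<cdot> c)))) =
      ?e x (T a (y \<cdot> b) (z \<cdot> c))"
    if m [simp]: "a \<in> carrier H" "b \<in> carrier H" "c \<in> carrier H" "x \<in> carrier H" "y \<in> carrier H" "z \<in> carrier H"
    for a b c x y z
  proof -
    have l: "lin H X (\<lambda>b2. ?e x (T a (y \<cdot> b2) (z \<cdot> c)))"
      by (intro lin_rules) simp_all
    show ?thesis
      using counit_left_sum[OF _ l, of b] by (simp add: 3 del: counit_mult)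
  qed
  \<comment> \<open>Here the counit sits in the second leg, which contains the first leg of 1
    \<otimes> \<phi>; this leg is not yet known to be normalized and survives.\<close>
  have q: "quad X (\<lambda>a b c d. ?e b (T a c d))"
    by (intro lin_rules) simp_all
  show ?B
    using pentagon_sum[OF q] unfolding c1 using 4 by (simp del: counit_mult cong: s3_cong)
qed

text \<open>\<phi> is cancelled in the two equations of \<open>phi_counit_step\<close>. On the level
  of test functions, cancelling means to precompose with a multiplication by the inverse of
  \<phi>.\<close>

lemma phi_counit3:
  assumes G: "bil H H X G"
  shows "s3 X Ph (\<lambda>a b c. counit H c \<odot>\<^bsub>X\<^esub> G a b) = G \<one>\<^bsub>H\<^esub> \<one>\<^bsub>H\<^esub>"
    and phi_counit1: "s3 X Ph (\<lambda>a b c. counit H a \<odot>\<^bsub>X\<^esub> G b c) = G \<one>\<^bsub>H\<^esub> \<one>\<^bsub>H\<^esub>"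
proof -
  note [lin_rules] = bil_linr[OF G]
  note [simp] = bil_closed[OF G]
  let ?e = "\<lambda>h x. counit H h \<odot>\<^bsub>X\<^esub> x"
  have t: "tril X (\<lambda>a b c. ?e c (G a b))" by (intro lin_rules) simp_all
  \<comment> \<open>Multiplication by the inverse from the left, as the unknown factor stands to the
    right of \<phi>.\<close>
  let ?T = "\<lambda>a b c. s3 X Ps (\<lambda>p q r. ?e (r \<cdot> c) (G (p \<cdot> a) (q \<cdot> b)))"
  have t': "tril X ?T" by (intro lin_rules) simp_all
  have "s3 X Ph ?T = G \<one>\<^bsub>H\<^esub> \<one>\<^bsub>H\<^esub>"
    using phi_cancel(2)[OF t] by (subst s3_s3_swap) simp_all
  moreover have "s3 X Ph ?T = s3 X Ph (\<lambda>u v w. ?e w (G u v))"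
  proof -
    have "s3 X Ph (\<lambda>a b c. s3 X Ps (\<lambda>p q r. ?e (r \<cdot> c) (G (p \<cdot> a \<cdot> u) (q \<cdot> b \<cdot> v)))) = G u v"
      if [simp]: "u \<in> carrier H" "v \<in> carrier H" for u v
    proof -
      have "tril X (\<lambda>a b c. ?e c (G (a \<cdot> u) (b \<cdot> v)))" by (intro lin_rules) simp_all
      from phi_cancel(2)[OF this] show ?thesis by (subst s3_s3_swap) simp_all
    qed
    note a = this
    have "s3 X Ph ?T = s3 X Ph (\<lambda>u v w. s3 X Ph (\<lambda>a b c. ?e w (?T (a \<cdot> u) (b \<cdot> v) c)))"
      by (subst phi_counit_step(1)[OF t'], rule s3_s3_swap) simp_all
    also have "\<dots> = s3 X Ph (\<lambda>u v w. ?e w (G u v))"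
      by (simp add: s_smult_push a m_assoc[symmetric] del: counit_mult)
    finally show ?thesis .
  qed
  ultimately show "s3 X Ph (\<lambda>a b c. ?e c (G a b)) = G \<one>\<^bsub>H\<^esub> \<one>\<^bsub>H\<^esub>" by simp
  have t: "tril X (\<lambda>a b c. ?e a (G b c))" by (intro lin_rules) simp_all
  \<comment> \<open>Multiplication by the inverse from the right, as the unknown factor now stands
    to the left of \<phi>.\<close>
  let ?T = "\<lambda>a b c. s3 X Ps (\<lambda>p q r. ?e (a \<cdot> p) (G (b \<cdot> q) (c \<cdot> r)))"
  have t': "tril X ?T" by (intro lin_rules) simp_all
  have "s3 X Ph ?T = G \<one>\<^bsub>H\<^esub> \<one>\<^bsub>H\<^esub>"
    using phi_cancel(1)[OF t] by simp
  moreover have "s3 X Ph ?T = s3 X Ph (\<lambda>u v w. ?e u (G v w))"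
  proof -
    have "s3 X Ph (\<lambda>a b c. s3 X Ps (\<lambda>p q r. ?e (a \<cdot> p) (G (u \<cdot> b \<cdot> q) (v \<cdot> c \<cdot> r)))) = G u v"
      if [simp]: "u \<in> carrier H" "v \<in> carrier H" for u v
    proof -
      have "tril X (\<lambda>a b c. ?e a (G (u \<cdot> b) (v \<cdot> c)))" by (intro lin_rules) simp_all
      from phi_cancel(1)[OF this] show ?thesis by (simp add: m_assoc)
    qed
    note a = this
    have "s3 X Ph ?T = s3 X Ph (\<lambda>u v w. s3 X Ph (\<lambda>a b c. ?e u (?T a (v \<cdot> b) (w \<cdot> c))))"
      by (rule phi_counit_step(2)[OF t'])
    also have "\<dots> = s3 X Ph (\<lambda>u v w. ?e u (G v w))"
      by (simp add: s_smult_push a del: counit_mult)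
    finally show ?thesis .
  qed
  ultimately show "s3 X Ph (\<lambda>a b c. ?e a (G b c)) = G \<one>\<^bsub>H\<^esub> \<one>\<^bsub>H\<^esub>" by simp
qed

text \<open>The counit is multiplicative, so in the product of the inverse of \<phi> with \<phi> the
  sum over \<phi> is already trivial and only the sum over the inverse remains.\<close>

lemma phi_inv_counit:
  assumes G: "bil H H X G"
  shows phi_inv_counit1: "s3 X Ps (\<lambda>a b c. counit H a \<odot>\<^bsub>X\<^esub> G b c) = G \<one>\<^bsub>H\<^esub> \<one>\<^bsub>H\<^esub>"
    and phi_inv_counit2: "s3 X Ps (\<lambda>a b c. counit H b \<odot>\<^bsub>X\<^esub> G a c) = G \<one>\<^bsub>H\<^esub> \<one>\<^bsub>H\<^esub>"
    and phi_inv_counit3: "s3 X Ps (\<lambda>a b c. counit H c \<odot>\<^bsub>X\<^esub> G a b) = G \<one>\<^bsub>H\<^esub> \<one>\<^bsub>H\<^esub>"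
proof -
  note [lin_rules] = bil_linr[OF G]
  note [simp] = bil_closed[OF G]
  let ?e = "\<lambda>h x. counit H h \<odot>\<^bsub>X\<^esub> x"
  have b: "bil H H X (\<lambda>x y. G (u \<cdot> x) (v \<cdot> y))" if "u \<in> carrier H" "v \<in> carrier H" for u v
    using that by (intro lin_rules) simp_all
  have 1: "s3 X Ph (\<lambda>x y z. ?e (a \<cdot> x) (G (b \<cdot> y) (c \<cdot> z))) = ?e a (G b c)"
    and 2: "s3 X Ph (\<lambda>x y z. ?e (b \<cdot> y) (G (a \<cdot> x) (c \<cdot> z))) = ?e b (G a c)"
    and 3: "s3 X Ph (\<lambda>x y z. ?e (c \<cdot> z) (G (a \<cdot> x) (b \<cdot> y))) = ?e c (G a b)"
    if [simp]: "a \<in> carrier H" "b \<in> carrier H" "c \<in> carrier H" for a b c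
    using phi_counit1[OF b, of b c] phi_counit2[OF b, of a c] phi_counit3[OF b, of a b]
    by (simp_all add: smult_expand s_smult_push)
  have t1: "tril X (\<lambda>a b c. ?e a (G b c))" and t2: "tril X (\<lambda>a b c. ?e b (G a c))" and t3: "tril X (\<lambda>a b c. ?e c (G a b))"
    by (intro lin_rules; simp)+
  show "s3 X Ps (\<lambda>a b c. ?e a (G b c)) = G \<one>\<^bsub>H\<^esub> \<one>\<^bsub>H\<^esub>"
    using phi_cancel(2)[OF t1] 1 by (simp del: counit_mult cong: s3_cong)
  show "s3 X Ps (\<lambda>a b c. ?e b (G a c)) = G \<one>\<^bsub>H\<^esub> \<one>\<^bsub>H\<^esub>"
    using phi_cancel(2)[OF t2] 2 by (simp del: counit_mult cong: s3_cong)
  show "s3 X Ps (\<lambda>a b c. ?e c (G a b)) = G \<one>\<^bsub>H\<^esub> \<one>\<^bsub>H\<^esub>"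
    using phi_cancel(2)[OF t3] 3 by (simp del: counit_mult cong: s3_cong)
qed

end

end

section \<open>Antipode and universal R-matrix\<close>

context quasi_hopf_algebra
begin

lemma antip_lin: "lin H H (antip H)" by (rule antip_linear)

lemma antip_closed [simp]: "h \<in> carrier H \<Longrightarrow> antip H h \<in> carrier H"
  by (rule lin_closed[OF antip_lin])

lemmas [simp] = alpha_closed beta_closed antip_one

lemma antip_linr [lin_rules]: "lin V H g \<Longrightarrow> lin V H (\<lambda>v. antip H (g v))"
  by (rule lin_comp[OF _ antip_lin])

context
  fixes X :: "('k, 'x, 'm) module_scheme"
  assumes X [simp]: "module k X"
begin

section \<open>Antipode axioms and the two inversion formulas for currying\<close>

lemma antip_alpha_sum:
  assumes "lin H X f" "h \<in> carrier H"
  shows "s2 X (Dl h) (\<lambda>a b. f (antip H a \<cdot> alpha H \<cdot> b)) = counit H h \<odot>\<^bsub>X\<^esub> f (alpha H)"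
proof -
  have b: "bil H H H (\<lambda>a b. antip H a \<cdot> alpha H \<cdot> b)" by (intro lin_rules) simp_all
  have "f (tlift H (\<lambda>a b. antip H a \<cdot> alpha H \<cdot> b) (comul H h)) = f (counit H h \<odot>\<^bsub>H\<^esub> alpha H)"
    using assms by (simp add: antip_alpha)
  then show ?thesis using assms
    by (simp add: tlift_comul b s2_push[OF assms(1)] linD(3)[OF assms(1)])
qed

lemma antip_beta_sum:
  assumes "lin H X f" "h \<in> carrier H"
  shows "s2 X (Dl h) (\<lambda>a b. f (a \<cdot> beta H \<cdot> antip H b)) = counit H h \<odot>\<^bsub>X\<^esub> f (beta H)"
proof -
  have b: "bil H H H (\<lambda>a b. a \<cdot> beta H \<cdot> antip H b)" by (intro lin_rules) simp_all
  have "f (tlift H (\<lambda>a b. a \<cdot> beta H \<cdot> antip H b) (comul H h)) = f (counit H h \<odot>\<^bsub>H\<^esub> beta H)"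
    using assms by (simp add: antip_beta)
  then show ?thesis using assms
    by (simp add: tlift_comul b s2_push[OF assms(1)] linD(3)[OF assms(1)])
qed

lemma antip_phi_sum:
  assumes "lin H X f"
  shows "s3 X Ph (\<lambda>a b c. f (a \<cdot> beta H \<cdot> antip H b \<cdot> alpha H \<cdot> c)) = f \<one>\<^bsub>H\<^esub>"
proof -
  have t: "tril H (\<lambda>a b c. a \<cdot> beta H \<cdot> antip H b \<cdot> alpha H \<cdot> c)" by (intro lin_rules) simp_all
  show ?thesis
    using arg_cong[OF antip_phi, of f] by (simp add: tlift3_rep3[OF _ _ t] Ph_def s3_push[OF assms])
qed

lemma antip_phi_inv_sum:
  assumes "lin H X f"
  shows "s3 X Ps (\<lambda>a b c. f (antip H a \<cdot> alpha H \<cdot> b \<cdot> beta H \<cdot> antip H c)) = f \<one>\<^bsub>H\<^esub>"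
proof -
  have t: "tril H (\<lambda>a b c. antip H a \<cdot> alpha H \<cdot> b \<cdot> beta H \<cdot> antip H c)" by (intro lin_rules) simp_all
  show ?thesis
    using arg_cong[OF antip_phi_inv, of f] by (simp add: tlift3_rep3[OF _ _ t] Ps_def s3_push[OF assms])
qed

context
  fixes G assumes G: "bil H H X G"
begin

text \<open>Behind evaluation after currying. The pentagon separates the legs. The axiom for
  \<open>beta\<close> then removes the middle leg of one \<phi>, whose other legs vanish by
  normalization; the axiom for \<open>alpha\<close> removes the third leg of the inverse of \<phi>;
  the remaining \<phi> contracts to the unit by \<open>antip_phi_sum\<close>, and the inverse is
  trivial by normalization.\<close>

lemma eval_curry_sum:
  "s3 X Ph (\<lambda>a b c. s2 X (Dl a) (\<lambda>a1 a2. s3 X Ps (\<lambda>x y z.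
     G (a1 \<cdot> x) (a2 \<cdot> y \<cdot> beta H \<cdot> antip H (b \<cdot> z) \<cdot> alpha H \<cdot> c)))) = G \<one>\<^bsub>H\<^esub> \<one>\<^bsub>H\<^esub>"
proof -
  note [lin_rules] = bil_linr[OF G]
  note [simp] = bil_closed[OF G]
  let ?e = "\<lambda>h x. counit H h \<odot>\<^bsub>X\<^esub> x"
  let ?E = "\<lambda>p q r s. G p (q \<cdot> beta H \<cdot> antip H r \<cdot> alpha H \<cdot> s)"
  have q: "quad X ?E" by (intro lin_rules) simp_all
  have 1: "s2 X (Dl b) (\<lambda>b1 b2. ?E (p \<cdot> a) (q \<cdot> x \<cdot> b1) (r1 \<cdot> y \<cdot> b2) (r2 \<cdot> z \<cdot> c)) =
      ?e b (?E (p \<cdot> a) (q \<cdot> x) (r1 \<cdot> y) (r2 \<cdot> z \<cdot> c))"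
    if [simp]: "p \<in> carrier H" "q \<in> carrier H" "r1 \<in> carrier H" "r2 \<in> carrier H" "x \<in> carrier H" "y \<in> carrier H" "z \<in> carrier H"
      "a \<in> carrier H" "b \<in> carrier H" "c \<in> carrier H" for p q r1 r2 x y z a b c
  proof -
    have "lin H X (\<lambda>u. G (p \<cdot> a) (q \<cdot> x \<cdot> u \<cdot> antip H (r1 \<cdot> y) \<cdot> alpha H \<cdot> (r2 \<cdot> z \<cdot> c)))"
      by (intro lin_rules) simp_all
    from antip_beta_sum[OF this, of b] show ?thesis by (simp add: antip_mult m_assoc)
  qed
  have 2: "s3 X Ph (\<lambda>a b c. ?e b (?E (p \<cdot> a) (q \<cdot> x) (r1 \<cdot> y) (r2 \<cdot> z \<cdot> c))) =
      ?E p (q \<cdot> x) (r1 \<cdot> y) (r2 \<cdot> z)"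
    if [simp]: "p \<in> carrier H" "q \<in> carrier H" "r1 \<in> carrier H" "r2 \<in> carrier H" "x \<in> carrier H" "y \<in> carrier H" "z \<in> carrier H"
     for p q r1 r2 x y z
  proof -
    have "bil H H X (\<lambda>a c. ?E (p \<cdot> a) (q \<cdot> x) (r1 \<cdot> y) (r2 \<cdot> z \<cdot> c))"
      by (intro lin_rules) simp_all
    from phi_counit2[OF X this] show ?thesis by simp
  qed
  have 3: "s2 X (Dl r) (\<lambda>r1 r2. ?E p (q \<cdot> x) (r1 \<cdot> y) (r2 \<cdot> z)) = ?e r (?E p (q \<cdot> x) y z)"
    if [simp]: "p \<in> carrier H" "q \<in> carrier H" "r \<in> carrier H" "x \<in> carrier H" "y \<in> carrier H" "z \<in> carrier H"
     for p q r x y z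
  proof -
    have "lin H X (\<lambda>u. G p (q \<cdot> x \<cdot> beta H \<cdot> antip H y \<cdot> u \<cdot> z))"
      by (intro lin_rules) simp_all
    from antip_alpha_sum[OF this, of r] show ?thesis by (simp add: antip_mult m_assoc)
  qed
  have 4: "s2 X (Dl r) (\<lambda>r1 r2. s3 X Ph (\<lambda>x y z. ?E p (q \<cdot> x) (r1 \<cdot> y) (r2 \<cdot> z))) = ?e r (G p q)"
    if m [simp]: "p \<in> carrier H" "q \<in> carrier H" "r \<in> carrier H" for p q r
  proof -
    have "s2 X (Dl r) (\<lambda>r1 r2. s3 X Ph (\<lambda>x y z. ?E p (q \<cdot> x) (r1 \<cdot> y) (r2 \<cdot> z))) =
      s3 X Ph (\<lambda>x y z. s2 X (Dl r) (\<lambda>r1 r2. ?E p (q \<cdot> x) (r1 \<cdot> y) (r2 \<cdot> z)))"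
      by (rule s2_s3_swap) simp_all
    also have "\<dots> = s3 X Ph (\<lambda>x y z. ?e r (?E p (q \<cdot> x) y z))" by (intro s3_cong refl 3 m)
    also have "\<dots> = ?e r (s3 X Ph (\<lambda>x y z. ?E p (q \<cdot> x) y z))" by (rule s_smult_push) simp_all
    also have "s3 X Ph (\<lambda>x y z. ?E p (q \<cdot> x) y z) = G p q"
    proof -
      have "lin H X (\<lambda>u. G p (q \<cdot> u))" by (intro lin_rules) simp_all
      from antip_phi_sum[OF this] show ?thesis by (simp add: m_assoc)
    qed
    finally show ?thesis .
  qed
  have "s3 X Ps (\<lambda>p q r. s2 X (Dl r) (\<lambda>r1 r2. s3 X Ph (\<lambda>x y z. s3 X Ph (\<lambda>a b c. s2 X (Dl b) (\<lambda>b1 b2.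
      ?E (p \<cdot> a) (q \<cdot> x \<cdot> b1) (r1 \<cdot> y \<cdot> b2) (r2 \<cdot> z \<cdot> c)))))) =
     s3 X Ps (\<lambda>p q r. s2 X (Dl r) (\<lambda>r1 r2. s3 X Ph (\<lambda>x y z. s3 X Ph (\<lambda>a b c.
      ?e b (?E (p \<cdot> a) (q \<cdot> x) (r1 \<cdot> y) (r2 \<cdot> z \<cdot> c))))))"
    by (intro s3_cong s2_cong refl 1)
  also have "\<dots> = s3 X Ps (\<lambda>p q r. s2 X (Dl r) (\<lambda>r1 r2. s3 X Ph (\<lambda>x y z. ?E p (q \<cdot> x) (r1 \<cdot> y) (r2 \<cdot> z))))"
    by (intro s3_cong[of Ps Ps] s2_cong[of "Dl _"] refl, rule s3_cong[OF refl], rule 2)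
  also have "\<dots> = s3 X Ps (\<lambda>p q r. ?e r (G p q))" by (intro s3_cong refl 4)
  also have "\<dots> = G \<one>\<^bsub>H\<^esub> \<one>\<^bsub>H\<^esub>" by (rule phi_inv_counit3[OF X G])
  finally show ?thesis using pentagon_left_sum[OF X q] by simp
qed

text \<open>Behind currying after evaluation, with the roles exchanged: \<open>beta\<close> consumes
  the third leg of \<phi>, \<open>alpha\<close> the middle leg of one inverse of \<phi>, and the
  other inverse contracts to the unit by \<open>antip_phi_inv_sum\<close>.\<close>

lemma curry_eval_sum:
  "s3 X Ph (\<lambda>x y z. s3 X Ps (\<lambda>a b c. s2 X (Dl a) (\<lambda>a1 a2.
     G (x \<cdot> a1) (antip H (y \<cdot> a2) \<cdot> alpha H \<cdot> (z \<cdot> b) \<cdot> beta H \<cdot> antip H c)))) = G \<one>\<^bsub>H\<^esub> \<one>\<^bsub>H\<^esub>"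
proof -
  note [lin_rules] = bil_linr[OF G]
  note [simp] = bil_closed[OF G]
  let ?e = "\<lambda>h x. counit H h \<odot>\<^bsub>X\<^esub> x"
  let ?E = "\<lambda>p q r s. G p (antip H q \<cdot> alpha H \<cdot> r \<cdot> beta H \<cdot> antip H s)"
  have q: "quad X ?E" by (intro lin_rules) simp_all
  have 1: "s2 X (Dl z) (\<lambda>z1 z2. ?E (a \<cdot> x) (b1 \<cdot> p \<cdot> y) (b2 \<cdot> q \<cdot> z1) (c \<cdot> r \<cdot> z2)) =
      ?e z (?E (a \<cdot> x) (b1 \<cdot> p \<cdot> y) (b2 \<cdot> q) (c \<cdot> r))"
    if [simp]: "p \<in> carrier H" "q \<in> carrier H" "r \<in> carrier H" "b1 \<in> carrier H" "b2 \<in> carrier H" "x \<in> carrier H" "y \<in> carrier H" "z \<in> carrier H"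
      "a \<in> carrier H" "c \<in> carrier H" for p q r b1 b2 x y z a c
  proof -
    have "lin H X (\<lambda>u. G (a \<cdot> x) (antip H (b1 \<cdot> p \<cdot> y) \<cdot> alpha H \<cdot> (b2 \<cdot> q) \<cdot> u \<cdot> antip H (c \<cdot> r)))"
      by (intro lin_rules) simp_all
    from antip_beta_sum[OF this, of z] show ?thesis by (simp add: antip_mult m_assoc)
  qed
  have 2: "s3 X Ph (\<lambda>x y z. ?e z (?E (a \<cdot> x) (b1 \<cdot> p \<cdot> y) (b2 \<cdot> q) (c \<cdot> r))) =
      ?E a (b1 \<cdot> p) (b2 \<cdot> q) (c \<cdot> r)"
    if [simp]: "p \<in> carrier H" "q \<in> carrier H" "r \<in> carrier H" "b1 \<in> carrier H" "b2 \<in> carrier H"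
      "a \<in> carrier H" "c \<in> carrier H" for p q r b1 b2 a c
  proof -
    have "bil H H X (\<lambda>x y. ?E (a \<cdot> x) (b1 \<cdot> p \<cdot> y) (b2 \<cdot> q) (c \<cdot> r))"
      by (intro lin_rules) simp_all
    from phi_counit3[OF X this] show ?thesis by simp
  qed
  have 3: "s2 X (Dl b) (\<lambda>b1 b2. ?E a (b1 \<cdot> p) (b2 \<cdot> q) (c \<cdot> r)) = ?e b (?E a p q (c \<cdot> r))"
    if [simp]: "p \<in> carrier H" "q \<in> carrier H" "r \<in> carrier H" "a \<in> carrier H" "b \<in> carrier H" "c \<in> carrier H"
     for p q r a b c
  proof -
    have "lin H X (\<lambda>u. G a (antip H p \<cdot> u \<cdot> q \<cdot> beta H \<cdot> antip H (c \<cdot> r)))"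
      by (intro lin_rules) simp_all
    from antip_alpha_sum[OF this, of b] show ?thesis by (simp add: antip_mult m_assoc)
  qed
  have 4: "s2 X (Dl b) (\<lambda>b1 b2. s3 X Ps (\<lambda>p q r. ?E a (b1 \<cdot> p) (b2 \<cdot> q) (c \<cdot> r))) = ?e b (G a (antip H c))"
    if m [simp]: "a \<in> carrier H" "b \<in> carrier H" "c \<in> carrier H" for a b c
  proof -
    have "s2 X (Dl b) (\<lambda>b1 b2. s3 X Ps (\<lambda>p q r. ?E a (b1 \<cdot> p) (b2 \<cdot> q) (c \<cdot> r))) =
      s3 X Ps (\<lambda>p q r. s2 X (Dl b) (\<lambda>b1 b2. ?E a (b1 \<cdot> p) (b2 \<cdot> q) (c \<cdot> r)))"
      by (rule s2_s3_swap) simp_all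
    also have "\<dots> = s3 X Ps (\<lambda>p q r. ?e b (?E a p q (c \<cdot> r)))" by (intro s3_cong refl 3 m)
    also have "\<dots> = ?e b (s3 X Ps (\<lambda>p q r. ?E a p q (c \<cdot> r)))" by (rule s_smult_push) simp_all
    also have "s3 X Ps (\<lambda>p q r. ?E a p q (c \<cdot> r)) = G a (antip H c)"
    proof -
      have "lin H X (\<lambda>u. G a (u \<cdot> antip H c))" by (intro lin_rules) simp_all
      from antip_phi_inv_sum[OF this] show ?thesis by (simp add: m_assoc antip_mult)
    qed
    finally show ?thesis .
  qed
  have b: "bil H H X (\<lambda>a c. G a (antip H c))" by (intro lin_rules) simp_all
  have "s3 X Ps (\<lambda>a b c. s2 X (Dl b) (\<lambda>b1 b2. s3 X Ps (\<lambda>p q r. s3 X Ph (\<lambda>x y z. s2 X (Dl z) (\<lambda>z1 z2.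
      ?E (a \<cdot> x) (b1 \<cdot> p \<cdot> y) (b2 \<cdot> q \<cdot> z1) (c \<cdot> r \<cdot> z2)))))) =
     s3 X Ps (\<lambda>a b c. s2 X (Dl b) (\<lambda>b1 b2. s3 X Ps (\<lambda>p q r. s3 X Ph (\<lambda>x y z.
      ?e z (?E (a \<cdot> x) (b1 \<cdot> p \<cdot> y) (b2 \<cdot> q) (c \<cdot> r))))))"
    by (intro s3_cong s2_cong refl 1)
  also have "\<dots> = s3 X Ps (\<lambda>a b c. s2 X (Dl b) (\<lambda>b1 b2. s3 X Ps (\<lambda>p q r. ?E a (b1 \<cdot> p) (b2 \<cdot> q) (c \<cdot> r))))"
    by (rule s3_cong[OF refl], rule s2_cong[OF refl], rule s3_cong[OF refl], rule 2)
  also have "\<dots> = s3 X Ps (\<lambda>a b c. ?e b (G a (antip H c)))" by (intro s3_cong refl 4)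
  also have "\<dots> = G \<one>\<^bsub>H\<^esub> \<one>\<^bsub>H\<^esub>" using phi_inv_counit2[OF X b] by simp
  finally show ?thesis using pentagon_right_sum[OF X q] by simp
qed

end

end

end

section \<open>The universal R-matrix on components\<close>

context quasitriangular_quasi_hopf
begin

definition "Rl = rep2 (rmat H)"
definition "Ri = rep2 (inv\<^bsub>tensor2 k H\<^esub> (rmat H))"

lemma T2_ring: "ring (tensor2 k H)" by (rule algD) simp

sublocale T2: ring "tensor2 k H" by (rule T2_ring)

lemma rmat_closed [simp]: "rmat H \<in> carrier (tensor2 k H)" "inv\<^bsub>tensor2 k H\<^esub> (rmat H) \<in> carrier (tensor2 k H)"
  using rmat_unit by (simp_all add: T2.Units_closed)

lemma rmat_Rl: "rmat H = s2 (tensor2 k H) Rl (pure2 k H)"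
  and rmat_inv_Ri: "inv\<^bsub>tensor2 k H\<^esub> (rmat H) = s2 (tensor2 k H) Ri (pure2 k H)"
  by (simp_all add: rep2 Rl_def Ri_def)

context
  fixes X :: "('k, 'x, 'm) module_scheme"
  assumes X [simp]: "module k X"
begin

lemma rmat_cancel:
  assumes T [simp]: "bil H H X T"
  shows "s2 X Rl (\<lambda>r s. s2 X Ri (\<lambda>p q. T (r \<cdot> p) (s \<cdot> q))) = T \<one>\<^bsub>H\<^esub> \<one>\<^bsub>H\<^esub>"
proof -
  have e: "rmat H \<otimes>\<^bsub>tensor2 k H\<^esub> inv\<^bsub>tensor2 k H\<^esub> (rmat H) = \<one>\<^bsub>tensor2 k H\<^esub>"
    using rmat_unit by (simp add: T2.Units_r_inv)
  have o: "tlift X T \<one>\<^bsub>tensor2 k H\<^esub> = T \<one>\<^bsub>H\<^esub> \<one>\<^bsub>H\<^esub>" by (simp add: tensor_one)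
  have "tlift X T (rmat H \<otimes>\<^bsub>tensor2 k H\<^esub> inv\<^bsub>tensor2 k H\<^esub> (rmat H)) =
      s2 X Rl (\<lambda>r s. tlift X T (pure2 k H r s \<otimes>\<^bsub>tensor2 k H\<^esub> inv\<^bsub>tensor2 k H\<^esub> (rmat H)))"
    by (subst (1) rmat_Rl) (simp add: alg_mult_s tlift_s)
  also have "\<dots> = s2 X Rl (\<lambda>r s. s2 X Ri (\<lambda>p q. T (r \<cdot> p) (s \<cdot> q)))"
    by (simp add: rmat_inv_Ri alg_mult_s tlift_s pure_mult)
  finally show ?thesis using o e by simp
qed

text \<open>The conjugation axiom multiplied through by \<open>R\<close>. In this form it expresses
  the equivariance of the braiding, see \<open>Br_ebil\<close>.\<close>

lemma rmat_comul_sum: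
  assumes T [simp]: "bil H H X T" and [simp]: "h \<in> carrier H"
  shows "s2 X Rl (\<lambda>r s. s2 X (Dl h) (\<lambda>a b. T (r \<cdot> a) (s \<cdot> b))) =
    s2 X (Dl h) (\<lambda>a b. s2 X Rl (\<lambda>r s. T (b \<cdot> r) (a \<cdot> s)))"
proof -
  have b: "bil H H (tensor2 k H) (\<lambda>a b. pure2 k H b a)" by (intro lin_rules)
  let ?d = "s2 (tensor2 k H) (Dl h) (\<lambda>a b. pure2 k H b a)"
  have "?d \<otimes>\<^bsub>tensor2 k H\<^esub> rmat H = rmat H \<otimes>\<^bsub>tensor2 k H\<^esub> comul H h"
    using rmat_comul[of h] rmat_unit
    by (simp add: tlift_comul b T2.m_assoc T2.Units_l_inv)
  from arg_cong[where f = "tlift X T", OF this[symmetric]] show ?thesis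
    by (simp add: rmat_Rl comul_Dl alg_mult_s(1,3) tlift_s) (simp add: alg_mult_s tlift_s pure_mult)
qed

context
  fixes T assumes T [simp]: "tril X T"
begin

lemma hexagon_left_sum:
  "s3 X Ps (\<lambda>p q t. s2 X Rl (\<lambda>r s. s2 X (Dl r) (\<lambda>r1 r2. s3 X Ps (\<lambda>x y z.
     T (q \<cdot> r1 \<cdot> x) (t \<cdot> r2 \<cdot> y) (p \<cdot> s \<cdot> z))))) =
   s2 X Rl (\<lambda>r s. s3 X Ps (\<lambda>p q t. s2 X Rl (\<lambda>r' s'. T (r \<cdot> p) (t \<cdot> r') (s \<cdot> q \<cdot> s'))))"
proof -
  have t: "tril (tensor3 k H) (\<lambda>a b c. pure3 k H b c a)" "tril (tensor3 k H) (\<lambda>a b c. pure3 k H a c b)"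
    by (intro lin_rules; simp)+
  have b: "bil H H (tensor3 k H) (\<lambda>a b. pure3 k H a \<one>\<^bsub>H\<^esub> b)" "bil H H (tensor3 k H) (\<lambda>a b. pure3 k H \<one>\<^bsub>H\<^esub> a b)"
    by (intro lin_rules; simp)+
  have l: "leg k H (\<lambda>a b c. pure3 k H b c a) (phi_inv k H) = s3 (tensor3 k H) Ps (\<lambda>a b c. pure3 k H b c a)"
    "leg k H (\<lambda>a b c. pure3 k H a c b) (phi_inv k H) = s3 (tensor3 k H) Ps (\<lambda>a b c. pure3 k H a c b)"
    unfolding leg_def Ps_def by (rule tlift3_rep3; simp add: t)+
  have rl: "rleg k H (\<lambda>a b. pure3 k H a \<one>\<^bsub>H\<^esub> b) = s2 (tensor3 k H) Rl (\<lambda>a b. pure3 k H a \<one>\<^bsub>H\<^esub> b)"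
    "rleg k H (\<lambda>a b. pure3 k H \<one>\<^bsub>H\<^esub> a b) = s2 (tensor3 k H) Rl (\<lambda>a b. pure3 k H \<one>\<^bsub>H\<^esub> a b)"
    unfolding rleg_def Rl_def by (rule tlift_rep2; simp add: b)+
  have c: "comul_left k H (rmat H) = s2 (tensor3 k H) Rl (\<lambda>r s. s2 (tensor3 k H) (Dl r) (\<lambda>c d. pure3 k H c d s))"
    by (simp add: rmat_Rl s2_push[OF khomD(1)[OF comul_left_khom]] comul_left_pure)
  let ?R = "rleg k H (\<lambda>a b. pure3 k H \<one>\<^bsub>H\<^esub> a b)" and ?L = "leg k H (\<lambda>a b c. pure3 k H a c b) (phi_inv k H)"
  have cl: "?R \<in> carrier (tensor3 k H)" "?L \<in> carrier (tensor3 k H)" by (simp_all add: rl l)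
  have 1: "tlift3 X T (leg k H (\<lambda>a b c. pure3 k H b c a) (phi_inv k H)
         \<otimes>\<^bsub>tensor3 k H\<^esub> comul_left k H (rmat H) \<otimes>\<^bsub>tensor3 k H\<^esub> phi_inv k H) =
     s3 X Ps (\<lambda>p q t. s2 X Rl (\<lambda>r s. s2 X (Dl r) (\<lambda>r1 r2. s3 X Ps (\<lambda>x y z.
     T (q \<cdot> r1 \<cdot> x) (t \<cdot> r2 \<cdot> y) (p \<cdot> s \<cdot> z)))))"
    by (simp add: l alg_mult_s tlift_s)
       (simp add: c alg_mult_s tlift_s pure_mult, simp add: phi_inv_Ps alg_mult_s tlift_s pure_mult tlift3_pure)
  have 2: "tlift3 X T (rleg k H (\<lambda>a b. pure3 k H a \<one>\<^bsub>H\<^esub> b) \<otimes>\<^bsub>tensor3 k H\<^esub> ?L \<otimes>\<^bsub>tensor3 k H\<^esub> ?R) =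
     s2 X Rl (\<lambda>r s. s3 X Ps (\<lambda>p q t. s2 X Rl (\<lambda>r' s'. T (r \<cdot> p) (t \<cdot> r') (s \<cdot> q \<cdot> s'))))"
    using cl by (simp add: rl(1) alg_mult_s tlift_s)
       (simp add: l alg_mult_s tlift_s pure_mult, simp add: rl alg_mult_s tlift_s pure_mult tlift3_pure)
  show ?thesis using hexagon_left 1 2 by simp
qed

lemma hexagon_right_sum:
  "s3 X Ph (\<lambda>p q t. s2 X Rl (\<lambda>r s. s2 X (Dl s) (\<lambda>s1 s2. s3 X Ph (\<lambda>x y z.
     T (t \<cdot> r \<cdot> x) (p \<cdot> s1 \<cdot> y) (q \<cdot> s2 \<cdot> z))))) =
   s2 X Rl (\<lambda>r s. s3 X Ph (\<lambda>p q t. s2 X Rl (\<lambda>r' s'. T (r \<cdot> q \<cdot> r') (p \<cdot> s') (s \<cdot> t))))"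
proof -
  have t: "tril (tensor3 k H) (\<lambda>a b c. pure3 k H c a b)" "tril (tensor3 k H) (\<lambda>a b c. pure3 k H b a c)"
    by (intro lin_rules; simp)+
  have b: "bil H H (tensor3 k H) (\<lambda>a b. pure3 k H a \<one>\<^bsub>H\<^esub> b)" "bil H H (tensor3 k H) (\<lambda>a b. pure3 k H a b \<one>\<^bsub>H\<^esub>)"
    by (intro lin_rules; simp)+
  have l: "leg k H (\<lambda>a b c. pure3 k H c a b) (phi H) = s3 (tensor3 k H) Ph (\<lambda>a b c. pure3 k H c a b)"
    "leg k H (\<lambda>a b c. pure3 k H b a c) (phi H) = s3 (tensor3 k H) Ph (\<lambda>a b c. pure3 k H b a c)"
    unfolding leg_def Ph_def by (rule tlift3_rep3; simp add: t)+
  have rl: "rleg k H (\<lambda>a b. pure3 k H a \<one>\<^bsub>H\<^esub> b) = s2 (tensor3 k H) Rl (\<lambda>a b. pure3 k H a \<one>\<^bsub>H\<^esub> b)"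
    "rleg k H (\<lambda>a b. pure3 k H a b \<one>\<^bsub>H\<^esub>) = s2 (tensor3 k H) Rl (\<lambda>a b. pure3 k H a b \<one>\<^bsub>H\<^esub>)"
    unfolding rleg_def Rl_def by (rule tlift_rep2; simp add: b)+
  have c: "comul_right k H (rmat H) = s2 (tensor3 k H) Rl (\<lambda>r s. s2 (tensor3 k H) (Dl s) (\<lambda>c d. pure3 k H r c d))"
    by (simp add: rmat_Rl s2_push[OF khomD(1)[OF comul_right_khom]] comul_right_pure)
  let ?R = "rleg k H (\<lambda>a b. pure3 k H a b \<one>\<^bsub>H\<^esub>)" and ?L = "leg k H (\<lambda>a b c. pure3 k H b a c) (phi H)"
  have cl: "?R \<in> carrier (tensor3 k H)" "?L \<in> carrier (tensor3 k H)" by (simp_all add: rl l)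
  have 1: "tlift3 X T (leg k H (\<lambda>a b c. pure3 k H c a b) (phi H)
         \<otimes>\<^bsub>tensor3 k H\<^esub> comul_right k H (rmat H) \<otimes>\<^bsub>tensor3 k H\<^esub> phi H) =
     s3 X Ph (\<lambda>p q t. s2 X Rl (\<lambda>r s. s2 X (Dl s) (\<lambda>s1 s2. s3 X Ph (\<lambda>x y z.
     T (t \<cdot> r \<cdot> x) (p \<cdot> s1 \<cdot> y) (q \<cdot> s2 \<cdot> z)))))"
    by (simp add: l alg_mult_s tlift_s)
       (simp add: c alg_mult_s tlift_s pure_mult, simp add: phi_Ph alg_mult_s tlift_s pure_mult tlift3_pure)
  have 2: "tlift3 X T (rleg k H (\<lambda>a b. pure3 k H a \<one>\<^bsub>H\<^esub> b) \<otimes>\<^bsub>tensor3 k H\<^esub> ?L \<otimes>\<^bsub>tensor3 k H\<^esub> ?R) =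
     s2 X Rl (\<lambda>r s. s3 X Ph (\<lambda>p q t. s2 X Rl (\<lambda>r' s'. T (r \<cdot> q \<cdot> r') (p \<cdot> s') (s \<cdot> t))))"
    using cl by (simp add: rl(1) alg_mult_s tlift_s)
       (simp add: l alg_mult_s tlift_s pure_mult, simp add: rl alg_mult_s tlift_s pure_mult tlift3_pure)
  show ?thesis using hexagon_right 1 2 by simp
qed

end

text \<open>The counit in the first leg of a hexagon turns all associators into units and leaves R =
  (1 \<otimes> q) R, where q is the contraction of \<open>R\<close> by the counit in its first leg.
  Invertibility of \<open>R\<close> then gives q = 1.\<close>

lemma counit_rmat:
  assumes f: "lin H X f"
  shows "s2 X Rl (\<lambda>r s. counit H r \<odot>\<^bsub>X\<^esub> f s) = f \<one>\<^bsub>H\<^esub>"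
proof -
  note [lin_rules] = lin_comp[OF _ f]
  note [simp] = lin_closed[OF f]
  let ?e = "\<lambda>h x. counit H h \<odot>\<^bsub>X\<^esub> x"
  have key: "s2 X Rl T = s2 X Rl (\<lambda>r s. s2 X Rl (\<lambda>r' s'. ?e r (T r' (s \<cdot> s'))))" if T: "bil H H X T" for T
  proof -
    note [lin_rules] = bil_linr[OF T]
    note [simp] = bil_closed[OF T]
    have t: "tril X (\<lambda>a b c. ?e a (T b c))" by (intro lin_rules) simp_all
    have 1: "s3 X Ps (\<lambda>x y z. ?e (q \<cdot> r1 \<cdot> x) (T (t \<cdot> r2 \<cdot> y) (p \<cdot> s \<cdot> z))) =
        ?e q (?e r1 (T (t \<cdot> r2) (p \<cdot> s)))"
      if [simp]: "p \<in> carrier H" "q \<in> carrier H" "t \<in> carrier H" "r1 \<in> carrier H" "r2 \<in> carrier H" "s \<in> carrier H" for p q t r1 r2 s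
    proof -
      have "bil H H X (\<lambda>y z. T (t \<cdot> r2 \<cdot> y) (p \<cdot> s \<cdot> z))" by (intro lin_rules) simp_all
      from phi_inv_counit1[OF X this] show ?thesis by (simp add: smult_expand s_smult_push)
    qed
    have 2: "s2 X (Dl r) (\<lambda>r1 r2. ?e q (?e r1 (T (t \<cdot> r2) (p \<cdot> s)))) = ?e q (T (t \<cdot> r) (p \<cdot> s))"
      if [simp]: "p \<in> carrier H" "q \<in> carrier H" "t \<in> carrier H" "r \<in> carrier H" "s \<in> carrier H" for p q t r s
    proof -
      have "lin H X (\<lambda>r2. T (t \<cdot> r2) (p \<cdot> s))" by (intro lin_rules) simp_all
      from counit_left_sum[OF X _ this, of r] show ?thesis by (simp add: s_smult_push)
    qed
    have 3: "s3 X Ps (\<lambda>p q t. ?e q (T (t \<cdot> r) (p \<cdot> s))) = T r s"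
      if [simp]: "r \<in> carrier H" "s \<in> carrier H" for r s
    proof -
      have "bil H H X (\<lambda>p t. T (t \<cdot> r) (p \<cdot> s))" by (intro lin_rules) simp_all
      from phi_inv_counit2[OF X this] show ?thesis by simp
    qed
    have "s3 X Ps (\<lambda>p q t. s2 X Rl (\<lambda>r s. s2 X (Dl r) (\<lambda>r1 r2. s3 X Ps (\<lambda>x y z.
         ?e (q \<cdot> r1 \<cdot> x) (T (t \<cdot> r2 \<cdot> y) (p \<cdot> s \<cdot> z))))))
       = s3 X Ps (\<lambda>p q t. s2 X Rl (\<lambda>r s. s2 X (Dl r) (\<lambda>r1 r2. ?e q (?e r1 (T (t \<cdot> r2) (p \<cdot> s))))))"
      by (intro s3_cong s2_cong refl 1)
    also have "\<dots> = s3 X Ps (\<lambda>p q t. s2 X Rl (\<lambda>r s. ?e q (T (t \<cdot> r) (p \<cdot> s))))"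
      by (rule s3_cong[OF refl], rule s2_cong[OF refl], rule 2)
    also have "\<dots> = s2 X Rl (\<lambda>r s. s3 X Ps (\<lambda>p q t. ?e q (T (t \<cdot> r) (p \<cdot> s))))"
      by (rule s2_s3_swap[symmetric]) simp_all
    also have "\<dots> = s2 X Rl T" by (intro s2_cong refl 3)
    finally have L: "s3 X Ps (\<lambda>p q t. s2 X Rl (\<lambda>r s. s2 X (Dl r) (\<lambda>r1 r2. s3 X Ps (\<lambda>x y z.
         ?e (q \<cdot> r1 \<cdot> x) (T (t \<cdot> r2 \<cdot> y) (p \<cdot> s \<cdot> z)))))) = s2 X Rl T" .
    have 4: "s3 X Ps (\<lambda>p q t. s2 X Rl (\<lambda>r' s'. ?e (r \<cdot> p) (T (t \<cdot> r') (s \<cdot> q \<cdot> s')))) =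
        s2 X Rl (\<lambda>r' s'. ?e r (T r' (s \<cdot> s')))" if [simp]: "r \<in> carrier H" "s \<in> carrier H" for r s
    proof -
      have "bil H H X (\<lambda>q t. s2 X Rl (\<lambda>r' s'. T (t \<cdot> r') (s \<cdot> q \<cdot> s')))" by (intro lin_rules) simp_all
      from phi_inv_counit1[OF X this] show ?thesis by (simp add: smult_expand s_smult_push)
    qed
    show ?thesis
      using hexagon_left_sum[OF t] unfolding L by (simp only: 4 cong: s2_cong)
  qed
  \<comment> \<open>The right factor \<open>R\<close> in \<open>key\<close> is cancelled by testing
    against a multiplication by the inverse of \<open>R\<close> from the right.\<close>
  let ?T = "\<lambda>r s. s2 X Ri (\<lambda>p q. ?e (r \<cdot> p) (f (s \<cdot> q)))"
  have T: "bil H H X ?T" by (intro lin_rules) simp_all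
  have 1: "s2 X Rl (\<lambda>r' s'. ?T r' (s \<cdot> s')) = f s" if [simp]: "s \<in> carrier H" for s
  proof -
    have "bil H H X (\<lambda>p q. ?e p (f (s \<cdot> q)))" by (intro lin_rules) simp_all
    from rmat_cancel[OF this] show ?thesis by (simp add: m_assoc del: counit_mult)
  qed
  have "bil H H X (\<lambda>p q. ?e p (f q))" by (intro lin_rules) simp_all
  from rmat_cancel[OF this] have "f \<one>\<^bsub>H\<^esub> = s2 X Rl ?T" by (simp del: counit_mult)
  also have "\<dots> = s2 X Rl (\<lambda>r s. s2 X Rl (\<lambda>r' s'. ?e r (?T r' (s \<cdot> s'))))" by (rule key[OF T])
  also have "\<dots> = s2 X Rl (\<lambda>r s. ?e r (f s))" by (simp add: s_smult_push 1 del: counit_mult)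
  finally show ?thesis by simp
qed

end

end

section \<open>Internal homs and evaluation\<close>

context quasi_hopf_algebra
begin

text \<open>The structure of \<open>hmod\<close> without the grading, which plays no role for evaluation and composition.\<close>

definition hact :: "('k, 'h, 'v, 'm) gmod_scheme \<Rightarrow> bool" where
  "hact V \<longleftrightarrow> module k V \<and> bil H V V (act V) \<and>
     (\<forall>g\<in>carrier H. \<forall>h\<in>carrier H. \<forall>v\<in>carrier V. act V (g \<cdot> h) v = act V g (act V h v)) \<and>
     (\<forall>v\<in>carrier V. act V \<one>\<^bsub>H\<^esub> v = v)"

lemma hmod_hact: "hmod k H V \<Longrightarrow> hact V"
  unfolding hact_def hmod_def hmod_axioms_def bil_def
  by (auto intro!: linI simp: linD)

lemma hactD:
  assumes "hact V"
  shows hact_module [simp]: "module k V"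
    and hact_bil: "bil H V V (act V)"
    and act_closed [simp]: "h \<in> carrier H \<Longrightarrow> v \<in> carrier V \<Longrightarrow> act V h v \<in> carrier V"
    and act_act: "g \<in> carrier H \<Longrightarrow> h \<in> carrier H \<Longrightarrow> v \<in> carrier V \<Longrightarrow> act V g (act V h v) = act V (g \<cdot> h) v"
    and act_one [simp]: "v \<in> carrier V \<Longrightarrow> act V \<one>\<^bsub>H\<^esub> v = v"
  using assms bil_closed[of H V V "act V"] by (simp_all add: hact_def)

lemma hactI:
  assumes "module k V" "bil H V V (act V)"
    "\<And>g h v. g \<in> carrier H \<Longrightarrow> h \<in> carrier H \<Longrightarrow> v \<in> carrier V \<Longrightarrow> act V (g \<cdot> h) v = act V g (act V h v)"
    "\<And>v. v \<in> carrier V \<Longrightarrow> act V \<one>\<^bsub>H\<^esub> v = v"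
  shows "hact V"
  unfolding hact_def by (intro conjI ballI assms)

lemma act_linr [lin_rules]:
  "hact V \<Longrightarrow> lin U H g \<Longrightarrow> v \<in> carrier V \<Longrightarrow> lin U V (\<lambda>u. act V (g u) v)"
  "hact V \<Longrightarrow> lin U V f \<Longrightarrow> h \<in> carrier H \<Longrightarrow> lin U V (\<lambda>u. act V h (f u))"
  by (rule bil_linr(1)[OF hact_bil], assumption+) (rule bil_linr(2)[OF hact_bil], assumption+)

lemma act_lin: "hact V \<Longrightarrow> h \<in> carrier H \<Longrightarrow> lin V V (act V h)"
  by (rule bil_lin2[OF hact_bil])

lemma act_s:
  assumes "hact V" "h \<in> carrier H"
  shows "(\<And>a b. a \<in> carrier H \<Longrightarrow> b \<in> carrier H \<Longrightarrow> T a b \<in> carrier V) \<Longrightarrow> act V h (s2 V ps T) = s2 V ps (\<lambda>a b. act V h (T a b))"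
    and "(\<And>a b c. a \<in> carrier H \<Longrightarrow> b \<in> carrier H \<Longrightarrow> c \<in> carrier H \<Longrightarrow> T' a b c \<in> carrier V) \<Longrightarrow>
      act V h (s3 V qs T') = s3 V qs (\<lambda>a b c. act V h (T' a b c))"
  using assms by (auto intro!: s2_push[OF act_lin] s3_push[OF act_lin])

text \<open>The bilinear form of an \<open>H\<close>-linear map on a tensor product. It avoids
  quotients in all later statements and ignores the grading.\<close>

definition ebil where
  "ebil X Y Z b \<longleftrightarrow> bil X Y Z b \<and> (\<forall>h\<in>carrier H. \<forall>x\<in>carrier X. \<forall>y\<in>carrier Y.
     act Z h (b x y) = s2 Z (Dl h) (\<lambda>h1 h2. b (act X h1 x) (act Y h2 y)))"

lemma ebil_bil: "ebil X Y Z b \<Longrightarrow> bil X Y Z b"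
  by (simp add: ebil_def)

lemma ebil_act: "ebil X Y Z b \<Longrightarrow> h \<in> carrier H \<Longrightarrow> x \<in> carrier X \<Longrightarrow> y \<in> carrier Y \<Longrightarrow>
    act Z h (b x y) = s2 Z (Dl h) (\<lambda>h1 h2. b (act X h1 x) (act Y h2 y))"
  by (simp add: ebil_def)

lemma bil_s:
  assumes "bil X Y Z b" "module k X" "module k Y" "module k Z"
  shows "y \<in> carrier Y \<Longrightarrow> (\<And>a b. a \<in> carrier H \<Longrightarrow> b \<in> carrier H \<Longrightarrow> T a b \<in> carrier X) \<Longrightarrow>
      b (s2 X ps T) y = s2 Z ps (\<lambda>a c. b (T a c) y)"
    and "x \<in> carrier X \<Longrightarrow> (\<And>a b. a \<in> carrier H \<Longrightarrow> b \<in> carrier H \<Longrightarrow> U a b \<in> carrier Y) \<Longrightarrow>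
      b x (s2 Y ps U) = s2 Z ps (\<lambda>a c. b x (U a c))"
    and "y \<in> carrier Y \<Longrightarrow> (\<And>a b c. a \<in> carrier H \<Longrightarrow> b \<in> carrier H \<Longrightarrow> c \<in> carrier H \<Longrightarrow> T' a b c \<in> carrier X) \<Longrightarrow>
      b (s3 X qs T') y = s3 Z qs (\<lambda>a c d. b (T' a c d) y)"
    and "x \<in> carrier X \<Longrightarrow> (\<And>a b c. a \<in> carrier H \<Longrightarrow> b \<in> carrier H \<Longrightarrow> c \<in> carrier H \<Longrightarrow> U' a b c \<in> carrier Y) \<Longrightarrow>
      b x (s3 Y qs U') = s3 Z qs (\<lambda>a c d. b x (U' a c d))"
  by (rule s2_push[OF bil_lin1[OF assms(1)] assms(2,4)] s2_push[OF bil_lin2[OF assms(1)] assms(3,4)]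
      s3_push[OF bil_lin1[OF assms(1)] assms(2,4)] s3_push[OF bil_lin2[OF assms(1)] assms(3,4)]; assumption)+

section \<open>The internal hom as an \<open>H\<close>-module\<close>

lemma ihom_simps:
  "carrier (ihom k H V W) = {L \<in> extensional (carrier V). lin V W L}"
  "\<zero>\<^bsub>ihom k H V W\<^esub> = (\<lambda>v\<in>carrier V. \<zero>\<^bsub>W\<^esub>)"
  "L \<oplus>\<^bsub>ihom k H V W\<^esub> L' = (\<lambda>v\<in>carrier V. L v \<oplus>\<^bsub>W\<^esub> L' v)"
  "c \<odot>\<^bsub>ihom k H V W\<^esub> L = (\<lambda>v\<in>carrier V. c \<odot>\<^bsub>W\<^esub> L v)"
  "act (ihom k H V W) h L = (\<lambda>v\<in>carrier V. tlift W (\<lambda>a b. act W a (L (act V (antip H b) v))) (comul H h))"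
  "grade (ihom k H V W) n = {L \<in> carrier (ihom k H V W). \<forall>m. L ` grade V m \<subseteq> grade W (m + n)}"
  by (simp_all add: ihom_def Let_def)

lemma ihom_lin: "L \<in> carrier (ihom k H V W) \<Longrightarrow> lin V W L"
  by (simp add: ihom_simps)

lemma ihom_app [simp]: "L \<in> carrier (ihom k H V W) \<Longrightarrow> v \<in> carrier V \<Longrightarrow> L v \<in> carrier W"
  by (rule lin_closed[OF ihom_lin])

lemma ihom_app_op:
  assumes "v \<in> carrier V"
  shows "\<zero>\<^bsub>ihom k H V W\<^esub> v = \<zero>\<^bsub>W\<^esub>"
    and "(L \<oplus>\<^bsub>ihom k H V W\<^esub> L') v = L v \<oplus>\<^bsub>W\<^esub> L' v"
    and "(c \<odot>\<^bsub>ihom k H V W\<^esub> L) v = c \<odot>\<^bsub>W\<^esub> L v"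
  using assms by (simp_all add: ihom_simps)

lemma ihom_eqI:
  "L \<in> carrier (ihom k H V W) \<Longrightarrow> L' \<in> carrier (ihom k H V W) \<Longrightarrow> (\<And>v. v \<in> carrier V \<Longrightarrow> L v = L' v) \<Longrightarrow> L = L'"
  by (auto simp: ihom_simps intro: extensionalityI)

lemma ihomI:
  assumes "module k V" "lin V W f"
  shows "(\<lambda>v\<in>carrier V. f v) \<in> carrier (ihom k H V W)"
proof -
  have "lin V W (restrict f (carrier V)) = lin V W f" by (rule lin_cong[OF assms(1)]) simp
  then show ?thesis using assms(2) by (simp add: ihom_simps)
qed

lemma ihom_module [simp]:
  assumes V: "module k V" and W: "module k W"
  shows "module k (ihom k H V W)"
proof -
  interpret W: module k W by fact
  have cl: "(\<lambda>v\<in>carrier V. L v \<oplus>\<^bsub>W\<^esub> L' v) \<in> carrier (ihom k H V W)"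
    "(\<lambda>v\<in>carrier V. \<zero>\<^bsub>W\<^esub>) \<in> carrier (ihom k H V W)"
    "c \<in> carrier k \<Longrightarrow> (\<lambda>v\<in>carrier V. c \<odot>\<^bsub>W\<^esub> L v) \<in> carrier (ihom k H V W)"
    "(\<lambda>v\<in>carrier V. \<ominus>\<^bsub>W\<^esub> L v) \<in> carrier (ihom k H V W)"
    if "L \<in> carrier (ihom k H V W)" "L' \<in> carrier (ihom k H V W)" for L L' c
    by (rule ihomI[OF V] lin_add[OF W] lin_const_zero[OF W] lin_smult[OF W] lin_uminus[OF W];
        (rule ihomI[OF V] lin_add[OF W] lin_const_zero[OF W] lin_smult[OF W] lin_uminus[OF W] ihom_lin that | assumption)+)+
  show ?thesis
  proof (rule moduleI)
    show "abelian_group (ihom k H V W)"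
    proof (rule abelian_groupI, goal_cases)
      case (1 x y) then show ?case unfolding ihom_simps(3) by (rule cl)
    next
      case 2 show ?case unfolding ihom_simps(2) by (rule ihomI[OF V lin_const_zero[OF W]])
    next
      case (3 x y z) then show ?case unfolding ihom_simps(3) by (intro restrict_ext) (simp add: W.M.a_assoc)
    next
      case (4 x y) then show ?case unfolding ihom_simps(3) by (intro restrict_ext) (simp add: W.M.a_comm)
    next
      case (5 x)
      then have "\<zero>\<^bsub>ihom k H V W\<^esub> \<oplus>\<^bsub>ihom k H V W\<^esub> x \<in> carrier (ihom k H V W)"
        unfolding ihom_simps(2,3) by (intro cl(1)[unfolded ihom_simps(3)] cl(2)) simp_all
      then show ?case using 5 by (intro ihom_eqI[of _ V W]) (simp_all add: ihom_app_op)
    next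
      case (6 x) then show ?case
        by (intro bexI[of _ "\<lambda>v\<in>carrier V. \<ominus>\<^bsub>W\<^esub> x v"] cl) (auto simp: ihom_simps(2,3) W.M.l_neg intro!: restrict_ext)
    qed
  next
    fix a x assume "a \<in> carrier k" "x \<in> carrier (ihom k H V W)"
    then show "a \<odot>\<^bsub>ihom k H V W\<^esub> x \<in> carrier (ihom k H V W)" unfolding ihom_simps(4) by (rule_tac cl)
  next
    fix x assume "x \<in> carrier (ihom k H V W)"
    then show "\<one>\<^bsub>k\<^esub> \<odot>\<^bsub>ihom k H V W\<^esub> x = x"
      by (intro ihom_eqI[of _ V W]) (auto simp: ihom_app_op cl[folded ihom_simps(4)])
  qed (auto intro!: restrict_ext is_cring simp: ihom_simps(3,4) W.smult_l_distr W.smult_r_distr W.smult_assoc1)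
qed

lemma ihom_app_lin: "v \<in> carrier V \<Longrightarrow> lin (ihom k H V W) W (\<lambda>L. L v)"
  by (rule linI) (simp_all add: ihom_app_op)

lemma lin_ihomI:
  assumes "\<And>u. u \<in> carrier U \<Longrightarrow> g u \<in> carrier (ihom k H V W)" "module k U" "module k V" "module k W"
    "\<And>v. v \<in> carrier V \<Longrightarrow> lin U W (\<lambda>u. g u v)"
  shows "lin U (ihom k H V W) g"
proof (rule linI)
  fix u u' assume "u \<in> carrier U" "u' \<in> carrier U"
  then show "g (u \<oplus>\<^bsub>U\<^esub> u') = g u \<oplus>\<^bsub>ihom k H V W\<^esub> g u'"
    by (intro ihom_eqI[of _ V W]) (simp_all add: assms(1-4) ihom_app_op linD(2)[OF assms(5)])
next
  fix c u assume "c \<in> carrier k" "u \<in> carrier U"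
  then show "g (c \<odot>\<^bsub>U\<^esub> u) = c \<odot>\<^bsub>ihom k H V W\<^esub> g u"
    by (intro ihom_eqI[of _ V W]) (simp_all add: assms(1-4) ihom_app_op linD(3)[OF assms(5)])
qed (rule assms(1))

text \<open>The evaluation \<open>iev\<close> as a bilinear map.\<close>

definition evb where
  "evb V W L v = s3 W Ph (\<lambda>a b c. act W a (L (act V (antip H b \<cdot> alpha H \<cdot> c) v)))"

context
  fixes V :: "('k, 'h, 'v, 'm) gmod_scheme" and W :: "('k, 'h, 'w, 'n) gmod_scheme"
  assumes V [simp]: "hact V" and W [simp]: "hact W"
begin

lemma ihom_act:
  assumes L [simp]: "L \<in> carrier (ihom k H V W)" and [simp]: "h \<in> carrier H"
  shows "act (ihom k H V W) h L = (\<lambda>v\<in>carrier V. s2 W (Dl h) (\<lambda>a b. act W a (L (act V (antip H b) v))))"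
  unfolding ihom_simps(5)
proof (rule restrict_ext)
  note [lin_rules] = lin_comp[OF _ ihom_lin[OF L]]
  note [simp] = ihom_app[OF L]
  fix v assume [simp]: "v \<in> carrier V"
  have "bil H H W (\<lambda>a b. act W a (L (act V (antip H b) v)))" by (intro lin_rules) simp_all
  then show "tlift W (\<lambda>a b. act W a (L (act V (antip H b) v))) (comul H h) = s2 W (Dl h) (\<lambda>a b. act W a (L (act V (antip H b) v)))"
    by (simp add: tlift_comul)
qed

lemma ihom_act_closed [simp]:
  assumes L [simp]: "L \<in> carrier (ihom k H V W)" and [simp]: "h \<in> carrier H"
  shows "act (ihom k H V W) h L \<in> carrier (ihom k H V W)"
proof -
  note [lin_rules] = lin_comp[OF _ ihom_lin[OF L]]
  note [simp] = ihom_app[OF L]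
  show ?thesis unfolding ihom_act[OF assms] by (rule ihomI, simp, intro lin_rules) simp_all
qed

lemma ihom_act_app:
  "L \<in> carrier (ihom k H V W) \<Longrightarrow> h \<in> carrier H \<Longrightarrow> v \<in> carrier V \<Longrightarrow>
   act (ihom k H V W) h L v = s2 W (Dl h) (\<lambda>a b. act W a (L (act V (antip H b) v)))"
  by (simp add: ihom_act)

text \<open>The action is multiplicative because the coproduct preserves products while the
  antipode, applied to the part acting on the argument, reverses them.\<close>

lemma ihom_hact [simp]: "hact (ihom k H V W)"
proof (rule hactI)
  show "module k (ihom k H V W)" by simp
  show "bil H (ihom k H V W) (ihom k H V W) (act (ihom k H V W))"
  proof (rule bilI; rule lin_ihomI)
    fix h v assume [simp]: "h \<in> carrier H" "v \<in> carrier V"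
    have "lin (ihom k H V W) W (\<lambda>L. s2 W (Dl h) (\<lambda>a b. act W a (L (act V (antip H b) v))))"
      by (intro lin_s2 act_linr ihom_app_lin) simp_all
    then show "lin (ihom k H V W) W (\<lambda>L. act (ihom k H V W) h L v)"
      by (subst lin_cong[of _ _ "\<lambda>L. s2 W (Dl h) (\<lambda>a b. act W a (L (act V (antip H b) v)))"]) (simp_all add: ihom_act_app)
  next
    fix L v assume L [simp]: "L \<in> carrier (ihom k H V W)" and [simp]: "v \<in> carrier V"
    note [lin_rules] = lin_comp[OF _ ihom_lin[OF L]]
    note [simp] = ihom_app[OF L]
    have "lin H W (\<lambda>h. s2 W (Dl h) (\<lambda>a b. act W a (L (act V (antip H b) v))))"
      by (intro lin_rules) simp_all
    then show "lin H W (\<lambda>h. act (ihom k H V W) h L v)"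
      by (subst lin_cong[of _ _ "\<lambda>h. s2 W (Dl h) (\<lambda>a b. act W a (L (act V (antip H b) v)))"]) (simp_all add: ihom_act_app)
  qed simp_all
next
  fix g h L assume [simp]: "g \<in> carrier H" "h \<in> carrier H" and L [simp]: "L \<in> carrier (ihom k H V W)"
  note [lin_rules] = lin_comp[OF _ ihom_lin[OF L]]
  note [simp] = ihom_app[OF L]
  show "act (ihom k H V W) (g \<cdot> h) L = act (ihom k H V W) g (act (ihom k H V W) h L)"
  proof (rule ihom_eqI[of _ V W])
    fix v assume [simp]: "v \<in> carrier V"
    have b: "bil H H W (\<lambda>a b. act W a (L (act V (antip H b) v)))" by (intro lin_rules) simp_all
    show "act (ihom k H V W) (g \<cdot> h) L v = act (ihom k H V W) g (act (ihom k H V W) h L) v"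
      by (simp add: ihom_act_app comul_mult_sum b act_s act_act antip_mult)
  qed simp_all
next
  fix L assume L [simp]: "L \<in> carrier (ihom k H V W)"
  note [lin_rules] = lin_comp[OF _ ihom_lin[OF L]]
  note [simp] = ihom_app[OF L]
  show "act (ihom k H V W) \<one>\<^bsub>H\<^esub> L = L"
  proof (rule ihom_eqI[of _ V W])
    fix v assume [simp]: "v \<in> carrier V"
    have b: "bil H H W (\<lambda>a b. act W a (L (act V (antip H b) v)))" by (intro lin_rules) simp_all
    show "act (ihom k H V W) \<one>\<^bsub>H\<^esub> L v = L v"
      by (simp add: ihom_act_app comul_one_sum b)
  qed simp_all
qed

lemma evb_bil: "bil (ihom k H V W) V W (evb V W)"
proof (rule bilI)
  fix L assume L [simp]: "L \<in> carrier (ihom k H V W)"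
  note [lin_rules] = lin_comp[OF _ ihom_lin[OF L]]
  note [simp] = ihom_app[OF L]
  show "lin V W (evb V W L)" unfolding evb_def[abs_def] by (intro lin_rules) simp_all
next
  fix v assume v [simp]: "v \<in> carrier V"
  show "lin (ihom k H V W) W (\<lambda>L. evb V W L v)" unfolding evb_def[abs_def]
    by (intro lin_s3 act_linr ihom_app_lin) simp_all
qed

lemma evb_tril:
  assumes L [simp]: "L \<in> carrier (ihom k H V W)" and v [simp]: "v \<in> carrier V"
  shows "tril W (\<lambda>a b c. act W a (L (act V (antip H b \<cdot> alpha H \<cdot> c) v)))"
proof -
  note [lin_rules] = lin_comp[OF _ ihom_lin[OF L]]
  note [simp] = ihom_app[OF L]
  show ?thesis by (intro lin_rules) simp_all
qed

lemma zeta_inv_id_bil: "bil (ihom k H V W) V W (\<lambda>L v. tlift3 W (\<lambda>a b c. act W a (id L (act V (antip H b \<cdot> alpha H \<cdot> c) v))) (phi H))"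
  by (rule iffD1[OF bil_cong evb_bil]) (simp_all add: evb_def Ph_def tlift3_rep3 evb_tril)

lemma iev_lin: "lin (tensor k (ihom k H V W) V) W (iev k H V W)"
  unfolding iev_def zeta_inv_def by (rule lin_tlift) (simp_all only: zeta_inv_id_bil ihom_module hact_module V W)

lemma iev_pure: "L \<in> carrier (ihom k H V W) \<Longrightarrow> v \<in> carrier V \<Longrightarrow> iev k H V W (tpure k (ihom k H V W) V L v) = evb V W L v"
  unfolding iev_def zeta_inv_def
  by (subst tlift_tpure) (simp_all add: zeta_inv_id_bil[unfolded id_apply] evb_def Ph_def tlift3_rep3 evb_tril)

text \<open>Quasi-coassociativity regroups the parts of \<open>h\<close> so that two of them enclose
  \<open>alpha\<close> and cancel by the antipode axiom; the counit left over returns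
  \<open>h\<close> in front.\<close>

lemma evb_ebil: "ebil (ihom k H V W) V W (evb V W)"
  unfolding ebil_def
proof (intro conjI ballI evb_bil)
  fix h L v assume h [simp]: "h \<in> carrier H" and L [simp]: "L \<in> carrier (ihom k H V W)" and v [simp]: "v \<in> carrier V"
  note [lin_rules] = lin_comp[OF _ ihom_lin[OF L]]
  note [simp] = ihom_app[OF L]
  let ?T = "\<lambda>a b c. act W a (L (act V (antip H b \<cdot> alpha H \<cdot> c) v))"
  let ?e = "\<lambda>h x. counit H h \<odot>\<^bsub>W\<^esub> x"
  have t: "tril W ?T" by (rule evb_tril[OF L v])
  have 1: "evb V W (act (ihom k H V W) h1 L) (act V h2 v) = s3 W Ph (\<lambda>x y z. s2 W (Dl h1) (\<lambda>a b. ?T (x \<cdot> a) (y \<cdot> b) (z \<cdot> h2)))"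
    if [simp]: "h1 \<in> carrier H" "h2 \<in> carrier H" for h1 h2
    by (simp add: evb_def ihom_act_app act_s act_act antip_mult m_assoc)
  have 2: "s2 W (Dl b) (\<lambda>c d. s3 W Ph (\<lambda>x y z. ?T (a \<cdot> x) (c \<cdot> y) (d \<cdot> z))) =
      ?e b (s3 W Ph (\<lambda>x y z. ?T (a \<cdot> x) y z))"
    if [simp]: "a \<in> carrier H" "b \<in> carrier H" for a b
  proof -
    have "s2 W (Dl b) (\<lambda>c d. ?T (a \<cdot> x) (c \<cdot> y) (d \<cdot> z)) = ?e b (?T (a \<cdot> x) y z)"
      if [simp]: "x \<in> carrier H" "y \<in> carrier H" "z \<in> carrier H" for x y z
    proof -
      have "lin H W (\<lambda>u. act W (a \<cdot> x) (L (act V (antip H y \<cdot> u \<cdot> z) v)))"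
        by (intro lin_rules) simp_all
      from antip_alpha_sum[OF _ this, of b] show ?thesis by (simp add: antip_mult m_assoc)
    qed
    then show ?thesis by (simp add: s2_s3_swap s_smult_push[symmetric])
  qed
  have "s2 W (Dl h) (\<lambda>h1 h2. evb V W (act (ihom k H V W) h1 L) (act V h2 v)) =
      s2 W (Dl h) (\<lambda>h1 h2. s3 W Ph (\<lambda>x y z. s2 W (Dl h1) (\<lambda>a b. ?T (x \<cdot> a) (y \<cdot> b) (z \<cdot> h2))))"
    by (intro s2_cong refl 1)
  also have "\<dots> = s3 W Ph (\<lambda>x y z. s2 W (Dl h) (\<lambda>h1 h2. s2 W (Dl h1) (\<lambda>a b. ?T (x \<cdot> a) (y \<cdot> b) (z \<cdot> h2))))"
    by (rule s2_s3_swap) simp_all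
  also have "\<dots> = s2 W (Dl h) (\<lambda>a b. s2 W (Dl b) (\<lambda>c d. s3 W Ph (\<lambda>x y z. ?T (a \<cdot> x) (c \<cdot> y) (d \<cdot> z))))"
    by (rule coassoc_phi[symmetric, OF _ t h]) simp
  also have "\<dots> = s2 W (Dl h) (\<lambda>a b. ?e b (s3 W Ph (\<lambda>x y z. ?T (a \<cdot> x) y z)))"
    by (intro s2_cong refl 2)
  also have "\<dots> = s3 W Ph (\<lambda>x y z. ?T (h \<cdot> x) y z)"
    by (rule counit_right_sum) (simp, simp, intro lin_rules, simp_all)
  also have "\<dots> = act W h (evb V W L v)" by (simp add: evb_def act_s act_act)
  finally show "act W h (evb V W L v) = s2 W (Dl h) (\<lambda>h1 h2. evb V W (act (ihom k H V W) h1 L) (act V h2 v))" by simp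
qed

lemmas evb_linr [lin_rules] = bil_linr[OF evb_bil]
lemmas evb_closed [simp] = bil_closed[OF evb_bil]

text \<open>Currying the evaluation is the identity: a map is recovered from the evaluations of its
  \<open>H\<close>-translates.\<close>

lemma ihom_evb:
  assumes L [simp]: "L \<in> carrier (ihom k H V W)" and v [simp]: "v \<in> carrier V"
  shows "s3 W Ps (\<lambda>a b c. evb V W (act (ihom k H V W) a L) (act V (b \<cdot> beta H \<cdot> antip H c) v)) = L v"
proof -
  note [lin_rules] = lin_comp[OF _ ihom_lin[OF L]]
  note [simp] = ihom_app[OF L]
  have G: "bil H H W (\<lambda>p q. act W p (L (act V q v)))" by (intro lin_rules) simp_all
  have "s3 W Ps (\<lambda>a b c. evb V W (act (ihom k H V W) a L) (act V (b \<cdot> beta H \<cdot> antip H c) v)) =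
    s3 W Ps (\<lambda>a b c. s3 W Ph (\<lambda>x y z. s2 W (Dl a) (\<lambda>a1 a2.
     act W (x \<cdot> a1) (L (act V (antip H (y \<cdot> a2) \<cdot> alpha H \<cdot> (z \<cdot> b) \<cdot> beta H \<cdot> antip H c) v)))))"
    by (simp add: evb_def ihom_act_app act_s act_act antip_mult m_assoc)
  also have "\<dots> = L v"
    using curry_eval_sum[OF _ G] by (subst s3_s3_swap) simp_all
  finally show ?thesis .
qed

text \<open>The recovery formula \<open>ihom_evb\<close> involves translates of the map, hence the
  hypothesis for every \<open>h\<close>. For equivariant families these translates are again sums of
  values of the family, see \<open>hbil_ihom_eq\<close>.\<close>

lemma ihom_unique:
  assumes L: "L \<in> carrier (ihom k H V W)" and L': "L' \<in> carrier (ihom k H V W)"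
    and eq: "\<And>h v. h \<in> carrier H \<Longrightarrow> v \<in> carrier V \<Longrightarrow> evb V W (act (ihom k H V W) h L) v = evb V W (act (ihom k H V W) h L') v"
  shows "L = L'"
proof (rule ihom_eqI[OF L L'])
  fix v assume v: "v \<in> carrier V"
  show "L v = L' v"
    unfolding ihom_evb[OF L v, symmetric] ihom_evb[OF L' v, symmetric]
    by (rule s3_cong[OF refl], rule eq) (simp_all add: v)
qed

end

end

section \<open>Currying, associators and composition\<close>

context base_ring
begin

lemma module_transfer:
  assumes V: "module k V" and eq: "carrier W = carrier V" "add W = add V" "\<zero>\<^bsub>W\<^esub> = \<zero>\<^bsub>V\<^esub>" "smult W = smult V"
  shows "module k W"
proof -
  interpret V: module k V by fact
  have "abelian_group W"
    by (rule abelian_groupI; unfold eq;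
        (rule V.M.a_closed V.M.zero_closed V.M.a_assoc V.M.a_comm V.M.l_zero V.M.add.l_inv_ex[simplified]; assumption))
  then show ?thesis
    by (intro moduleI is_cring) (simp_all add: eq V.smult_l_distr V.smult_r_distr V.smult_assoc1)
qed

lemma tlift_trilinear:
  assumes U: "module k U" and V: "module k V" and W: "module k W" and X: "module k X"
    and 1: "\<And>w. w \<in> carrier W \<Longrightarrow> bil U V X (\<lambda>u v. B u v w)"
    and 2: "\<And>u v. u \<in> carrier U \<Longrightarrow> v \<in> carrier V \<Longrightarrow> lin W X (B u v)"
  shows "bil (tensor k U V) W X (\<lambda>s w. tlift X (\<lambda>u v. B u v w) s)"
  by (intro bilI lin_tlift[OF U V X] lin_tlift_param[OF U V X _ _ _ W] 1 2)

end

context quasi_hopf_algebra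
begin

text \<open>\<open>zeta\<close> for a map on the tensor product that is given as a bilinear map.\<close>

definition cur where
  "cur V W X b v = (\<lambda>w\<in>carrier W. s3 X Ps (\<lambda>p q r. b (act V p v) (act W (q \<cdot> beta H \<cdot> antip H r) w)))"

text \<open>Precomposition of a trilinear map with the associator and with its inverse.\<close>

definition Fi where
  "Fi X Y Z U T x y z = s3 U Ph (\<lambda>a b c. T (act X a x) (act Y b y) (act Z c z))"

definition Fv where
  "Fv X Y Z U T x y z = s3 U Ps (\<lambda>a b c. T (act X a x) (act Y b y) (act Z c z))"

context
  fixes V :: "('k, 'h, 'v, 'm) gmod_scheme" and W :: "('k, 'h, 'w, 'n) gmod_scheme"
    and X :: "('k, 'h, 'x, 'l) gmod_scheme" and b
  assumes V [simp]: "hact V" and W [simp]: "hact W" and X [simp]: "hact X" and b: "ebil V W X b"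
begin

private lemmas b_lin = bil_linr[OF ebil_bil[OF b]]
private lemmas b_closed = bil_closed[OF ebil_bil[OF b]]

text \<open>\<open>zeta\<close> evaluates its argument on pure tensors only, so a map on the tensor
  product may be replaced by its bilinear form.\<close>

lemma zeta_cur:
  assumes f: "\<And>v w. v \<in> carrier V \<Longrightarrow> w \<in> carrier W \<Longrightarrow> f (tpure k V W v w) = b v w" and [simp]: "v \<in> carrier V"
  shows "zeta k H V W X f v = cur V W X b v"
  unfolding zeta_def cur_def
proof (rule restrict_ext)
  note [lin_rules] = b_lin
  note [simp] = b_closed
  fix w assume [simp]: "w \<in> carrier W"
  have t: "tril X (\<lambda>p q r. b (act V p v) (act W (q \<cdot> beta H \<cdot> antip H r) w))" by (intro lin_rules) simp_all
  have t': "tril X (\<lambda>p q r. f (tpure k V W (act V p v) (act W (q \<cdot> beta H \<cdot> antip H r) w)))"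
    using t unfolding tril_def by (simp add: f cong: lin_cong[OF H_module])
  show "tlift3 X (\<lambda>p q r. f (tpure k V W (act V p v) (act W (q \<cdot> beta H \<cdot> antip H r) w))) (phi_inv k H) =
     s3 X Ps (\<lambda>p q r. b (act V p v) (act W (q \<cdot> beta H \<cdot> antip H r) w))"
    by (simp add: tlift3_rep3[OF _ _ t'] Ps_def f)
qed

lemma cur_app: "w \<in> carrier W \<Longrightarrow> cur V W X b v w = s3 X Ps (\<lambda>p q r. b (act V p v) (act W (q \<cdot> beta H \<cdot> antip H r) w))"
  by (simp add: cur_def)

lemma cur_closed [simp]: "v \<in> carrier V \<Longrightarrow> cur V W X b v \<in> carrier (ihom k H W X)"
  unfolding cur_def by (rule ihomI, simp, intro lin_rules b_lin) (simp_all add: b_closed)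

lemma cur_lin: "lin V (ihom k H W X) (cur V W X b)"
proof (rule lin_ihomI)
  fix w assume [simp]: "w \<in> carrier W"
  show "lin V X (\<lambda>v. cur V W X b v w)" by (simp add: cur_app) (intro lin_rules b_lin; simp)
qed simp_all

text \<open>Equivariance of currying. The parts of \<open>h\<close> are regrouped by
  quasi-coassociativity so that two of them enclose \<open>beta\<close> and cancel; the counit left
  over returns \<open>h\<close> on the first argument.\<close>

lemma cur_act:
  assumes v [simp]: "v \<in> carrier V" and h [simp]: "h \<in> carrier H"
  shows "act (ihom k H W X) h (cur V W X b v) = cur V W X b (act V h v)"
proof (rule ihom_eqI[of _ W X])
  note [lin_rules] = b_lin
  note [simp] = b_closed
  fix w assume w [simp]: "w \<in> carrier W"
  let ?T = "\<lambda>p q r. b (act V p v) (act W (q \<cdot> beta H \<cdot> antip H r) w)"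
  let ?e = "\<lambda>h x. counit H h \<odot>\<^bsub>X\<^esub> x"
  have t: "tril X ?T" by (intro lin_rules) simp_all
  have 2: "s2 X (Dl bb) (\<lambda>c d. ?T (x \<cdot> a) (y \<cdot> c) (z \<cdot> d)) = ?e bb (?T (x \<cdot> a) y z)"
    if [simp]: "a \<in> carrier H" "bb \<in> carrier H" "x \<in> carrier H" "y \<in> carrier H" "z \<in> carrier H" for a bb x y z
  proof -
    have "lin H X (\<lambda>u. b (act V (x \<cdot> a) v) (act W (y \<cdot> u \<cdot> antip H z) w))" by (intro lin_rules) simp_all
    from antip_beta_sum[OF _ this, of bb] show ?thesis by (simp add: antip_mult m_assoc)
  qed
  have 3: "s2 X (Dl h) (\<lambda>a bb. ?e bb (?T (x \<cdot> a) y z)) = ?T (x \<cdot> h) y z"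
    if [simp]: "x \<in> carrier H" "y \<in> carrier H" "z \<in> carrier H" for x y z
    by (rule counit_right_sum) (simp, simp, intro lin_rules, simp_all)
  have "act (ihom k H W X) h (cur V W X b v) w =
      s2 X (Dl h) (\<lambda>h1 h2. s3 X Ps (\<lambda>p q r. s2 X (Dl h1) (\<lambda>c d. ?T (c \<cdot> p) (d \<cdot> q) (h2 \<cdot> r))))"
    by (simp add: ihom_act_app cur_app act_s ebil_act[OF b] act_act antip_mult m_assoc)
  also have "\<dots> = s2 X (Dl h) (\<lambda>h1 h2. s2 X (Dl h1) (\<lambda>c d. s3 X Ps (\<lambda>p q r. ?T (c \<cdot> p) (d \<cdot> q) (h2 \<cdot> r))))"
    by (rule s2_cong[OF refl], rule s2_s3_swap[symmetric]) simp_all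
  also have "\<dots> = s3 X Ps (\<lambda>x y z. s2 X (Dl h) (\<lambda>a bb. s2 X (Dl bb) (\<lambda>c d. ?T (x \<cdot> a) (y \<cdot> c) (z \<cdot> d))))"
    by (rule coassoc_phi_inv[symmetric, OF _ t h]) simp
  also have "\<dots> = s3 X Ps (\<lambda>x y z. s2 X (Dl h) (\<lambda>a bb. ?e bb (?T (x \<cdot> a) y z)))"
    by (intro s3_cong s2_cong refl 2)
  also have "\<dots> = s3 X Ps (\<lambda>x y z. ?T (x \<cdot> h) y z)"
    by (intro s3_cong refl 3)
  also have "\<dots> = cur V W X b (act V h v) w"
    by (simp add: cur_app act_act)
  finally show "act (ihom k H W X) h (cur V W X b v) w = cur V W X b (act V h v) w" .
qed simp_all

text \<open>Equivariance of \<open>b\<close> distributes the outer leg of \<phi> over both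
  arguments, after which \<open>eval_curry_sum\<close> applies.\<close>

lemma evb_cur:
  assumes v [simp]: "v \<in> carrier V" and w [simp]: "w \<in> carrier W"
  shows "evb W X (cur V W X b v) w = b v w"
proof -
  note [lin_rules] = b_lin
  note [simp] = b_closed
  let ?G = "\<lambda>p q. b (act V p v) (act W q w)"
  have G: "bil H H X ?G" by (intro lin_rules) simp_all
  have "evb W X (cur V W X b v) w = s3 X Ph (\<lambda>x y z. s3 X Ps (\<lambda>p q r. s2 X (Dl x) (\<lambda>x1 x2.
      ?G (x1 \<cdot> p) (x2 \<cdot> q \<cdot> beta H \<cdot> antip H (y \<cdot> r) \<cdot> alpha H \<cdot> z))))"
    by (simp add: evb_def cur_app act_s ebil_act[OF b] act_act antip_mult m_assoc)
  also have "\<dots> = s3 X Ph (\<lambda>x y z. s2 X (Dl x) (\<lambda>x1 x2. s3 X Ps (\<lambda>p q r.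
      ?G (x1 \<cdot> p) (x2 \<cdot> q \<cdot> beta H \<cdot> antip H (y \<cdot> r) \<cdot> alpha H \<cdot> z))))"
    by (rule s3_cong[OF refl], rule s2_s3_swap[symmetric]) simp_all
  also have "\<dots> = b v w"
    using eval_curry_sum[OF _ G] by simp
  finally show ?thesis .
qed

text \<open>Equivariance carries the vanishing from \<open>v\<close> to its translates, and
  evaluation returns \<open>b\<close>. Conversely, the curried map is a sum of values of
  \<open>b\<close> at translates of \<open>v\<close>.\<close>

lemma cur_zero_iff:
  assumes v [simp]: "v \<in> carrier V"
  shows "cur V W X b v = \<zero>\<^bsub>ihom k H W X\<^esub> \<longleftrightarrow> (\<forall>h\<in>carrier H. \<forall>w\<in>carrier W. b (act V h v) w = \<zero>\<^bsub>X\<^esub>)"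
proof
  assume "cur V W X b v = \<zero>\<^bsub>ihom k H W X\<^esub>"
  then have "cur V W X b (act V h v) = \<zero>\<^bsub>ihom k H W X\<^esub>" if "h \<in> carrier H" for h
    using cur_act[OF v that] lin_zero[OF _ _ act_lin, of "ihom k H W X" h] that by simp
  then have "evb W X \<zero>\<^bsub>ihom k H W X\<^esub> w = b (act V h v) w" if "h \<in> carrier H" "w \<in> carrier W" for h w
    using evb_cur[of "act V h v" w] that by simp
  moreover have "evb W X \<zero>\<^bsub>ihom k H W X\<^esub> w = \<zero>\<^bsub>X\<^esub>" if "w \<in> carrier W" for w
    using lin_zero[OF _ _ bil_lin1[OF evb_bil[of W X] that]] by simp
  ultimately show "\<forall>h\<in>carrier H. \<forall>w\<in>carrier W. b (act V h v) w = \<zero>\<^bsub>X\<^esub>" by simp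
next
  assume *: "\<forall>h\<in>carrier H. \<forall>w\<in>carrier W. b (act V h v) w = \<zero>\<^bsub>X\<^esub>"
  show "cur V W X b v = \<zero>\<^bsub>ihom k H W X\<^esub>"
    unfolding cur_def ihom_simps(2)
    by (rule restrict_ext, rule s3_zero) (simp_all add: *)
qed

end

subsection \<open>Tensor products of modules\<close>

lemma gtensor_simps [simp]:
  "carrier (gtensor k H V W) = carrier (tensor k V W)" "add (gtensor k H V W) = add (tensor k V W)"
  "\<zero>\<^bsub>gtensor k H V W\<^esub> = \<zero>\<^bsub>tensor k V W\<^esub>" "smult (gtensor k H V W) = smult (tensor k V W)"
  by (simp_all add: gtensor_def module.defs)

lemma lin_gtensor: "lin (gtensor k H V W) X f \<longleftrightarrow> lin (tensor k V W) X f"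
  "lin U (gtensor k H V W) g \<longleftrightarrow> lin U (tensor k V W) g"
  by (simp_all add: k_linear_def)

lemma gtensor_module [simp]: "module k V \<Longrightarrow> module k W \<Longrightarrow> module k (gtensor k H V W)"
  by (rule module_transfer[OF tensor_module]) simp_all

context
  fixes V :: "('k, 'h, 'v, 'm) gmod_scheme" and W :: "('k, 'h, 'w, 'n) gmod_scheme"
  assumes V [simp]: "hact V" and W [simp]: "hact W"
begin

lemma tpure_lin [lin_rules]:
  "lin U V g \<Longrightarrow> w \<in> carrier W \<Longrightarrow> lin U (tensor k V W) (\<lambda>u. tpure k V W (g u) w)"
  "lin U W g' \<Longrightarrow> v \<in> carrier V \<Longrightarrow> lin U (tensor k V W) (\<lambda>u. tpure k V W v (g' u))"
  by (rule bil_linr[OF tpure_bil]; simp)+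

lemma gtensor_act: "act (gtensor k H V W) h = tlift (tensor k V W) (\<lambda>v w.
            tlift (tensor k V W) (\<lambda>a b. tpure k V W (act V a v) (act W b w)) (comul H h))"
  by (simp add: gtensor_def module.defs gmod.defs)

lemma gtensor_act_bil: "h \<in> carrier H \<Longrightarrow> bil V W (tensor k V W) (\<lambda>v w.
            tlift (tensor k V W) (\<lambda>a b. tpure k V W (act V a v) (act W b w)) (comul H h))"
proof -
  assume [simp]: "h \<in> carrier H"
  have t: "bil H H (tensor k V W) (\<lambda>a b. tpure k V W (act V a v) (act W b w))" if "v \<in> carrier V" "w \<in> carrier W" for v w
    using that by (intro lin_rules) simp_all
  have "bil V W (tensor k V W) (\<lambda>v w. s2 (tensor k V W) (Dl h) (\<lambda>a b. tpure k V W (act V a v) (act W b w)))"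
    by (intro lin_rules) simp_all
  then show ?thesis
    by (subst bil_cong[where b' = "\<lambda>v w. s2 (tensor k V W) (Dl h) (\<lambda>a b. tpure k V W (act V a v) (act W b w))"])
       (simp_all add: tlift_comul t)
qed

lemma gtensor_act_pure:
  assumes [simp]: "h \<in> carrier H" "v \<in> carrier V" "w \<in> carrier W"
  shows "act (gtensor k H V W) h (tpure k V W v w) = s2 (tensor k V W) (Dl h) (\<lambda>a b. tpure k V W (act V a v) (act W b w))"
proof -
  have "bil H H (tensor k V W) (\<lambda>a b. tpure k V W (act V a v) (act W b w))"
    by (intro lin_rules) simp_all
  then show ?thesis by (simp add: gtensor_act gtensor_act_bil tlift_comul)
qed

lemma gtensor_act_lin: "h \<in> carrier H \<Longrightarrow> lin (tensor k V W) (tensor k V W) (act (gtensor k H V W) h)"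
  unfolding gtensor_act by (rule lin_tlift) (simp_all add: gtensor_act_bil)

lemma gtensor_hact [simp]: "hact (gtensor k H V W)"
proof (rule hactI)
  let ?T = "tensor k V W"
  show "module k (gtensor k H V W)" by simp
  have l: "lin H ?T (\<lambda>h. act (gtensor k H V W) h t)" if t: "t \<in> carrier ?T" for t
  proof -
    obtain ps where ps: "set ps \<subseteq> carrier V \<times> carrier W" "t = lsum ?T ps (\<lambda>p. tpure k V W (fst p) (snd p))"
      by (rule tensor_list[OF _ _ t]) simp_all
    have "lin H ?T (\<lambda>h. lsum ?T ps (\<lambda>p. s2 ?T (Dl h) (\<lambda>a b. tpure k V W (act V a (fst p)) (act W b (snd p)))))"
      by (rule lin_lsum, simp, intro lin_rules) (use ps in auto)
    moreover have "act (gtensor k H V W) h t = lsum ?T ps (\<lambda>p. s2 ?T (Dl h) (\<lambda>a b. tpure k V W (act V a (fst p)) (act W b (snd p))))"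
      if "h \<in> carrier H" for h
      unfolding ps(2)
    proof -
      have m: "fst p \<in> carrier V" "snd p \<in> carrier W" if "p \<in> set ps" for p using ps(1) that by auto
      have "act (gtensor k H V W) h (lsum ?T ps (\<lambda>p. tpure k V W (fst p) (snd p))) =
          lsum ?T ps (\<lambda>p. act (gtensor k H V W) h (tpure k V W (fst p) (snd p)))"
        by (rule lin_lsum_push[OF _ _ gtensor_act_lin[OF that]]) (simp_all add: m)
      also have "\<dots> = lsum ?T ps (\<lambda>p. s2 ?T (Dl h) (\<lambda>a b. tpure k V W (act V a (fst p)) (act W b (snd p))))"
        by (rule lsum_cong) (simp add: m gtensor_act_pure that)
      finally show "act (gtensor k H V W) h (lsum ?T ps (\<lambda>p. tpure k V W (fst p) (snd p))) =
          lsum ?T ps (\<lambda>p. s2 ?T (Dl h) (\<lambda>a b. tpure k V W (act V a (fst p)) (act W b (snd p))))" .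
    qed
    ultimately show ?thesis by (subst lin_cong[OF H_module]) auto
  qed
  show "bil H (gtensor k H V W) (gtensor k H V W) (act (gtensor k H V W))"
    by (rule bilI) (simp_all add: lin_gtensor gtensor_act_lin l)
next
  let ?T = "tensor k V W"
  fix t assume t: "t \<in> carrier (gtensor k H V W)"
  show "act (gtensor k H V W) \<one>\<^bsub>H\<^esub> t = t"
  proof (rule lin_ext[OF _ _ _ gtensor_act_lin lin_id])
    fix v w assume [simp]: "v \<in> carrier V" "w \<in> carrier W"
    have b: "bil H H ?T (\<lambda>a b. tpure k V W (act V a v) (act W b w))" by (intro lin_rules) simp_all
    show "act (gtensor k H V W) \<one>\<^bsub>H\<^esub> (tpure k V W v w) = tpure k V W v w"
      by (simp add: gtensor_act_pure comul_one_sum[OF _ b])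
  qed (use t in simp_all)
  fix g h assume [simp]: "g \<in> carrier H" "h \<in> carrier H"
  show "act (gtensor k H V W) (g \<cdot> h) t = act (gtensor k H V W) g (act (gtensor k H V W) h t)"
  proof (rule lin_ext[OF _ _ _ gtensor_act_lin lin_comp[OF gtensor_act_lin gtensor_act_lin]])
    fix v w assume [simp]: "v \<in> carrier V" "w \<in> carrier W"
    have b: "bil H H ?T (\<lambda>a b. tpure k V W (act V a v) (act W b w))" by (intro lin_rules) simp_all
    have "act (gtensor k H V W) (g \<cdot> h) (tpure k V W v w) =
      s2 ?T (Dl g) (\<lambda>a b. s2 ?T (Dl h) (\<lambda>c d. tpure k V W (act V (a \<cdot> c) v) (act W (b \<cdot> d) w)))"
      by (simp add: gtensor_act_pure comul_mult_sum[OF _ _ _ b])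
    also have "\<dots> = s2 ?T (Dl h) (\<lambda>c d. s2 ?T (Dl g) (\<lambda>a b. tpure k V W (act V (a \<cdot> c) v) (act W (b \<cdot> d) w)))"
      by (rule s2_s2_swap) simp_all
    also have "\<dots> = act (gtensor k H V W) g (act (gtensor k H V W) h (tpure k V W v w))"
      by (simp add: gtensor_act_pure s2_push[OF gtensor_act_lin] act_act)
    finally show "act (gtensor k H V W) (g \<cdot> h) (tpure k V W v w) = act (gtensor k H V W) g (act (gtensor k H V W) h (tpure k V W v w))" .
  qed (use t in simp_all)
qed

end

text \<open>Two nested equivariant maps split \<open>h\<close> with a second coproduct in the right
  part; passing through \<phi> moves it to the left part, as befits the bracketing of the arguments
  of \<open>Fi\<close>.\<close>

lemma Fi_act:
  fixes X :: "('k, 'h, 'x, 'm) gmod_scheme" and Y :: "('k, 'h, 'y, 'n) gmod_scheme"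
    and Z :: "('k, 'h, 'z, 'l) gmod_scheme" and M :: "('k, 'h, 'i, 'j) gmod_scheme" and U :: "('k, 'h, 'u, 'o) gmod_scheme"
  assumes [simp]: "hact X" "hact Y" "hact Z" "hact M" "hact U" and b1: "ebil X M U b1" and b2: "ebil Y Z M b2"
    and [simp]: "x \<in> carrier X" "y \<in> carrier Y" "z \<in> carrier Z" "h \<in> carrier H"
  shows "act U h (Fi X Y Z U (\<lambda>x y z. b1 x (b2 y z)) x y z) =
    s2 U (Dl h) (\<lambda>a b. s2 U (Dl a) (\<lambda>c d. Fi X Y Z U (\<lambda>x y z. b1 x (b2 y z)) (act X c x) (act Y d y) (act Z b z)))"
proof -
  note [lin_rules] = bil_linr[OF ebil_bil[OF b1]] bil_linr[OF ebil_bil[OF b2]]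
  note [simp] = bil_closed[OF ebil_bil[OF b1]] bil_closed[OF ebil_bil[OF b2]]
  let ?T = "\<lambda>a b c. b1 (act X a x) (b2 (act Y b y) (act Z c z))"
  have t: "tril U ?T" by (intro lin_rules) simp_all
  have "act U h (Fi X Y Z U (\<lambda>x y z. b1 x (b2 y z)) x y z) =
    s3 U Ph (\<lambda>x y z. s2 U (Dl h) (\<lambda>a b. s2 U (Dl b) (\<lambda>c d. ?T (a \<cdot> x) (c \<cdot> y) (d \<cdot> z))))"
  proof -
    have "act U h (?T p q r) = s2 U (Dl h) (\<lambda>a b. s2 U (Dl b) (\<lambda>c d. ?T (a \<cdot> p) (c \<cdot> q) (d \<cdot> r)))"
      if [simp]: "p \<in> carrier H" "q \<in> carrier H" "r \<in> carrier H" for p q r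
      by (simp add: ebil_act[OF b1] ebil_act[OF b2] act_act bil_s(2)[OF ebil_bil[OF b1]])
    then show ?thesis unfolding Fi_def by (subst act_s(2)) simp_all
  qed
  also have "\<dots> = s2 U (Dl h) (\<lambda>a b. s2 U (Dl b) (\<lambda>c d. s3 U Ph (\<lambda>x y z. ?T (a \<cdot> x) (c \<cdot> y) (d \<cdot> z))))"
    by (simp add: s2_s3_swap)
  also have "\<dots> = s3 U Ph (\<lambda>x y z. s2 U (Dl h) (\<lambda>a b. s2 U (Dl a) (\<lambda>c d. ?T (x \<cdot> c) (y \<cdot> d) (z \<cdot> b))))"
    by (rule coassoc_phi[OF _ t]) simp_all
  also have "\<dots> = s2 U (Dl h) (\<lambda>a b. s2 U (Dl a) (\<lambda>c d. s3 U Ph (\<lambda>x y z. ?T (x \<cdot> c) (y \<cdot> d) (z \<cdot> b))))"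
    by (simp add: s2_s3_swap)
  also have "\<dots> = s2 U (Dl h) (\<lambda>a b. s2 U (Dl a) (\<lambda>c d. Fi X Y Z U (\<lambda>x y z. b1 x (b2 y z)) (act X c x) (act Y d y) (act Z b z)))"
    by (simp add: Fi_def act_act)
  finally show ?thesis .
qed

context
  fixes X :: "('k, 'h, 'x, 'l) gmod_scheme" and Y :: "('k, 'h, 'y, 'm) gmod_scheme"
    and Z :: "('k, 'h, 'z, 'n) gmod_scheme"
  assumes X [simp]: "hact X" and Y [simp]: "hact Y" and Z [simp]: "hact Z"
begin

private abbreviation "gYZ \<equiv> gtensor k H Y Z"
private abbreviation "gXYZ \<equiv> gtensor k H X gYZ"
private abbreviation "atri \<equiv> \<lambda>x y z. tlift3 gXYZ (\<lambda>a b c. tpure k X gYZ (act X a x) (tpure k Y Z (act Y b y) (act Z c z))) (phi H)"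
private abbreviation "atri2 \<equiv> \<lambda>x y z. s3 gXYZ Ph (\<lambda>a b c. tpure k X gYZ (act X a x) (tpure k Y Z (act Y b y) (act Z c z)))"

private lemma gXYZ_lin:
  "lin U X g \<Longrightarrow> s \<in> carrier (tensor k Y Z) \<Longrightarrow> lin U gXYZ (\<lambda>u. tpure k X gYZ (g u) s)"
  "lin U (tensor k Y Z) g' \<Longrightarrow> n \<in> carrier X \<Longrightarrow> lin U gXYZ (\<lambda>u. tpure k X gYZ n (g' u))"
  unfolding lin_gtensor(2)[of _ X] by (rule tpure_lin; simp add: lin_gtensor)+

private lemmas gYZ_lin = tpure_lin[of Y Z, simplified]

private lemma atri_eq:
  assumes [simp]: "x \<in> carrier X" "y \<in> carrier Y" "z \<in> carrier Z"
  shows "atri x y z = atri2 x y z"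
proof -
  have "tril gXYZ (\<lambda>a b c. tpure k X gYZ (act X a x) (tpure k Y Z (act Y b y) (act Z c z)))"
    by (intro lin_rules gXYZ_lin gYZ_lin) simp_all
  then show ?thesis by (simp add: tlift3_rep3 Ph_def)
qed

private lemma atri_lin:
  "z \<in> carrier Z \<Longrightarrow> bil X Y gXYZ (\<lambda>x y. atri x y z)" (is "_ \<Longrightarrow> ?A")
  "x \<in> carrier X \<Longrightarrow> y \<in> carrier Y \<Longrightarrow> lin Z gXYZ (atri x y)" (is "_ \<Longrightarrow> _ \<Longrightarrow> ?B")
proof -
  assume [simp]: "z \<in> carrier Z"
  have "bil X Y gXYZ (\<lambda>x y. atri2 x y z)" by (intro lin_rules gXYZ_lin gYZ_lin) simp_all
  then show ?A by (subst bil_cong[where b' = "\<lambda>x y. atri2 x y z"]) (simp_all add: atri_eq)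
next
  assume [simp]: "x \<in> carrier X" "y \<in> carrier Y"
  have "lin Z gXYZ (\<lambda>z. atri2 x y z)" by (intro lin_rules gXYZ_lin gYZ_lin) simp_all
  then show ?B by (subst lin_cong[where g = "\<lambda>z. atri2 x y z"]) (simp_all add: atri_eq)
qed

private lemma atri_bil: "bil (gtensor k H X Y) Z gXYZ (\<lambda>s z. tlift gXYZ (\<lambda>x y. atri x y z) s)"
proof -
  have "bil (tensor k X Y) Z gXYZ (\<lambda>s z. tlift gXYZ (\<lambda>x y. atri x y z) s)"
    by (rule tlift_trilinear[OF _ _ _ _ atri_lin]) simp_all
  then show ?thesis unfolding bil_def lin_gtensor by simp
qed

lemma assoc_lin: "lin (tensor k (gtensor k H X Y) Z) gXYZ (assoc k H X Y Z)"
  unfolding assoc_def Let_def tlift3_def[of gXYZ "\<lambda>x y z. atri x y z"]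
  by (rule lin_tlift[OF _ _ _ atri_bil]) simp_all

lemma assoc_pure:
  assumes [simp]: "x \<in> carrier X" "y \<in> carrier Y" "z \<in> carrier Z"
  shows "assoc k H X Y Z (tpure k (gtensor k H X Y) Z (tpure k X Y x y) z) = atri2 x y z"
proof -
  have "assoc k H X Y Z (tpure k (gtensor k H X Y) Z (tpure k X Y x y) z) = tlift gXYZ (\<lambda>x y. atri x y z) (tpure k X Y x y)"
    unfolding assoc_def Let_def tlift3_def[of gXYZ "\<lambda>x y z. atri x y z"]
    by (rule tlift_tpure[OF _ _ _ atri_bil]) simp_all
  also have "\<dots> = atri x y z" by (rule tlift_tpure[OF _ _ _ atri_lin(1)]) simp_all
  finally show ?thesis by (simp add: atri_eq)
qed

end

subsection \<open>Internal composition\<close>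

definition comp where
  "comp V W X L K = icomp k H V W X (tpure k (ihom k H W X) (ihom k H V W) L K)"

context
  fixes V :: "('k, 'h, 'v, 'l) gmod_scheme" and W :: "('k, 'h, 'w, 'm) gmod_scheme"
    and X :: "('k, 'h, 'x, 'n) gmod_scheme"
  assumes V [simp]: "hact V" and W [simp]: "hact W" and X [simp]: "hact X"
begin

private abbreviation "N \<equiv> ihom k H W X"
private abbreviation "M \<equiv> ihom k H V W"
text \<open>The trilinear map whose currying is the composition: reassociate, then evaluate
  twice.\<close>

private abbreviation "ev3 \<equiv> Fi N M V X (\<lambda>L K v. evb W X L (evb V W K v))"
private abbreviation "ev3t \<equiv> \<lambda>t v. tlift X (\<lambda>L K. ev3 L K v) t"

private lemma e1: "ebil N W X (evb W X)" and e2: "ebil M V W (evb V W)"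
  by (simp_all add: evb_ebil)

private lemma ev3_lin:
  "v \<in> carrier V \<Longrightarrow> bil N M X (\<lambda>L K. ev3 L K v)" "L \<in> carrier N \<Longrightarrow> K \<in> carrier M \<Longrightarrow> lin V X (ev3 L K)"
  unfolding Fi_def[abs_def] by (intro lin_rules; simp)+

private lemma ev3t_bil: "bil (tensor k N M) V X ev3t"
  by (rule tlift_trilinear) (simp_all add: ev3_lin)

private lemma ev3t_pure: "L \<in> carrier N \<Longrightarrow> K \<in> carrier M \<Longrightarrow> v \<in> carrier V \<Longrightarrow> ev3t (tpure k N M L K) v = ev3 L K v"
  by (simp add: ev3_lin)

private lemma ev3t_ebil: "ebil (gtensor k H N M) V X ev3t"
  unfolding ebil_def
proof (intro conjI ballI)
  show "bil (gtensor k H N M) V X ev3t"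
    using ev3t_bil unfolding bil_def lin_gtensor by simp
  fix h t v assume [simp]: "h \<in> carrier H" "v \<in> carrier V" and t: "t \<in> carrier (gtensor k H N M)"
  note [lin_rules] = bil_linr[OF ev3t_bil]
  note gl [lin_rules] = lin_comp[OF _ gtensor_act_lin[of N M]]
  show "act X h (ev3t t v) = s2 X (Dl h) (\<lambda>h1 h2. ev3t (act (gtensor k H N M) h1 t) (act V h2 v))"
  proof (rule lin_ext[of N M X "\<lambda>t. act X h (ev3t t v)" "\<lambda>t. s2 X (Dl h) (\<lambda>h1 h2. ev3t (act (gtensor k H N M) h1 t) (act V h2 v))"])
    show "lin (tensor k N M) X (\<lambda>t. act X h (ev3t t v))" by (intro act_linr bil_lin1[OF ev3t_bil]) simp_all
    show "lin (tensor k N M) X (\<lambda>t. s2 X (Dl h) (\<lambda>h1 h2. ev3t (act (gtensor k H N M) h1 t) (act V h2 v)))"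
      by (intro lin_s2 lin_comp[OF gtensor_act_lin bil_lin1[OF ev3t_bil]]) simp_all
    fix L K assume [simp]: "L \<in> carrier N" "K \<in> carrier M"
    have "ev3t (act (gtensor k H N M) h1 (tpure k N M L K)) (act V h2 v) =
        s2 X (Dl h1) (\<lambda>c d. ev3 (act N c L) (act M d K) (act V h2 v))" if [simp]: "h1 \<in> carrier H" "h2 \<in> carrier H" for h1 h2
      by (simp add: gtensor_act_pure s2_push[OF bil_lin1[OF ev3t_bil]] ev3t_pure)
    then show "act X h (ev3t (tpure k N M L K) v) = s2 X (Dl h) (\<lambda>h1 h2. ev3t (act (gtensor k H N M) h1 (tpure k N M L K)) (act V h2 v))"
      by (simp add: ev3t_pure Fi_act[OF _ _ _ _ _ e1 e2] del: tlift_tpure)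
  qed (use t in simp_all)
qed

private abbreviation "MV \<equiv> gtensor k H M V"
private abbreviation "TT \<equiv> gtensor k H N MV"

private lemma iev_MV: "lin MV W (iev k H V W)"
  unfolding lin_gtensor by (rule iev_lin) simp_all

private lemma icomp_fun:
  assumes t: "t \<in> carrier (gtensor k H N M)" and v [simp]: "v \<in> carrier V"
  shows "iev k H W X (tmap k N W id (iev k H V W) (assoc k H N M V (tpure k (gtensor k H N M) V t v))) = ev3t t v"
proof (rule lin_ext[of N M X "\<lambda>t. iev k H W X (tmap k N W id (iev k H V W) (assoc k H N M V (tpure k (gtensor k H N M) V t v)))" "\<lambda>t. ev3t t v"])
  have l1: "lin (tensor k N M) (tensor k (gtensor k H N M) V) (\<lambda>t. tpure k (gtensor k H N M) V t v)"
    unfolding lin_gtensor(1)[symmetric] by (rule bil_lin1[OF tpure_bil]) simp_all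
  have l2: "lin TT (tensor k N W) (tmap k N W id (iev k H V W))"
    unfolding lin_gtensor(1)[of N] by (rule tmap_lin) (simp_all add: lin_id_id iev_MV)
  note l3 = lin_comp[OF l2 iev_lin[OF W X]]
  show "lin (tensor k N M) X (\<lambda>t. iev k H W X (tmap k N W id (iev k H V W) (assoc k H N M V (tpure k (gtensor k H N M) V t v))))"
    by (rule lin_comp[OF l1 lin_comp[OF assoc_lin l3]]) simp_all
  show "lin (tensor k N M) X (\<lambda>t. ev3t t v)" by (rule bil_lin1[OF ev3t_bil v])
  fix L K assume L [simp]: "L \<in> carrier N" and K [simp]: "K \<in> carrier M"
  show "iev k H W X (tmap k N W id (iev k H V W) (assoc k H N M V (tpure k (gtensor k H N M) V (tpure k N M L K) v))) = ev3t (tpure k N M L K) v"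
    unfolding ev3t_pure[OF L K v]
    by (simp add: assoc_pure s3_push[OF l3] tmap_pure lin_id_id iev_MV iev_pure Fi_def del: tlift_tpure)
qed (use t in simp_all)

private lemma icomp_cur: "t \<in> carrier (gtensor k H N M) \<Longrightarrow> icomp k H V W X t = cur (gtensor k H N M) V X ev3t t"
  unfolding icomp_def by (rule zeta_cur[OF _ _ _ ev3t_ebil icomp_fun]) simp_all

lemma icomp_lin: "lin (tensor k N M) (ihom k H V X) (icomp k H V W X)"
proof -
  have "lin (gtensor k H N M) (ihom k H V X) (cur (gtensor k H N M) V X ev3t)"
    by (rule cur_lin[OF _ _ _ ev3t_ebil]) simp_all
  then show ?thesis
    unfolding lin_gtensor by (subst lin_cong[where g = "cur (gtensor k H N M) V X ev3t"]) (simp_all add: icomp_cur)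
qed

lemma comp_ebil: "ebil N M (ihom k H V X) (comp V W X)"
  unfolding ebil_def
proof (intro conjI ballI)
  show "bil N M (ihom k H V X) (comp V W X)"
    unfolding comp_def[abs_def] by (rule bil_comp_lin[OF tpure_bil icomp_lin]) simp_all
  fix h L K assume [simp]: "h \<in> carrier H" "L \<in> carrier N" "K \<in> carrier M"
  have "act (ihom k H V X) h (comp V W X L K) = icomp k H V W X (act (gtensor k H N M) h (tpure k N M L K))"
    unfolding comp_def by (simp add: icomp_cur cur_act[OF _ _ _ ev3t_ebil] act_closed[of "gtensor k H N M", simplified])
  also have "\<dots> = s2 (ihom k H V X) (Dl h) (\<lambda>h1 h2. comp V W X (act N h1 L) (act M h2 K))"
    by (simp add: gtensor_act_pure s2_push[OF icomp_lin] comp_def)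
  finally show "act (ihom k H V X) h (comp V W X L K) = s2 (ihom k H V X) (Dl h) (\<lambda>h1 h2. comp V W X (act N h1 L) (act M h2 K))" .
qed

lemmas comp_bil = ebil_bil[OF comp_ebil]
lemmas comp_linr [lin_rules] = bil_linr[OF comp_bil]
lemmas comp_closed [simp] = bil_closed[OF comp_bil]

text \<open>Together with equivariance and \<open>ihom_unique\<close>, this replaces the curried
  definition of composition in the proofs of identities.\<close>

lemma evb_comp:
  assumes [simp]: "L \<in> carrier N" "K \<in> carrier M" "v \<in> carrier V"
  shows "evb V X (comp V W X L K) v = Fi N M V X (\<lambda>L K v. evb W X L (evb V W K v)) L K v"
  by (simp add: comp_def icomp_cur evb_cur[OF _ _ _ ev3t_ebil] ev3t_pure del: tlift_tpure)

end

end

section \<open>Associativity of composition and the hexagons\<close>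

context quasi_hopf_algebra
begin

text \<open>After evaluation at \<open>v\<close>, the two bracketings are the two sides of the
  pentagon applied to one quadrilinear map.\<close>

lemma comp_assoc:
  fixes V :: "('k, 'h, 'v, 'l) gmod_scheme" and W :: "('k, 'h, 'w, 'm) gmod_scheme"
    and X :: "('k, 'h, 'x, 'n) gmod_scheme" and Y :: "('k, 'h, 'y, 'o) gmod_scheme"
  assumes V [simp]: "hact V" and W [simp]: "hact W" and X [simp]: "hact X" and Y [simp]: "hact Y"
    and L: "L \<in> carrier (ihom k H X Y)" and K: "K \<in> carrier (ihom k H W X)" and J: "J \<in> carrier (ihom k H V W)"
  shows "comp V W Y (comp W X Y L K) J =
    Fi (ihom k H X Y) (ihom k H W X) (ihom k H V W) (ihom k H V Y) (\<lambda>L K J. comp V X Y L (comp V W X K J)) L K J"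
proof -
  let ?A = "ihom k H X Y" and ?B = "ihom k H W X" and ?C = "ihom k H V W" and ?D = "ihom k H V Y"
  let ?l = "\<lambda>L K J. comp V W Y (comp W X Y L K) J" and ?r = "Fi ?A ?B ?C ?D (\<lambda>L K J. comp V X Y L (comp V W X K J))"
  note c1 = comp_ebil[OF V W Y] and c2 = comp_ebil[OF W X Y] and c3 = comp_ebil[OF V X Y] and c4 = comp_ebil[OF V W X]
  note bb = ebil_bil[OF c1] ebil_bil[OF c2] ebil_bil[OF c3] ebil_bil[OF c4]
  note eb = evb_ebil[OF V Y] evb_ebil[OF W Y] evb_ebil[OF X Y] evb_ebil[OF V X] evb_ebil[OF W X] evb_ebil[OF V W]
  have rc [simp]: "?r L K J \<in> carrier ?D"
    if "L \<in> carrier ?A" "K \<in> carrier ?B" "J \<in> carrier ?C" for L K J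
    using that by (simp add: Fi_def)
  have core: "evb V Y (?l L K J) v = evb V Y (?r L K J) v"
    if [simp]: "L \<in> carrier ?A" "K \<in> carrier ?B" "J \<in> carrier ?C" "v \<in> carrier V" for L K J v
  proof -
    \<comment> \<open>The four legs of the pentagon act on \<open>L\<close>, \<open>K\<close>,
      \<open>J\<close> and \<open>v\<close>.\<close>
    let ?Q = "\<lambda>p q r s. evb X Y (act ?A p L) (evb W X (act ?B q K) (evb V W (act ?C r J) (act V s v)))"
    have q: "quad Y ?Q" by (intro lin_rules) simp_all
    have 1: "evb V Y (?l L K J) v = s3 Y Ph (\<lambda>a b c. s2 Y (Dl a) (\<lambda>a1 a2. s3 Y Ph (\<lambda>x y z. s2 Y (Dl z) (\<lambda>z1 z2.
        ?Q (x \<cdot> a1) (y \<cdot> a2) (z1 \<cdot> b) (z2 \<cdot> c)))))"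
      by (simp add: evb_comp Fi_def ebil_act[OF c2] bil_s[OF eb(2)[THEN ebil_bil]] ebil_act[OF eb(6)] act_act
        bil_s[OF eb(5)[THEN ebil_bil]] bil_s[OF eb(3)[THEN ebil_bil]])
    also have "\<dots> = s3 Y Ph (\<lambda>x y z. s2 Y (Dl z) (\<lambda>z1 z2. s3 Y Ph (\<lambda>a b c. s2 Y (Dl a) (\<lambda>a1 a2.
        ?Q (x \<cdot> a1) (y \<cdot> a2) (z1 \<cdot> b) (z2 \<cdot> c)))))"
    proof -
      have "s3 Y Ph (\<lambda>a b c. s2 Y (Dl a) (\<lambda>a1 a2. s3 Y Ph (\<lambda>x y z. s2 Y (Dl z) (\<lambda>z1 z2.
          ?Q (x \<cdot> a1) (y \<cdot> a2) (z1 \<cdot> b) (z2 \<cdot> c)))))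
        = s3 Y Ph (\<lambda>a b c. s3 Y Ph (\<lambda>x y z. s2 Y (Dl z) (\<lambda>z1 z2. s2 Y (Dl a) (\<lambda>a1 a2.
          ?Q (x \<cdot> a1) (y \<cdot> a2) (z1 \<cdot> b) (z2 \<cdot> c)))))"
        by (rule s3_cong[OF refl], subst s2_s3_swap, simp, simp, rule s3_cong[OF refl], rule s2_s2_swap) simp_all
      also have "\<dots> = s3 Y Ph (\<lambda>x y z. s3 Y Ph (\<lambda>a b c. s2 Y (Dl z) (\<lambda>z1 z2. s2 Y (Dl a) (\<lambda>a1 a2.
          ?Q (x \<cdot> a1) (y \<cdot> a2) (z1 \<cdot> b) (z2 \<cdot> c)))))"
        by (rule s3_s3_swap) simp_all
      finally show ?thesis by (simp add: s2_s3_swap)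
    qed
    also have "\<dots> = s3 Y Ph (\<lambda>x y z. s3 Y Ph (\<lambda>a b c. s2 Y (Dl b) (\<lambda>b1 b2. s3 Y Ph (\<lambda>u v w.
      ?Q (a \<cdot> u) (x \<cdot> b1 \<cdot> v) (y \<cdot> b2 \<cdot> w) (z \<cdot> c)))))"
      by (rule pentagon_sum[OF _ q]) simp
    also have "\<dots> = s3 Y Ph (\<lambda>u v w. s3 Y Ph (\<lambda>a b c. s2 Y (Dl b) (\<lambda>b1 b2. s3 Y Ph (\<lambda>x y z.
      ?Q (a \<cdot> u) (x \<cdot> b1 \<cdot> v) (y \<cdot> b2 \<cdot> w) (z \<cdot> c)))))"
    proof -
      let ?R = "\<lambda>x y z a b c b1 b2 u v w. ?Q (a \<cdot> u) (x \<cdot> b1 \<cdot> v) (y \<cdot> b2 \<cdot> w) (z \<cdot> c)"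
      have "s3 Y Ph (\<lambda>x y z. s3 Y Ph (\<lambda>a b c. s2 Y (Dl b) (\<lambda>b1 b2. s3 Y Ph (?R x y z a b c b1 b2)))) =
          s3 Y Ph (\<lambda>a b c. s3 Y Ph (\<lambda>x y z. s2 Y (Dl b) (\<lambda>b1 b2. s3 Y Ph (?R x y z a b c b1 b2))))"
        by (rule s3_s3_swap) simp_all
      also have "\<dots> = s3 Y Ph (\<lambda>a b c. s2 Y (Dl b) (\<lambda>b1 b2. s3 Y Ph (\<lambda>x y z. s3 Y Ph (?R x y z a b c b1 b2))))"
        by (rule s3_cong[OF refl], rule s2_s3_swap[symmetric]) simp_all
      also have "\<dots> = s3 Y Ph (\<lambda>a b c. s2 Y (Dl b) (\<lambda>b1 b2. s3 Y Ph (\<lambda>u v w. s3 Y Ph (\<lambda>x y z. ?R x y z a b c b1 b2 u v w))))"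
        by (rule s3_cong[OF refl], rule s2_cong[OF refl], rule s3_s3_swap) simp_all
      also have "\<dots> = s3 Y Ph (\<lambda>a b c. s3 Y Ph (\<lambda>u v w. s2 Y (Dl b) (\<lambda>b1 b2. s3 Y Ph (\<lambda>x y z. ?R x y z a b c b1 b2 u v w))))"
        by (rule s3_cong[OF refl], rule s2_s3_swap) simp_all
      also have "\<dots> = s3 Y Ph (\<lambda>u v w. s3 Y Ph (\<lambda>a b c. s2 Y (Dl b) (\<lambda>b1 b2. s3 Y Ph (\<lambda>x y z. ?R x y z a b c b1 b2 u v w))))"
        by (rule s3_s3_swap) simp_all
      finally show ?thesis .
    qed
    also have "\<dots> = evb V Y (?r L K J) v"
      by (simp add: evb_comp Fi_def bil_s[OF eb(1)[THEN ebil_bil]] ebil_act[OF c4] bil_s[OF eb(4)[THEN ebil_bil]] act_act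
         bil_s[OF eb(3)[THEN ebil_bil]] m_assoc)
    finally show ?thesis .
  qed
  show ?thesis
  \<comment> \<open>A translate of either side is a sum of the same expression in translates of
    \<open>L\<close>, \<open>K\<close> and \<open>J\<close>, to which \<open>core\<close>
    applies.\<close>
  proof (rule ihom_unique[OF V Y])
    fix h v assume [simp]: "h \<in> carrier H" "v \<in> carrier V"
    note [simp] = L K J
    have "evb V Y (act ?D h (?l L K J)) v = s2 Y (Dl h) (\<lambda>a b. s2 Y (Dl a) (\<lambda>c d. evb V Y (?l (act ?A c L) (act ?B d K) (act ?C b J)) v))"
      by (simp add: ebil_act[OF c1] ebil_act[OF c2] bil_s[OF bb(1)] bil_s[OF eb(1)[THEN ebil_bil]])
    also have "\<dots> = s2 Y (Dl h) (\<lambda>a b. s2 Y (Dl a) (\<lambda>c d. evb V Y (?r (act ?A c L) (act ?B d K) (act ?C b J)) v))"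
      by (intro s2_cong refl core) simp_all
    also have "\<dots> = evb V Y (act ?D h (?r L K J)) v"
      by (subst Fi_act[OF _ _ _ _ _ c3 c4]) (simp_all add: bil_s[OF eb(1)[THEN ebil_bil]])
    finally show "evb V Y (act ?D h (?l L K J)) v = evb V Y (act ?D h (?r L K J)) v" .
  qed (use L K J in simp_all)
qed

end

section \<open>The hexagons solved for the coproduct of the R-matrix\<close>

context quasitriangular_quasi_hopf
begin

context
  fixes X :: "('k, 'x, 'm) module_scheme" and T
  assumes X [simp]: "module k X" and T: "tril X T"
begin

text \<open>One hexagon with its outer associators moved to the other side. The two extra factors
  \<phi>, one of them with permuted legs, are the reassociations that surround the two successive
  braidings.\<close>

lemma braid_tensor_left_sum:
  "s3 X Ph (\<lambda>a b c. s2 X Rl (\<lambda>r' s'. s3 X Ps (\<lambda>p q t. s2 X Rl (\<lambda>r s. s3 X Ph (\<lambda>u v w.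
     T (v \<cdot> (r \<cdot> p \<cdot> a)) (w \<cdot> (t \<cdot> r' \<cdot> b)) (u \<cdot> (s \<cdot> q \<cdot> s' \<cdot> c))))))) =
   s2 X Rl (\<lambda>r s. s2 X (Dl r) (\<lambda>r1 r2. T r1 r2 s))"
proof -
  note [lin_rules] = tril_linr[OF T]
  note [simp] = tril_closed[OF T]
  let ?m = "\<lambda>a b. a \<cdot> b"
  let ?T = "\<lambda>i j k. s3 X Ph (\<lambda>u v w. T (?m v i) (?m w j) (?m u k))"
  have t: "tril X ?T" by (intro lin_rules) simp_all
  \<comment> \<open>The hexagon itself, after its two sums over \<open>Rl\<close> have been brought
    into its order.\<close>
  have 1: "s2 X Rl (\<lambda>r' s'. s3 X Ps (\<lambda>p q t. s2 X Rl (\<lambda>r s.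
      ?T (?m (?m r p) a) (?m (?m t r') b) (?m (?m (?m s q) s') c)))) =
     s3 X Ps (\<lambda>p q t. s2 X Rl (\<lambda>r s. s2 X (Dl r) (\<lambda>r1 r2. s3 X Ps (\<lambda>x y z.
     ?T (?m (?m (?m q r1) x) a) (?m (?m (?m t r2) y) b) (?m (?m (?m p s) z) c)))))"
    if [simp]: "a \<in> carrier H" "b \<in> carrier H" "c \<in> carrier H" for a b c
  proof -
    have t': "tril X (\<lambda>i j k. ?T (?m i a) (?m j b) (?m k c))" by (intro lin_rules) simp_all
    have "s2 X Rl (\<lambda>r' s'. s3 X Ps (\<lambda>p q t. s2 X Rl (\<lambda>r s. ?T (?m (?m r p) a) (?m (?m t r') b) (?m (?m (?m s q) s') c)))) =
        s3 X Ps (\<lambda>p q t. s2 X Rl (\<lambda>r' s'. s2 X Rl (\<lambda>r s. ?T (?m (?m r p) a) (?m (?m t r') b) (?m (?m (?m s q) s') c))))"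
      by (rule s2_s3_swap) simp_all
    also have "\<dots> = s3 X Ps (\<lambda>p q t. s2 X Rl (\<lambda>r s. s2 X Rl (\<lambda>r' s'. ?T (?m (?m r p) a) (?m (?m t r') b) (?m (?m (?m s q) s') c))))"
      by (rule s3_cong[OF refl], rule s2_s2_swap) simp_all
    also have "\<dots> = s2 X Rl (\<lambda>r s. s3 X Ps (\<lambda>p q t. s2 X Rl (\<lambda>r' s'. ?T (?m (?m r p) a) (?m (?m t r') b) (?m (?m (?m s q) s') c))))"
      by (rule s2_s3_swap[symmetric]) simp_all
    finally show ?thesis using hexagon_left_sum[OF X t'] by simp
  qed
  \<comment> \<open>The associator on the right of the hexagon cancels against the added
    \<phi>.\<close>
  have 2: "s3 X Ph (\<lambda>a b c. s3 X Ps (\<lambda>x y z. ?T (?m (?m i x) a) (?m (?m j y) b) (?m (?m l z) c))) = ?T i j l"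
    if [simp]: "i \<in> carrier H" "j \<in> carrier H" "l \<in> carrier H" for i j l
  proof -
    have "tril X (\<lambda>a b c. ?T (?m i a) (?m j b) (?m l c))" by (intro lin_rules) simp_all
    from phi_cancel(2)[OF X this] show ?thesis by (subst s3_s3_swap) (simp_all add: m_assoc)
  qed
  \<comment> \<open>The permuted associator on the left cancels against the added \<phi> with the
    same permutation.\<close>
  have 3: "s3 X Ph (\<lambda>u v w. s3 X Ps (\<lambda>p q t. T (?m v (?m q r1)) (?m w (?m t r2)) (?m u (?m p s)))) = T r1 r2 s"
    if [simp]: "r1 \<in> carrier H" "r2 \<in> carrier H" "s \<in> carrier H" for r1 r2 s
  proof -
    have "tril X (\<lambda>u v w. T (?m v r1) (?m w r2) (?m u s))" by (intro lin_rules) simp_all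
    from phi_cancel(1)[OF X this] show ?thesis by (simp add: m_assoc)
  qed
  have "s3 X Ph (\<lambda>a b c. s2 X Rl (\<lambda>r' s'. s3 X Ps (\<lambda>p q t. s2 X Rl (\<lambda>r s.
      ?T (?m (?m r p) a) (?m (?m t r') b) (?m (?m (?m s q) s') c))))) =
      s3 X Ph (\<lambda>a b c. s3 X Ps (\<lambda>p q t. s2 X Rl (\<lambda>r s. s2 X (Dl r) (\<lambda>r1 r2. s3 X Ps (\<lambda>x y z.
      ?T (?m (?m (?m q r1) x) a) (?m (?m (?m t r2) y) b) (?m (?m (?m p s) z) c))))))"
    by (rule s3_cong[OF refl], rule 1)
  also have "\<dots> = s3 X Ps (\<lambda>p q t. s3 X Ph (\<lambda>a b c. s2 X Rl (\<lambda>r s. s2 X (Dl r) (\<lambda>r1 r2. s3 X Ps (\<lambda>x y z.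
      ?T (?m (?m (?m q r1) x) a) (?m (?m (?m t r2) y) b) (?m (?m (?m p s) z) c))))))"
    by (rule s3_s3_swap) simp_all
  also have "\<dots> = s3 X Ps (\<lambda>p q t. s2 X Rl (\<lambda>r s. s3 X Ph (\<lambda>a b c. s2 X (Dl r) (\<lambda>r1 r2. s3 X Ps (\<lambda>x y z.
      ?T (?m (?m (?m q r1) x) a) (?m (?m (?m t r2) y) b) (?m (?m (?m p s) z) c))))))"
    by (rule s3_cong[OF refl], rule s2_s3_swap[symmetric]) simp_all
  also have "\<dots> = s3 X Ps (\<lambda>p q t. s2 X Rl (\<lambda>r s. s2 X (Dl r) (\<lambda>r1 r2. s3 X Ph (\<lambda>a b c. s3 X Ps (\<lambda>x y z.
      ?T (?m (?m (?m q r1) x) a) (?m (?m (?m t r2) y) b) (?m (?m (?m p s) z) c))))))"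
    by (rule s3_cong[OF refl], rule s2_cong[OF refl], rule s2_s3_swap[symmetric]) simp_all
  also have "\<dots> = s3 X Ps (\<lambda>p q t. s2 X Rl (\<lambda>r s. s2 X (Dl r) (\<lambda>r1 r2. ?T (?m q r1) (?m t r2) (?m p s))))"
    by (rule s3_cong[OF refl], rule s2_cong[OF refl], rule s2_cong[OF refl], rule 2) simp_all
  also have "\<dots> = s2 X Rl (\<lambda>r s. s3 X Ps (\<lambda>p q t. s2 X (Dl r) (\<lambda>r1 r2. ?T (?m q r1) (?m t r2) (?m p s))))"
    by (rule s2_s3_swap[symmetric]) simp_all
  also have "\<dots> = s2 X Rl (\<lambda>r s. s2 X (Dl r) (\<lambda>r1 r2. s3 X Ps (\<lambda>p q t. ?T (?m q r1) (?m t r2) (?m p s))))"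
    by (rule s2_cong[OF refl], rule s2_s3_swap[symmetric]) simp_all
  also have "\<dots> = s2 X Rl (\<lambda>r s. s2 X (Dl r) (\<lambda>r1 r2. T r1 r2 s))"
    by (rule s2_cong[OF refl], rule s2_cong[OF refl], subst s3_s3_swap, simp, simp, rule 3)
  finally show ?thesis .
qed

text \<open>The same solution of the other hexagon; here the added associators are inverses of
  \<phi>.\<close>

lemma braid_tensor_right_sum:
  "s3 X Ps (\<lambda>a b c. s2 X Rl (\<lambda>r' s'. s3 X Ph (\<lambda>p q t. s2 X Rl (\<lambda>r s. s3 X Ps (\<lambda>u v w.
     T (w \<cdot> (r \<cdot> q \<cdot> r' \<cdot> a)) (u \<cdot> (p \<cdot> s' \<cdot> b)) (v \<cdot> (s \<cdot> t \<cdot> c))))))) =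
   s2 X Rl (\<lambda>r s. s2 X (Dl s) (\<lambda>s1 s2. T r s1 s2))"
proof -
  note [lin_rules] = tril_linr[OF T]
  note [simp] = tril_closed[OF T]
  let ?m = "\<lambda>a b. a \<cdot> b"
  let ?T = "\<lambda>i j k. s3 X Ps (\<lambda>u v w. T (?m w i) (?m u j) (?m v k))"
  have t: "tril X ?T" by (intro lin_rules) simp_all
  have 1: "s2 X Rl (\<lambda>r' s'. s3 X Ph (\<lambda>p q t. s2 X Rl (\<lambda>r s.
      ?T (?m (?m (?m r q) r') a) (?m (?m p s') b) (?m (?m s t) c)))) =
     s3 X Ph (\<lambda>p q t. s2 X Rl (\<lambda>r s. s2 X (Dl s) (\<lambda>s1 s2. s3 X Ph (\<lambda>x y z.
     ?T (?m (?m (?m t r) x) a) (?m (?m (?m p s1) y) b) (?m (?m (?m q s2) z) c)))))"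
    if [simp]: "a \<in> carrier H" "b \<in> carrier H" "c \<in> carrier H" for a b c
  proof -
    have t': "tril X (\<lambda>i j k. ?T (?m i a) (?m j b) (?m k c))" by (intro lin_rules) simp_all
    have "s2 X Rl (\<lambda>r' s'. s3 X Ph (\<lambda>p q t. s2 X Rl (\<lambda>r s. ?T (?m (?m (?m r q) r') a) (?m (?m p s') b) (?m (?m s t) c)))) =
        s3 X Ph (\<lambda>p q t. s2 X Rl (\<lambda>r' s'. s2 X Rl (\<lambda>r s. ?T (?m (?m (?m r q) r') a) (?m (?m p s') b) (?m (?m s t) c))))"
      by (rule s2_s3_swap) simp_all
    also have "\<dots> = s3 X Ph (\<lambda>p q t. s2 X Rl (\<lambda>r s. s2 X Rl (\<lambda>r' s'. ?T (?m (?m (?m r q) r') a) (?m (?m p s') b) (?m (?m s t) c))))"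
      by (rule s3_cong[OF refl], rule s2_s2_swap) simp_all
    also have "\<dots> = s2 X Rl (\<lambda>r s. s3 X Ph (\<lambda>p q t. s2 X Rl (\<lambda>r' s'. ?T (?m (?m (?m r q) r') a) (?m (?m p s') b) (?m (?m s t) c))))"
      by (rule s2_s3_swap[symmetric]) simp_all
    finally show ?thesis using hexagon_right_sum[OF X t'] by simp
  qed
  have 2: "s3 X Ps (\<lambda>a b c. s3 X Ph (\<lambda>x y z. ?T (?m (?m i x) a) (?m (?m j y) b) (?m (?m l z) c))) = ?T i j l"
    if [simp]: "i \<in> carrier H" "j \<in> carrier H" "l \<in> carrier H" for i j l
  proof -
    have "tril X (\<lambda>a b c. ?T (?m i a) (?m j b) (?m l c))" by (intro lin_rules) simp_all
    from phi_cancel(1)[OF X this] show ?thesis by (subst s3_s3_swap) (simp_all add: m_assoc)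
  qed
  have 3: "s3 X Ps (\<lambda>u v w. s3 X Ph (\<lambda>p q t. T (?m w (?m t r)) (?m u (?m p s1)) (?m v (?m q s2)))) = T r s1 s2"
    if [simp]: "s1 \<in> carrier H" "s2 \<in> carrier H" "r \<in> carrier H" for s1 s2 r
  proof -
    have "tril X (\<lambda>u v w. T (?m w r) (?m u s1) (?m v s2))" by (intro lin_rules) simp_all
    from phi_cancel(2)[OF X this] show ?thesis by (simp add: m_assoc)
  qed
  have "s3 X Ps (\<lambda>a b c. s2 X Rl (\<lambda>r' s'. s3 X Ph (\<lambda>p q t. s2 X Rl (\<lambda>r s.
      ?T (?m (?m (?m r q) r') a) (?m (?m p s') b) (?m (?m s t) c))))) =
      s3 X Ps (\<lambda>a b c. s3 X Ph (\<lambda>p q t. s2 X Rl (\<lambda>r s. s2 X (Dl s) (\<lambda>s1 s2. s3 X Ph (\<lambda>x y z.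
      ?T (?m (?m (?m t r) x) a) (?m (?m (?m p s1) y) b) (?m (?m (?m q s2) z) c))))))"
    by (rule s3_cong[OF refl], rule 1)
  also have "\<dots> = s3 X Ph (\<lambda>p q t. s3 X Ps (\<lambda>a b c. s2 X Rl (\<lambda>r s. s2 X (Dl s) (\<lambda>s1 s2. s3 X Ph (\<lambda>x y z.
      ?T (?m (?m (?m t r) x) a) (?m (?m (?m p s1) y) b) (?m (?m (?m q s2) z) c))))))"
    by (rule s3_s3_swap) simp_all
  also have "\<dots> = s3 X Ph (\<lambda>p q t. s2 X Rl (\<lambda>r s. s3 X Ps (\<lambda>a b c. s2 X (Dl s) (\<lambda>s1 s2. s3 X Ph (\<lambda>x y z.
      ?T (?m (?m (?m t r) x) a) (?m (?m (?m p s1) y) b) (?m (?m (?m q s2) z) c))))))"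
    by (rule s3_cong[OF refl], rule s2_s3_swap[symmetric]) simp_all
  also have "\<dots> = s3 X Ph (\<lambda>p q t. s2 X Rl (\<lambda>r s. s2 X (Dl s) (\<lambda>s1 s2. s3 X Ps (\<lambda>a b c. s3 X Ph (\<lambda>x y z.
      ?T (?m (?m (?m t r) x) a) (?m (?m (?m p s1) y) b) (?m (?m (?m q s2) z) c))))))"
    by (rule s3_cong[OF refl], rule s2_cong[OF refl], rule s2_s3_swap[symmetric]) simp_all
  also have "\<dots> = s3 X Ph (\<lambda>p q t. s2 X Rl (\<lambda>r s. s2 X (Dl s) (\<lambda>s1 s2. ?T (?m t r) (?m p s1) (?m q s2))))"
    by (rule s3_cong[OF refl], rule s2_cong[OF refl], rule s2_cong[OF refl], rule 2) simp_all
  also have "\<dots> = s2 X Rl (\<lambda>r s. s3 X Ph (\<lambda>p q t. s2 X (Dl s) (\<lambda>s1 s2. ?T (?m t r) (?m p s1) (?m q s2))))"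
    by (rule s2_s3_swap[symmetric]) simp_all
  also have "\<dots> = s2 X Rl (\<lambda>r s. s2 X (Dl s) (\<lambda>s1 s2. s3 X Ph (\<lambda>p q t. ?T (?m t r) (?m p s1) (?m q s2))))"
    by (rule s2_cong[OF refl], rule s2_s3_swap[symmetric]) simp_all
  also have "\<dots> = s2 X Rl (\<lambda>r s. s2 X (Dl s) (\<lambda>s1 s2. T r s1 s2))"
    by (rule s2_cong[OF refl], rule s2_cong[OF refl], subst s3_s3_swap, simp, simp, rule 3)
  finally show ?thesis .
qed

end

end

section \<open>Gradings\<close>

context base_ring
begin

lemma finsum_closed':
  "module k V \<Longrightarrow> (\<And>i. i \<in> F \<Longrightarrow> f i \<in> carrier V) \<Longrightarrow> finsum V f F \<in> carrier V"
  by (intro abelian_monoid.finsum_closed abelian_group.axioms(1) module_abelian_group) auto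

lemma finsum_eq:
  assumes "module k V" "\<And>i. i \<in> F \<Longrightarrow> f i = g i" "\<And>i. i \<in> F \<Longrightarrow> g i \<in> carrier V"
  shows "finsum V f F = finsum V g F"
  using assms(2,3)
  by (intro abelian_monoid.finsum_cong' abelian_group.axioms(1) module_abelian_group assms(1)) auto

lemma finsum_zero':
  assumes "module k V" "\<And>i. i \<in> F \<Longrightarrow> f i = \<zero>\<^bsub>V\<^esub>"
  shows "finsum V f F = \<zero>\<^bsub>V\<^esub>"
proof -
  interpret V: module k V by fact
  show ?thesis using assms(2) by (rule V.M.add.finprod_one_eqI)
qed

lemma finsum_insert':
  assumes "module k V" "finite F" "a \<notin> F" "\<And>i. i \<in> insert a F \<Longrightarrow> f i \<in> carrier V"
  shows "finsum V f (insert a F) = f a \<oplus>\<^bsub>V\<^esub> finsum V f F"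
proof -
  interpret V: module k V by fact
  show ?thesis using assms(2-4) by (intro V.M.finsum_insert) auto
qed

lemma finsum_push:
  assumes V: "module k V" and W: "module k W" and f: "lin V W f" and F: "finite F" and "\<And>i. i \<in> F \<Longrightarrow> c i \<in> carrier V"
  shows "f (finsum V c F) = finsum W (\<lambda>i. f (c i)) F"
  using F assms(5)
proof (induction F rule: finite_induct)
  case empty
  have "finsum V c {} = \<zero>\<^bsub>V\<^esub>" "finsum W (\<lambda>i. f (c i)) {} = \<zero>\<^bsub>W\<^esub>"
    by (rule finsum_zero'; simp add: V W)+
  then show ?case using lin_zero[OF V W f] by simp
next
  case (insert a F)
  have c: "c i \<in> carrier V" if "i \<in> insert a F" for i using insert(4) that by simp
  have "f (finsum V c (insert a F)) = f (c a \<oplus>\<^bsub>V\<^esub> finsum V c F)"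
    by (subst finsum_insert'[OF V insert(1,2)]) (simp_all add: c)
  also have "\<dots> = f (c a) \<oplus>\<^bsub>W\<^esub> f (finsum V c F)"
    by (rule linD(2)[OF f]) (simp_all add: c finsum_closed'[OF V])
  also have "\<dots> = finsum W (\<lambda>i. f (c i)) (insert a F)"
    using insert(3) by (subst finsum_insert'[OF W insert(1,2)]) (auto simp: c linD(1)[OF f])
  finally show ?case .
qed

lemma finsum_single:
  assumes V: "module k V" and F: "finite F" and z: "\<And>i. i \<in> F \<Longrightarrow> i \<noteq> p \<Longrightarrow> f i = \<zero>\<^bsub>V\<^esub>" "p \<notin> F \<Longrightarrow> f p = \<zero>\<^bsub>V\<^esub>"
    and c: "f p \<in> carrier V"
  shows "finsum V f F = f p"
proof (cases "p \<in> F")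
  case True
  have fc: "f i \<in> carrier V" if "i \<in> F" for i by (cases "i = p") (use that z c V in auto)
  have "F = insert p (F - {p})" using True by auto
  then have "finsum V f F = finsum V f (insert p (F - {p}))" by simp
  also have "\<dots> = f p \<oplus>\<^bsub>V\<^esub> finsum V f (F - {p})"
    by (rule finsum_insert'[OF V]) (use F c fc in auto)
  also have "finsum V f (F - {p}) = \<zero>\<^bsub>V\<^esub>" by (rule finsum_zero'[OF V]) (use z in auto)
  finally show ?thesis using c V by (simp add: abelian_monoid.r_zero[OF abelian_group.axioms(1)[OF module_abelian_group]])
next
  case False
  then show ?thesis using z by (auto intro!: finsum_zero'[OF V])
qed

lemma lin_finsum:
  assumes V: "module k V" and X: "module k X" and F: "finite F" and "\<And>i. i \<in> F \<Longrightarrow> lin V X (\<lambda>v. f v i)"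
  shows "lin V X (\<lambda>v. finsum X (f v) F)"
  using F assms(4)
proof (induction F rule: finite_induct)
  case empty
  have "finsum X (f v) {} = \<zero>\<^bsub>X\<^esub>" for v by (rule finsum_zero'[OF X]) simp
  then show ?case by (simp add: lin_const_zero[OF X])
next
  case (insert a F)
  have l: "lin V X (\<lambda>v. f v i)" if "i \<in> insert a F" for i using insert(4) that by simp
  have "lin V X (\<lambda>v. f v a \<oplus>\<^bsub>X\<^esub> finsum X (f v) F)" using insert(3) l by (intro lin_add[OF X]) auto
  then show ?case
    by (subst lin_cong[OF V, where g = "\<lambda>v. f v a \<oplus>\<^bsub>X\<^esub> finsum X (f v) F"])
       (simp_all only: finsum_insert'[OF X insert(1,2)] linD(1)[OF l])
qed

lemma submodule_criterion:
  assumes V: "module k V" and "S \<subseteq> carrier V" "\<zero>\<^bsub>V\<^esub> \<in> S" "\<And>x y. x \<in> S \<Longrightarrow> y \<in> S \<Longrightarrow> x \<oplus>\<^bsub>V\<^esub> y \<in> S"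
    "\<And>c x. c \<in> carrier k \<Longrightarrow> x \<in> S \<Longrightarrow> c \<odot>\<^bsub>V\<^esub> x \<in> S"
  shows "submodule S k V"
proof -
  interpret V: module k V by fact
  have "\<ominus>\<^bsub>V\<^esub> x \<in> S" if "x \<in> S" for x
    using assms(5)[OF a_inv_closed[OF one_closed] that] V.smult_l_minus[of "\<one>\<^bsub>k\<^esub>" x] assms(2) that by auto
  then show ?thesis using assms by (intro V.submoduleI) auto
qed

end

section \<open>Homogeneous components in graded modules\<close>

context quasi_hopf_algebra
begin

context
  fixes V :: "('k, 'h, 'v, 'm) gmod_scheme"
  assumes V: "hmod k H V"
begin

lemma grade_module: "module k V" and grade_hact: "hact V"
  using V hmod_hact by (simp_all add: hmod_def)

lemma grade_carrier: "v \<in> grade V n \<Longrightarrow> v \<in> carrier V"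
  using module.submoduleE(1)[OF grade_module hmod.grade_submodule[OF V]] by auto

lemma grade_zero: "\<zero>\<^bsub>V\<^esub> \<in> grade V n"
  using hmod.grade_submodule[OF V, of n] by (auto simp: submodule_def subgroup_def)

lemma grade_add: "v \<in> grade V n \<Longrightarrow> w \<in> grade V n \<Longrightarrow> v \<oplus>\<^bsub>V\<^esub> w \<in> grade V n"
  using module.submoduleE(5)[OF grade_module hmod.grade_submodule[OF V]] by auto

lemma grade_smult: "c \<in> carrier k \<Longrightarrow> v \<in> grade V n \<Longrightarrow> c \<odot>\<^bsub>V\<^esub> v \<in> grade V n"
  using module.submoduleE(4)[OF grade_module hmod.grade_submodule[OF V]] by auto

lemma grade_uminus: "v \<in> grade V n \<Longrightarrow> \<ominus>\<^bsub>V\<^esub> v \<in> grade V n"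
  using module.submoduleE(3)[OF grade_module hmod.grade_submodule[OF V]] by auto

lemma grade_minus: "v \<in> grade V n \<Longrightarrow> w \<in> grade V n \<Longrightarrow> v \<ominus>\<^bsub>V\<^esub> w \<in> grade V n"
  unfolding a_minus_def by (intro grade_add grade_uminus)

lemma grade_act': "h \<in> carrier H \<Longrightarrow> v \<in> grade V n \<Longrightarrow> act V h v \<in> grade V n"
  by (rule hmod.grade_act[OF V])

lemma lsum_grade: "(\<And>p. p \<in> set ps \<Longrightarrow> f p \<in> grade V n) \<Longrightarrow> lsum V ps f \<in> grade V n"
  by (induction ps) (auto intro: grade_zero grade_add)

lemma s2_grade: "(\<And>a b. a \<in> carrier H \<Longrightarrow> b \<in> carrier H \<Longrightarrow> T a b \<in> grade V n) \<Longrightarrow> s2 V ps T \<in> grade V n"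
  unfolding s2_def by (rule lsum_grade) auto

lemma s3_grade: "(\<And>a b c. a \<in> carrier H \<Longrightarrow> b \<in> carrier H \<Longrightarrow> c \<in> carrier H \<Longrightarrow> T a b c \<in> grade V n) \<Longrightarrow> s3 V ps T \<in> grade V n"
  unfolding s3_def by (rule lsum_grade) auto

lemma gproj_prop:
  assumes "v \<in> carrier V"
  shows "gproj V v n \<in> grade V n" "v = finsum V (gproj V v) (gsupp V)"
  using theI'[OF hmod.grade_direct_sum[OF V assms]] unfolding gproj_def by auto

lemma gproj_unique:
  assumes "v \<in> carrier V" "\<And>n. c n \<in> grade V n" "v = finsum V c (gsupp V)"
  shows "gproj V v = c"
  unfolding gproj_def by (rule the1_equality[OF hmod.grade_direct_sum[OF V assms(1)]]) (use assms in auto)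

lemma gsupp_finite: "finite (gsupp V)"
  by (rule hmod.grade_bounded[OF V])

lemma not_gsupp: "n \<notin> gsupp V \<Longrightarrow> v \<in> grade V n \<Longrightarrow> v = \<zero>\<^bsub>V\<^esub>"
  by (auto simp: gsupp_def)

text \<open>An element is the finite sum of its components. The lemma reduces identities to
  homogeneous arguments, on which the braiding has a definite sign.\<close>

lemma homog_ext:
  assumes U: "module k U" and f: "lin V U f" and g: "lin V U g" and e: "\<And>n v. v \<in> grade V n \<Longrightarrow> f v = g v"
    and v: "v \<in> carrier V"
  shows "f v = g v"
proof -
  note c = gproj_prop(1)[OF v, THEN grade_carrier]
  have "f (finsum V (gproj V v) (gsupp V)) = finsum U (\<lambda>i. f (gproj V v i)) (gsupp V)"
    by (rule finsum_push[OF grade_module U f gsupp_finite c])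
  also have "\<dots> = finsum U (\<lambda>i. g (gproj V v i)) (gsupp V)"
    by (rule finsum_eq[OF U]) (use e[OF gproj_prop(1)[OF v]] linD(1)[OF g c] in auto)
  also have "\<dots> = g (finsum V (gproj V v) (gsupp V))"
    by (rule finsum_push[OF grade_module U g gsupp_finite c, symmetric])
  finally show ?thesis by (simp only: gproj_prop(2)[OF v, symmetric])
qed

text \<open>The sum of two decompositions and a multiple of a decomposition are again
  decompositions, and these are unique.\<close>

lemma gproj_lin: "lin V V (\<lambda>v. gproj V v n)"
proof -
  interpret V: module k V by (rule grade_module)
  note gc = gproj_prop(1)[THEN grade_carrier]
  show ?thesis
  proof (rule linI)
    fix v w assume v: "v \<in> carrier V" and w: "w \<in> carrier V"
    have "gproj V (v \<oplus>\<^bsub>V\<^esub> w) = (\<lambda>n. gproj V v n \<oplus>\<^bsub>V\<^esub> gproj V w n)"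
    proof (rule gproj_unique)
      show "v \<oplus>\<^bsub>V\<^esub> w = finsum V (\<lambda>n. gproj V v n \<oplus>\<^bsub>V\<^esub> gproj V w n) (gsupp V)"
        using gc[OF v] gc[OF w]
        by (subst V.M.finsum_addf) (auto simp: gproj_prop(2)[OF v, symmetric] gproj_prop(2)[OF w, symmetric])
    qed (use v w gproj_prop(1) grade_add in auto)
    then show "gproj V (v \<oplus>\<^bsub>V\<^esub> w) n = gproj V v n \<oplus>\<^bsub>V\<^esub> gproj V w n" by simp
  next
    fix c v assume c: "c \<in> carrier k" and v: "v \<in> carrier V"
    have "gproj V (c \<odot>\<^bsub>V\<^esub> v) = (\<lambda>n. c \<odot>\<^bsub>V\<^esub> gproj V v n)"
    proof (rule gproj_unique)
      show "c \<odot>\<^bsub>V\<^esub> v = finsum V (\<lambda>n. c \<odot>\<^bsub>V\<^esub> gproj V v n) (gsupp V)"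
        by (rule trans[OF arg_cong[OF gproj_prop(2)[OF v], of "\<lambda>x. c \<odot>\<^bsub>V\<^esub> x"]],
            rule finsum_push[OF grade_module grade_module lin_smult[OF grade_module lin_id c] gsupp_finite], rule gc[OF v])
    qed (use c v gproj_prop(1) grade_smult in auto)
    then show "gproj V (c \<odot>\<^bsub>V\<^esub> v) n = c \<odot>\<^bsub>V\<^esub> gproj V v n" by simp
  qed (rule gc)
qed

lemma gproj_homog:
  assumes v: "v \<in> grade V m"
  shows "gproj V v n = (if n = m then v else \<zero>\<^bsub>V\<^esub>)"
proof -
  have "gproj V v = (\<lambda>n. if n = m then v else \<zero>\<^bsub>V\<^esub>)"
  proof (rule gproj_unique)
    show "v = (\<Oplus>\<^bsub>V\<^esub>n\<in>gsupp V. if n = m then v else \<zero>\<^bsub>V\<^esub>)"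
      using finsum_single[OF grade_module gsupp_finite, of m "\<lambda>n. if n = m then v else \<zero>\<^bsub>V\<^esub>"] not_gsupp[OF _ v] grade_carrier[OF v]
      by auto
  qed (use grade_carrier[OF v] v grade_zero in auto)
  then show ?thesis by simp
qed

lemma gproj_act:
  assumes h: "h \<in> carrier H" and v: "v \<in> carrier V"
  shows "gproj V (act V h v) n = act V h (gproj V v n)"
proof -
  note gc = gproj_prop(1)[OF v, THEN grade_carrier]
  have "gproj V (act V h v) = (\<lambda>n. act V h (gproj V v n))"
  proof (rule gproj_unique)
    show "act V h v = (\<Oplus>\<^bsub>V\<^esub>n\<in>gsupp V. act V h (gproj V v n))"
      by (rule trans[OF arg_cong[OF gproj_prop(2)[OF v], of "act V h"]],
          rule finsum_push[OF grade_module grade_module act_lin[OF grade_hact h] gsupp_finite], rule gc)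
  qed (use h v gproj_prop(1) grade_act' grade_hact in auto)
  then show ?thesis by simp
qed

end

text \<open>The decomposition is supplied by linear projections \<open>P n\<close>. The finite set
  \<open>F\<close> may be larger than the support, so that \<open>gsupp\<close> of a constructed
  object never has to be computed.\<close>

lemma hmodI:
  fixes V :: "('k, 'h, 'v, 'm) gmod_scheme"
  assumes V: "hact V" and gr: "\<And>n. submodule (grade V n) k V"
    and ga: "\<And>h n v. h \<in> carrier H \<Longrightarrow> v \<in> grade V n \<Longrightarrow> act V h v \<in> grade V n"
    and F: "finite F" and P: "\<And>n v. v \<in> carrier V \<Longrightarrow> P n v \<in> grade V n" "\<And>n. lin V V (P n)"
      "\<And>v. v \<in> carrier V \<Longrightarrow> v = finsum V (\<lambda>n. P n v) F"
      "\<And>m n v. v \<in> grade V m \<Longrightarrow> P n v = (if n = m then v else \<zero>\<^bsub>V\<^esub>)"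
  shows "hmod k H V"
proof -
  have m: "module k V" using V by simp
  have gc: "v \<in> grade V n \<Longrightarrow> v \<in> carrier V" for v n
    using module.submoduleE(1)[OF m gr] by auto
  have "\<zero>\<^bsub>V\<^esub> \<in> grade V n" for n using gr[of n] by (auto simp: submodule_def subgroup_def)
  \<comment> \<open>A homogeneous element of degree outside \<open>F\<close> is the sum of its
    projections over \<open>F\<close>, all of which vanish.\<close>
  have sub: "gsupp V \<subseteq> F"
  proof
    fix n assume n: "n \<in> gsupp V"
    then obtain v where v: "v \<in> grade V n" "v \<noteq> \<zero>\<^bsub>V\<^esub>"
      using \<open>\<zero>\<^bsub>V\<^esub> \<in> grade V n\<close> unfolding gsupp_def by auto
    have "v = \<zero>\<^bsub>V\<^esub>" if "n \<notin> F"
      using P(3)[OF gc[OF v(1)]] that by (subst (asm) finsum_zero'[OF m]) (auto simp: P(4)[OF v(1)])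
    then show "n \<in> F" using v by blast
  qed
  then have fin: "finite (gsupp V)" using F finite_subset by blast
  have ns: "v = \<zero>\<^bsub>V\<^esub>" if "n \<notin> gsupp V" "v \<in> grade V n" for n v using that by (auto simp: gsupp_def)
  have "\<exists>!c. (\<forall>n. c n \<in> grade V n) \<and> v = (\<Oplus>\<^bsub>V\<^esub>n\<in>gsupp V. c n)" if v: "v \<in> carrier V" for v
  proof (rule ex1I[of _ "\<lambda>n. P n v"])
    interpret V: module k V by fact
    have "v = finsum V (\<lambda>n. P n v) F" by (rule P(3)[OF v])
    also have "\<dots> = finsum V (\<lambda>n. P n v) (gsupp V)"
      by (rule V.M.add.finprod_mono_neutral_cong_right[OF F sub]) (use ns P(1)[OF v] gc[OF P(1)[OF v]] in auto)
    finally show "(\<forall>n. P n v \<in> grade V n) \<and> v = (\<Oplus>\<^bsub>V\<^esub>n\<in>gsupp V. P n v)" using P(1)[OF v] by auto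
    fix c assume c: "(\<forall>n. c n \<in> grade V n) \<and> v = (\<Oplus>\<^bsub>V\<^esub>n\<in>gsupp V. c n)"
    show "c = (\<lambda>n. P n v)"
    proof
      fix n
      have cg: "c i \<in> grade V i" for i using c by simp
      \<comment> \<open>Uniqueness: the projection \<open>P n\<close> kills all terms of a competing
        decomposition except the one of degree \<open>n\<close>.\<close>
      have "P n v = P n (finsum V c (gsupp V))" using c by simp
      also have "\<dots> = finsum V (\<lambda>i. P n (c i)) (gsupp V)"
        by (rule finsum_push[OF m m P(2) fin]) (use c gc in auto)
      also have "\<dots> = P n (c n)"
        by (rule finsum_single[OF m fin]) (use ns[OF _ cg] in \<open>auto simp: P(4)[OF cg] gc[OF cg] lin_zero[OF m m P(2)]\<close>)
      finally show "c n = P n v" using c P(4)[of "c n" n n] by simp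
    qed
  qed
  then show ?thesis
    unfolding hmod_def hmod_axioms_def
    using m gr ga fin V act_lin[OF V] hact_bil[OF V] linD(2,3)[OF bil_lin1[OF hact_bil[OF V]]]
    by (auto simp: act_act)
qed

lemma ihom_grade_iff: "L \<in> grade (ihom k H V W) n \<longleftrightarrow> L \<in> carrier (ihom k H V W) \<and> (\<forall>m. \<forall>v\<in>grade V m. L v \<in> grade W (m + n))"
  by (auto simp: ihom_simps(6))

text \<open>Boundedness of both modules makes every linear map a finite sum of homogeneous ones,
  since only differences of supported degrees occur.\<close>

lemma ihom_hmod:
  fixes V :: "('k, 'h, 'v, 'm) gmod_scheme" and W :: "('k, 'h, 'w, 'n) gmod_scheme"
  assumes V: "hmod k H V" and W: "hmod k H W"
  shows "hmod k H (ihom k H V W)"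
proof -
  note [simp] = grade_hact[OF V] grade_hact[OF W] grade_module[OF V] grade_module[OF W]
  let ?E = "ihom k H V W"
  let ?F = "(\<lambda>(l, m). l - m) ` (gsupp W \<times> gsupp V)"
  \<comment> \<open>The part of degree \<open>n\<close>: the component of degree \<open>m\<close> is
    mapped by \<open>L\<close> and projected to degree \<open>m + n\<close>.\<close>
  let ?P = "\<lambda>n L. \<lambda>v\<in>carrier V. \<Oplus>\<^bsub>W\<^esub>m\<in>gsupp V. gproj W (L (gproj V v m)) (m + n)"
  have gc: "v \<in> grade V n \<Longrightarrow> v \<in> carrier V" "w \<in> grade W n \<Longrightarrow> w \<in> carrier W" for v w n
    using grade_carrier[OF V] grade_carrier[OF W] by auto
  have pc: "v \<in> carrier V \<Longrightarrow> gproj V v n \<in> carrier V" "w \<in> carrier W \<Longrightarrow> gproj W w n \<in> carrier W" for v w n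
    by (rule gc(1)[OF gproj_prop(1)[OF V]], assumption) (rule gc(2)[OF gproj_prop(1)[OF W]], assumption)
  have Plin: "lin V W (\<lambda>v. \<Oplus>\<^bsub>W\<^esub>m\<in>gsupp V. gproj W (L (gproj V v m)) (m + n))" if L: "L \<in> carrier ?E" for L n
    by (rule lin_finsum[OF _ _ gsupp_finite[OF V]])
       (simp, simp, rule lin_comp[OF lin_comp[OF gproj_lin[OF V] ihom_lin[OF L]] gproj_lin[OF W]])
  have Pc: "?P n L \<in> carrier ?E" if "L \<in> carrier ?E" for n L
    using that by (intro ihomI Plin) simp_all
  have Ph: "?P n L v = gproj W (L v) (m + n)" if L: "L \<in> carrier ?E" and v: "v \<in> grade V m" for n L m v
  proof -
    have "(\<Oplus>\<^bsub>W\<^esub>m'\<in>gsupp V. gproj W (L (gproj V v m')) (m' + n)) = gproj W (L (gproj V v m)) (m + n)"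
    proof (rule finsum_single[OF _ gsupp_finite[OF V]])
      have z: "gproj W (L \<zero>\<^bsub>V\<^esub>) i = \<zero>\<^bsub>W\<^esub>" for i
        by (rule lin_zero[OF _ _ lin_comp[OF ihom_lin[OF L] gproj_lin[OF W]]]) simp_all
      show "i \<noteq> m \<Longrightarrow> gproj W (L (gproj V v i)) (i + n) = \<zero>\<^bsub>W\<^esub>" for i
        using z by (simp add: gproj_homog[OF V v])
      show "m \<notin> gsupp V \<Longrightarrow> gproj W (L (gproj V v m)) (m + n) = \<zero>\<^bsub>W\<^esub>"
        using z not_gsupp[OF V _ v] gproj_homog[OF V v, of m] by simp
      show "gproj W (L (gproj V v m)) (m + n) \<in> carrier W"
        using L gc(1)[OF v] by (intro pc ihom_app[OF L])
    qed simp
    then show ?thesis using gc(1)[OF v] by (simp add: gproj_homog[OF V v])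
  qed
  show ?thesis
  proof (rule hmodI[where P = ?P and F = ?F])
    show "hact ?E" by simp
    show "submodule (grade ?E n) k ?E" for n
      by (rule submodule_criterion)
         (auto simp: ihom_grade_iff ihom_app_op gc intro: grade_zero[OF W] grade_add[OF W] grade_smult[OF W])
    show "act ?E h L \<in> grade ?E n" if "h \<in> carrier H" "L \<in> grade ?E n" for h n L
      using that by (auto simp: ihom_grade_iff ihom_act_app gc grade_act'[OF V] intro!: s2_grade[OF W] grade_act'[OF W])
    show "finite ?F" using gsupp_finite[OF V] gsupp_finite[OF W] by simp
    show "?P n L \<in> grade ?E n" if L: "L \<in> carrier ?E" for n L
      unfolding ihom_grade_iff using Pc[OF L] Ph[OF L] gproj_prop(1)[OF W ihom_app[OF L gc(1)]] by simp
    show "lin ?E ?E (?P n)" for n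
    proof (rule lin_ihomI)
      fix v assume v: "v \<in> carrier V"
      have "lin ?E W (\<lambda>L. \<Oplus>\<^bsub>W\<^esub>m\<in>gsupp V. gproj W (L (gproj V v m)) (m + n))"
        by (rule lin_finsum[OF _ _ gsupp_finite[OF V]])
           (simp, simp, rule lin_comp[OF ihom_app_lin gproj_lin[OF W]], rule pc(1)[OF v])
      then show "lin ?E W (\<lambda>L. ?P n L v)" using v by simp
    qed (simp_all add: Pc)
    show "?P n L = (if n = m then L else \<zero>\<^bsub>?E\<^esub>)" if L: "L \<in> grade ?E m" for m n L
    proof -
      have Lc: "L \<in> carrier ?E" using L by (simp add: ihom_grade_iff)
      have R: "(if n = m then L else \<zero>\<^bsub>?E\<^esub>) \<in> carrier ?E" using Lc by simp
      show ?thesis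
      proof (rule ihom_eqI[OF Pc[OF Lc] R])
        fix v assume v: "v \<in> carrier V"
        show "?P n L v = (if n = m then L else \<zero>\<^bsub>?E\<^esub>) v"
        proof (rule homog_ext[OF V _ ihom_lin[OF Pc[OF Lc]] ihom_lin[OF R] _ v])
          fix j u assume u: "u \<in> grade V j"
          have "L u \<in> grade W (j + m)" using L u by (simp add: ihom_grade_iff)
          then show "?P n L u = (if n = m then L else \<zero>\<^bsub>?E\<^esub>) u"
            using Ph[OF Lc u] gproj_homog[OF W] by (simp add: ihom_app_op gc(1)[OF u])
        qed simp
      qed
    qed
    show "L = finsum ?E (\<lambda>n. ?P n L) ?F" if L: "L \<in> carrier ?E" for L
    proof -
      have fc: "finsum ?E (\<lambda>n. ?P n L) ?F \<in> carrier ?E"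
        by (rule finsum_closed') (simp_all add: Pc[OF L])
      show ?thesis
      proof (rule ihom_eqI[OF L fc])
        fix v assume v: "v \<in> carrier V"
        show "L v = finsum ?E (\<lambda>n. ?P n L) ?F v"
        proof (rule homog_ext[OF V _ ihom_lin[OF L] ihom_lin[OF fc] _ v])
          fix j u assume u: "u \<in> grade V j"
          note uc = gc(1)[OF u]
          interpret W: module k W by simp
          have Lu: "L u \<in> carrier W" by (rule ihom_app[OF L uc])
          have fF: "finite ?F" using gsupp_finite[OF V] gsupp_finite[OF W] by simp
          have "finsum ?E (\<lambda>n. ?P n L) ?F u = finsum W (\<lambda>n. ?P n L u) ?F"
            by (rule finsum_push[OF _ _ ihom_app_lin[OF uc] fF]) (simp_all add: Pc[OF L])
          also have "\<dots> = finsum W (\<lambda>n. gproj W (L u) (j + n)) ?F"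
            by (rule finsum_eq) (simp_all only: Ph[OF L u] pc(2)[OF Lu] grade_module[OF W])
          also have "\<dots> = L u"
          \<comment> \<open>The shift of \<open>?F\<close> by \<open>j\<close> is only known to
            cover the support of \<open>W\<close> if \<open>j\<close> is supported in
            \<open>V\<close>; otherwise \<open>u\<close> is zero and both sides vanish.\<close>
          proof (cases "j \<in> gsupp V")
            case True
            have "finsum W (\<lambda>n. gproj W (L u) (j + n)) ?F = finsum W (gproj W (L u)) ((\<lambda>n. j + n) ` ?F)"
              by (rule W.M.add.finprod_reindex[symmetric]) (auto simp: pc(2)[OF Lu] inj_on_def)
            also have "\<dots> = finsum W (gproj W (L u)) (gsupp W)"
            proof (rule W.M.add.finprod_mono_neutral_cong_right)
              show "gsupp W \<subseteq> (\<lambda>n. j + n) ` ?F"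
              proof
                fix l assume "l \<in> gsupp W"
                then have "l - j \<in> ?F" using True by force
                then show "l \<in> (\<lambda>n. j + n) ` ?F" by (intro image_eqI[of _ _ "l - j"]) auto
              qed
            qed (use fF not_gsupp[OF W _ gproj_prop(1)[OF W Lu]] pc(2)[OF Lu] in auto)
            also have "\<dots> = L u" by (rule gproj_prop(2)[OF W Lu, symmetric])
            finally show ?thesis .
          next
            case False
            then have "u = \<zero>\<^bsub>V\<^esub>" using not_gsupp[OF V _ u] by simp
            then have z: "L u = \<zero>\<^bsub>W\<^esub>" using lin_zero[OF _ _ ihom_lin[OF L]] by simp
            have "gproj W \<zero>\<^bsub>W\<^esub> i = \<zero>\<^bsub>W\<^esub>" for i
              by (rule lin_zero[OF _ _ gproj_lin[OF W]]) simp_all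
            then show ?thesis unfolding z by (intro finsum_zero') simp_all
          qed
          finally show "L u = finsum ?E (\<lambda>n. ?P n L) ?F u" by simp
        qed simp
      qed
    qed
  qed
qed

subsection \<open>Graded subobjects, products and the shifted unit\<close>

text \<open>A comparison field by field rather than an equality of records, because the two objects
  may have different record extensions: \<open>hom_over\<close> carries two actions that the
  internal hom does not have.\<close>

definition hsub :: "('k, 'h, 'v, 'n) gmod_scheme \<Rightarrow> ('k, 'h, 'v, 'm) gmod_scheme \<Rightarrow> bool" where
  "hsub W V \<longleftrightarrow> carrier W \<subseteq> carrier V \<and> add W = add V \<and> \<zero>\<^bsub>W\<^esub> = \<zero>\<^bsub>V\<^esub> \<and> smult W = smult V \<and> act W = act V \<and>
     (\<forall>n. grade W n = grade V n \<inter> carrier W)"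

lemma hsub_s: "hsub W V \<Longrightarrow> s2 W ps T = s2 V ps T" "hsub W V \<Longrightarrow> s3 W qs T' = s3 V qs T'"
  by (simp_all add: hsub_def s2_def s3_def lsum_def)

text \<open>Closure under \<open>gproj\<close> lets the projections of \<open>V\<close> serve as
  projections of \<open>W\<close>.\<close>

lemma hsub_hmod:
  fixes W :: "('k, 'h, 'v, 'n) gmod_scheme" and V :: "('k, 'h, 'v, 'm) gmod_scheme"
  assumes V: "hmod k H V" and s: "hsub W V" and z: "\<zero>\<^bsub>V\<^esub> \<in> carrier W"
    and add: "\<And>x y. x \<in> carrier W \<Longrightarrow> y \<in> carrier W \<Longrightarrow> x \<oplus>\<^bsub>V\<^esub> y \<in> carrier W"
    and sm: "\<And>c x. c \<in> carrier k \<Longrightarrow> x \<in> carrier W \<Longrightarrow> c \<odot>\<^bsub>V\<^esub> x \<in> carrier W"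
    and ac: "\<And>h x. h \<in> carrier H \<Longrightarrow> x \<in> carrier W \<Longrightarrow> act V h x \<in> carrier W"
    and gp: "\<And>n x. x \<in> carrier W \<Longrightarrow> gproj V x n \<in> carrier W"
  shows "hmod k H W"
proof -
  interpret V: module k V by (rule grade_module[OF V])
  note ha = grade_hact[OF V]
  have c: "x \<in> carrier W \<Longrightarrow> x \<in> carrier V" for x using s by (auto simp: hsub_def)
  note [simp] = s[unfolded hsub_def, THEN conjunct2, THEN conjunct1] s[unfolded hsub_def, THEN conjunct2, THEN conjunct2, THEN conjunct1]
    s[unfolded hsub_def, THEN conjunct2, THEN conjunct2, THEN conjunct2, THEN conjunct1]
    s[unfolded hsub_def, THEN conjunct2, THEN conjunct2, THEN conjunct2, THEN conjunct2, THEN conjunct1]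
    s[unfolded hsub_def, THEN conjunct2, THEN conjunct2, THEN conjunct2, THEN conjunct2, THEN conjunct2, rule_format]
  have neg: "\<ominus>\<^bsub>V\<^esub> x \<in> carrier W" if "x \<in> carrier W" for x
    using sm[OF R.a_inv_closed[OF R.one_closed] that] V.smult_l_minus[of "\<one>\<^bsub>k\<^esub>" x] c[OF that] by simp
  have ab: "abelian_group W"
  proof (rule abelian_groupI)
    show "\<exists>y\<in>carrier W. y \<oplus>\<^bsub>W\<^esub> x = \<zero>\<^bsub>W\<^esub>" if "x \<in> carrier W" for x
      using neg[OF that] V.M.l_neg[OF c[OF that]] by auto
  qed (use z add c in \<open>auto simp: V.M.a_ac\<close>)
  have mW: "module k W"
    by (rule moduleI[OF is_cring ab]) (use sm c V.smult_l_distr V.smult_r_distr V.smult_assoc1 in auto)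
  have hW: "hact W"
  proof (rule hactI[OF mW])
    show "bil H W W (act W)"
      by (intro bilI linI) (use c ac linD(2,3)[OF act_lin[OF ha]] linD(2,3)[OF bil_lin1[OF hact_bil[OF ha]]] in auto)
  qed (use c act_act[OF ha] ha in auto)
  have idl: "lin W V (\<lambda>x. x)" by (rule linI) (auto simp: c)
  show ?thesis
  proof (rule hmodI[OF hW, where P = "\<lambda>n v. gproj V v n" and F = "gsupp V"])
    show "submodule (grade W n) k W" for n
      by (rule submodule_criterion[OF mW])
         (auto intro: z grade_zero[OF V] grade_add[OF V] add grade_smult[OF V] sm)
    show "v = finsum W (gproj V v) (gsupp V)" if v: "v \<in> carrier W" for v
      by (rule trans[OF gproj_prop(2)[OF V c[OF v]]], rule finsum_push[symmetric, OF mW V.module_axioms idl gsupp_finite[OF V]], rule gp[OF v])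
    show "lin W W (\<lambda>v. gproj V v n)" for n
      by (rule linI) (use c gp linD(2,3)[OF gproj_lin[OF V]] in auto)
  qed (use gproj_prop(1)[OF V c] gp ac gproj_homog[OF V] grade_act'[OF V] gsupp_finite[OF V] in auto)
qed

lemma shifted_unit_simps [simp]:
  "carrier (shifted_unit k H n) = carrier k" "\<zero>\<^bsub>shifted_unit k H n\<^esub> = \<zero>\<^bsub>k\<^esub>" "add (shifted_unit k H n) = add k"
  "smult (shifted_unit k H n) = monoid.mult k" "act (shifted_unit k H n) h c = counit H h \<otimes>\<^bsub>k\<^esub> c"
  "grade (shifted_unit k H n) m = (if m = n then carrier k else {\<zero>\<^bsub>k\<^esub>})"
  by (simp_all add: shifted_unit_def)

lemma shifted_unit_hmod: "hmod k H (shifted_unit k H n)"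
proof -
  let ?I = "shifted_unit k H n"
  have ab: "abelian_group ?I"
  proof (rule abelian_groupI)
    show "\<exists>y\<in>carrier ?I. y \<oplus>\<^bsub>?I\<^esub> x = \<zero>\<^bsub>?I\<^esub>" if "x \<in> carrier ?I" for x
      using that R.l_neg by auto
  qed (auto simp: R.a_ac)
  have m: "module k ?I"
    by (rule moduleI[OF R.is_cring ab]) (auto simp: R.l_distr R.r_distr R.m_assoc)
  have h: "hact ?I"
  proof (rule hactI[OF m])
    show "bil H ?I ?I (act ?I)"
      by (intro bilI linI) (auto simp: R.r_distr R.l_distr R.m_lcomm R.m_assoc counit_add counit_smult)
  qed (auto simp: R.m_assoc)
  show ?thesis
  proof (rule hmodI[OF h, where P = "\<lambda>m c. if m = n then c else \<zero>\<^bsub>k\<^esub>" and F = "{n}"])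
    show "submodule (grade ?I m) k ?I" for m by (rule submodule_criterion[OF m]) auto
    show "lin ?I ?I (\<lambda>c. if m = n then c else \<zero>\<^bsub>k\<^esub>)" for m by (rule linI) auto
    show "v = finsum ?I (\<lambda>m. if m = n then v else \<zero>\<^bsub>k\<^esub>) {n}" if "v \<in> carrier ?I" for v
      using finsum_single[OF m, of "{n}" n "\<lambda>m. if m = n then v else \<zero>\<^bsub>k\<^esub>"] that by simp
  qed auto
qed

lemma gprod_simps [simp]:
  "carrier (gprod V W) = carrier V \<times> carrier W" "\<zero>\<^bsub>gprod V W\<^esub> = (\<zero>\<^bsub>V\<^esub>, \<zero>\<^bsub>W\<^esub>)"
  "x \<oplus>\<^bsub>gprod V W\<^esub> y = (fst x \<oplus>\<^bsub>V\<^esub> fst y, snd x \<oplus>\<^bsub>W\<^esub> snd y)"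
  "c \<odot>\<^bsub>gprod V W\<^esub> x = (c \<odot>\<^bsub>V\<^esub> fst x, c \<odot>\<^bsub>W\<^esub> snd x)"
  "act (gprod V W) h x = (act V h (fst x), act W h (snd x))"
  "grade (gprod V W) n = grade V n \<times> grade W n"
  by (simp_all add: gprod_def)

lemma gprod_hmod:
  fixes V :: "('k, 'h, 'v, 'm) gmod_scheme" and W :: "('k, 'h, 'w, 'n) gmod_scheme"
  assumes V: "hmod k H V" and W: "hmod k H W"
  shows "hmod k H (gprod V W)"
proof -
  let ?I = "gprod V W"
  interpret V: module k V by (rule grade_module[OF V])
  interpret W: module k W by (rule grade_module[OF W])
  have ab: "abelian_group ?I"
  proof (rule abelian_groupI)
    show "\<exists>y\<in>carrier ?I. y \<oplus>\<^bsub>?I\<^esub> x = \<zero>\<^bsub>?I\<^esub>" if "x \<in> carrier ?I" for x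
      using that V.M.l_neg W.M.l_neg by (intro bexI[of _ "(\<ominus>\<^bsub>V\<^esub> fst x, \<ominus>\<^bsub>W\<^esub> snd x)"]) auto
  qed (auto simp: V.M.a_ac W.M.a_ac)
  have m: "module k ?I"
    by (rule moduleI[OF R.is_cring ab])
       (auto simp: V.smult_l_distr V.smult_r_distr V.smult_assoc1 W.smult_l_distr W.smult_r_distr W.smult_assoc1)
  note hV = grade_hact[OF V] and hW = grade_hact[OF W]
  have h: "hact ?I"
  proof (rule hactI[OF m])
    show "bil H ?I ?I (act ?I)"
      by (intro bilI linI)
         (use linD(2,3)[OF act_lin[OF hV]] linD(2,3)[OF bil_lin1[OF hact_bil[OF hV]]]
           linD(2,3)[OF act_lin[OF hW]] linD(2,3)[OF bil_lin1[OF hact_bil[OF hW]]] hV hW in auto)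
  qed (use hV hW in \<open>auto simp: act_act\<close>)
  \<comment> \<open>The support of a product lies in the union of the supports; the missing
    components on either side are zero.\<close>
  let ?F = "gsupp V \<union> gsupp W"
  have F: "finite ?F" using gsupp_finite[OF V] gsupp_finite[OF W] by simp
  have pc: "v \<in> carrier V \<Longrightarrow> gproj V v n \<in> carrier V" "w \<in> carrier W \<Longrightarrow> gproj W w n \<in> carrier W" for v w n
    using gproj_prop(1)[OF V, THEN grade_carrier[OF V]] gproj_prop(1)[OF W, THEN grade_carrier[OF W]] by auto
  show ?thesis
  proof (rule hmodI[OF h, where P = "\<lambda>n x. (gproj V (fst x) n, gproj W (snd x) n)" and F = ?F])
    show "submodule (grade ?I n) k ?I" for n
      by (rule submodule_criterion[OF m])
         (auto intro: grade_zero[OF V] grade_add[OF V] grade_smult[OF V] grade_carrier[OF V]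
           grade_zero[OF W] grade_add[OF W] grade_smult[OF W] grade_carrier[OF W])
    show "lin ?I ?I (\<lambda>x. (gproj V (fst x) n, gproj W (snd x) n))" for n
      by (rule linI) (auto simp: linD(2,3)[OF gproj_lin[OF V]] linD(2,3)[OF gproj_lin[OF W]] pc)
    show "x = finsum ?I (\<lambda>n. (gproj V (fst x) n, gproj W (snd x) n)) ?F" if x: "x \<in> carrier ?I" for x
    proof -
      have l1: "lin ?I V fst" and l2: "lin ?I W snd" by (rule linI; auto)+
      have xc: "fst x \<in> carrier V" "snd x \<in> carrier W" using x by auto
      have "fst (finsum ?I (\<lambda>n. (gproj V (fst x) n, gproj W (snd x) n)) ?F) = finsum V (gproj V (fst x)) ?F"
        using finsum_push[OF m V.module_axioms l1 F, of "\<lambda>n. (gproj V (fst x) n, gproj W (snd x) n)"] xc pc by simp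
      also have "\<dots> = finsum V (gproj V (fst x)) (gsupp V)"
        by (rule V.M.add.finprod_mono_neutral_cong_right[OF F])
           (use not_gsupp[OF V _ gproj_prop(1)[OF V xc(1)]] pc xc in auto)
      finally have 1: "fst (finsum ?I (\<lambda>n. (gproj V (fst x) n, gproj W (snd x) n)) ?F) = fst x"
        by (simp only: gproj_prop(2)[OF V xc(1), symmetric])
      have "snd (finsum ?I (\<lambda>n. (gproj V (fst x) n, gproj W (snd x) n)) ?F) = finsum W (gproj W (snd x)) ?F"
        using finsum_push[OF m W.module_axioms l2 F, of "\<lambda>n. (gproj V (fst x) n, gproj W (snd x) n)"] xc pc by simp
      also have "\<dots> = finsum W (gproj W (snd x)) (gsupp W)"
        by (rule W.M.add.finprod_mono_neutral_cong_right[OF F])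
           (use not_gsupp[OF W _ gproj_prop(1)[OF W xc(2)]] pc xc in auto)
      finally show ?thesis using 1 by (intro prod_eqI) (simp_all only: gproj_prop(2)[OF W xc(2), symmetric])
    qed
  qed (use F gproj_prop(1)[OF V] gproj_prop(1)[OF W] gproj_homog[OF V] gproj_homog[OF W] grade_act'[OF V] grade_act'[OF W] in auto)
qed

end

section \<open>Braided multilinear maps\<close>

context quasitriangular_quasi_hopf
begin

text \<open>The Koszul sign as a case distinction instead of an integer multiple, so that linear
  maps pass through it by \<open>lin_minus\<close>.\<close>

definition ksgn :: "('x, 'm) ring_scheme \<Rightarrow> int \<Rightarrow> int \<Rightarrow> 'x \<Rightarrow> 'x" where
  "ksgn U p q u = (if odd p \<and> odd q then \<ominus>\<^bsub>U\<^esub> u else u)"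

lemma ksgn_lin [lin_rules]: "module k U \<Longrightarrow> lin X U f \<Longrightarrow> lin X U (\<lambda>x. ksgn U p q (f x))"
  by (cases "odd p"; cases "odd q"; simp add: ksgn_def lin_uminus)

lemma ksgn_closed [simp]: "module k U \<Longrightarrow> u \<in> carrier U \<Longrightarrow> ksgn U p q u \<in> carrier U"
  by (rule lin_closed[OF ksgn_lin[OF _ lin_id]])

lemma ksgn_push: "lin X U g \<Longrightarrow> module k X \<Longrightarrow> module k U \<Longrightarrow> x \<in> carrier X \<Longrightarrow> g (ksgn X p q x) = ksgn U p q (g x)"
  by (simp add: ksgn_def lin_minus)

lemma ksgn_s:
  "module k U \<Longrightarrow> (\<And>a b. a \<in> carrier H \<Longrightarrow> b \<in> carrier H \<Longrightarrow> T a b \<in> carrier U) \<Longrightarrow>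
     s2 U ps (\<lambda>a b. ksgn U p q (T a b)) = ksgn U p q (s2 U ps T)"
  "module k U \<Longrightarrow> (\<And>a b c. a \<in> carrier H \<Longrightarrow> b \<in> carrier H \<Longrightarrow> c \<in> carrier H \<Longrightarrow> T' a b c \<in> carrier U) \<Longrightarrow>
     s3 U qs (\<lambda>a b c. ksgn U p q (T' a b c)) = ksgn U p q (s3 U qs T')"
  by (rule s2_push[OF ksgn_lin[OF _ lin_id], symmetric] s3_push[OF ksgn_lin[OF _ lin_id], symmetric]; assumption)+

lemma ksgn_add:
  assumes "module k U" "u \<in> carrier U"
  shows "ksgn U (p + q) r u = ksgn U q r (ksgn U p r u)" "ksgn U p (q + r) u = ksgn U p q (ksgn U p r u)"
    "ksgn U p q (ksgn U p q u) = u"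
proof -
  interpret U: module k U by fact
  show "ksgn U (p + q) r u = ksgn U q r (ksgn U p r u)" "ksgn U p (q + r) u = ksgn U p q (ksgn U p r u)"
    "ksgn U p q (ksgn U p q u) = u"
    using assms(2) by (auto simp: ksgn_def)
qed

lemma ksgn_comm: "ksgn U p q u = ksgn U q p u"
  by (auto simp: ksgn_def)

lemma add_pow_koszul: "module k Z \<Longrightarrow> u \<in> carrier Z \<Longrightarrow> [koszul p q] \<cdot>\<^bsub>Z\<^esub> u = ksgn Z p q u"
proof -
  assume "module k Z" and u: "u \<in> carrier Z"
  then interpret Z: module k Z by simp
  show ?thesis using u Z.M.add.int_pow_neg[of u 1] Z.M.add.int_pow_1[of u] by (simp add: koszul_def ksgn_def a_inv_def add_pow_def)
qed

text \<open>Precomposition of a bilinear map with the braiding, see \<open>braid_Br\<close>.\<close>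

definition Br where
  "Br X Y U b x y = (\<Oplus>\<^bsub>U\<^esub>p\<in>gsupp X. \<Oplus>\<^bsub>U\<^esub>q\<in>gsupp Y. ksgn U p q
     (s2 U Rl (\<lambda>r s. b (act Y s (gproj Y y q)) (act X r (gproj X x p)))))"

context
  fixes X :: "('k, 'h, 'x, 'm) gmod_scheme" and Y :: "('k, 'h, 'y, 'n) gmod_scheme"
    and U :: "('k, 'u, 'l) module_scheme"
  assumes X: "hmod k H X" and Y: "hmod k H Y" and U [simp]: "module k U"
begin

private lemmas ha [simp] = grade_hact[OF X] grade_hact[OF Y]
private lemmas gc [simp] = grade_carrier[OF X] grade_carrier[OF Y]
private lemmas pc [simp] = gproj_prop(1)[OF X, THEN grade_carrier[OF X]] gproj_prop(1)[OF Y, THEN grade_carrier[OF Y]]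

lemma Br_cong:
  assumes "x \<in> carrier X" "y \<in> carrier Y" "\<And>x y. x \<in> carrier X \<Longrightarrow> y \<in> carrier Y \<Longrightarrow> b y x = b' y x"
  shows "Br X Y U b x y = Br X Y U b' x y"
  using assms by (simp add: Br_def)

text \<open>All but one of the components of \<open>x\<close> and of \<open>y\<close> vanish, so the
  double sum reduces to one sign and one sum over the R-matrix.\<close>

lemma Br_homog:
  assumes x: "x \<in> grade X p" and y: "y \<in> grade Y q"
    and b: "\<And>x y. x \<in> carrier X \<Longrightarrow> y \<in> carrier Y \<Longrightarrow> b y x \<in> carrier U" and z: "\<And>x. x \<in> carrier X \<Longrightarrow> b \<zero>\<^bsub>Y\<^esub> x = \<zero>\<^bsub>U\<^esub>"
      "\<And>y. y \<in> carrier Y \<Longrightarrow> b y \<zero>\<^bsub>X\<^esub> = \<zero>\<^bsub>U\<^esub>"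
  shows "Br X Y U b x y = ksgn U p q (s2 U Rl (\<lambda>r s. b (act Y s y) (act X r x)))"
proof -
  interpret X: module k X by (rule grade_module[OF X])
  interpret Y: module k Y by (rule grade_module[OF Y])
  interpret U: module k U by (rule U)
  have az: "act X h \<zero>\<^bsub>X\<^esub> = \<zero>\<^bsub>X\<^esub>" "act Y h \<zero>\<^bsub>Y\<^esub> = \<zero>\<^bsub>Y\<^esub>" if "h \<in> carrier H" for h
    by (rule lin_zero[OF _ _ act_lin[OF _ that]]; simp)+
  have sz: "ksgn U i j \<zero>\<^bsub>U\<^esub> = \<zero>\<^bsub>U\<^esub>" for i j by (simp add: ksgn_def)
  let ?t = "\<lambda>i j. ksgn U i j (s2 U Rl (\<lambda>r s. b (act Y s (gproj Y y j)) (act X r (gproj X x i))))"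
  have tc: "?t i j \<in> carrier U" for i j using x y by (simp add: b)
  have t0: "?t i j = \<zero>\<^bsub>U\<^esub>" if "i \<noteq> p \<or> j \<noteq> q" for i j
  proof -
    have "s2 U Rl (\<lambda>r s. b (act Y s (gproj Y y j)) (act X r (gproj X x i))) = \<zero>\<^bsub>U\<^esub>"
      by (rule s2_zero) (use that x y in \<open>auto simp: gproj_homog[OF X x] gproj_homog[OF Y y] az z\<close>)
    then show ?thesis by (simp add: sz)
  qed
  \<comment> \<open>If the degree lies outside the support, the expected term is missing from the
    sum; but then the element is zero, and so is the term.\<close>
  have tp: "?t i j = \<zero>\<^bsub>U\<^esub>" if "i = p \<and> i \<notin> gsupp X \<or> j = q \<and> j \<notin> gsupp Y" for i j
  proof -
    have "x = \<zero>\<^bsub>X\<^esub> \<or> y = \<zero>\<^bsub>Y\<^esub>" using that not_gsupp[OF X _ x] not_gsupp[OF Y _ y] by auto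
    then have "s2 U Rl (\<lambda>r s. b (act Y s (gproj Y y j)) (act X r (gproj X x i))) = \<zero>\<^bsub>U\<^esub>"
      by (intro s2_zero) (use x y in \<open>auto simp: gproj_homog[OF X x] gproj_homog[OF Y y] az z\<close>)
    then show ?thesis by (simp add: sz)
  qed
  have 1: "(\<Oplus>\<^bsub>U\<^esub>j\<in>gsupp Y. ?t i j) = ?t i q" for i
    by (rule finsum_single[OF U gsupp_finite[OF Y]]) (use t0 tp tc in auto)
  have "Br X Y U b x y = (\<Oplus>\<^bsub>U\<^esub>i\<in>gsupp X. ?t i q)"
    unfolding Br_def by (rule finsum_eq[OF U 1 tc])
  also have "\<dots> = ?t p q"
    by (rule finsum_single[OF U gsupp_finite[OF X]]) (use t0 tp tc in auto)
  finally show ?thesis by (simp add: gproj_homog[OF X x] gproj_homog[OF Y y])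
qed

lemma bil_zero:
  assumes "bil Y X U b"
  shows "x \<in> carrier X \<Longrightarrow> b \<zero>\<^bsub>Y\<^esub> x = \<zero>\<^bsub>U\<^esub>" "y \<in> carrier Y \<Longrightarrow> b y \<zero>\<^bsub>X\<^esub> = \<zero>\<^bsub>U\<^esub>"
  using lin_zero[OF _ _ bil_lin1[OF assms], of x] lin_zero[OF _ _ bil_lin2[OF assms], of y] by simp_all

lemma Br_homog_bil:
  assumes "bil Y X U b" "x \<in> grade X p" "y \<in> grade Y q"
  shows "Br X Y U b x y = ksgn U p q (s2 U Rl (\<lambda>r s. b (act Y s y) (act X r x)))"
  by (rule Br_homog[OF assms(2,3)]) (simp_all add: bil_closed[OF assms(1)] bil_zero[OF assms(1)])

lemma Br_param:
  assumes "\<And>x y. x \<in> carrier X \<Longrightarrow> y \<in> carrier Y \<Longrightarrow> lin Z U (\<lambda>z. b z y x)" "x \<in> carrier X" "y \<in> carrier Y" "module k Z"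
  shows "lin Z U (\<lambda>z. Br X Y U (b z) x y)"
  unfolding Br_def
  by (intro lin_finsum lin_s2 ksgn_lin) (simp_all add: assms gsupp_finite[OF X] gsupp_finite[OF Y])

lemma Br_bil:
  assumes b: "bil Y X U b"
  shows "bil X Y U (Br X Y U b)"
proof -
  note [lin_rules] = bil_linr[OF b]
  note [simp] = bil_closed[OF b]
  show ?thesis
    unfolding Br_def[abs_def]
    by (rule bilI; intro lin_finsum lin_s2 ksgn_lin bil_linr[OF b] act_linr gproj_lin)
       (simp_all add: gsupp_finite[OF X] gsupp_finite[OF Y] X Y grade_module[OF X] grade_module[OF Y])
qed

lemmas Br_linr = bil_linr[OF Br_bil]
lemmas Br_closed = bil_closed[OF Br_bil]

lemma Br_eqI:
  assumes f: "bil X Y U f" and g: "bil X Y U g"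
    and e: "\<And>p q x y. x \<in> grade X p \<Longrightarrow> y \<in> grade Y q \<Longrightarrow> f x y = g x y" and x: "x \<in> carrier X" and y: "y \<in> carrier Y"
  shows "f x y = g x y"
proof (rule homog_ext[OF X U bil_lin1[OF f y] bil_lin1[OF g y] _ x])
  fix p x assume xp: "x \<in> grade X p"
  show "f x y = g x y"
    by (rule homog_ext[OF Y U bil_lin2[OF f] bil_lin2[OF g] _ y]) (use xp in \<open>auto intro: e\<close>)
qed

lemma Br_push:
  fixes U' :: "('k, 'v, 'j) module_scheme"
  assumes b: "bil Y X U b" and g: "lin U U' g" and [simp]: "module k U'" and x: "x \<in> carrier X" and y: "y \<in> carrier Y"
  shows "g (Br X Y U b x y) = Br X Y U' (\<lambda>y x. g (b y x)) x y"
proof -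
  note [simp] = bil_closed[OF b]
  have c: "ksgn U p q (s2 U Rl (\<lambda>r s. b (act Y s (gproj Y y q)) (act X r (gproj X x p)))) \<in> carrier U" for p q
    using x y by simp
  have e: "g (ksgn U p q (s2 U Rl (\<lambda>r s. b (act Y s (gproj Y y q)) (act X r (gproj X x p))))) =
    ksgn U' p q (s2 U' Rl (\<lambda>r s. g (b (act Y s (gproj Y y q)) (act X r (gproj X x p)))))" for p q
    using x y by (simp add: ksgn_push[OF g] s2_push[OF g])
  have c': "ksgn U' p q (s2 U' Rl (\<lambda>r s. g (b (act Y s (gproj Y y q)) (act X r (gproj X x p))))) \<in> carrier U'" for p q
    using lin_closed[OF g c, of p q] by (simp add: e)
  have i: "g (\<Oplus>\<^bsub>U\<^esub>q\<in>gsupp Y. ksgn U p q (s2 U Rl (\<lambda>r s. b (act Y s (gproj Y y q)) (act X r (gproj X x p))))) =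
    (\<Oplus>\<^bsub>U'\<^esub>q\<in>gsupp Y. ksgn U' p q (s2 U' Rl (\<lambda>r s. g (b (act Y s (gproj Y y q)) (act X r (gproj X x p))))))" for p
    by (subst finsum_push[OF U _ g gsupp_finite[OF Y] c], simp, rule finsum_eq) (simp_all only: e c' assms)
  show ?thesis
    unfolding Br_def
    by (subst finsum_push[OF U _ g gsupp_finite[OF X]], simp, rule finsum_closed'[OF U c], rule finsum_eq[OF _ i])
       (simp, rule finsum_closed'[OF _ c'], simp)
qed

end

text \<open>The link between \<open>braid\<close>, which takes values in a tensor product, and its
  effect on bilinear forms: a linear map is pushed through all sums and signs.\<close>

lemma braid_Br:
  fixes X :: "('k, 'h, 'x, 'm) gmod_scheme" and Y :: "('k, 'h, 'y, 'n) gmod_scheme"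
    and U :: "('k, 'u, 'l) module_scheme"
  assumes X: "hmod k H X" and Y: "hmod k H Y" and U [simp]: "module k U"
    and f: "lin (tensor k Y X) U f" and x: "x \<in> carrier X" and y: "y \<in> carrier Y"
  shows "f (braid k H X Y (tpure k X Y x y)) = Br X Y U (\<lambda>y x. f (tpure k Y X y x)) x y"
proof -
  note [simp] = grade_hact[OF X] grade_hact[OF Y] gproj_prop(1)[OF X, THEN grade_carrier[OF X]] gproj_prop(1)[OF Y, THEN grade_carrier[OF Y]]
  let ?T = "gtensor k H Y X"
  let ?b = "\<lambda>v w. \<Oplus>\<^bsub>?T\<^esub>p\<in>gsupp X. \<Oplus>\<^bsub>?T\<^esub>q\<in>gsupp Y.
           [koszul p q] \<cdot>\<^bsub>?T\<^esub> tlift ?T (\<lambda>a b. tpure k Y X (act Y b (gproj Y w q)) (act X a (gproj X v p))) (rmat H)"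
  have m: "module k ?T" by simp
  have bt: "bil Y X ?T (tpure k Y X)"
    unfolding bil_def lin_gtensor using tpure_bil[of Y X] by (simp add: bil_def)
  have bb: "bil H H ?T (\<lambda>a b. tpure k Y X (act Y b y) (act X a x))" if "x \<in> carrier X" "y \<in> carrier Y" for x y
    using that by (intro bilI bil_linr[OF bt] act_linr lin_id) simp_all
  have tr: "tlift ?T (\<lambda>a b. tpure k Y X (act Y b (gproj Y w q)) (act X a (gproj X v p))) (rmat H) =
      s2 ?T Rl (\<lambda>a b. tpure k Y X (act Y b (gproj Y w q)) (act X a (gproj X v p)))"
    if "v \<in> carrier X" "w \<in> carrier Y" for v w p q
    unfolding Rl_def by (rule tlift_rep2[OF rmat_closed(1) m bb]) (simp_all add: that)
  have c: "s2 ?T Rl (\<lambda>a b. tpure k Y X (act Y b (gproj Y w q)) (act X a (gproj X v p))) \<in> carrier ?T"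
    if "v \<in> carrier X" "w \<in> carrier Y" for v w p q
    by (rule s2_closed[OF m]) (simp add: that)
  have eq: "?b v w = Br X Y ?T (tpure k Y X) v w" if v: "v \<in> carrier X" and w: "w \<in> carrier Y" for v w
    unfolding Br_def tr[OF v w] add_pow_koszul[OF m c[OF v w]] ..
  have mX: "module k X" and mY: "module k Y" by simp_all
  have fg: "lin ?T U f" unfolding lin_gtensor by (rule f)
  have "braid k H X Y (tpure k X Y x y) = ?b x y"
    unfolding braid_def Let_def
    by (rule tlift_tpure[OF mX mY m iffD2[OF bil_cong[OF mX mY eq] Br_bil[OF X Y m bt]] x y])
  also have "\<dots> = Br X Y ?T (tpure k Y X) x y" by (rule eq[OF x y])
  finally show ?thesis by (simp only: Br_push[OF X Y m bt fg U x y])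
qed

text \<open>On homogeneous arguments this is the intertwining relation
  \<open>rmat_comul_sum\<close>; the sign is unaffected because the action preserves
  degrees.\<close>

lemma Br_ebil:
  fixes X :: "('k, 'h, 'x, 'm) gmod_scheme" and Y :: "('k, 'h, 'y, 'n) gmod_scheme"
    and U :: "('k, 'h, 'u, 'l) gmod_scheme"
  assumes X: "hmod k H X" and Y: "hmod k H Y" and U [simp]: "hact U" and b: "ebil Y X U b"
  shows "ebil X Y U (Br X Y U b)"
  unfolding ebil_def
proof (intro conjI ballI)
  note [simp] = grade_hact[OF X] grade_hact[OF Y] grade_carrier[OF X] grade_carrier[OF Y]
  note bb = ebil_bil[OF b]
  note [simp] = bil_closed[OF bb]
  show B: "bil X Y U (Br X Y U b)" by (rule Br_bil[OF X Y _ bb]) simp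
  note Bl = bil_linr[OF B]
  fix h x y assume h [simp]: "h \<in> carrier H" and x: "x \<in> carrier X" and y: "y \<in> carrier Y"
  show "act U h (Br X Y U b x y) = s2 U (Dl h) (\<lambda>h1 h2. Br X Y U b (act X h1 x) (act Y h2 y))"
  proof (rule Br_eqI[OF X Y, where f = "\<lambda>x y. act U h (Br X Y U b x y)"
        and g = "\<lambda>x y. s2 U (Dl h) (\<lambda>h1 h2. Br X Y U b (act X h1 x) (act Y h2 y))", OF _ _ _ _ x y])
    show "bil X Y U (\<lambda>x y. act U h (Br X Y U b x y))"
      by (rule bilI; intro act_linr Bl lin_id) simp_all
    show "bil X Y U (\<lambda>x y. s2 U (Dl h) (\<lambda>h1 h2. Br X Y U b (act X h1 x) (act Y h2 y)))"
      by (rule bilI; intro lin_s2 act_linr Bl lin_id) simp_all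
    fix p q x y assume xp: "x \<in> grade X p" and yq: "y \<in> grade Y q"
    note [simp] = xp[THEN grade_carrier[OF X]] yq[THEN grade_carrier[OF Y]]
    have T: "bil H H U (\<lambda>r s. b (act Y s y) (act X r x))"
      by (rule bilI; intro bil_linr[OF bb] act_linr lin_id) simp_all
    have "act U h (Br X Y U b x y) = ksgn U p q (s2 U Rl (\<lambda>r s. s2 U (Dl h) (\<lambda>h1 h2. b (act Y (h1 \<cdot> s) y) (act X (h2 \<cdot> r) x))))"
      by (simp add: Br_homog_bil[OF X Y _ bb xp yq] ksgn_push[OF act_lin] act_s ebil_act[OF b] act_act)
    also have "\<dots> = ksgn U p q (s2 U (Dl h) (\<lambda>h1 h2. s2 U Rl (\<lambda>r s. b (act Y (h1 \<cdot> s) y) (act X (h2 \<cdot> r) x))))"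
      by (subst s2_s2_swap) simp_all
    also have "\<dots> = ksgn U p q (s2 U Rl (\<lambda>r s. s2 U (Dl h) (\<lambda>h1 h2. b (act Y (s \<cdot> h2) y) (act X (r \<cdot> h1) x))))"
      by (simp add: rmat_comul_sum[OF _ T])
    also have "\<dots> = ksgn U p q (s2 U (Dl h) (\<lambda>h1 h2. s2 U Rl (\<lambda>r s. b (act Y (s \<cdot> h2) y) (act X (r \<cdot> h1) x))))"
      by (subst s2_s2_swap) simp_all
    also have "\<dots> = s2 U (Dl h) (\<lambda>h1 h2. Br X Y U b (act X h1 x) (act Y h2 y))"
      by (simp add: Br_homog_bil[OF X Y _ bb grade_act'[OF X _ xp] grade_act'[OF Y _ yq]] ksgn_s act_act)
    finally show "act U h (Br X Y U b x y) = s2 U (Dl h) (\<lambda>h1 h2. Br X Y U b (act X h1 x) (act Y h2 y))" .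
  qed simp
qed

text \<open>Morphisms preserve degrees and commute with the action, so neither the sign nor the legs
  of the R-matrix distinguish the two sides.\<close>

lemma Br_natural:
  fixes X :: "('k, 'h, 'x, 'm) gmod_scheme" and Y :: "('k, 'h, 'y, 'n) gmod_scheme"
    and X' :: "('k, 'h, 'x', 'm') gmod_scheme" and Y' :: "('k, 'h, 'y', 'n') gmod_scheme"
    and U :: "('k, 'u, 'l) module_scheme"
  assumes X: "hmod k H X" and Y: "hmod k H Y" and X': "hmod k H X'" and Y': "hmod k H Y'"
    and U [simp]: "module k U" and b: "bil Y' X' U b" and f: "hmorph k H X X' f" and g: "hmorph k H Y Y' g"
    and x: "x \<in> carrier X" and y: "y \<in> carrier Y"
  shows "Br X Y U (\<lambda>y x. b (g y) (f x)) x y = Br X' Y' U b (f x) (g y)"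
proof (rule Br_eqI[OF X Y U, where f = "\<lambda>x y. Br X Y U (\<lambda>y x. b (g y) (f x)) x y" and g = "\<lambda>x y. Br X' Y' U b (f x) (g y)", OF _ _ _ x y])
  note fl = f[unfolded hmorph_def, THEN conjunct1] and gl = g[unfolded hmorph_def, THEN conjunct1]
  have fa: "f (act X h v) = act X' h (f v)" if "h \<in> carrier H" "v \<in> carrier X" for h v
    using f that by (simp add: hmorph_def)
  have ga: "g (act Y h v) = act Y' h (g v)" if "h \<in> carrier H" "v \<in> carrier Y" for h v
    using g that by (simp add: hmorph_def)
  have B: "bil Y X U (\<lambda>y x. b (g y) (f x))"
    by (rule bilI; intro bil_linr[OF b] fl gl lin_closed[OF fl] lin_closed[OF gl])
  note [simp] = grade_hact[OF X] grade_hact[OF Y] grade_carrier[OF X] grade_carrier[OF Y]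
  show "bil X Y U (Br X Y U (\<lambda>y x. b (g y) (f x)))" by (rule Br_bil[OF X Y U B])
  show "bil X Y U (\<lambda>x y. Br X' Y' U b (f x) (g y))"
    by (rule bilI; intro Br_linr[OF X' Y' U b] fl gl lin_closed[OF fl] lin_closed[OF gl])
  fix p q x y assume xp: "x \<in> grade X p" and yq: "y \<in> grade Y q"
  have fp: "f x \<in> grade X' p" and gq: "g y \<in> grade Y' q" using f[unfolded hmorph_def] g[unfolded hmorph_def] xp yq by blast+
  show "Br X Y U (\<lambda>y x. b (g y) (f x)) x y = Br X' Y' U b (f x) (g y)"
    using xp[THEN grade_carrier[OF X]] yq[THEN grade_carrier[OF Y]]
    by (simp add: Br_homog_bil[OF X Y U B xp yq] Br_homog_bil[OF X' Y' U b fp gq] fa ga)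
qed

section \<open>Associators and hexagons for multilinear maps\<close>

lemma Fi_Fv:
  fixes X :: "('k, 'h, 'x, 'm) gmod_scheme" and Y :: "('k, 'h, 'y, 'n) gmod_scheme"
    and Z :: "('k, 'h, 'z, 'l) gmod_scheme" and U :: "('k, 'u, 'o) module_scheme"
  assumes [simp]: "hact X" "hact Y" "hact Z" "module k U"
    and T: "\<And>y z. y \<in> carrier Y \<Longrightarrow> z \<in> carrier Z \<Longrightarrow> lin X U (\<lambda>x. T x y z)"
      "\<And>x z. x \<in> carrier X \<Longrightarrow> z \<in> carrier Z \<Longrightarrow> lin Y U (\<lambda>y. T x y z)"
      "\<And>x y. x \<in> carrier X \<Longrightarrow> y \<in> carrier Y \<Longrightarrow> lin Z U (\<lambda>z. T x y z)"
    and [simp]: "x \<in> carrier X" "y \<in> carrier Y" "z \<in> carrier Z"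
  shows "Fi X Y Z U (Fv X Y Z U T) x y z = T x y z" "Fv X Y Z U (Fi X Y Z U T) x y z = T x y z"
proof -
  let ?T = "\<lambda>a b c. T (act X a x) (act Y b y) (act Z c z)"
  have t: "tril U ?T"
    by (rule trilI; rule lin_comp[OF _ T(1)] lin_comp[OF _ T(2)] lin_comp[OF _ T(3)]; (intro act_linr lin_id)?; simp)
  note c = tril_closed[OF t]
  have 1: "s3 U Ps (\<lambda>a b c. s3 U Ph (\<lambda>u v w. ?T (u \<cdot> a) (v \<cdot> b) (w \<cdot> c))) =
      s3 U Ph (\<lambda>u v w. s3 U Ps (\<lambda>a b c. ?T (u \<cdot> a) (v \<cdot> b) (w \<cdot> c)))"
    by (rule s3_s3_swap) (simp_all add: c)
  have 2: "s3 U Ph (\<lambda>a b c. s3 U Ps (\<lambda>u v w. ?T (u \<cdot> a) (v \<cdot> b) (w \<cdot> c))) =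
      s3 U Ps (\<lambda>u v w. s3 U Ph (\<lambda>a b c. ?T (u \<cdot> a) (v \<cdot> b) (w \<cdot> c)))"
    by (rule s3_s3_swap) (simp_all add: c)
  show "Fi X Y Z U (Fv X Y Z U T) x y z = T x y z"
    using phi_cancel(2)[OF _ t] by (simp add: Fi_def Fv_def act_act 2)
  show "Fv X Y Z U (Fi X Y Z U T) x y z = T x y z"
    using phi_cancel(1)[OF _ t] by (simp add: Fi_def Fv_def act_act 1)
qed

text \<open>Braiding \<open>x \<otimes> y\<close> past \<open>z\<close> is, up to reassociation, braiding \<open>y\<close> and then \<open>x\<close> past \<open>z\<close>.\<close>

lemma braid_tensor_left:
  fixes X :: "('k, 'h, 'x, 'm) gmod_scheme" and Y :: "('k, 'h, 'y, 'n) gmod_scheme"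
    and Z :: "('k, 'h, 'z, 'l) gmod_scheme" and M :: "('k, 'h, 'i, 'j) gmod_scheme" and U :: "('k, 'u, 'o) module_scheme"
  assumes X: "hmod k H X" and Y: "hmod k H Y" and Z: "hmod k H Z" and M: "hmod k H M" and U [simp]: "module k U"
    and m: "ebil X Y M m" and gm: "\<And>p q x y. x \<in> grade X p \<Longrightarrow> y \<in> grade Y q \<Longrightarrow> m x y \<in> grade M (p + q)"
    and l: "bil Z M U l" and x: "x \<in> carrier X" and y: "y \<in> carrier Y" and z: "z \<in> carrier Z"
  shows "Br M Z U l (m x y) z = Fi X Y Z U (\<lambda>x y z. Br Y Z U (\<lambda>z y. Fv X Z Y U (\<lambda>x z y. Br X Z U
      (\<lambda>z x. Fi Z X Y U (\<lambda>z x y. l z (m x y)) z x y) x z) x z y) y z) x y z"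
    (is "_ = ?R x y z")
proof -
  note [simp] = grade_hact[OF X] grade_hact[OF Y] grade_hact[OF Z] grade_hact[OF M]
    grade_carrier[OF X] grade_carrier[OF Y] grade_carrier[OF Z] grade_carrier[OF M]
  note mb = ebil_bil[OF m]
  note [simp] = bil_closed[OF mb] bil_closed[OF l]
  note ml = bil_linr[OF mb] bil_linr[OF l] bil_linr[OF Br_bil[OF M Z U l]] act_linr lin_id
  have i1l: "bil Z X U (\<lambda>z x. Fi Z X Y U (\<lambda>z x y. l z (m x y)) z x y)" if "y \<in> carrier Y" for y
    unfolding Fi_def by (rule bilI; intro lin_s3 ml) (simp_all add: that)
  note i1 = i1l
  have i1y: "lin Y U (\<lambda>y. Fi Z X Y U (\<lambda>z x y. l z (m x y)) z x y)" if "x \<in> carrier X" "z \<in> carrier Z" for x z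
    unfolding Fi_def by (intro lin_s3 ml) (simp_all add: that)
  let ?B1 = "\<lambda>x z y. Br X Z U (\<lambda>z x. Fi Z X Y U (\<lambda>z x y. l z (m x y)) z x y) x z"
  have B1: "bil X Z U (\<lambda>x z. ?B1 x z y)" if "y \<in> carrier Y" for y
    by (rule Br_bil[OF X Z U i1[OF that]])
  have B1y: "lin Y U (\<lambda>y. ?B1 x z y)" if "x \<in> carrier X" "z \<in> carrier Z" for x z
    by (rule Br_param[OF X Z U i1y]) (simp_all add: that)
  note B1l = bil_linr[OF B1] lin_comp[OF _ B1y]
  let ?V = "Fv X Z Y U ?B1"
  have V: "bil Z Y U (\<lambda>z y. ?V x z y)" if "x \<in> carrier X" for x
    unfolding Fv_def by (rule bilI; intro lin_s3 B1l act_linr lin_id) (simp_all add: that)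
  have Vx: "lin X U (\<lambda>x. ?V x z y)" if "z \<in> carrier Z" "y \<in> carrier Y" for z y
    unfolding Fv_def by (intro lin_s3 B1l act_linr lin_id) (simp_all add: that)
  let ?B2 = "\<lambda>x y z. Br Y Z U (\<lambda>z y. ?V x z y) y z"
  have B2: "bil Y Z U (\<lambda>y z. ?B2 x y z)" if "x \<in> carrier X" for x
    by (rule Br_bil[OF Y Z U V[OF that]])
  have B2x: "lin X U (\<lambda>x. ?B2 x y z)" if "y \<in> carrier Y" "z \<in> carrier Z" for y z
    by (rule Br_param[OF Y Z U Vx]) (simp_all add: that)
  note B2l = bil_linr[OF B2] lin_comp[OF _ B2x]
  \<comment> \<open>Linearity of the right-hand side in each argument is what permits the
    restriction to homogeneous elements.\<close>
  have Rz: "lin Z U (\<lambda>z. ?R x y z)" and Rxy: "bil X Y U (\<lambda>x y. ?R x y z)"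
    if "x \<in> carrier X" "y \<in> carrier Y" "z \<in> carrier Z" for x y z
    unfolding Fi_def[of X Y Z] by (rule bilI | intro lin_s3 B2l act_linr lin_id; simp add: that)+
  show ?thesis
  proof (rule homog_ext[OF Z U _ Rz[OF x y z] _ z])
    show "lin Z U (\<lambda>z. Br M Z U l (m x y) z)" by (intro ml) (simp_all add: x y)
    fix n z assume zn: "z \<in> grade Z n"
    note zc [simp] = zn[THEN grade_carrier[OF Z]]
    show "Br M Z U l (m x y) z = ?R x y z"
    proof (rule Br_eqI[OF X Y U _ Rxy[OF x y zc] _ x y])
      show "bil X Y U (\<lambda>x y. Br M Z U l (m x y) z)" by (rule bilI; intro ml) simp_all
      fix p q x y assume xp: "x \<in> grade X p" and yq: "y \<in> grade Y q"
      note [simp] = xp[THEN grade_carrier[OF X]] yq[THEN grade_carrier[OF Y]]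
      let ?T = "\<lambda>i j k. l (act Z k z) (m (act X i x) (act Y j y))"
      have t: "tril U ?T" by (rule trilI; intro ml) simp_all
      \<comment> \<open>As degrees add up under \<open>m\<close>, the sign for passing
        \<open>m x y\<close> across \<open>z\<close> is the product of the signs for
        \<open>y\<close> and for \<open>x\<close>.\<close>
      have "Br M Z U l (m x y) z = ksgn U q n (ksgn U p n (s2 U Rl (\<lambda>r s. s2 U (Dl r) (\<lambda>r1 r2. ?T r1 r2 s))))"
        by (simp add: Br_homog_bil[OF M Z U l gm[OF xp yq] zn] ksgn_add(1) ebil_act[OF m] bil_s(2)[OF l])
      also have "\<dots> = ?R x y z"
      proof -
        have e1: "?B1 x z y = ksgn U p n (s2 U Rl (\<lambda>r s. Fi Z X Y U (\<lambda>z x y. l z (m x y)) (act Z s z) (act X r x) y))"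
          if "x \<in> grade X p" "z \<in> grade Z n" "y \<in> carrier Y" for x y z
          by (rule Br_homog_bil[OF X Z U i1 that(1,2)]) fact
        have e2: "?B2 x y z = ksgn U q n (s2 U Rl (\<lambda>r s. ?V x (act Z s z) (act Y r y)))"
          if "x \<in> carrier X" "y \<in> grade Y q" "z \<in> grade Z n" for x y z
          by (rule Br_homog_bil[OF Y Z U V that(2,3)]) fact
        note g = grade_act'[OF X] grade_act'[OF Y] grade_act'[OF Z] xp yq zn
        have "?R x y z = s3 U Ph (\<lambda>a b c. ksgn U q n (s2 U Rl (\<lambda>r s. s3 U Ps (\<lambda>p' q' t. ksgn U p n (s2 U Rl (\<lambda>r' s'.
            Fi Z X Y U (\<lambda>z x y. l z (m x y)) (act Z s' (act Z q' (act Z s (act Z c z)))) (act X r' (act X p' (act X a x))) (act Y t (act Y r (act Y b y)))))))))"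
          unfolding Fi_def[of X Y Z] by (simp add: e2 g) (simp add: Fv_def e1 g)
        then show ?thesis
          by (simp add: Fi_def act_act ksgn_s braid_tensor_left_sum[OF U t, symmetric] m_assoc)
      qed
      finally show "Br M Z U l (m x y) z = ?R x y z" .
    qed
  qed
qed

text \<open>Braiding \<open>x\<close> past a product amounts to braiding it past \<open>y\<close>
  and then past \<open>z\<close>; the legs are matched by \<open>braid_tensor_right_sum\<close>, the
  signs by additivity of degrees.\<close>

lemma braid_tensor_right:
  fixes X :: "('k, 'h, 'x, 'm) gmod_scheme" and Y :: "('k, 'h, 'y, 'n) gmod_scheme"
    and Z :: "('k, 'h, 'z, 'l) gmod_scheme" and M :: "('k, 'h, 'i, 'j) gmod_scheme" and U :: "('k, 'u, 'o) module_scheme"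
  assumes X: "hmod k H X" and Y: "hmod k H Y" and Z: "hmod k H Z" and M: "hmod k H M" and U [simp]: "module k U"
    and m: "ebil Y Z M m" and gm: "\<And>p q y z. y \<in> grade Y p \<Longrightarrow> z \<in> grade Z q \<Longrightarrow> m y z \<in> grade M (p + q)"
    and l: "bil M X U l" and x: "x \<in> carrier X" and y: "y \<in> carrier Y" and z: "z \<in> carrier Z"
  shows "Br X M U l x (m y z) = Fv X Y Z U (\<lambda>x y z. Br X Y U (\<lambda>y x. Fi Y X Z U (\<lambda>y x z. Br X Z U
      (\<lambda>z x. Fv Y Z X U (\<lambda>y z x. l (m y z) x) y z x) x z) y x z) x y) x y z"
    (is "_ = ?R x y z")
proof -
  note [simp] = grade_hact[OF X] grade_hact[OF Y] grade_hact[OF Z] grade_hact[OF M]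
    grade_carrier[OF X] grade_carrier[OF Y] grade_carrier[OF Z] grade_carrier[OF M]
  note mb = ebil_bil[OF m]
  note [simp] = bil_closed[OF mb] bil_closed[OF l]
  note ml = bil_linr[OF mb] bil_linr[OF l] bil_linr[OF Br_bil[OF X M U l]] act_linr lin_id
  have i1: "bil Z X U (\<lambda>z x. Fv Y Z X U (\<lambda>y z x. l (m y z) x) y z x)" if "y \<in> carrier Y" for y
    unfolding Fv_def by (rule bilI; intro lin_s3 ml) (simp_all add: that)
  have i1y: "lin Y U (\<lambda>y. Fv Y Z X U (\<lambda>y z x. l (m y z) x) y z x)" if "x \<in> carrier X" "z \<in> carrier Z" for x z
    unfolding Fv_def by (intro lin_s3 ml) (simp_all add: that)
  let ?B1 = "\<lambda>y x z. Br X Z U (\<lambda>z x. Fv Y Z X U (\<lambda>y z x. l (m y z) x) y z x) x z"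
  have B1: "bil X Z U (\<lambda>x z. ?B1 y x z)" if "y \<in> carrier Y" for y
    by (rule Br_bil[OF X Z U i1[OF that]])
  have B1y: "lin Y U (\<lambda>y. ?B1 y x z)" if "x \<in> carrier X" "z \<in> carrier Z" for x z
    by (rule Br_param[OF X Z U i1y]) (simp_all add: that)
  note B1l = bil_linr[OF B1] lin_comp[OF _ B1y]
  let ?V = "Fi Y X Z U ?B1"
  have V: "bil Y X U (\<lambda>y x. ?V y x z)" if "z \<in> carrier Z" for z
    unfolding Fi_def by (rule bilI; intro lin_s3 B1l act_linr lin_id) (simp_all add: that)
  have Vz: "lin Z U (\<lambda>z. ?V y x z)" if "x \<in> carrier X" "y \<in> carrier Y" for x y
    unfolding Fi_def by (intro lin_s3 B1l act_linr lin_id) (simp_all add: that)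
  let ?B2 = "\<lambda>x y z. Br X Y U (\<lambda>y x. ?V y x z) x y"
  have B2: "bil X Y U (\<lambda>x y. ?B2 x y z)" if "z \<in> carrier Z" for z
    by (rule Br_bil[OF X Y U V[OF that]])
  have B2z: "lin Z U (\<lambda>z. ?B2 x y z)" if "x \<in> carrier X" "y \<in> carrier Y" for x y
    by (rule Br_param[OF X Y U Vz]) (simp_all add: that)
  note B2l = bil_linr[OF B2] lin_comp[OF _ B2z]
  have Rz: "lin Z U (\<lambda>z. ?R x y z)" and Rxy: "bil X Y U (\<lambda>x y. ?R x y z)"
    if "x \<in> carrier X" "y \<in> carrier Y" "z \<in> carrier Z" for x y z
    unfolding Fv_def[of X Y Z] by (rule bilI | intro lin_s3 B2l act_linr lin_id; simp add: that)+
  show ?thesis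
  proof (rule homog_ext[OF Z U _ Rz[OF x y z] _ z])
    show "lin Z U (\<lambda>z. Br X M U l x (m y z))" by (intro ml) (simp_all add: x y)
    fix n z assume zn: "z \<in> grade Z n"
    note zc [simp] = zn[THEN grade_carrier[OF Z]]
    show "Br X M U l x (m y z) = ?R x y z"
    proof (rule Br_eqI[OF X Y U _ Rxy[OF x y zc] _ x y])
      show "bil X Y U (\<lambda>x y. Br X M U l x (m y z))" by (rule bilI; intro ml) simp_all
      fix p q x y assume xp: "x \<in> grade X p" and yq: "y \<in> grade Y q"
      note [simp] = xp[THEN grade_carrier[OF X]] yq[THEN grade_carrier[OF Y]]
      let ?T = "\<lambda>i j k. l (m (act Y j y) (act Z k z)) (act X i x)"
      have t: "tril U ?T" by (rule trilI; intro ml) simp_all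
      have "Br X M U l x (m y z) = ksgn U p q (ksgn U p n (s2 U Rl (\<lambda>r s. s2 U (Dl s) (\<lambda>s1 s2. ?T r s1 s2))))"
        by (simp add: Br_homog_bil[OF X M U l xp gm[OF yq zn]] ksgn_add(2) ebil_act[OF m] bil_s(1)[OF l])
      also have "\<dots> = ?R x y z"
      proof -
        have e1: "?B1 y x z = ksgn U p n (s2 U Rl (\<lambda>r s. Fv Y Z X U (\<lambda>y z x. l (m y z) x) y (act Z s z) (act X r x)))"
          if "x \<in> grade X p" "z \<in> grade Z n" "y \<in> carrier Y" for x y z
          by (rule Br_homog_bil[OF X Z U i1 that(1,2)]) fact
        have e2: "?B2 x y z = ksgn U p q (s2 U Rl (\<lambda>r s. ?V (act Y s y) (act X r x) z))"
          if "x \<in> grade X p" "y \<in> grade Y q" "z \<in> carrier Z" for x y z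
          by (rule Br_homog_bil[OF X Y U V that(1,2)]) fact
        note g = grade_act'[OF X] grade_act'[OF Y] grade_act'[OF Z] xp yq zn
        have "?R x y z = s3 U Ps (\<lambda>a b c. ksgn U p q (s2 U Rl (\<lambda>r s. s3 U Ph (\<lambda>p' q' t. ksgn U p n (s2 U Rl (\<lambda>r' s'.
            Fv Y Z X U (\<lambda>y z x. l (m y z) x) (act Y p' (act Y s (act Y b y))) (act Z s' (act Z t (act Z c z))) (act X r' (act X q' (act X r (act X a x))))))))))"
          unfolding Fv_def[of X Y Z] by (simp add: e2 g) (simp add: Fi_def e1 g)
        then show ?thesis
          by (simp add: Fv_def act_act ksgn_s braid_tensor_right_sum[OF U t, symmetric] m_assoc)
      qed
      finally show "Br X M U l x (m y z) = ?R x y z" .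
    qed
  qed
qed

end

section \<open>Graded equivariant bilinear maps and kernels\<close>

context quasitriangular_quasi_hopf
begin

text \<open>The bilinear counterpart of a morphism from a tensor product, see
  \<open>hmorph_hbil\<close>.\<close>

definition hbil where
  "hbil X Y Z b \<longleftrightarrow> ebil X Y Z b \<and>
     (\<forall>p q. \<forall>x\<in>grade X p. \<forall>y\<in>grade Y q. b x y \<in> grade Z (p + q))"

lemma hbilD:
  assumes "hbil X Y Z b"
  shows hbil_ebil: "ebil X Y Z b" and hbil_bil: "bil X Y Z b"
    and hbil_grade: "x \<in> grade X p \<Longrightarrow> y \<in> grade Y q \<Longrightarrow> b x y \<in> grade Z (p + q)"
  using assms ebil_bil by (auto simp: hbil_def)

lemma hmorphD:
  assumes "hmorph k H X Y f"
  shows hmorph_lin: "lin X Y f" and hmorph_closed: "x \<in> carrier X \<Longrightarrow> f x \<in> carrier Y"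
    and hmorph_act: "h \<in> carrier H \<Longrightarrow> x \<in> carrier X \<Longrightarrow> f (act X h x) = act Y h (f x)"
    and hmorph_grade: "x \<in> grade X p \<Longrightarrow> f x \<in> grade Y p"
proof -
  show 1: "lin X Y f" using assms by (simp add: hmorph_def)
  show "x \<in> carrier X \<Longrightarrow> f x \<in> carrier Y" by (rule linD(1)[OF 1])
  show "h \<in> carrier H \<Longrightarrow> x \<in> carrier X \<Longrightarrow> f (act X h x) = act Y h (f x)" using assms by (simp add: hmorph_def)
  show "x \<in> grade X p \<Longrightarrow> f x \<in> grade Y p" using assms unfolding hmorph_def by (elim conjE allE[of _ p]) (erule subsetD, erule imageI)
qed

lemma hmorphI:
  assumes "lin X Y f" "\<And>h x. h \<in> carrier H \<Longrightarrow> x \<in> carrier X \<Longrightarrow> f (act X h x) = act Y h (f x)"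
    "\<And>p x. x \<in> grade X p \<Longrightarrow> f x \<in> grade Y p"
  shows "hmorph k H X Y f"
  using assms unfolding hmorph_def by auto

lemma hmorph_id: "hmorph k H X X (\<lambda>x. x)"
  by (rule hmorphI) (simp_all add: lin_id)

lemma hsub_hmorph: "hsub W V \<Longrightarrow> hmorph k H W V (\<lambda>x. x)"
  by (rule hmorphI) (auto simp: hsub_def intro!: linI)

lemma hmorph_into_hsub:
  assumes f: "hmorph k H X V f" and s: "hsub W V" and c: "\<And>x. x \<in> carrier X \<Longrightarrow> f x \<in> carrier W"
    and g: "\<And>p x. x \<in> grade X p \<Longrightarrow> x \<in> carrier X"
  shows "hmorph k H X W f"
proof (rule hmorphI)
  show "lin X W f"
    using linD(2,3)[OF hmorph_lin[OF f]] c s by (intro linI) (auto simp: hsub_def)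
qed (use s hmorph_act[OF f] hmorph_grade[OF f] c g in \<open>auto simp: hsub_def\<close>)

lemma hbilI:
  assumes "bil X Y Z b" "\<And>h x y. h \<in> carrier H \<Longrightarrow> x \<in> carrier X \<Longrightarrow> y \<in> carrier Y \<Longrightarrow>
      act Z h (b x y) = s2 Z (Dl h) (\<lambda>h1 h2. b (act X h1 x) (act Y h2 y))"
    "\<And>p q x y. x \<in> grade X p \<Longrightarrow> y \<in> grade Y q \<Longrightarrow> b x y \<in> grade Z (p + q)"
  shows "hbil X Y Z b"
  using assms by (auto simp: hbil_def ebil_def)

lemma hbil_morph:
  fixes X :: "('k, 'h, 'x, 'm) gmod_scheme" and Y :: "('k, 'h, 'y, 'n) gmod_scheme"
    and X' :: "('k, 'h, 'x', 'm') gmod_scheme" and Y' :: "('k, 'h, 'y', 'n') gmod_scheme"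
    and Z :: "('k, 'h, 'z, 'l) gmod_scheme" and Z' :: "('k, 'h, 'z', 'l') gmod_scheme"
  assumes b: "hbil X Y Z b" and f: "hmorph k H X' X f" and g: "hmorph k H Y' Y g" and e: "hmorph k H Z Z' e"
    and h: "hact X" "hact Y" "hact Z" "hact Z'"
  shows "hbil X' Y' Z' (\<lambda>x y. e (b (f x) (g y)))"
proof (rule hbilI)
  note c = bil_closed[OF hbil_bil[OF b]]
  show "bil X' Y' Z' (\<lambda>x y. e (b (f x) (g y)))"
    by (rule bilI; rule lin_comp[OF _ hmorph_lin[OF e]];
        rule bil_linr[OF hbil_bil[OF b]] ; (rule hmorph_lin[OF f] hmorph_lin[OF g] hmorph_closed[OF f] hmorph_closed[OF g])?; assumption?)
  fix g' x y assume [simp]: "g' \<in> carrier H" "x \<in> carrier X'" "y \<in> carrier Y'"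
  show "act Z' g' (e (b (f x) (g y))) = s2 Z' (Dl g') (\<lambda>h1 h2. e (b (f (act X' h1 x)) (g (act Y' h2 y))))"
    using h by (simp add: hmorph_act[OF e, symmetric] ebil_act[OF hbil_ebil[OF b]] hmorph_closed[OF f] hmorph_closed[OF g] c
        s2_push[OF hmorph_lin[OF e]] hmorph_act[OF f] hmorph_act[OF g])
qed (intro hmorph_grade[OF e] hbil_grade[OF b] hmorph_grade[OF f] hmorph_grade[OF g])

lemma hbil_into_hsub:
  fixes X :: "('k, 'h, 'x, 'm) gmod_scheme" and Y :: "('k, 'h, 'y, 'n) gmod_scheme"
    and W :: "('k, 'h, 'v, 'l) gmod_scheme" and V :: "('k, 'h, 'v, 'i) gmod_scheme"
  assumes b: "hbil X Y V b" and s: "hsub W V" and c: "\<And>x y. x \<in> carrier X \<Longrightarrow> y \<in> carrier Y \<Longrightarrow> b x y \<in> carrier W"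
    and X: "hmod k H X" and Y: "hmod k H Y"
  shows "hbil X Y W b"
proof (rule hbilI)
  show "bil X Y W b"
    using linD(2,3)[OF bil_lin1[OF hbil_bil[OF b]]] linD(2,3)[OF bil_lin2[OF hbil_bil[OF b]]] c s
    by (intro bilI linI) (auto simp: hsub_def)
  show "b x y \<in> grade W (p + q)" if "x \<in> grade X p" "y \<in> grade Y q" for p q x y
    using hbil_grade[OF b that] c[OF grade_carrier[OF X that(1)] grade_carrier[OF Y that(2)]] s by (auto simp: hsub_def)
  show "act W h (b x y) = s2 W (Dl h) (\<lambda>h1 h2. b (act X h1 x) (act Y h2 y))"
    if "h \<in> carrier H" "x \<in> carrier X" "y \<in> carrier Y" for h x y
  proof -
    have "act W h (b x y) = act V h (b x y)" using s by (simp add: hsub_def)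
    then show ?thesis unfolding hsub_s(1)[OF s] ebil_act[OF hbil_ebil[OF b] that] .
  qed
qed

lemma hbil_minus:
  fixes X :: "('k, 'h, 'x, 'm) gmod_scheme" and Y :: "('k, 'h, 'y, 'n) gmod_scheme"
    and Z :: "('k, 'h, 'z, 'l) gmod_scheme"
  assumes b: "hbil X Y Z b" and c: "hbil X Y Z c" and X: "hmod k H X" and Y: "hmod k H Y" and Z: "hmod k H Z"
  shows "hbil X Y Z (\<lambda>x y. b x y \<ominus>\<^bsub>Z\<^esub> c x y)"
proof (rule hbilI)
  note [simp] = grade_hact[OF X] grade_hact[OF Y] grade_hact[OF Z]
  note [simp] = bil_closed[OF hbil_bil[OF b]] bil_closed[OF hbil_bil[OF c]]
  interpret Z: module k Z by (rule grade_module[OF Z])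
  show "bil X Y Z (\<lambda>x y. b x y \<ominus>\<^bsub>Z\<^esub> c x y)"
    by (intro bilI lin_sub bil_lin1[OF hbil_bil[OF b]] bil_lin1[OF hbil_bil[OF c]] bil_lin2[OF hbil_bil[OF b]] bil_lin2[OF hbil_bil[OF c]]) simp_all
  show "b x y \<ominus>\<^bsub>Z\<^esub> c x y \<in> grade Z (p + q)" if "x \<in> grade X p" "y \<in> grade Y q" for p q x y
    by (rule grade_minus[OF Z hbil_grade[OF b that] hbil_grade[OF c that]])
  fix h x y assume [simp]: "h \<in> carrier H" "x \<in> carrier X" "y \<in> carrier Y"
  have neg: "\<ominus>\<^bsub>Z\<^esub> s2 Z (Dl h) T = s2 Z (Dl h) (\<lambda>a b. \<ominus>\<^bsub>Z\<^esub> T a b)"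
    if "\<And>a b. a \<in> carrier H \<Longrightarrow> b \<in> carrier H \<Longrightarrow> T a b \<in> carrier Z" for T
    by (rule s2_push[OF lin_uminus[OF _ lin_id]]) (simp_all add: that)
  show "act Z h (b x y \<ominus>\<^bsub>Z\<^esub> c x y) = s2 Z (Dl h) (\<lambda>h1 h2. b (act X h1 x) (act Y h2 y) \<ominus>\<^bsub>Z\<^esub> c (act X h1 x) (act Y h2 y))"
    by (simp add: lin_diff[OF _ _ act_lin] ebil_act[OF hbil_ebil[OF b]] ebil_act[OF hbil_ebil[OF c]])
       (simp add: a_minus_def neg s2_add)
qed

lemma hbil_evb:
  fixes V :: "('k, 'h, 'v, 'm) gmod_scheme" and W :: "('k, 'h, 'w, 'n) gmod_scheme"
  assumes V: "hmod k H V" and W: "hmod k H W"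
  shows "hbil (ihom k H V W) V W (evb V W)"
proof (rule hbilI)
  note h = grade_hact[OF V] grade_hact[OF W]
  show "bil (ihom k H V W) V W (evb V W)" by (rule evb_bil[OF h])
  show "act W g (evb V W L v) = s2 W (Dl g) (\<lambda>h1 h2. evb V W (act (ihom k H V W) h1 L) (act V h2 v))"
    if "g \<in> carrier H" "L \<in> carrier (ihom k H V W)" "v \<in> carrier V" for g L v
    by (rule ebil_act[OF evb_ebil[OF h] that])
  show "evb V W L v \<in> grade W (p + q)" if L: "L \<in> grade (ihom k H V W) p" and v: "v \<in> grade V q" for L v p q
    unfolding evb_def
  proof (intro s3_grade[OF W] grade_act'[OF W])
    fix a b c assume "a \<in> carrier H" "b \<in> carrier H" "c \<in> carrier H"
    then have "act V (antip H b \<cdot> alpha H \<cdot> c) v \<in> grade V q" by (intro grade_act'[OF V _ v]) simp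
    then show "L (act V (antip H b \<cdot> alpha H \<cdot> c) v) \<in> grade W (p + q)"
      using L by (simp add: ihom_grade_iff add.commute[of p])
  qed
qed

lemma cur_hmorph:
  fixes X :: "('k, 'h, 'x, 'm) gmod_scheme" and Y :: "('k, 'h, 'y, 'n) gmod_scheme"
    and Z :: "('k, 'h, 'z, 'l) gmod_scheme"
  assumes b: "hbil X Y Z b" and X: "hmod k H X" and Y: "hmod k H Y" and Z: "hmod k H Z"
  shows "hmorph k H X (ihom k H Y Z) (cur X Y Z b)"
proof (rule hmorphI)
  note h = grade_hact[OF X] grade_hact[OF Y] grade_hact[OF Z]
  note e = hbil_ebil[OF b]
  show "lin X (ihom k H Y Z) (cur X Y Z b)" by (rule cur_lin[OF h e])
  show "cur X Y Z b (act X g x) = act (ihom k H Y Z) g (cur X Y Z b x)" if "g \<in> carrier H" "x \<in> carrier X" for g x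
    by (rule cur_act[OF h e that(2,1), symmetric])
  show "cur X Y Z b x \<in> grade (ihom k H Y Z) p" if x: "x \<in> grade X p" for x p
    unfolding ihom_grade_iff
  proof (intro conjI allI ballI)
    show "cur X Y Z b x \<in> carrier (ihom k H Y Z)" by (rule cur_closed[OF h e grade_carrier[OF X x]])
    fix q y assume y: "y \<in> grade Y q"
    show "cur X Y Z b x y \<in> grade Z (q + p)"
      unfolding cur_app[OF h e grade_carrier[OF Y y]] add.commute[of q]
      by (intro s3_grade[OF Z] hbil_grade[OF b] grade_act'[OF X] grade_act'[OF Y] x y) simp_all
  qed
qed

lemma hbil_comp:
  fixes V :: "('k, 'h, 'v, 'm) gmod_scheme" and W :: "('k, 'h, 'w, 'n) gmod_scheme"
    and X :: "('k, 'h, 'x, 'l) gmod_scheme"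
  assumes V: "hmod k H V" and W: "hmod k H W" and X: "hmod k H X"
  shows "hbil (ihom k H W X) (ihom k H V W) (ihom k H V X) (comp V W X)"
proof (rule hbilI)
  note h [simp] = grade_hact[OF V] grade_hact[OF W] grade_hact[OF X]
  note e = comp_ebil[OF h]
  let ?N = "ihom k H W X" and ?M = "ihom k H V W"
  show "bil ?N ?M (ihom k H V X) (comp V W X)" by (rule ebil_bil[OF e])
  show "act (ihom k H V X) g (comp V W X L K) = s2 (ihom k H V X) (Dl g) (\<lambda>h1 h2. comp V W X (act ?N h1 L) (act ?M h2 K))"
    if "g \<in> carrier H" "L \<in> carrier ?N" "K \<in> carrier ?M" for g L K
    by (rule ebil_act[OF e that])
  fix p q L K assume L: "L \<in> grade ?N p" and K: "K \<in> grade ?M q"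
  note Nh = ihom_hmod[OF W X] and Mh = ihom_hmod[OF V W]
  note Lc [simp] = grade_carrier[OF Nh L] and Kc [simp] = grade_carrier[OF Mh K]
  show "comp V W X L K \<in> grade (ihom k H V X) (p + q)"
    unfolding ihom_grade_iff
  proof (intro conjI allI ballI)
    show "comp V W X L K \<in> carrier (ihom k H V X)" by simp
    fix r v assume v: "v \<in> grade V r"
    note vc [simp] = grade_carrier[OF V v]
    have "evb V X (comp V W X (act ?N a L) (act ?M b K)) w \<in> grade X (r + (p + q))"
      if [simp]: "a \<in> carrier H" "b \<in> carrier H" and w: "w \<in> grade V r" for a b w
    proof -
      have "evb W X (act ?N a' (act ?N a L)) (evb V W (act ?M b' (act ?M b K)) (act V c' w)) \<in> grade X (p + (q + r))"
        if "a' \<in> carrier H" "b' \<in> carrier H" "c' \<in> carrier H" for a' b' c'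
        by (intro hbil_grade[OF hbil_evb[OF W X]] hbil_grade[OF hbil_evb[OF V W]] grade_act'[OF Nh] grade_act'[OF Mh] grade_act'[OF V])
           (use that L K w in simp_all)
      then show ?thesis
        using grade_carrier[OF V w] by (simp add: evb_comp Fi_def s3_grade[OF X] add_ac)
    qed
    \<comment> \<open>The value of the composite is not itself an evaluation;
      \<open>ihom_evb\<close> writes it as a sum of evaluations of translates, whose degrees are
      known.\<close>
    then show "comp V W X L K v \<in> grade X (r + (p + q))"
      by (subst ihom_evb[OF h(1,3), symmetric])
         (simp_all add: ebil_act[OF e] bil_s(1)[OF evb_bil] s3_grade[OF X] s2_grade[OF X] grade_act'[OF V _ v])
  qed
qed

lemma hbil_Br:
  fixes X :: "('k, 'h, 'x, 'm) gmod_scheme" and Y :: "('k, 'h, 'y, 'n) gmod_scheme"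
    and U :: "('k, 'h, 'u, 'l) gmod_scheme"
  assumes X: "hmod k H X" and Y: "hmod k H Y" and U: "hmod k H U" and b: "hbil Y X U b"
  shows "hbil X Y U (Br X Y U b)"
  unfolding hbil_def
proof (intro conjI allI ballI)
  show "ebil X Y U (Br X Y U b)" by (rule Br_ebil[OF X Y grade_hact[OF U] hbil_ebil[OF b]])
  fix p q x y assume x: "x \<in> grade X p" and y: "y \<in> grade Y q"
  have "s2 U Rl (\<lambda>r s. b (act Y s y) (act X r x)) \<in> grade U (p + q)"
    unfolding add.commute[of p]
    by (intro s2_grade[OF U] hbil_grade[OF b] grade_act'[OF X] grade_act'[OF Y] x y)
  then show "Br X Y U b x y \<in> grade U (p + q)"
    by (simp add: Br_homog_bil[OF X Y grade_module[OF U] hbil_bil[OF b] x y] ksgn_def grade_uminus[OF U])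
qed

lemma hmorph_hbil:
  fixes X :: "('k, 'h, 'x, 'm) gmod_scheme" and Y :: "('k, 'h, 'y, 'n) gmod_scheme"
    and Z :: "('k, 'h, 'z, 'l) gmod_scheme"
  assumes f: "hmorph k H (gtensor k H X Y) Z f" and X: "hact X" and Y: "hact Y" and Z: "hact Z"
  shows "hbil X Y Z (\<lambda>x y. f (tpure k X Y x y))"
proof (rule hbilI)
  note [simp] = X Y Z
  have l: "lin (tensor k X Y) Z f" using hmorph_lin[OF f] by (simp add: lin_gtensor)
  show "bil X Y Z (\<lambda>x y. f (tpure k X Y x y))"
    by (rule bil_comp_lin[OF tpure_bil l]) simp_all
  show "act Z h (f (tpure k X Y x y)) = s2 Z (Dl h) (\<lambda>h1 h2. f (tpure k X Y (act X h1 x) (act Y h2 y)))"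
    if [simp]: "h \<in> carrier H" "x \<in> carrier X" "y \<in> carrier Y" for h x y
    by (simp add: hmorph_act[OF f, symmetric] gtensor_act_pure s2_push[OF l])
  show "f (tpure k X Y x y) \<in> grade Z (p + q)" if "x \<in> grade X p" "y \<in> grade Y q" for p q x y
    by (rule hmorph_grade[OF f]) (use that in \<open>auto simp: gtensor_def module.defs gmod.defs intro!: generate.incl\<close>)
qed

text \<open>The kernel of \<open>zeta b\<close>: evaluating a curried map again loses the information on the \<open>H\<close>-translates,
  which therefore have to be quantified explicitly.\<close>

definition radical :: "('k, 'h, 'x, 'm) gmod_scheme \<Rightarrow> ('k, 'h, 'y, 'n) gmod_scheme \<Rightarrow> ('k, 'z, 'l) module_scheme \<Rightarrow> ('x \<Rightarrow> 'y \<Rightarrow> 'z) \<Rightarrow> 'x set" where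
  "radical X Y Z b = {x \<in> carrier X. \<forall>h\<in>carrier H. \<forall>y\<in>carrier Y. b (act X h x) y = \<zero>\<^bsub>Z\<^esub>}"

lemma radicalD:
  assumes "x \<in> radical X Y Z b" "hact X" "y \<in> carrier Y"
  shows "x \<in> carrier X" "b x y = \<zero>\<^bsub>Z\<^esub>"
proof -
  show "x \<in> carrier X" using assms by (auto simp: radical_def)
  then have "act X \<one>\<^bsub>H\<^esub> x = x" using assms(2) by simp
  moreover have "b (act X \<one>\<^bsub>H\<^esub> x) y = \<zero>\<^bsub>Z\<^esub>" using assms(1,3) unfolding radical_def by blast
  ultimately show "b x y = \<zero>\<^bsub>Z\<^esub>" by simp
qed

section \<open>Kernels of curried maps as graded submodules\<close>

lemma radical_hmod:
  fixes X :: "('k, 'h, 'x, 'm) gmod_scheme" and Y :: "('k, 'h, 'y, 'n) gmod_scheme"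
    and Z :: "('k, 'h, 'z, 'l) gmod_scheme" and K :: "('k, 'h, 'x, 'i) gmod_scheme"
  assumes X: "hmod k H X" and Y: "hmod k H Y" and Z: "hmod k H Z" and b: "hbil X Y Z b"
    and K: "hsub K X" "carrier K = radical X Y Z b"
  shows "hmod k H K"
proof (rule hsub_hmod[OF X K(1)]; unfold K(2))
  note [simp] = grade_hact[OF X] grade_hact[OF Y] grade_hact[OF Z]
  note [simp] = bil_closed[OF hbil_bil[OF b]]
  interpret X: module k X by simp
  interpret Z: module k Z by simp
  note l1 = bil_lin1[OF hbil_bil[OF b]] note l2 = bil_lin2[OF hbil_bil[OF b]]
  have m: "module k X" "module k Z" by simp_all
  have b0: "b \<zero>\<^bsub>X\<^esub> y = \<zero>\<^bsub>Z\<^esub>" if "y \<in> carrier Y" for y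
    by (rule lin_zero[OF m l1[OF that]])
  have a0: "act X h \<zero>\<^bsub>X\<^esub> = \<zero>\<^bsub>X\<^esub>" if "h \<in> carrier H" for h
    by (rule lin_zero[OF m(1) m(1) act_lin[OF _ that]]) simp
  show "\<zero>\<^bsub>X\<^esub> \<in> radical X Y Z b" by (simp add: radical_def a0 b0)
  show "x \<oplus>\<^bsub>X\<^esub> y \<in> radical X Y Z b" if "x \<in> radical X Y Z b" "y \<in> radical X Y Z b" for x y
    using that by (auto simp: radical_def linD(2)[OF act_lin] linD(2)[OF l1])
  show "c \<odot>\<^bsub>X\<^esub> x \<in> radical X Y Z b" if "c \<in> carrier k" "x \<in> radical X Y Z b" for c x
    using that by (auto simp: radical_def linD(3)[OF act_lin] linD(3)[OF l1])
  show "act X h x \<in> radical X Y Z b" if "h \<in> carrier H" "x \<in> radical X Y Z b" for h x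
    using that by (auto simp: radical_def act_act)
  fix n x assume x: "x \<in> radical X Y Z b"
  have xc: "x \<in> carrier X" using x by (simp add: radical_def)
  note pc = gproj_prop(1)[OF X, THEN grade_carrier[OF X]]
  have "b (gproj X z n) y = \<zero>\<^bsub>Z\<^esub>" if z: "z \<in> carrier X" "\<And>y. y \<in> carrier Y \<Longrightarrow> b z y = \<zero>\<^bsub>Z\<^esub>" and y: "y \<in> carrier Y" for z y
  proof (rule homog_ext[OF Y _ l2[OF pc[OF z(1)]] lin_const_zero _ y])
    fix q y assume yq: "y \<in> grade Y q"
    note yc = grade_carrier[OF Y yq]
    \<comment> \<open>For homogeneous \<open>y\<close> of degree \<open>q\<close>, the value of
      \<open>b\<close> at the component of \<open>z\<close> of degree \<open>n\<close> is the
      component of \<open>b z y\<close> of degree \<open>n + q\<close>, hence zero. This makes the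
      radical closed under homogeneous components.\<close>
    have "gproj Z (b z y) (n + q) = b (gproj X z n) y"
    proof (rule homog_ext[OF X _ lin_comp[OF l1[OF yc] gproj_lin[OF Z]] lin_comp[OF gproj_lin[OF X] l1[OF yc]] _ z(1)])
      fix p z assume zp: "z \<in> grade X p"
      show "gproj Z (b z y) (n + q) = b (gproj X z n) y"
        by (simp add: gproj_homog[OF Z hbil_grade[OF b zp yq]] gproj_homog[OF X zp] b0 yc)
    qed simp
    moreover have "gproj Z \<zero>\<^bsub>Z\<^esub> (n + q) = \<zero>\<^bsub>Z\<^esub>" by (rule lin_zero[OF m(2) m(2) gproj_lin[OF Z]])
    ultimately show "b (gproj X z n) y = \<zero>\<^bsub>Z\<^esub>" by (simp add: z(2)[OF yc])
  qed simp_all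
  then show "gproj X x n \<in> radical X Y Z b"
    using x pc[OF xc] by (auto simp: radical_def gproj_act[OF X, symmetric])
qed

text \<open>By \<open>cur_zero_iff\<close>, vanishing of \<open>zeta f\<close> at \<open>x\<close>
  is the vanishing of the bilinear form of \<open>f\<close> on all translates of
  \<open>x\<close>.\<close>

lemma ker_obj_radical:
  fixes X :: "('k, 'h, 'x) gmod" and Y :: "('k, 'h, 'y, 'n) gmod_scheme"
    and Z :: "('k, 'h, 'z, 'l) gmod_scheme"
  assumes X: "hmod k H X" and Y: "hmod k H Y" and Z: "hmod k H Z" and b: "hbil X Y Z b"
    and f: "\<And>x y. x \<in> carrier X \<Longrightarrow> y \<in> carrier Y \<Longrightarrow> f (tpure k X Y x y) = b x y"
  defines "K \<equiv> ker_obj X (ihom k H Y Z) (zeta k H X Y Z f)"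
  shows "carrier K = radical X Y Z b" "hsub K X" "hmod k H K"
proof -
  note h = grade_hact[OF X] grade_hact[OF Y] grade_hact[OF Z]
  note e = hbil_ebil[OF b]
  have z: "zeta k H X Y Z f x = \<zero>\<^bsub>ihom k H Y Z\<^esub> \<longleftrightarrow> (\<forall>h\<in>carrier H. \<forall>y\<in>carrier Y. b (act X h x) y = \<zero>\<^bsub>Z\<^esub>)"
    if "x \<in> carrier X" for x
    using zeta_cur[OF h e f that] cur_zero_iff[OF h e that] by simp
  show c: "carrier K = radical X Y Z b"
    using z by (auto simp: K_def ker_obj_def subobj_def radical_def)
  show s: "hsub K X"
    using grade_carrier[OF X] by (auto simp: hsub_def K_def ker_obj_def subobj_def)
  show "hmod k H K" by (rule radical_hmod[OF X Y Z b s c])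
qed

text \<open>The translates demanded by \<open>ihom_unique\<close> are, by equivariance, sums of
  values of the families at other arguments, where the evaluations already agree.\<close>

lemma hbil_ihom_eq:
  fixes V :: "('k, 'h, 'v, 'm) gmod_scheme" and W :: "('k, 'h, 'w, 'n) gmod_scheme"
    and X :: "('k, 'h, 'x, 'l) gmod_scheme" and Y :: "('k, 'h, 'y, 'i) gmod_scheme"
  assumes h: "hact V" "hact W" "hact X" "hact Y" and f: "ebil X Y (ihom k H V W) f" and g: "ebil X Y (ihom k H V W) g"
    and e: "\<And>x y v. x \<in> carrier X \<Longrightarrow> y \<in> carrier Y \<Longrightarrow> v \<in> carrier V \<Longrightarrow> evb V W (f x y) v = evb V W (g x y) v"
    and x: "x \<in> carrier X" and y: "y \<in> carrier Y"
  shows "f x y = g x y"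
proof (rule ihom_unique[OF h(1,2)])
  note [simp] = h x y bil_closed[OF ebil_bil[OF f]] bil_closed[OF ebil_bil[OF g]]
  show "f x y \<in> carrier (ihom k H V W)" "g x y \<in> carrier (ihom k H V W)" by simp_all
  fix h' v assume [simp]: "h' \<in> carrier H" "v \<in> carrier V"
  show "evb V W (act (ihom k H V W) h' (f x y)) v = evb V W (act (ihom k H V W) h' (g x y)) v"
    by (simp add: ebil_act[OF f] ebil_act[OF g] bil_s(1)[OF evb_bil] e)
qed

end

section \<open>Brackets of compositions\<close>

context quasitriangular_quasi_hopf
begin

section \<open>Calculus of reassociated trilinear maps\<close>

context
  fixes X :: "('k, 'h, 'x, 'm) gmod_scheme" and Y :: "('k, 'h, 'y, 'n) gmod_scheme"
    and Z :: "('k, 'h, 'z, 'l) gmod_scheme" and U :: "('k, 'u, 'o) module_scheme"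
  assumes X: "hact X" and Y: "hact Y" and Z: "hact Z" and U: "module k U"
begin

private lemmas hs1 = X Y Z U

lemma Fi_cong:
  assumes "\<And>x y z. x \<in> carrier X \<Longrightarrow> y \<in> carrier Y \<Longrightarrow> z \<in> carrier Z \<Longrightarrow> T x y z = T' x y z"
    and "x \<in> carrier X" "y \<in> carrier Y" "z \<in> carrier Z"
  shows "Fi X Y Z U T x y z = Fi X Y Z U T' x y z" "Fv X Y Z U T x y z = Fv X Y Z U T' x y z"
  using assms hs1 by (simp_all add: Fi_def Fv_def)

lemma Fi_add:
  assumes "\<And>x y z. x \<in> carrier X \<Longrightarrow> y \<in> carrier Y \<Longrightarrow> z \<in> carrier Z \<Longrightarrow> T x y z \<in> carrier U \<and> T' x y z \<in> carrier U"
    and "x \<in> carrier X" "y \<in> carrier Y" "z \<in> carrier Z"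
  shows "Fi X Y Z U (\<lambda>x y z. T x y z \<oplus>\<^bsub>U\<^esub> T' x y z) x y z = Fi X Y Z U T x y z \<oplus>\<^bsub>U\<^esub> Fi X Y Z U T' x y z"
    "Fv X Y Z U (\<lambda>x y z. T x y z \<oplus>\<^bsub>U\<^esub> T' x y z) x y z = Fv X Y Z U T x y z \<oplus>\<^bsub>U\<^esub> Fv X Y Z U T' x y z"
  using assms hs1 by (simp_all add: Fi_def Fv_def s3_add)

lemma Fi_morph:
  assumes "hmorph k H X X' f" "hmorph k H Y Y' g" "hmorph k H Z Z' e"
    and "x \<in> carrier X" "y \<in> carrier Y" "z \<in> carrier Z"
  shows "Fi X Y Z U (\<lambda>x y z. T (f x) (g y) (e z)) x y z = Fi X' Y' Z' U T (f x) (g y) (e z)"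
    "Fv X Y Z U (\<lambda>x y z. T (f x) (g y) (e z)) x y z = Fv X' Y' Z' U T (f x) (g y) (e z)"
  using assms(4-) hs1 by (simp_all add: Fi_def Fv_def hmorph_act[OF assms(1)] hmorph_act[OF assms(2)] hmorph_act[OF assms(3)])

text \<open>A leg of \<phi> that acts through the counit is removed, and by normalization the other
  two legs disappear with it. This is how reassociation becomes invisible next to the constant of
  degree one.\<close>

lemma Fi_trivial_left:
  assumes t: "\<And>h x y z. h \<in> carrier H \<Longrightarrow> x \<in> carrier X \<Longrightarrow> y \<in> carrier Y \<Longrightarrow> z \<in> carrier Z \<Longrightarrow>
      T (act X h x) y z = counit H h \<odot>\<^bsub>U\<^esub> T x y z"
    and b: "bil Y Z U (T x)" and c: "x \<in> carrier X" "y \<in> carrier Y" "z \<in> carrier Z"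
  shows "Fi X Y Z U T x y z = T x y z" "Fv X Y Z U T x y z = T x y z"
proof -
  have "bil H H U (\<lambda>u v. T x (act Y u y) (act Z v z))"
    by (rule bilI; intro bil_linr[OF b] act_linr lin_id) (simp_all add: c hs1)
  from phi_counit1[OF U this] phi_inv_counit1[OF U this]
  show "Fi X Y Z U T x y z = T x y z" "Fv X Y Z U T x y z = T x y z"
    using c hs1 by (simp_all add: Fi_def Fv_def t)
qed

text \<open>The same for the middle leg, where the normalization is an axiom.\<close>

lemma Fi_trivial_middle:
  assumes t: "\<And>h x y z. h \<in> carrier H \<Longrightarrow> x \<in> carrier X \<Longrightarrow> y \<in> carrier Y \<Longrightarrow> z \<in> carrier Z \<Longrightarrow>
      T x (act Y h y) z = counit H h \<odot>\<^bsub>U\<^esub> T x y z"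
    and b: "bil X Z U (\<lambda>x z. T x y z)" and c: "x \<in> carrier X" "y \<in> carrier Y" "z \<in> carrier Z"
  shows "Fi X Y Z U T x y z = T x y z"
proof -
  have "bil H H U (\<lambda>u v. T (act X u x) y (act Z v z))"
    by (rule bilI; intro bil_linr[OF b] act_linr lin_id) (simp_all add: c hs1)
  from phi_counit2[OF U this] show "Fi X Y Z U T x y z = T x y z"
    using c hs1 by (simp add: Fi_def t)
qed

end

lemma Br_add:
  fixes X :: "('k, 'h, 'x, 'm) gmod_scheme" and Y :: "('k, 'h, 'y, 'n) gmod_scheme"
    and U :: "('k, 'u, 'l) module_scheme"
  assumes X: "hmod k H X" and Y: "hmod k H Y" and U [simp]: "module k U"
    and b: "bil Y X U b" and c: "bil Y X U c" and x: "x \<in> carrier X" and y: "y \<in> carrier Y"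
  shows "Br X Y U (\<lambda>y x. b y x \<oplus>\<^bsub>U\<^esub> c y x) x y = Br X Y U b x y \<oplus>\<^bsub>U\<^esub> Br X Y U c x y"
proof -
  interpret U: module k U by simp
  note [simp] = grade_hact[OF X] grade_hact[OF Y] bil_closed[OF b] bil_closed[OF c]
  have bc: "bil Y X U (\<lambda>y x. b y x \<oplus>\<^bsub>U\<^esub> c y x)"
    by (intro bilI lin_add bil_lin1[OF b] bil_lin1[OF c] bil_lin2[OF b] bil_lin2[OF c]) simp_all
  show ?thesis
  proof (rule Br_eqI[OF X Y U, where f = "Br X Y U (\<lambda>y x. b y x \<oplus>\<^bsub>U\<^esub> c y x)" and g = "\<lambda>x y. Br X Y U b x y \<oplus>\<^bsub>U\<^esub> Br X Y U c x y", OF Br_bil[OF X Y U bc] _ _ x y])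
    show "bil X Y U (\<lambda>x y. Br X Y U b x y \<oplus>\<^bsub>U\<^esub> Br X Y U c x y)"
      by (intro bilI lin_add bil_lin1[OF Br_bil[OF X Y U b]] bil_lin1[OF Br_bil[OF X Y U c]]
          bil_lin2[OF Br_bil[OF X Y U b]] bil_lin2[OF Br_bil[OF X Y U c]]) simp_all
    fix p q x y assume xp: "x \<in> grade X p" and yq: "y \<in> grade Y q"
    note [simp] = grade_carrier[OF X xp] grade_carrier[OF Y yq]
    have "ksgn U p q (u \<oplus>\<^bsub>U\<^esub> v) = ksgn U p q u \<oplus>\<^bsub>U\<^esub> ksgn U p q v" if "u \<in> carrier U" "v \<in> carrier U" for u v
      using that by (simp add: ksgn_def U.M.minus_add)
    then show "Br X Y U (\<lambda>y x. b y x \<oplus>\<^bsub>U\<^esub> c y x) x y = Br X Y U b x y \<oplus>\<^bsub>U\<^esub> Br X Y U c x y"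
      by (simp add: Br_homog_bil[OF X Y U bc xp yq] Br_homog_bil[OF X Y U b xp yq] Br_homog_bil[OF X Y U c xp yq] s2_add)
  qed
qed

lemma hmorph_cong:
  fixes X :: "('k, 'h, 'x, 'm) gmod_scheme" and Y :: "('k, 'h, 'y, 'n) gmod_scheme"
  assumes X: "hmod k H X" and f: "hmorph k H X Y g" and e: "\<And>x. x \<in> carrier X \<Longrightarrow> f x = g x"
  shows "hmorph k H X Y f"
proof (rule hmorphI)
  show "lin X Y f" using hmorph_lin[OF f] lin_cong[OF grade_module[OF X], of f g Y] e by simp
  show "f (act X h x) = act Y h (f x)" if "h \<in> carrier H" "x \<in> carrier X" for h x
    using hmorph_act[OF f that] that grade_hact[OF X] by (simp add: e)
  show "f x \<in> grade Y p" if "x \<in> grade X p" for x p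
    using hmorph_grade[OF f that] grade_carrier[OF X that] by (simp add: e)
qed

text \<open>Only the left action enters \<open>lhat\<close>, so that \<open>hom_over\<close> can be used as \<open>V\<close> before its right action
  is known to be one.\<close>

definition lmod :: "('k, 'h, 'a, 'm) gmod_scheme \<Rightarrow> ('k, 'h, 'a, 'v) hbimod \<Rightarrow> bool" where
  "lmod A V \<longleftrightarrow> hmod k H V \<and> hbil A V V (\<lambda>a v. lact V (tpure k A V a v))"

lemma lmodD:
  assumes "lmod A V"
  shows lmod_hmod: "hmod k H V" and lmod_hbil: "hbil A V V (\<lambda>a v. lact V (tpure k A V a v))"
  using assms by (simp_all add: lmod_def)

context
  fixes A :: "('k, 'h, 'a) halg" and V :: "('k, 'h, 'a, 'v) hbimod"
  assumes A: "hmod k H A" and V: "lmod A V"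
begin

private lemmas Vh = lmod_hmod[OF V] and Vb = lmod_hbil[OF V]
private lemmas hs2 = grade_hact[OF A] grade_hact[OF Vh]

lemma lhat_cur: "a \<in> carrier A \<Longrightarrow> lhat k H A V a = cur A V V (\<lambda>a v. lact V (tpure k A V a v)) a"
  unfolding lhat_def by (rule zeta_cur[OF hs2(1,2,2) hbil_ebil[OF Vb] refl])

lemma lhat_hmorph: "hmorph k H A (iend k H V) (lhat k H A V)"
  by (rule hmorph_cong[OF A cur_hmorph[OF Vb A Vh Vh] lhat_cur])

lemma evb_lhat: "a \<in> carrier A \<Longrightarrow> v \<in> carrier V \<Longrightarrow> evb V V (lhat k H A V a) v = lact V (tpure k A V a v)"
  unfolding lhat_cur by (rule evb_cur[OF hs2(1,2,2) hbil_ebil[OF Vb]])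

end

text \<open>\<open>M\<close> stands for the internal hom over \<open>A\<close>. It is kept abstract
  as a graded subobject on which the bracket with \<open>A\<close> vanishes, with the braiding in
  \<open>MA\<close> formed over \<open>M\<close> itself.\<close>

context
  fixes A :: "('k, 'h, 'a) halg" and V :: "('k, 'h, 'a, 'v) hbimod" and W :: "('k, 'h, 'a, 'w) hbimod"
    and M :: "('k, 'h, 'v \<Rightarrow> 'w, 'm) gmod_scheme"
  assumes A: "hmod k H A" and V: "lmod A V" and W: "lmod A W" and M: "hmod k H M" and MN: "hsub M (ihom k H V W)"
    and MA: "\<And>K a. K \<in> carrier M \<Longrightarrow> a \<in> carrier A \<Longrightarrow> comp V V W K (lhat k H A V a) =
       Br M A (ihom k H V W) (\<lambda>a K. comp V W W (lhat k H A W a) K) K a"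
begin

private abbreviation "HVW \<equiv> ihom k H V W"
private abbreviation "EV \<equiv> iend k H V"
private abbreviation "EW \<equiv> iend k H W"
private abbreviation "lV \<equiv> lhat k H A V"
private abbreviation "lW \<equiv> lhat k H A W"
private abbreviation "cW \<equiv> comp V W W"
private abbreviation "cV \<equiv> comp V V W"
private abbreviation "l \<equiv> \<lambda>a K. cW (lW a) K"

private lemmas Vm = lmod_hmod[OF V] and Wm = lmod_hmod[OF W]
private lemmas Nm = ihom_hmod[OF Vm Wm] and EVm = ihom_hmod[OF Vm Vm] and EWm = ihom_hmod[OF Wm Wm]
private lemmas hs = grade_hact[OF Vm] grade_hact[OF Wm] grade_hact[OF A] grade_hact[OF M]
private lemmas lVh = lhat_hmorph[OF A V] and lWh = lhat_hmorph[OF A W]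
private lemmas lc = hmorph_closed[OF lVh] hmorph_closed[OF lWh]
private lemmas ll = lin_comp[OF _ hmorph_lin[OF lVh]] lin_comp[OF _ hmorph_lin[OF lWh]]
private lemmas inc = hsub_hmorph[OF MN]
private lemmas Mc = hmorph_closed[OF inc]
private lemmas Ml = lin_comp[OF _ hmorph_lin[OF inc]]

private lemma Nmod: "module k HVW" using hs by simp

private lemma l_bil: "bil A M HVW l"
  by (rule bilI; intro lin_rules ll Ml lin_id) (simp_all add: hs lc Mc)

context
  fixes X :: "('k, 'h, 'x, 'n) gmod_scheme" and D
  assumes X: "hmod k H X" and D: "hbil X A A D"
    and Dt: "\<And>h x a. h \<in> carrier H \<Longrightarrow> x \<in> carrier X \<Longrightarrow> a \<in> carrier A \<Longrightarrow> D (act X h x) a = counit H h \<odot>\<^bsub>A\<^esub> D x a"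
begin

private lemmas Xh = grade_hact[OF X]
private lemmas Dc = bil_closed[OF hbil_bil[OF D]]
private lemmas Dl' = bil_linr[OF hbil_bil[OF D]]

text \<open>\<open>D x a\<close> stands for \<open>d(c) a\<close>, where \<open>c\<close> is the component of \<open>x\<close> in \<open>I[1]\<close>; its only properties used
  are equivariance and that \<open>H\<close> acts trivially on \<open>x\<close>.\<close>

lemma trivial_left_act:
  assumes [simp]: "h \<in> carrier H" "x \<in> carrier X" "a \<in> carrier A"
  shows "act A h (D x a) = D x (act A h a)"
proof -
  note [simp] = hs Xh Dc
  have f: "lin H A (\<lambda>u. D x (act A u a))" by (intro Dl' act_linr lin_id) simp_all
  have "act A h (D x a) = s2 A (Dl h) (\<lambda>u v. counit H u \<odot>\<^bsub>A\<^esub> D x (act A v a))"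
    by (simp add: ebil_act[OF hbil_ebil[OF D]] Dt)
  also have "\<dots> = D x (act A h a)" by (rule counit_left_sum[OF _ _ f]) simp_all
  finally show ?thesis .
qed

text \<open>The commutation rule of \<open>g\<close>, composed with \<open>K\<close> from the right.
  Associativity of composition rewrites each term as nested actions on \<open>K\<close>, at the
  price of one reassociation.\<close>

lemma comp_left_action:
  assumes g: "hmorph k H X EW g"
    and gD: "\<And>x a. x \<in> carrier X \<Longrightarrow> a \<in> carrier A \<Longrightarrow> comp W W W (g x) (lW a) =
       Br X A EW (\<lambda>a x. comp W W W (lW a) (g x)) x a \<oplus>\<^bsub>EW\<^esub> lW (D x a)"
    and x [simp]: "x \<in> carrier X" and a [simp]: "a \<in> carrier A" and K [simp]: "K \<in> carrier M"
  shows "Br X A HVW (\<lambda>a x. Fi A X M HVW (\<lambda>a x K. l a (cW (g x) K)) a x K) x a \<oplus>\<^bsub>HVW\<^esub> l (D x a) K =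
    Fi X A M HVW (\<lambda>x a K. cW (g x) (l a K)) x a K" (is "?F1 x a K \<oplus>\<^bsub>_\<^esub> ?lD x a K = Fi _ _ _ _ ?S _ _ _")
proof -
  note [simp] = hs Xh lc Mc Dc hmorph_closed[OF g] Nmod
  note gl = lin_comp[OF _ hmorph_lin[OF g]]
  note LL = comp_linr ll Ml gl lin_id Dl'
  let ?B = "\<lambda>a x. comp W W W (lW a) (g x)"
  have Bb: "bil A X EW ?B" by (rule bilI; intro LL) simp_all
  have cl: "lin EW HVW (\<lambda>L. cW L K)" by (intro LL) simp_all
  have "?F1 x a K = Br X A HVW (\<lambda>a x. cW (?B a x) K) x a"
  proof (rule Br_cong[OF X A Nmod x a])
    fix x a assume [simp]: "x \<in> carrier X" "a \<in> carrier A"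
    show "Fi A X M HVW (\<lambda>a x K. l a (cW (g x) K)) a x K = cW (?B a x) K"
      by (subst comp_assoc, simp_all, rule Fi_morph(1)[OF _ _ _ Nmod lWh g inc]) simp_all
  qed
  also have "\<dots> = cW (Br X A EW ?B x a) K"
    by (rule Br_push[OF X A _ Bb cl Nmod x a, symmetric]) simp
  finally have "?F1 x a K \<oplus>\<^bsub>HVW\<^esub> ?lD x a K = cW (Br X A EW ?B x a \<oplus>\<^bsub>EW\<^esub> lW (D x a)) K"
    using Br_closed[OF X A _ Bb x a] by (simp add: linD(2)[OF cl])
  also have "\<dots> = cW (comp W W W (g x) (lW a)) K" by (simp only: gD[OF x a])
  also have "\<dots> = Fi X A M HVW ?S x a K"
    by (subst comp_assoc, simp_all, rule Fi_morph(1)[OF _ _ _ Nmod g lWh inc, symmetric]) simp_all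
  finally show ?thesis .
qed

text \<open>Associativity brings \<open>a\<close> next to \<open>K\<close>, \<open>MA\<close>
  exchanges them, and the rule of \<open>g\<close> then applies to \<open>g x\<close> and
  \<open>a\<close>. The resulting sequence of braidings and associators is one side of the hexagon
  for \<open>x\<close> and \<open>K\<close> past \<open>a\<close>.\<close>

lemma bracket_comp_left:
  assumes g: "hmorph k H X EW g"
    and gD: "\<And>x a. x \<in> carrier X \<Longrightarrow> a \<in> carrier A \<Longrightarrow> comp W W W (g x) (lW a) =
       Br X A EW (\<lambda>a x. comp W W W (lW a) (g x)) x a \<oplus>\<^bsub>EW\<^esub> lW (D x a)"
    and x: "x \<in> carrier X" and K: "K \<in> carrier M" and a: "a \<in> carrier A"
  shows "cV (cW (g x) K) (lV a) = Br HVW A HVW l (cW (g x) K) a \<oplus>\<^bsub>HVW\<^esub> Br M A HVW (\<lambda>a K. l (D x a) K) K a"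
proof -
  note [simp] = hs Xh lc Mc Dc hmorph_closed[OF g] Nmod
  note gl = lin_comp[OF _ hmorph_lin[OF g]]
  note LL = comp_linr ll Ml gl lin_id Dl'
  let ?S = "\<lambda>x a K. cW (g x) (l a K)"
  let ?lD = "\<lambda>x a K. l (D x a) K"
  let ?F1 = "\<lambda>x a K. Br X A HVW (\<lambda>a x. Fi A X M HVW (\<lambda>a x K. l a (cW (g x) K)) a x K) x a"
  have lN: "bil A HVW HVW l" by (rule bilI; intro LL) simp_all
  have Sb: "bil A M HVW (?S x)" and lDb: "bil A M HVW (?lD x)" if "x \<in> carrier X" for x
    by (rule bilI; intro LL; simp add: that)+
  have m: "hbil X M HVW (\<lambda>x K. cW (g x) K)"
    by (rule hbil_morph[OF hbil_comp[OF Vm Wm Wm] g inc hmorph_id]) simp_all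
  note F1 = comp_left_action[OF g gD]
  have F1c: "?F1 x a K \<in> carrier HVW" if [simp]: "x \<in> carrier X" "a \<in> carrier A" "K \<in> carrier M" for x a K
  proof -
    have "bil A X HVW (\<lambda>a x. Fi A X M HVW (\<lambda>a x K. l a (cW (g x) K)) a x K)"
      unfolding Fi_def by (rule bilI; intro lin_s3 LL act_linr) simp_all
    from Br_closed[OF X A Nmod this] show ?thesis by simp
  qed
  \<comment> \<open>\<open>comp_left_action\<close> determines the reassociated composite;
    \<open>Fv\<close> isolates the composite itself. The derivative term is unchanged, since
    \<open>H\<close> acts on \<open>x\<close> through the counit.\<close>
  have S: "?S x a K = Fv X A M HVW ?F1 x a K \<oplus>\<^bsub>HVW\<^esub> ?lD x a K"
    if x [simp]: "x \<in> carrier X" and a [simp]: "a \<in> carrier A" and K [simp]: "K \<in> carrier M" for x a K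
  proof -
    have "?S x a K = Fv X A M HVW (Fi X A M HVW ?S) x a K"
      by (rule Fi_Fv(2)[symmetric]) (simp_all, (intro LL; simp)+)
    also have "\<dots> = Fv X A M HVW (\<lambda>x a K. ?F1 x a K \<oplus>\<^bsub>HVW\<^esub> ?lD x a K) x a K"
      by (rule Fi_cong(2)) (simp_all only: F1 hs Xh Nmod x a K)
    also have "\<dots> = Fv X A M HVW ?F1 x a K \<oplus>\<^bsub>HVW\<^esub> Fv X A M HVW ?lD x a K"
      by (rule Fi_add(2)) (simp_all add: F1c)
    also have "Fv X A M HVW ?lD x a K = ?lD x a K"
      by (rule Fi_trivial_left(2)[where T = ?lD and x = x, OF _ _ _ _ _ lDb[OF x] x a K]) (simp_all add: Dt linD(3)[OF hmorph_lin[OF lWh]] linD(3)[OF bil_lin1[OF comp_bil]])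
    finally show ?thesis .
  qed
  \<comment> \<open>Bilinearity of the braided term is read off from \<open>S\<close>, which
    presents it as a difference of two bilinear maps.\<close>
  have Vb: "bil A M HVW (Fv X A M HVW ?F1 x)" if x [simp]: "x \<in> carrier X" for x
  proof -
    interpret N: module k HVW by simp
    have "bil A M HVW (\<lambda>a K. ?S x a K \<ominus>\<^bsub>HVW\<^esub> ?lD x a K)"
      by (rule bilI; intro lin_sub LL) simp_all
    moreover have "Fv X A M HVW ?F1 x a K = ?S x a K \<ominus>\<^bsub>HVW\<^esub> ?lD x a K" if [simp]: "a \<in> carrier A" "K \<in> carrier M" for a K
    proof -
      have "Fv X A M HVW ?F1 x a K \<in> carrier HVW" by (simp add: Fv_def F1c)
      then show ?thesis by (subst S) (simp_all add: a_minus_def N.M.a_assoc N.M.r_neg)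
    qed
    ultimately show ?thesis by (subst bil_cong[where b' = "\<lambda>a K. ?S x a K \<ominus>\<^bsub>HVW\<^esub> ?lD x a K"]) simp_all
  qed
  let ?P = "\<lambda>x K a. Br M A HVW (\<lambda>a K. Fv X A M HVW ?F1 x a K) K a"
  let ?Q = "\<lambda>x K a. Br M A HVW (?lD x) K a"
  have "cV (cW (g x) K) (lV a) = Fi X M A HVW (\<lambda>x K a. cW (g x) (cV K (lV a))) x K a"
    using x K a by (subst comp_assoc, simp_all, intro Fi_morph(1)[OF _ _ _ Nmod g inc lVh, symmetric]) simp_all
  also have "\<dots> = Fi X M A HVW (\<lambda>x K a. ?P x K a \<oplus>\<^bsub>HVW\<^esub> ?Q x K a) x K a"
  proof (rule Fi_cong(1)[OF _ _ _ _ _ x K a])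
    fix x K a assume x [simp]: "x \<in> carrier X" and K [simp]: "K \<in> carrier M" and a [simp]: "a \<in> carrier A"
    have cl: "lin HVW HVW (\<lambda>J. cW (g x) J)" by (intro LL) simp_all
    have "cW (g x) (cV K (lV a)) = Br M A HVW (?S x) K a"
      by (simp add: MA Br_push[OF M A Nmod l_bil cl Nmod])
    also have "\<dots> = Br M A HVW (\<lambda>a K. Fv X A M HVW ?F1 x a K \<oplus>\<^bsub>HVW\<^esub> ?lD x a K) K a"
      by (rule Br_cong[OF M A Nmod K a S]) simp_all
    also have "\<dots> = ?P x K a \<oplus>\<^bsub>HVW\<^esub> ?Q x K a"
      by (rule Br_add[OF M A Nmod Vb lDb K a]) simp_all
    finally show "cW (g x) (cV K (lV a)) = ?P x K a \<oplus>\<^bsub>HVW\<^esub> ?Q x K a" .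
  qed simp_all
  also have "\<dots> = Fi X M A HVW ?P x K a \<oplus>\<^bsub>HVW\<^esub> Fi X M A HVW ?Q x K a"
    by (rule Fi_add(1)) (simp_all add: x K a Br_closed[OF M A Nmod Vb] Br_closed[OF M A Nmod lDb])
  also have "Fi X M A HVW ?Q x K a = ?Q x K a"
  proof (rule Fi_trivial_left(1)[OF _ _ _ _ _ _ x K a])
    show "bil M A HVW (?Q x)" by (rule Br_bil[OF M A Nmod lDb[OF x]])
    fix h x K a assume [simp]: "h \<in> carrier H" "x \<in> carrier X" "K \<in> carrier M" "a \<in> carrier A"
    have cl: "lin HVW HVW (\<lambda>u. counit H h \<odot>\<^bsub>HVW\<^esub> u)" by (intro lin_smultr lin_id) simp_all
    have "?Q (act X h x) K a = Br M A HVW (\<lambda>a K. counit H h \<odot>\<^bsub>HVW\<^esub> ?lD x a K) K a"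
      by (rule Br_cong[OF M A Nmod]) (simp_all add: Dt linD(3)[OF hmorph_lin[OF lWh]] linD(3)[OF bil_lin1[OF comp_bil]])
    also have "\<dots> = counit H h \<odot>\<^bsub>HVW\<^esub> ?Q x K a"
      by (rule Br_push[OF M A Nmod lDb cl Nmod, symmetric]) simp_all
    finally show "?Q (act X h x) K a = counit H h \<odot>\<^bsub>HVW\<^esub> ?Q x K a" .
  qed simp_all
  \<comment> \<open>The hexagon is read from right to left.\<close>
  also have "Fi X M A HVW ?P x K a = Br HVW A HVW l (cW (g x) K) a"
    by (rule braid_tensor_left[OF X M A Nm Nmod hbil_ebil[OF m] hbil_grade[OF m] lN x K a, symmetric])
  finally show ?thesis .
qed

text \<open>With \<open>K\<close> on the left, \<open>a\<close> meets \<open>g x\<close> first, so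
  the derivative term appears directly behind \<open>K\<close>. The other term agrees, by the
  hexagon, with the braided left action on the composite.\<close>

lemma bracket_comp_right:
  assumes g: "hmorph k H X EV g"
    and gD: "\<And>x a. x \<in> carrier X \<Longrightarrow> a \<in> carrier A \<Longrightarrow> comp V V V (g x) (lV a) =
       Br X A EV (\<lambda>a x. comp V V V (lV a) (g x)) x a \<oplus>\<^bsub>EV\<^esub> lV (D x a)"
    and x: "x \<in> carrier X" and K: "K \<in> carrier M" and a: "a \<in> carrier A"
  shows "cV (cV K (g x)) (lV a) = Br HVW A HVW l (cV K (g x)) a \<oplus>\<^bsub>HVW\<^esub> cV K (lV (D x a))"
proof -
  note [simp] = hs Xh lc Mc Dc hmorph_closed[OF g] Nmod
  note gl = lin_comp[OF _ hmorph_lin[OF g]]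
  note LL = comp_linr ll Ml gl lin_id Dl'
  let ?B = "\<lambda>a x. comp V V V (lV a) (g x)"
  let ?G = "\<lambda>K a x. Br M A HVW (\<lambda>a K. Fi A M X HVW (\<lambda>a K x. l a (cV K (g x))) a K x) K a"
  let ?E = "\<lambda>K x a. Br X A EV ?B x a"
  have EVmod: "module k EV" by simp
  have Bb: "bil A X EV ?B" by (rule bilI; intro LL) simp_all
  have lN: "bil A HVW HVW l" by (rule bilI; intro LL) simp_all
  have m: "hbil M X HVW (\<lambda>K x. cV K (g x))"
    by (rule hbil_morph[OF hbil_comp[OF Vm Vm Wm] inc g hmorph_id]) simp_all
  \<comment> \<open>\<open>MA\<close> moves \<open>a\<close> past \<open>K\<close> inside a
    composite with \<open>g x\<close>; both reassociations come from associativity of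
    composition.\<close>
  have G: "?G K a x = Fi M A X HVW (\<lambda>K a x. cV K (?B a x)) K a x"
    if x [simp]: "x \<in> carrier X" and a [simp]: "a \<in> carrier A" and K [simp]: "K \<in> carrier M" for x a K
  proof -
    have cl: "lin HVW HVW (\<lambda>J. cV J (g x))" by (intro LL) simp_all
    have "?G K a x = Br M A HVW (\<lambda>a K. cV (l a K) (g x)) K a"
    proof (rule Br_cong[OF M A Nmod K a])
      fix K a assume [simp]: "K \<in> carrier M" "a \<in> carrier A"
      show "Fi A M X HVW (\<lambda>a K x. l a (cV K (g x))) a K x = cV (l a K) (g x)"
        by (subst comp_assoc, simp_all, rule Fi_morph(1)[OF _ _ _ Nmod lWh inc g]) simp_all
    qed
    also have "\<dots> = cV (Br M A HVW l K a) (g x)"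
      by (rule Br_push[OF M A Nmod l_bil cl Nmod K a, symmetric])
    also have "\<dots> = cV (cV K (lV a)) (g x)" by (simp add: MA)
    also have "\<dots> = Fi M A X HVW (\<lambda>K a x. cV K (?B a x)) K a x"
      by (subst comp_assoc, simp_all, rule Fi_morph(1)[OF _ _ _ Nmod inc lVh g, symmetric]) simp_all
    finally show ?thesis .
  qed
  have G': "Fv M A X HVW ?G K a x = cV K (?B a x)"
    if x [simp]: "x \<in> carrier X" and a [simp]: "a \<in> carrier A" and K [simp]: "K \<in> carrier M" for x a K
  proof -
    have "Fv M A X HVW ?G K a x = Fv M A X HVW (Fi M A X HVW (\<lambda>K a x. cV K (?B a x))) K a x"
      by (rule Fi_cong(2)) (simp_all add: G)
    also have "\<dots> = cV K (?B a x)"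
      by (rule Fi_Fv(2)) (simp_all, (intro LL; simp)+)
    finally show ?thesis .
  qed
  have Ec: "?E K x a \<in> carrier EV" if "x \<in> carrier X" "a \<in> carrier A" for x a K
    by (rule Br_closed[OF X A EVmod Bb that])
  \<comment> \<open>The hexagon splits the braiding of the composite past \<open>a\<close> into one
    past \<open>x\<close> and one past \<open>K\<close>; the latter is already computed in
    \<open>G'\<close>.\<close>
  have hex: "Br HVW A HVW l (cV K (g x)) a = Fi M X A HVW (\<lambda>K x a. cV K (?E K x a)) K x a"
  proof -
    have "Br HVW A HVW l (cV K (g x)) a = Fi M X A HVW (\<lambda>K x a. Br X A HVW (\<lambda>a x. Fv M A X HVW ?G K a x) x a) K x a"
      by (rule braid_tensor_left[OF M X A Nm Nmod hbil_ebil[OF m] hbil_grade[OF m] lN K x a])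
    also have "\<dots> = Fi M X A HVW (\<lambda>K x a. cV K (?E K x a)) K x a"
    proof (rule Fi_cong(1)[OF _ _ _ _ _ K x a])
      fix x K a assume x [simp]: "x \<in> carrier X" and K [simp]: "K \<in> carrier M" and a [simp]: "a \<in> carrier A"
      have cl: "lin EV HVW (\<lambda>J. cV K J)" by (intro LL) simp_all
      have "Br X A HVW (\<lambda>a x. Fv M A X HVW ?G K a x) x a = Br X A HVW (\<lambda>a x. cV K (?B a x)) x a"
        by (rule Br_cong[OF X A Nmod x a G']) simp_all
      also have "\<dots> = cV K (?E K x a)" by (rule Br_push[OF X A EVmod Bb cl Nmod x a, symmetric])
      finally show "Br X A HVW (\<lambda>a x. Fv M A X HVW ?G K a x) x a = cV K (?E K x a)" .
    qed simp_all
    finally show ?thesis .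
  qed
  have "cV (cV K (g x)) (lV a) = Fi M X A HVW (\<lambda>K x a. cV K (comp V V V (g x) (lV a))) K x a"
    using x K a by (subst comp_assoc, simp_all, intro Fi_morph(1)[OF _ _ _ Nmod inc g lVh, symmetric]) simp_all
  also have "\<dots> = Fi M X A HVW (\<lambda>K x a. cV K (?E K x a) \<oplus>\<^bsub>HVW\<^esub> cV K (lV (D x a))) K x a"
    by (rule Fi_cong(1)) (simp_all add: x K a gD Ec linD(2)[OF bil_lin2[OF comp_bil]])
  also have "\<dots> = Fi M X A HVW (\<lambda>K x a. cV K (?E K x a)) K x a \<oplus>\<^bsub>HVW\<^esub> Fi M X A HVW (\<lambda>K x a. cV K (lV (D x a))) K x a"
    by (rule Fi_add(1)) (simp_all add: x K a Ec)
  also have "Fi M X A HVW (\<lambda>K x a. cV K (lV (D x a))) K x a = cV K (lV (D x a))"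
  proof (rule Fi_trivial_middle[OF _ _ _ _ _ _ K x a])
    show "bil M A HVW (\<lambda>K a. cV K (lV (D x a)))" by (rule bilI; intro LL) (simp_all add: x)
  qed (simp_all add: Dt linD(3)[OF hmorph_lin[OF lVh]] linD(3)[OF bil_lin2[OF comp_bil]])
  finally show ?thesis by (simp only: hex)
qed

text \<open>The previous rule is pushed through the braiding of \<open>x\<close> past
  \<open>K\<close>. The derivative term then takes exactly the form it has in
  \<open>bracket_comp_left\<close>, which makes the difference of the two composites commute with
  \<open>A\<close>.\<close>

lemma bracket_comp_right_braided:
  assumes g: "hmorph k H X EV g"
    and gD: "\<And>x a. x \<in> carrier X \<Longrightarrow> a \<in> carrier A \<Longrightarrow> comp V V V (g x) (lV a) =
       Br X A EV (\<lambda>a x. comp V V V (lV a) (g x)) x a \<oplus>\<^bsub>EV\<^esub> lV (D x a)"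
    and x: "x \<in> carrier X" and K: "K \<in> carrier M" and a: "a \<in> carrier A"
  shows "cV (Br X M HVW (\<lambda>K x. cV K (g x)) x K) (lV a) =
    Br HVW A HVW l (Br X M HVW (\<lambda>K x. cV K (g x)) x K) a \<oplus>\<^bsub>HVW\<^esub> Br M A HVW (\<lambda>a K. l (D x a) K) K a"
proof -
  note [simp] = hs Xh lc Mc Dc hmorph_closed[OF g] Nmod
  note gl = lin_comp[OF _ hmorph_lin[OF g]]
  note LL = comp_linr ll Ml gl lin_id Dl'
  interpret N: module k HVW by simp
  let ?m = "\<lambda>K x. cV K (g x)"
  let ?R = "\<lambda>a K x. cV K (lV (D x a))"
  have mb: "bil M X HVW ?m" by (rule bilI; intro LL) simp_all
  have lN: "bil A HVW HVW l" by (rule bilI; intro LL) simp_all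
  note lb = bil_linr[OF Br_bil[OF Nm A Nmod lN]]
  have cl: "lin HVW HVW (\<lambda>J. cV J (lV a))" "lin HVW HVW (\<lambda>J. Br HVW A HVW l J a)" by (intro LL lb; simp add: a)+
  have Rb: "bil M X HVW (?R a)" if "a \<in> carrier A" for a by (rule bilI; intro LL) (simp_all add: that)
  have lDb: "bil A M HVW (\<lambda>a K. l (D x a) K)" if "x \<in> carrier X" for x
    by (rule bilI; intro LL) (simp_all add: that)
  have 1: "cV (Br X M HVW ?m x K) (lV a) = Br HVW A HVW l (Br X M HVW ?m x K) a \<oplus>\<^bsub>HVW\<^esub> Br X M HVW (?R a) x K"
  proof -
    have "cV (Br X M HVW ?m x K) (lV a) = Br X M HVW (\<lambda>K x. cV (?m K x) (lV a)) x K"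
      by (rule Br_push[OF X M Nmod mb cl(1) Nmod x K])
    also have "\<dots> = Br X M HVW (\<lambda>K x. Br HVW A HVW l (?m K x) a \<oplus>\<^bsub>HVW\<^esub> ?R a K x) x K"
      by (rule Br_cong[OF X M Nmod x K]) (rule bracket_comp_right[OF g gD _ _ a])
    also have "\<dots> = Br X M HVW (\<lambda>K x. Br HVW A HVW l (?m K x) a) x K \<oplus>\<^bsub>HVW\<^esub> Br X M HVW (?R a) x K"
      by (rule Br_add[OF X M Nmod _ Rb[OF a] x K]) (rule bil_comp_lin[OF mb cl(2)])
    also have "Br X M HVW (\<lambda>K x. Br HVW A HVW l (?m K x) a) x K = Br HVW A HVW l (Br X M HVW ?m x K) a"
      by (rule Br_push[OF X M Nmod mb cl(2) Nmod x K, symmetric])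
    finally show ?thesis .
  qed
  \<comment> \<open>The braided derivative term: by \<open>MA\<close> the right multiplication by
    \<open>lV (D x a)\<close> becomes a left action on \<open>K\<close>.\<close>
  have "Br X M HVW (?R a) x K = Br M A HVW (\<lambda>a K. l (D x a) K) K a"
  proof (rule homog_ext[OF A Nmod _ _ _ a])
    show "lin A HVW (\<lambda>a. Br X M HVW (?R a) x K)"
      by (rule Br_param[OF X M Nmod _ x K]) ((intro LL; simp), simp)
    show "lin A HVW (\<lambda>a. Br M A HVW (\<lambda>a K. l (D x a) K) K a)"
      by (rule bil_lin2[OF Br_bil[OF M A Nmod lDb[OF x]] K])
    fix s a assume as: "a \<in> grade A s"
    note a [simp] = grade_carrier[OF A as]
    show "Br X M HVW (?R a) x K = Br M A HVW (\<lambda>a K. l (D x a) K) K a"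
    proof (rule Br_eqI[OF X M Nmod, where f = "Br X M HVW (?R a)" and g = "\<lambda>x K. Br M A HVW (\<lambda>a K. l (D x a) K) K a", OF Br_bil[OF X M Nmod Rb[OF a]] _ _ x K])
      show "bil X M HVW (\<lambda>x K. Br M A HVW (\<lambda>a K. l (D x a) K) K a)"
        by (rule bilI, rule bil_lin1[OF Br_bil[OF M A Nmod lDb] a], assumption,
            rule Br_param[OF M A Nmod _ _ a]) ((intro LL; simp), simp_all)
      fix p q x K assume xp: "x \<in> grade X p" and Kq: "K \<in> grade M q"
      note x [simp] = grade_carrier[OF X xp] and K [simp] = grade_carrier[OF M Kq]
      have Da: "D x a \<in> grade A (p + s)" by (rule hbil_grade[OF D xp as])
      let ?s = "s2 HVW Rl (\<lambda>r t. l (D x (act A t a)) (act M r K))"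
      \<comment> \<open>The leg of the outer R-matrix on \<open>x\<close> acts through the counit,
        so by \<open>counit_rmat\<close> only the sign of the braiding is left.\<close>
      have "lin H HVW (\<lambda>t. cV (act M t K) (lV (D x a)))" by (intro LL act_linr) simp_all
      note c = counit_rmat[OF _ this]
      have "Br X M HVW (?R a) x K = ksgn HVW p q (cV K (lV (D x a)))"
        using c by (simp add: Br_homog_bil[OF X M Nmod Rb[OF a] xp Kq] Dt linD(3)[OF hmorph_lin[OF lVh]] linD(3)[OF bil_lin2[OF comp_bil]])
      also have "cV K (lV (D x a)) = ksgn HVW q (p + s) ?s"
        by (simp add: MA Br_homog_bil[OF M A Nmod l_bil Kq Da] trivial_left_act)
      \<comment> \<open>As \<open>D x a\<close> has degree \<open>p + s\<close>, the sign for
        passing it across \<open>K\<close> contains the sign for passing \<open>x\<close>, and the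
        latter occurs twice.\<close>
      also have "ksgn HVW p q (ksgn HVW q (p + s) ?s) = ksgn HVW q s ?s"
      proof -
        have sc: "?s \<in> carrier HVW" by simp
        show ?thesis
          by (simp only: ksgn_add(2)[OF Nmod sc] ksgn_comm[of HVW p q] ksgn_add(3)[OF Nmod ksgn_closed[OF Nmod sc]])
      qed
      also have "\<dots> = Br M A HVW (\<lambda>a K. l (D x a) K) K a"
        by (rule Br_homog_bil[OF M A Nmod lDb[OF x] Kq as, symmetric])
      finally show "Br X M HVW (?R a) x K = Br M A HVW (\<lambda>a K. l (D x a) K) K a" .
    qed
  qed
  with 1 show ?thesis by simp
qed

end

end

end

section \<open>The internal hom over the algebra\<close>

context base_ring
begin

lemma minus_zero_iff:
  assumes "module k V" "x \<in> carrier V" "y \<in> carrier V"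
  shows "x \<ominus>\<^bsub>V\<^esub> y = \<zero>\<^bsub>V\<^esub> \<longleftrightarrow> x = y"
proof -
  interpret V: module k V by fact
  show ?thesis
    using V.M.minus_equality[of x "\<ominus>\<^bsub>V\<^esub> y"] assms(2,3) by (auto simp: a_minus_def V.M.r_neg)
qed

lemma minus_minus_zero_iff:
  assumes "module k V" "x \<in> carrier V" "y \<in> carrier V" "z \<in> carrier V"
  shows "(x \<ominus>\<^bsub>V\<^esub> y) \<ominus>\<^bsub>V\<^esub> z = \<zero>\<^bsub>V\<^esub> \<longleftrightarrow> x = y \<oplus>\<^bsub>V\<^esub> z"
proof -
  interpret V: module k V by fact
  have "(x \<ominus>\<^bsub>V\<^esub> y) \<ominus>\<^bsub>V\<^esub> z = x \<ominus>\<^bsub>V\<^esub> (y \<oplus>\<^bsub>V\<^esub> z)"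
    using assms(2-) by (simp add: a_minus_def V.M.minus_add V.M.a_assoc)
  then show ?thesis using minus_zero_iff[OF assms(1,2), of "y \<oplus>\<^bsub>V\<^esub> z"] assms(3,4) by simp
qed

end

context quasitriangular_quasi_hopf
begin

lemma hbil_cong:
  fixes X :: "('k, 'h, 'x, 'm) gmod_scheme" and Y :: "('k, 'h, 'y, 'n) gmod_scheme"
    and Z :: "('k, 'h, 'z, 'l) gmod_scheme"
  assumes X: "hmod k H X" and Y: "hmod k H Y" and b: "hbil X Y Z b"
    and e: "\<And>x y. x \<in> carrier X \<Longrightarrow> y \<in> carrier Y \<Longrightarrow> c x y = b x y"
  shows "hbil X Y Z c"
proof (rule hbilI)
  note [simp] = grade_hact[OF X] grade_hact[OF Y]
  show "bil X Y Z c" using hbil_bil[OF b] bil_cong[of X Y c b Z] e by simp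
  show "act Z h (c x y) = s2 Z (Dl h) (\<lambda>h1 h2. c (act X h1 x) (act Y h2 y))"
    if "h \<in> carrier H" "x \<in> carrier X" "y \<in> carrier Y" for h x y
    using ebil_act[OF hbil_ebil[OF b] that] that by (simp add: e)
  show "c x y \<in> grade Z (p + q)" if "x \<in> grade X p" "y \<in> grade Y q" for p q x y
    using hbil_grade[OF b that] grade_carrier[OF X that(1)] grade_carrier[OF Y that(2)] by (simp add: e)
qed

lemma Br_zero:
  fixes X :: "('k, 'h, 'x, 'm) gmod_scheme" and Y :: "('k, 'h, 'y, 'n) gmod_scheme"
    and U :: "('k, 'u, 'l) module_scheme"
  assumes X: "hmod k H X" and Y: "hmod k H Y" and U: "module k U"
    and b: "\<And>x y. x \<in> carrier X \<Longrightarrow> y \<in> carrier Y \<Longrightarrow> b y x = \<zero>\<^bsub>U\<^esub>" and x: "x \<in> carrier X" and y: "y \<in> carrier Y"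
  shows "Br X Y U b x y = \<zero>\<^bsub>U\<^esub>"
proof -
  have z: "bil Y X U (\<lambda>y x. \<zero>\<^bsub>U\<^esub>)" by (rule bilI; rule lin_const_zero[OF U])
  have "Br X Y U b x y = Br X Y U (\<lambda>y x. \<zero>\<^bsub>U\<^esub>) x y" by (rule Br_cong[OF X Y U x y b])
  also have "\<dots> = \<zero>\<^bsub>U\<^esub>" by (rule Br_push[OF X Y U z lin_const_zero[OF U] U x y, symmetric])
  finally show ?thesis .
qed

lemma sym_bimodule_lmod:
  assumes A: "hmod k H A" and V: "hm_sym_bimodule k H A V"
  shows "lmod A V"
proof -
  have b: "hm_bimodule k H A V" using V by (rule hm_sym_bimodule.axioms(1))
  then have h: "hmod k H V" by (rule hm_bimodule.axioms(1))
  show ?thesis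
    unfolding lmod_def
    by (intro conjI h hmorph_hbil[OF hm_bimodule.lact_morph[OF b]] grade_hact[OF A] grade_hact[OF h])
qed

section \<open>Left multiplication in a symmetric bimodule over a braided commutative
  algebra\<close>

context
  fixes A :: "('k, 'h, 'a) halg" and W :: "('k, 'h, 'a, 'w) hbimod"
  assumes AC: "hm_comm_algebra k H A" and WB: "hm_sym_bimodule k H A W"
begin

private lemma Aa: "hm_algebra k H A" by (rule hm_comm_algebra.axioms(1)[OF AC])
lemma comm_algebra_hmod: "hmod k H A" by (rule hm_algebra.axioms(1)[OF Aa])
private lemmas Am = comm_algebra_hmod
private lemmas Wl = sym_bimodule_lmod[OF Am WB]
private lemmas Wm1 = lmod_hmod[OF Wl]
private lemmas hA [simp] = grade_hact[OF Am] grade_hact[OF Wm1]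
private lemmas lWh1 = lhat_hmorph[OF Am Wl]
private abbreviation "\<mu> a b \<equiv> mu A (tpure k A A a b)"
private lemmas mu_hbil = hmorph_hbil[OF hm_algebra.mu_morph[OF Aa] hA(1,1,1)]

text \<open>Evaluated at \<open>v\<close>, the claim is the associativity axiom of the left action;
  equivariance in \<open>a\<close> and \<open>b\<close> lifts it from evaluations to
  endomorphisms.\<close>

lemma lhat_mult:
  assumes a: "a \<in> carrier A" and b: "b \<in> carrier A"
  shows "comp W W W (lhat k H A W a) (lhat k H A W b) = lhat k H A W (\<mu> a b)"
proof (rule hbil_ihom_eq[OF hA(2,2,1,1) _ _ _ a b])
  note c = bil_closed[OF hbil_bil[OF mu_hbil]] bil_closed[OF hbil_bil[OF lmod_hbil[OF Wl]]] hmorph_closed[OF lWh1]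
  show "ebil A A (iend k H W) (\<lambda>a b. comp W W W (lhat k H A W a) (lhat k H A W b))"
    by (rule hbil_ebil[OF hbil_morph[OF hbil_comp[OF Wm1 Wm1 Wm1] lWh1 lWh1 hmorph_id]]) simp_all
  show "ebil A A (iend k H W) (\<lambda>a b. lhat k H A W (\<mu> a b))"
    by (rule hbil_ebil[OF hbil_morph[OF mu_hbil hmorph_id hmorph_id lWh1]]) simp_all
  fix a b v assume a [simp]: "a \<in> carrier A" and b [simp]: "b \<in> carrier A" and v [simp]: "v \<in> carrier W"
  let ?l = "\<lambda>a v. lact W (tpure k A W a v)"
  have lW: "lin (tensor k A W) W (lact W)"
    using hmorph_lin[OF hm_bimodule.lact_morph[OF hm_sym_bimodule.axioms(1)[OF WB]]] by (simp add: lin_gtensor)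
  have mul: "lin (gtensor k H A A) A (mu A)" by (rule hmorph_lin[OF hm_algebra.mu_morph[OF Aa]])
  have mt: "lin (gtensor k H A (gtensor k H A W)) (tensor k A W) (tmap k A W id (lact W))"
    unfolding lin_gtensor(1)[of A] by (rule tmap_lin) (simp_all add: lin_id_id lin_gtensor lW)
  let ?t = "tpure k (gtensor k H A A) W (tpure k A A a b) v"
  have tc: "?t \<in> carrier (gtensor k H (gtensor k H A A) W)" by simp
  have "evb W W (comp W W W (lhat k H A W a) (lhat k H A W b)) v =
      Fi (iend k H W) (iend k H W) W W (\<lambda>L K v. evb W W L (evb W W K v)) (lhat k H A W a) (lhat k H A W b) v"
    by (rule evb_comp) (simp_all add: c)
  also have "\<dots> = Fi A A W W (\<lambda>a b v. evb W W (lhat k H A W a) (evb W W (lhat k H A W b) v)) a b v"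
    by (rule Fi_morph(1)[OF _ _ _ _ lWh1 lWh1 hmorph_id, symmetric]) simp_all
  also have "\<dots> = Fi A A W W (\<lambda>a b v. ?l a (?l b v)) a b v"
    by (rule Fi_cong(1)) (simp_all add: evb_lhat[OF Am Wl] c)
  also have "\<dots> = lact W (tmap k A W id (lact W) (assoc k H A A W ?t))"
    by (simp add: assoc_pure s3_push[OF lin_comp[OF mt lW]] tmap_pure lin_id_id lW lin_gtensor Fi_def)
  also have "\<dots> = lact W (tmap k A W (mu A) id ?t)"
    by (rule hm_bimodule.lact_assoc[OF hm_sym_bimodule.axioms(1)[OF WB] tc, symmetric])
  also have "\<dots> = ?l (\<mu> a b) v"
    by (simp add: tmap_pure mul lin_id_id)
  also have "\<dots> = evb W W (lhat k H A W (\<mu> a b)) v"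
    by (simp add: evb_lhat[OF Am Wl] c)
  finally show "evb W W (comp W W W (lhat k H A W a) (lhat k H A W b)) v = evb W W (lhat k H A W (\<mu> a b)) v" .
qed

text \<open>Braided commutativity of the product, transported along \<open>lhat_mult\<close>. It
  says that \<open>lhat\<close> obeys the commutation rule of a connection with zero derivative
  term.\<close>

lemma lhat_commute:
  assumes a: "a \<in> carrier A" and b: "b \<in> carrier A"
  shows "comp W W W (lhat k H A W a) (lhat k H A W b) =
    Br A A (iend k H W) (\<lambda>b a. comp W W W (lhat k H A W b) (lhat k H A W a)) a b"
proof -
  have E: "module k (iend k H W)" by simp
  have mul: "lin (tensor k A A) A (mu A)" using hmorph_lin[OF hm_algebra.mu_morph[OF Aa]] by (simp add: lin_gtensor)
  have "Br A A (iend k H W) (\<lambda>b a. comp W W W (lhat k H A W b) (lhat k H A W a)) a b =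
      Br A A (iend k H W) (\<lambda>b a. lhat k H A W (\<mu> b a)) a b"
    by (rule Br_cong[OF Am Am E a b lhat_mult])
  also have "\<dots> = lhat k H A W (mu A (braid k H A A (tpure k A A a b)))"
    by (rule braid_Br[OF Am Am E lin_comp[OF mul hmorph_lin[OF lWh1]] a b, symmetric])
  also have "mu A (braid k H A A (tpure k A A a b)) = \<mu> a b"
    by (rule hm_comm_algebra.mu_comm[OF AC]) (simp add: a b)
  finally show ?thesis by (simp add: lhat_mult[OF a b])
qed

end

section \<open>The bracket with \<open>A\<close> and the internal hom over \<open>A\<close>\<close>

context
  fixes A :: "('k, 'h, 'a) halg" and V :: "('k, 'h, 'a, 'v) hbimod" and W :: "('k, 'h, 'a, 'w) hbimod"
  assumes A: "hmod k H A" and V: "lmod A V" and W: "lmod A W"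
begin

private abbreviation "eHVW \<equiv> ihom k H V W"
private abbreviation "hlV \<equiv> lhat k H A V"
private abbreviation "hlW \<equiv> lhat k H A W"
private abbreviation "hcW \<equiv> comp V W W"
private abbreviation "hcV \<equiv> comp V V W"
private abbreviation "hl \<equiv> \<lambda>a K. hcW (hlW a) K"

private lemmas Vm2 = lmod_hmod[OF V] and Wm2 = lmod_hmod[OF W]
private lemmas Nm2 = ihom_hmod[OF Vm2 Wm2]
private lemmas hs3 = grade_hact[OF Vm2] grade_hact[OF Wm2] grade_hact[OF A]
private lemmas lVh2 = lhat_hmorph[OF A V] and lWh2 = lhat_hmorph[OF A W]
private lemmas lc2 = hmorph_closed[OF lVh2] hmorph_closed[OF lWh2]

private lemma Nmod2: "module k eHVW" using hs3 by simp

lemma lhat_comp_hbil: "hbil A eHVW eHVW hl" "hbil eHVW A eHVW (\<lambda>K a. hcV K (hlV a))"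
  using hs3 by (intro hbil_morph[OF hbil_comp[OF Vm2 Wm2 Wm2] lWh2 hmorph_id hmorph_id] hbil_morph[OF hbil_comp[OF Vm2 Vm2 Wm2] hmorph_id lVh2 hmorph_id]; simp)+

text \<open>The bilinear form of \<open>hom_bracket\<close>; for equal modules it is also that of
  \<open>end_bracket\<close>.\<close>

definition bracket where
  "bracket K a = hcV K (hlV a) \<ominus>\<^bsub>eHVW\<^esub> Br eHVW A eHVW hl K a"

lemma bracket_hbil: "hbil eHVW A eHVW bracket"
  unfolding bracket_def[abs_def]
  by (rule hbil_minus[OF lhat_comp_hbil(2) hbil_Br[OF Nm2 A Nm2 lhat_comp_hbil(1)] Nm2 A Nm2])

lemma hom_bracket_pure:
  assumes [simp]: "K \<in> carrier eHVW" "a \<in> carrier A"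
  shows "hom_bracket k H A V W (tpure k eHVW A K a) = bracket K a"
proof -
  note [simp] = hs3 lc2
  have i: "lin (tensor k (iend k H W) eHVW) eHVW (icomp k H V W W)" by (rule icomp_lin) simp_all
  have t: "lin (tensor k A eHVW) (tensor k (iend k H W) eHVW) (tmap k (iend k H W) eHVW hlW id)"
    by (rule tmap_lin) (simp_all add: hmorph_lin[OF lWh2] lin_id_id)
  have "icomp k H V W W (tmap k (iend k H W) eHVW hlW id (braid k H eHVW A (tpure k eHVW A K a))) =
      Br eHVW A eHVW (\<lambda>a K. icomp k H V W W (tmap k (iend k H W) eHVW hlW id (tpure k A eHVW a K))) K a"
    by (rule braid_Br[OF Nm2 A Nmod2 lin_comp[OF t i]]) simp_all
  also have "\<dots> = Br eHVW A eHVW hl K a"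
    by (rule Br_cong[OF Nm2 A Nmod2]) (simp_all add: tmap_pure hmorph_lin[OF lWh2] lin_id_id comp_def)
  finally show ?thesis
    by (simp add: hom_bracket_def bracket_def tmap_pure hmorph_lin[OF lVh2] lin_id_id comp_def)
qed

lemma bracket_zero_iff:
  assumes "K \<in> carrier eHVW" "a \<in> carrier A"
  shows "bracket K a = \<zero>\<^bsub>eHVW\<^esub> \<longleftrightarrow> hcV K (hlV a) = Br eHVW A eHVW hl K a"
  unfolding bracket_def
  by (rule minus_zero_iff[OF Nmod2 bil_closed[OF hbil_bil[OF lhat_comp_hbil(2)] assms] Br_closed[OF Nm2 A Nmod2 hbil_bil[OF lhat_comp_hbil(1)] assms]])

private abbreviation "hM \<equiv> hom_over k H A V W"

lemma hom_over_simps: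
  "carrier hM = radical eHVW A eHVW bracket" "hsub hM eHVW" "hmod k H hM"
  "lact hM = (\<lambda>t. icomp k H V W W (tmap k (iend k H W) eHVW hlW id t))"
proof -
  let ?K = "ker_obj eHVW (ihom k H A eHVW) (zeta k H eHVW A eHVW (hom_bracket k H A V W))"
  note K = ker_obj_radical[OF Nm2 A Nm2 bracket_hbil hom_bracket_pure]
  have s: "carrier hM = carrier ?K" "add hM = add ?K" "\<zero>\<^bsub>hM\<^esub> = \<zero>\<^bsub>?K\<^esub>" "smult hM = smult ?K" "act hM = act ?K" "grade hM = grade ?K"
    by (simp_all add: hom_over_def gmod.defs)
  show c: "carrier hM = radical eHVW A eHVW bracket" by (simp only: s K(1))
  show h: "hsub hM eHVW" using K(2) by (simp add: hsub_def s)
  show "hmod k H hM" by (rule radical_hmod[OF Nm2 A Nm2 bracket_hbil h c])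
  show "lact hM = (\<lambda>t. icomp k H V W W (tmap k (iend k H W) eHVW hlW id t))"
    by (simp add: hom_over_def gmod.defs hbimod.defs)
qed

private lemmas inc2 = hsub_hmorph[OF hom_over_simps(2)]

text \<open>The bracket vanishes on \<open>K\<close>, and naturality along the inclusion allows the
  braiding to be formed on the subobject. This is the hypothesis \<open>MA\<close> of the bracket
  computations.\<close>

lemma hom_over_bracket:
  assumes K: "K \<in> carrier hM" and a: "a \<in> carrier A"
  shows "hcV K (hlV a) = Br hM A eHVW hl K a"
proof -
  note Kr = K[unfolded hom_over_simps(1)]
  have "hcV K (hlV a) = Br eHVW A eHVW hl K a"
    using radicalD[OF Kr grade_hact[OF Nm2] a] bracket_zero_iff[OF _ a] by blast
  also have "\<dots> = Br hM A eHVW hl K a"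
    by (rule Br_natural[OF hom_over_simps(3) A Nm2 A Nmod2 hbil_bil[OF lhat_comp_hbil(1)] inc2 hmorph_id K a, symmetric])
  finally show ?thesis .
qed

text \<open>A translate of a value of an equivariant family is a sum of values, so the commutation
  rule at all values already gives the vanishing on translates that \<open>radical\<close>
  demands.\<close>

lemma hom_over_mem:
  assumes f: "hbil X Y eHVW f" and X: "hmod k H X" and Y: "hmod k H Y"
    and e: "\<And>x y a. x \<in> carrier X \<Longrightarrow> y \<in> carrier Y \<Longrightarrow> a \<in> carrier A \<Longrightarrow> hcV (f x y) (hlV a) = Br eHVW A eHVW hl (f x y) a"
    and x: "x \<in> carrier X" and y: "y \<in> carrier Y"
  shows "f x y \<in> carrier hM"
  unfolding hom_over_simps(1) radical_def
proof (intro CollectI conjI ballI)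
  note [simp] = bil_closed[OF hbil_bil[OF f]] x y grade_hact[OF X] grade_hact[OF Y] Nmod2
  note bb = hbil_bil[OF bracket_hbil]
  show "f x y \<in> carrier eHVW" by simp
  fix h a assume [simp]: "h \<in> carrier H" "a \<in> carrier A"
  have z: "bracket (f x y) a = \<zero>\<^bsub>eHVW\<^esub>" if "x \<in> carrier X" "y \<in> carrier Y" for x y
    by (subst bracket_zero_iff) (simp_all add: that e)
  show "bracket (act eHVW h (f x y)) a = \<zero>\<^bsub>eHVW\<^esub>"
    by (simp add: ebil_act[OF hbil_ebil[OF f]] s2_push[OF bil_lin1[OF bb]] z s2_zero)
qed

lemma hom_over_lact:
  assumes "a \<in> carrier A" "K \<in> carrier hM"
  shows "lact hM (tpure k A hM a K) = hl a K"
  using assms grade_module[OF hom_over_simps(3)] hs3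
  by (simp add: hom_over_simps(4) tmap_pure hmorph_lin[OF lWh2] hmorph_lin[OF inc2] id_def comp_def)

text \<open>Closure enters as a hypothesis because its proof, \<open>hom_over_closed\<close>, needs
  the commutation rule of \<open>lhat\<close> over a braided commutative algebra.\<close>

lemma hom_over_lmod:
  assumes c: "\<And>a K. a \<in> carrier A \<Longrightarrow> K \<in> carrier hM \<Longrightarrow> hl a K \<in> carrier hM"
  shows "lmod A hM"
  unfolding lmod_def
proof (intro conjI hom_over_simps(3))
  have "hbil A hM eHVW hl"
    by (rule hbil_morph[OF lhat_comp_hbil(1) hmorph_id inc2 hmorph_id]) (use hs3 in simp_all)
  from hbil_into_hsub[OF this hom_over_simps(2) c A hom_over_simps(3)]
  show "hbil A hM hM (\<lambda>a K. lact hM (tpure k A hM a K))"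
    by (rule hbil_cong[OF A hom_over_simps(3) _ hom_over_lact])
qed

end

text \<open>The family is \<open>lhat\<close> on \<open>A\<close>; its commutation rule is
  \<open>lhat_commute\<close>, read with the zero map as derivative term.\<close>

lemma hom_over_closed:
  fixes A :: "('k, 'h, 'a) halg" and V :: "('k, 'h, 'a, 'v) hbimod" and W :: "('k, 'h, 'a, 'w) hbimod"
  assumes AC: "hm_comm_algebra k H A" and V: "lmod A V" and WB: "hm_sym_bimodule k H A W"
    and a: "a \<in> carrier A" and K: "K \<in> carrier (hom_over k H A V W)"
  shows "comp V W W (lhat k H A W a) K \<in> carrier (hom_over k H A V W)"
proof -
  note A = comm_algebra_hmod[OF AC WB] note W = sym_bimodule_lmod[OF A WB]
  let ?M = "hom_over k H A V W" and ?N = "ihom k H V W"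
  note M = hom_over_simps(2,3)[OF A V W]
  note inc = hsub_hmorph[OF M(1)]
  note lW = lhat_hmorph[OF A W]
  note Nm = ihom_hmod[OF lmod_hmod[OF V] lmod_hmod[OF W]]
  note [simp] = grade_hact[OF A] grade_hact[OF lmod_hmod[OF V]] grade_hact[OF lmod_hmod[OF W]] grade_hact[OF M(2)]
  interpret A: module k A by simp
  interpret N: module k ?N by simp
  have f: "hbil A ?M ?N (\<lambda>a K. comp V W W (lhat k H A W a) K)"
    by (rule hbil_morph[OF lhat_comp_hbil(1)[OF A V W] hmorph_id inc hmorph_id]) simp_all
  have z: "hbil A A A (\<lambda>_ _. \<zero>\<^bsub>A\<^esub>)"
    by (rule hbilI, rule bilI; (rule lin_const_zero)?) (simp_all add: s2_zero lin_zero[OF _ _ act_lin] grade_zero[OF A])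
  have l0: "lhat k H A W \<zero>\<^bsub>A\<^esub> = \<zero>\<^bsub>iend k H W\<^esub>" by (rule lin_zero[OF _ _ hmorph_lin[OF lW]]) simp_all
  have c0: "comp V W W \<zero>\<^bsub>iend k H W\<^esub> K = \<zero>\<^bsub>?N\<^esub>" if "K \<in> carrier ?N" for K
    by (rule lin_zero[OF _ _ bil_lin1[OF comp_bil]]) (simp_all add: that)
  show ?thesis
  proof (rule hom_over_mem[OF A V W f A M(2) _ a K])
    fix a K b assume a [simp]: "a \<in> carrier A" and K [simp]: "K \<in> carrier ?M" and b [simp]: "b \<in> carrier A"
    interpret EW: module k "iend k H W" by simp
    have "comp V V W (comp V W W (lhat k H A W a) K) (lhat k H A V b) =
       Br ?N A ?N (\<lambda>a K. comp V W W (lhat k H A W a) K) (comp V W W (lhat k H A W a) K) b \<oplus>\<^bsub>?N\<^esub>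
       Br ?M A ?N (\<lambda>a K. comp V W W (lhat k H A W \<zero>\<^bsub>A\<^esub>) K) K b"
    proof (rule bracket_comp_left[OF A V W M(2,1) hom_over_bracket[OF A V W] A z _ lW _ a K b])
      show "comp W W W (lhat k H A W x) (lhat k H A W a) =
          Br A A (iend k H W) (\<lambda>a x. comp W W W (lhat k H A W a) (lhat k H A W x)) x a \<oplus>\<^bsub>iend k H W\<^esub> lhat k H A W \<zero>\<^bsub>A\<^esub>"
        if "x \<in> carrier A" "a \<in> carrier A" for x a
        using that by (simp add: lhat_commute[OF AC WB that, symmetric] l0 hmorph_closed[OF lW])
    qed simp_all
    also have "Br ?M A ?N (\<lambda>a K. comp V W W (lhat k H A W \<zero>\<^bsub>A\<^esub>) K) K b = \<zero>\<^bsub>?N\<^esub>"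
      by (rule Br_zero[OF M(2) A _ _ K b]) (simp_all add: l0 c0 hmorph_closed[OF inc])
    finally show "comp V V W (comp V W W (lhat k H A W a) K) (lhat k H A V b) =
       Br ?N A ?N (\<lambda>a K. comp V W W (lhat k H A W a) K) (comp V W W (lhat k H A W a) K) b"
      using Br_closed[OF Nm A _ hbil_bil[OF lhat_comp_hbil(1)[OF A V W]], of "comp V W W (lhat k H A W a) K" b]
      by (simp add: hmorph_closed[OF lW] hmorph_closed[OF inc])
  qed
qed

end

section \<open>The adjoint connection\<close>

context quasitriangular_quasi_hopf
begin

text \<open>\<open>P\<close> stands for the fibred product, \<open>gW\<close> and \<open>gV\<close>
  for its components in the two endomorphism objects, and \<open>D x a\<close> for the derivative of
  \<open>a\<close> along the common constant.\<close>

context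
  fixes A :: "('k, 'h, 'a) halg" and V :: "('k, 'h, 'a, 'v) hbimod" and W :: "('k, 'h, 'a, 'w) hbimod"
    and P :: "('k, 'h, 'p, 'm) gmod_scheme" and gW gV D
  assumes AC: "hm_comm_algebra k H A" and V: "lmod A V" and WB: "hm_sym_bimodule k H A W"
    and P: "hmod k H P" and gW: "hmorph k H P (iend k H W) gW" and gV: "hmorph k H P (iend k H V) gV"
    and D: "hbil P A A D"
    and Dt: "\<And>h x a. h \<in> carrier H \<Longrightarrow> x \<in> carrier P \<Longrightarrow> a \<in> carrier A \<Longrightarrow> D (act P h x) a = counit H h \<odot>\<^bsub>A\<^esub> D x a"
    and DW: "\<And>x a. x \<in> carrier P \<Longrightarrow> a \<in> carrier A \<Longrightarrow> comp W W W (gW x) (lhat k H A W a) =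
       Br P A (iend k H W) (\<lambda>a x. comp W W W (lhat k H A W a) (gW x)) x a \<oplus>\<^bsub>iend k H W\<^esub> lhat k H A W (D x a)"
    and DV: "\<And>x a. x \<in> carrier P \<Longrightarrow> a \<in> carrier A \<Longrightarrow> comp V V V (gV x) (lhat k H A V a) =
       Br P A (iend k H V) (\<lambda>a x. comp V V V (lhat k H A V a) (gV x)) x a \<oplus>\<^bsub>iend k H V\<^esub> lhat k H A V (D x a)"
begin

private abbreviation "qN \<equiv> ihom k H V W"
private abbreviation "qM \<equiv> hom_over k H A V W"
private abbreviation "qlV \<equiv> lhat k H A V"
private abbreviation "qlW \<equiv> lhat k H A W"
private abbreviation "qcW \<equiv> comp V W W"
private abbreviation "qcV \<equiv> comp V V W"
private abbreviation "ql \<equiv> \<lambda>a K. qcW (qlW a) K"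
private abbreviation "qB \<equiv> Br P qM qN (\<lambda>K x. qcV K (gV x))"
private abbreviation "qF \<equiv> \<lambda>x K. qcW (gW x) K \<ominus>\<^bsub>qN\<^esub> qB x K"

private lemmas Am4 = comm_algebra_hmod[OF AC WB]
private lemmas W4 = sym_bimodule_lmod[OF Am4 WB]
private lemmas Vm4 = lmod_hmod[OF V] and Wm4 = lmod_hmod[OF W4]
private lemmas Nm4 = ihom_hmod[OF Vm4 Wm4]
private lemmas hM4 = hom_over_simps(2,3)[OF Am4 V W4]
private lemmas inc4 = hsub_hmorph[OF hM4(1)]
private lemmas hs4 = grade_hact[OF Vm4] grade_hact[OF Wm4] grade_hact[OF Am4] grade_hact[OF P] grade_hact[OF hM4(2)]
private lemmas MA4 = hom_over_bracket[OF Am4 V W4]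
private lemmas lVh4 = lhat_hmorph[OF Am4 V] and lWh4 = lhat_hmorph[OF Am4 W4]
private lemmas c4 = hmorph_closed[OF lVh4] hmorph_closed[OF lWh4] hmorph_closed[OF gW] hmorph_closed[OF gV] hmorph_closed[OF inc4]
private lemmas l4 = comp_linr lin_comp[OF _ hmorph_lin[OF lVh4]] lin_comp[OF _ hmorph_lin[OF lWh4]]
  lin_comp[OF _ hmorph_lin[OF gW]] lin_comp[OF _ hmorph_lin[OF gV]] lin_comp[OF _ hmorph_lin[OF inc4]] lin_id
private lemmas lcl4 = hom_over_closed[OF AC V WB]
private lemmas Ml4 = hom_over_lmod[OF Am4 V W4 lcl4]

private lemma Nmod4: "module k qN" using hs4 by simp

private lemma cW_hbil: "hbil P qM qN (\<lambda>x K. qcW (gW x) K)"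
  by (rule hbil_morph[OF hbil_comp[OF Vm4 Wm4 Wm4] gW inc4 hmorph_id]) (use hs4 in simp_all)

private lemma cV_hbil: "hbil qM P qN (\<lambda>K x. qcV K (gV x))"
  by (rule hbil_morph[OF hbil_comp[OF Vm4 Vm4 Wm4] inc4 gV hmorph_id]) (use hs4 in simp_all)

private lemmas B_hbil = hbil_Br[OF P hM4(2) Nm4 cV_hbil]
private lemmas B_closed4 = bil_closed[OF hbil_bil[OF B_hbil]]
private lemmas F_hbilN = hbil_minus[OF cW_hbil B_hbil P hM4(2) Nm4]

private lemma F_mem: "x \<in> carrier P \<Longrightarrow> K \<in> carrier qM \<Longrightarrow> qF x K \<in> carrier qM"
proof (rule hom_over_mem[OF Am4 V W4 F_hbilN P hM4(2)])
  fix x K a assume x [simp]: "x \<in> carrier P" and K [simp]: "K \<in> carrier qM" and a [simp]: "a \<in> carrier A"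
  note [simp] = hs4 c4 B_closed4
  interpret N: module k qN by (rule Nmod4)
  have lb: "bil A qN qN ql" by (rule hbil_bil[OF lhat_comp_hbil(1)[OF Am4 V W4]])
  have c1: "lin qN qN (\<lambda>J. qcV J (qlV a))" by (intro l4) simp_all
  have c2: "lin qN qN (\<lambda>J. Br qN A qN ql J a)" by (rule bil_lin1[OF Br_bil[OF Nm4 Am4 Nmod4 lb] a])
  let ?E = "Br qM A qN (\<lambda>a K. ql (D x a) K) K a"
  have lDb: "bil A qM qN (\<lambda>a K. ql (D x a) K)"
    by (rule bilI; intro l4 bil_linr[OF hbil_bil[OF D]]) (simp_all add: bil_closed[OF hbil_bil[OF D]])
  have Ec: "?E \<in> carrier qN" by (rule Br_closed[OF hM4(2) Am4 Nmod4 lDb K a])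
  \<comment> \<open>Both bracket formulas contain the same inhomogeneous term \<open>?E\<close>,
    which drops out of the difference.\<close>
  have cancel: "(u \<oplus>\<^bsub>qN\<^esub> ?E) \<ominus>\<^bsub>qN\<^esub> (v \<oplus>\<^bsub>qN\<^esub> ?E) = u \<ominus>\<^bsub>qN\<^esub> v" if "u \<in> carrier qN" "v \<in> carrier qN" for u v
  proof -
    have "u \<oplus>\<^bsub>qN\<^esub> ?E \<oplus>\<^bsub>qN\<^esub> (\<ominus>\<^bsub>qN\<^esub> v \<oplus>\<^bsub>qN\<^esub> \<ominus>\<^bsub>qN\<^esub> ?E) = u \<oplus>\<^bsub>qN\<^esub> \<ominus>\<^bsub>qN\<^esub> v \<oplus>\<^bsub>qN\<^esub> (?E \<oplus>\<^bsub>qN\<^esub> \<ominus>\<^bsub>qN\<^esub> ?E)"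
      using that Ec by (simp only: N.M.a_ac N.M.a_closed N.M.a_inv_closed)
    then show ?thesis using that Ec by (simp add: a_minus_def N.M.minus_add N.M.r_neg)
  qed
  show "qcV (qF x K) (qlV a) = Br qN A qN ql (qF x K) a"
    using bracket_comp_left[OF Am4 V W4 hM4(2,1) MA4 P D Dt gW DW x K a]
      bracket_comp_right_braided[OF Am4 V W4 hM4(2,1) MA4 P D Dt gV DV x K a]
    by (simp add: lin_diff[OF Nmod4 Nmod4 c1] lin_diff[OF Nmod4 Nmod4 c2] cancel Br_closed[OF Nm4 Am4 Nmod4 lb])
qed

private lemmas F_hbilM = hbil_into_hsub[OF F_hbilN hM4(1) F_mem P hM4(2)]

private lemma l_hbil: "hbil A qM qM ql"
  by (rule hbil_cong[OF Am4 hM4(2) lmod_hbil[OF Ml4] hom_over_lact[OF Am4 V W4, symmetric]])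

text \<open>No derivative term occurs, because \<open>a\<close> acts from the left and
  \<open>gV x\<close> from the right: only associativity of composition and the hexagon for braiding
  \<open>x\<close> past \<open>ql a K\<close> are involved.\<close>

private lemma braided_part:
  assumes x: "x \<in> carrier P" and a: "a \<in> carrier A" and K: "K \<in> carrier qM"
  shows "Fi P A qM qN (\<lambda>x a K. qB x (ql a K)) x a K =
    Br P A qN (\<lambda>a x. Fi A P qM qN (\<lambda>a x K. ql a (qB x K)) a x K) x a"
proof -
  note [simp] = hs4 c4 B_closed4 lcl4 Nmod4
  let ?G = "\<lambda>x a K. Br P A qN (\<lambda>a x. Fi A P qM qN (\<lambda>a x K. ql a (qB x K)) a x K) x a"
  note Bl = bil_linr[OF hbil_bil[OF B_hbil]]
  note cVb = hbil_bil[OF cV_hbil]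
  have ib: "bil A P qN (\<lambda>a x. Fi A P qM qN (\<lambda>a x K. ql a (qB x K)) a x K)" if "K \<in> carrier qM" for K
    unfolding Fi_def by (rule bilI; intro lin_s3 l4 Bl act_linr) (simp_all add: that)
  have iK: "lin qM qN (\<lambda>K. Fi A P qM qN (\<lambda>a x K. ql a (qB x K)) a x K)" if "a \<in> carrier A" "x \<in> carrier P" for a x
    unfolding Fi_def by (intro lin_s3 l4 Bl act_linr) (simp_all add: that)
  have Gb: "bil P A qN (\<lambda>x a. ?G x a K)" if "K \<in> carrier qM" for K
    by (rule Br_bil[OF P Am4 Nmod4 ib[OF that]])
  have GK: "lin qM qN (\<lambda>K. ?G x a K)" if "x \<in> carrier P" "a \<in> carrier A" for x a
    by (rule Br_param[OF P Am4 Nmod4 iK]) (simp_all add: that)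
  \<comment> \<open>The left action is pushed into the braiding and reassociated, which gives the
    innermost layer of the right-hand side of \<open>braid_tensor_right\<close>.\<close>
  have lB: "ql a (qB x K) = Br P qM qN (\<lambda>K x. Fv A qM P qN (\<lambda>a K x. qcV (ql a K) (gV x)) a K x) x K"
    if x: "x \<in> carrier P" and a [simp]: "a \<in> carrier A" and K: "K \<in> carrier qM" for x a K
  proof -
    have cl: "lin qN qN (\<lambda>J. ql a J)" by (intro l4) simp_all
    have "ql a (qB x K) = Br P qM qN (\<lambda>K x. ql a (qcV K (gV x))) x K"
      by (rule Br_push[OF P hM4(2) Nmod4 cVb cl Nmod4 x K])
    also have "\<dots> = Br P qM qN (\<lambda>K x. Fv A qM P qN (\<lambda>a K x. qcV (ql a K) (gV x)) a K x) x K"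
    proof (rule Br_cong[OF P hM4(2) Nmod4 x K])
      fix x K assume x [simp]: "x \<in> carrier P" and K [simp]: "K \<in> carrier qM"
      have "ql a (qcV K (gV x)) = Fv A qM P qN (Fi A qM P qN (\<lambda>a K x. ql a (qcV K (gV x)))) a K x"
        by (rule Fi_Fv(2)[symmetric]) (simp_all, (intro l4; simp)+)
      also have "\<dots> = Fv A qM P qN (\<lambda>a K x. qcV (ql a K) (gV x)) a K x"
      proof (rule Fi_cong(2)[OF _ _ _ _ _ a K x])
        fix a K x assume [simp]: "a \<in> carrier A" "K \<in> carrier qM" "x \<in> carrier P"
        show "Fi A qM P qN (\<lambda>a K x. ql a (qcV K (gV x))) a K x = qcV (ql a K) (gV x)"
          by (subst comp_assoc, simp_all, rule Fi_morph(1)[OF _ _ _ Nmod4 lWh4 inc4 gV]) simp_all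
      qed simp_all
      finally show "ql a (qcV K (gV x)) = Fv A qM P qN (\<lambda>a K x. qcV (ql a K) (gV x)) a K x" .
    qed
    finally show ?thesis .
  qed
  \<comment> \<open>The hexagon presents \<open>qB x (ql a K)\<close> as an \<open>Fv\<close>, which
    the outer \<open>Fi\<close> then cancels.\<close>
  have "Fi P A qM qN (\<lambda>x a K. qB x (ql a K)) x a K = Fi P A qM qN (Fv P A qM qN ?G) x a K"
  proof (rule Fi_cong(1)[OF _ _ _ _ _ x a K])
    fix x a K assume x [simp]: "x \<in> carrier P" and a [simp]: "a \<in> carrier A" and K [simp]: "K \<in> carrier qM"
    have "qB x (ql a K) = Fv P A qM qN (\<lambda>x a K. Br P A qN (\<lambda>a x. Fi A P qM qN (\<lambda>a x K. Br P qM qN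
        (\<lambda>K x. Fv A qM P qN (\<lambda>a K x. qcV (ql a K) (gV x)) a K x) x K) a x K) x a) x a K"
      by (rule braid_tensor_right[OF P Am4 hM4(2) hM4(2) Nmod4 hbil_ebil[OF l_hbil] hbil_grade[OF l_hbil] cVb x a K])
    also have "\<dots> = Fv P A qM qN ?G x a K"
    proof (rule Fi_cong(2)[OF _ _ _ _ _ x a K])
      fix x a K assume x: "x \<in> carrier P" and a: "a \<in> carrier A" and K: "K \<in> carrier qM"
      show "Br P A qN (\<lambda>a x. Fi A P qM qN (\<lambda>a x K. Br P qM qN
        (\<lambda>K x. Fv A qM P qN (\<lambda>a K x. qcV (ql a K) (gV x)) a K x) x K) a x K) x a = ?G x a K"
        by (rule Br_cong[OF P Am4 Nmod4 x a], rule Fi_cong(1)) (simp_all add: lB[symmetric] K)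
    qed simp_all
    finally show "qB x (ql a K) = Fv P A qM qN ?G x a K" .
  qed simp_all
  also have "\<dots> = ?G x a K"
    by (rule Fi_Fv(1)[OF _ _ _ _ bil_lin1[OF Gb] bil_lin2[OF Gb] GK x a K]) simp_all
  finally show ?thesis .
qed

text \<open>Left composition with \<open>gW x\<close> is the sum of \<open>qF x\<close> and
  \<open>qB x\<close>. The rule for this sum is \<open>comp_left_action\<close>, the rule for
  \<open>qB\<close> is \<open>braided_part\<close>, and additivity of \<open>Fi\<close> and
  \<open>Br\<close> leaves the rule for \<open>qF\<close>.\<close>

private lemma F_action:
  assumes x: "x \<in> carrier P" and a: "a \<in> carrier A" and K: "K \<in> carrier qM"
  shows "Fi P A qM qN (\<lambda>x a K. qF x (ql a K)) x a K =
    Br P A qN (\<lambda>a x. Fi A P qM qN (\<lambda>a x K. ql a (qF x K)) a x K) x a \<oplus>\<^bsub>qN\<^esub> ql (D x a) K"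
proof -
  note [simp] = hs4 c4 B_closed4 lcl4 Nmod4 F_mem
  interpret N: module k qN by (rule Nmod4)
  note FN = bil_closed[OF hbil_bil[OF F_hbilN]]
  have sum: "qcW (gW x) K = qF x K \<oplus>\<^bsub>qN\<^esub> qB x K" if "x \<in> carrier P" "K \<in> carrier qM" for x K
    using that by (simp add: a_minus_def N.M.a_assoc N.M.l_neg)
  have i: "bil A P qN (\<lambda>a x. Fi A P qM qN (\<lambda>a x K. ql a (T x K)) a x K)" if "bil P qM qN T" for T
    using bil_closed[OF that] unfolding Fi_def by (intro bilI; intro lin_s3 l4 bil_linr[OF that] act_linr) (simp_all add: K)
  let ?b = "\<lambda>T. Br P A qN (\<lambda>a x. Fi A P qM qN (\<lambda>a x K. ql a (T x K)) a x K) x a"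
  let ?f = "\<lambda>T. Fi P A qM qN (\<lambda>x a K. T x (ql a K)) x a K"
  let ?e = "ql (D x a) K"
  have bc: "?b qF \<in> carrier qN" "?b qB \<in> carrier qN"
    by (rule Br_closed[OF P Am4 Nmod4 i[OF hbil_bil[OF F_hbilN]] x a] Br_closed[OF P Am4 Nmod4 i[OF hbil_bil[OF B_hbil]] x a])+
  have fc: "?f qF \<in> carrier qN" using x a K by (simp add: Fi_def FN)
  have ec: "?e \<in> carrier qN" using x a K by (simp add: bil_closed[OF hbil_bil[OF D]])
  have "?f qF \<oplus>\<^bsub>qN\<^esub> ?f qB = Fi P A qM qN (\<lambda>x a K. qF x (ql a K) \<oplus>\<^bsub>qN\<^esub> qB x (ql a K)) x a K"
    by (rule Fi_add(1)[symmetric]) (simp_all add: x a K FN)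
  also have "\<dots> = Fi P A qM qN (\<lambda>x a K. qcW (gW x) (ql a K)) x a K"
    by (rule Fi_cong(1)) (simp_all only: sum[symmetric] lcl4 hs4 Nmod4 x a K)
  also have "\<dots> = Br P A qN (\<lambda>a x. Fi A P qM qN (\<lambda>a x K. ql a (qcW (gW x) K)) a x K) x a \<oplus>\<^bsub>qN\<^esub> ?e"
    by (rule comp_left_action[OF Am4 V W4 hM4(2,1) MA4 P D Dt gW DW x a K, symmetric])
  also have "Br P A qN (\<lambda>a x. Fi A P qM qN (\<lambda>a x K. ql a (qcW (gW x) K)) a x K) x a =
      Br P A qN (\<lambda>a x. Fi A P qM qN (\<lambda>a x K. ql a (qF x K)) a x K \<oplus>\<^bsub>qN\<^esub> Fi A P qM qN (\<lambda>a x K. ql a (qB x K)) a x K) x a"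
  proof (rule Br_cong[OF P Am4 Nmod4 x a])
    fix x a assume x [simp]: "x \<in> carrier P" and a [simp]: "a \<in> carrier A"
    have "Fi A P qM qN (\<lambda>a x K. ql a (qcW (gW x) K)) a x K = Fi A P qM qN (\<lambda>a x K. ql a (qF x K) \<oplus>\<^bsub>qN\<^esub> ql a (qB x K)) a x K"
    proof (rule Fi_cong(1)[OF _ _ _ _ _ a x K])
      fix a x K assume [simp]: "x \<in> carrier P" "a \<in> carrier A" "K \<in> carrier qM"
      have cl: "lin qN qN (\<lambda>J. ql a J)" by (intro l4) simp_all
      show "ql a (qcW (gW x) K) = ql a (qF x K) \<oplus>\<^bsub>qN\<^esub> ql a (qB x K)"
        by (subst sum, simp, simp, rule linD(2)[OF cl]) (simp_all add: FN)
    qed simp_all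
    also have "\<dots> = Fi A P qM qN (\<lambda>a x K. ql a (qF x K)) a x K \<oplus>\<^bsub>qN\<^esub> Fi A P qM qN (\<lambda>a x K. ql a (qB x K)) a x K"
      by (rule Fi_add(1)) (simp_all add: K FN)
    finally show "Fi A P qM qN (\<lambda>a x K. ql a (qcW (gW x) K)) a x K =
        Fi A P qM qN (\<lambda>a x K. ql a (qF x K)) a x K \<oplus>\<^bsub>qN\<^esub> Fi A P qM qN (\<lambda>a x K. ql a (qB x K)) a x K" .
  qed
  also have "\<dots> = ?b qF \<oplus>\<^bsub>qN\<^esub> ?b qB"
    by (rule Br_add[OF P Am4 Nmod4 i[OF hbil_bil[OF F_hbilN]] i[OF hbil_bil[OF B_hbil]] x a])
  finally have "?f qF \<oplus>\<^bsub>qN\<^esub> ?b qB = (?b qF \<oplus>\<^bsub>qN\<^esub> ?e) \<oplus>\<^bsub>qN\<^esub> ?b qB"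
    unfolding braided_part[OF x a K] using bc ec by (simp only: N.M.a_ac N.M.a_closed)
  then show ?thesis
    using N.M.add.right_cancel[OF bc(2) fc, of "?b qF \<oplus>\<^bsub>qN\<^esub> ?e"] bc(1) ec by simp
qed

private abbreviation "qFF \<equiv> cur P qM qM qF"

lemma adjoint_hmorph: "hmorph k H P (iend k H qM) qFF"
  by (rule cur_hmorph[OF F_hbilM P hM4(2) hM4(2)])

text \<open>Evaluation at \<open>K\<close> undoes the currying on both sides and reduces the claim
  to \<open>F_action\<close>.\<close>

lemma adjoint_connection:
  assumes x: "x \<in> carrier P" and a: "a \<in> carrier A"
  shows "comp qM qM qM (qFF x) (lhat k H A qM a) =
    Br P A (iend k H qM) (\<lambda>a x. comp qM qM qM (lhat k H A qM a) (qFF x)) x a \<oplus>\<^bsub>iend k H qM\<^esub> lhat k H A qM (D x a)"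
proof -
  note [simp] = hs4
  let ?E = "iend k H qM" and ?lM = "lhat k H A qM"
  have Em: "hmod k H ?E" by (rule ihom_hmod[OF hM4(2) hM4(2)])
  have Emod: "module k ?E" by simp
  have Mmod: "module k qM" by simp
  note lM = lhat_hmorph[OF Am4 Ml4]
  have Fm: "hmorph k H P ?E qFF" by (rule cur_hmorph[OF F_hbilM P hM4(2) hM4(2)])
  note [simp] = hmorph_closed[OF lM] hmorph_closed[OF Fm] bil_closed[OF hbil_bil[OF D]] lcl4 F_mem
  note cc = hbil_comp[OF hM4(2) hM4(2) hM4(2)]
  have c1: "hbil P A ?E (\<lambda>x a. comp qM qM qM (qFF x) (?lM a))"
    by (rule hbil_morph[OF cc Fm lM hmorph_id]) simp_all
  have c2: "hbil A P ?E (\<lambda>a x. comp qM qM qM (?lM a) (qFF x))"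
    by (rule hbil_morph[OF cc lM Fm hmorph_id]) simp_all
  note c3 = hbil_Br[OF P Am4 Em c2]
  have c4': "hbil P A ?E (\<lambda>x a. ?lM (D x a))"
    by (rule hbil_morph[OF D hmorph_id hmorph_id lM]) simp_all
  let ?u = "\<lambda>x a. comp qM qM qM (qFF x) (?lM a)" and ?v = "Br P A ?E (\<lambda>a x. comp qM qM qM (?lM a) (qFF x))"
  have evF: "evb qM qM (qFF x) K = qF x K" if "x \<in> carrier P" "K \<in> carrier qM" for x K
    by (rule evb_cur[OF _ _ _ hbil_ebil[OF F_hbilM] that]) simp_all
  have evl: "evb qM qM (?lM a) K = ql a K" if "a \<in> carrier A" "K \<in> carrier qM" for a K
    using evb_lhat[OF Am4 Ml4 that] hom_over_lact[OF Am4 V W4 that] by simp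
  \<comment> \<open>One side is written as a difference because \<open>hbil_minus\<close> provides
    the equivariance that \<open>hbil_ihom_eq\<close> requires of both families.\<close>
  have "?u x a \<ominus>\<^bsub>?E\<^esub> ?v x a = ?lM (D x a)"
  proof (rule hbil_ihom_eq[OF _ _ _ _ hbil_ebil[OF hbil_minus[OF c1 c3 P Am4 Em]] hbil_ebil[OF c4'] _ x a])
    fix x a K assume x [simp]: "x \<in> carrier P" and a [simp]: "a \<in> carrier A" and K [simp]: "K \<in> carrier qM"
    interpret M: module k qM by simp
    have el: "lin ?E qM (\<lambda>L. evb qM qM L K)" by (rule bil_lin1[OF evb_bil]) simp_all
    have inl: "lin qM qN (\<lambda>x. x)" by (rule hmorph_lin[OF inc4])
    have "evb qM qM (?u x a) K = Fi ?E ?E qM qM (\<lambda>L K v. evb qM qM L (evb qM qM K v)) (qFF x) (?lM a) K"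
      by (rule evb_comp) simp_all
    also have "\<dots> = Fi P A qM qM (\<lambda>x a K. evb qM qM (qFF x) (evb qM qM (?lM a) K)) x a K"
      by (rule Fi_morph(1)[OF _ _ _ Mmod Fm lM hmorph_id, symmetric]) simp_all
    also have "\<dots> = Fi P A qM qM (\<lambda>x a K. qF x (ql a K)) x a K"
      by (rule Fi_cong(1)) (simp_all add: evF evl)
    also have "\<dots> = Fi P A qM qN (\<lambda>x a K. qF x (ql a K)) x a K"
      by (simp only: Fi_def hsub_s[OF hM4(1)])
    finally have 1: "evb qM qM (?u x a) K = Fi P A qM qN (\<lambda>x a K. qF x (ql a K)) x a K" .
    have t: "evb qM qM (comp qM qM qM (?lM a) (qFF x)) K = Fi A P qM qN (\<lambda>a x K. ql a (qF x K)) a x K"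
      if [simp]: "x \<in> carrier P" "a \<in> carrier A" for x a
    proof -
      have "evb qM qM (comp qM qM qM (?lM a) (qFF x)) K = Fi ?E ?E qM qM (\<lambda>L K v. evb qM qM L (evb qM qM K v)) (?lM a) (qFF x) K"
        by (rule evb_comp) simp_all
      also have "\<dots> = Fi A P qM qM (\<lambda>a x K. evb qM qM (?lM a) (evb qM qM (qFF x) K)) a x K"
        by (rule Fi_morph(1)[OF _ _ _ Mmod lM Fm hmorph_id, symmetric]) simp_all
      also have "\<dots> = Fi A P qM qM (\<lambda>a x K. ql a (qF x K)) a x K"
        by (rule Fi_cong(1)) (simp_all add: evF evl)
      finally show ?thesis by (simp only: Fi_def hsub_s[OF hM4(1)])
    qed
    have vb: "bil A P qM (\<lambda>a x. evb qM qM (comp qM qM qM (?lM a) (qFF x)) K)"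
      by (rule bil_comp_lin[OF hbil_bil[OF c2] el])
    have "evb qM qM (?v x a) K = Br P A qM (\<lambda>a x. evb qM qM (comp qM qM qM (?lM a) (qFF x)) K) x a"
      by (rule Br_push[OF P Am4 Emod hbil_bil[OF c2] el Mmod x a])
    also have "\<dots> = Br P A qN (\<lambda>a x. evb qM qM (comp qM qM qM (?lM a) (qFF x)) K) x a"
      by (rule Br_push[OF P Am4 Mmod vb inl Nmod4 x a])
    also have "\<dots> = Br P A qN (\<lambda>a x. Fi A P qM qN (\<lambda>a x K. ql a (qF x K)) a x K) x a"
      by (rule Br_cong[OF P Am4 Nmod4 x a t])
    finally have "evb qM qM (?u x a) K = evb qM qM (?v x a) K \<oplus>\<^bsub>qN\<^esub> evb qM qM (?lM (D x a)) K"
      unfolding 1 F_action[OF x a K] by (simp add: evl)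
    \<comment> \<open>\<open>F_action\<close> was computed in the internal hom, with which the
      subobject shares its addition.\<close>
    also have "\<dots> = evb qM qM (?v x a) K \<oplus>\<^bsub>qM\<^esub> evb qM qM (?lM (D x a)) K"
      using hM4(1) by (simp add: hsub_def)
    finally have e: "evb qM qM (?u x a) K = evb qM qM (?v x a) K \<oplus>\<^bsub>qM\<^esub> evb qM qM (?lM (D x a)) K" .
    have vc: "?v x a \<in> carrier ?E" by (rule bil_closed[OF hbil_bil[OF c3] x a])
    have "evb qM qM (?u x a \<ominus>\<^bsub>?E\<^esub> ?v x a) K \<ominus>\<^bsub>qM\<^esub> evb qM qM (?lM (D x a)) K =
       (evb qM qM (?u x a) K \<ominus>\<^bsub>qM\<^esub> evb qM qM (?v x a) K) \<ominus>\<^bsub>qM\<^esub> evb qM qM (?lM (D x a)) K"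
      by (subst lin_diff[OF Emod Mmod el]) (simp_all add: vc)
    also have "\<dots> = \<zero>\<^bsub>qM\<^esub>"
      by (subst minus_minus_zero_iff[OF Mmod]) (simp_all add: vc e)
    finally show "evb qM qM (?u x a \<ominus>\<^bsub>?E\<^esub> ?v x a) K = evb qM qM (?lM (D x a)) K"
      by (subst (asm) minus_zero_iff[OF Mmod]) (simp_all add: vc Emod bil_closed[OF hbil_bil[OF hbil_minus[OF c1 c3 P Am4 Em]]])
  qed simp_all
  moreover have "?v x a \<in> carrier ?E" by (rule bil_closed[OF hbil_bil[OF c3] x a])
  ultimately show ?thesis
    using minus_zero_iff[OF Emod, of "?u x a \<ominus>\<^bsub>?E\<^esub> ?v x a" "?lM (D x a)"] minus_minus_zero_iff[OF Emod, of "?u x a" "?v x a" "?lM (D x a)"]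
      x a bil_closed[OF hbil_bil[OF hbil_minus[OF c1 c3 P Am4 Em]] x a] by simp
qed

end

end

section \<open>Connections\<close>

context quasitriangular_quasi_hopf
begin

lemma hmorph_comp: "hmorph k H X Y f \<Longrightarrow> hmorph k H Y Z g \<Longrightarrow> (\<And>x. x \<in> carrier X \<Longrightarrow> f x \<in> carrier Y) \<Longrightarrow> hmorph k H X Z (\<lambda>x. g (f x))"
  by (rule hmorphI) (auto simp: hmorph_act intro: lin_comp hmorph_lin hmorph_grade)

lemma hmorph_fst: "hmorph k H (gprod X Y) X fst" and hmorph_snd: "hmorph k H (gprod X Y) Y snd"
  by (rule hmorphI; auto intro!: linI)+

lemma hmorph_pair:
  "hmorph k H X Y f \<Longrightarrow> hmorph k H X Z g \<Longrightarrow> hmorph k H X (gprod Y Z) (\<lambda>x. (f x, g x))"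
  by (rule hmorphI, rule linI)
     (auto simp: hmorph_closed hmorph_act hmorph_grade linD(2,3)[OF hmorph_lin])

lemma gproj_hmorph:
  fixes X :: "('k, 'h, 'x, 'm) gmod_scheme" and Y :: "('k, 'h, 'y, 'n) gmod_scheme"
  assumes X: "hmod k H X" and Y: "hmod k H Y" and f: "hmorph k H X Y f" and x: "x \<in> carrier X"
  shows "f (gproj X x n) = gproj Y (f x) n"
proof (rule homog_ext[OF X grade_module[OF Y] lin_comp[OF gproj_lin[OF X] hmorph_lin[OF f]] lin_comp[OF hmorph_lin[OF f] gproj_lin[OF Y]] _ x])
  fix p x assume xp: "x \<in> grade X p"
  show "f (gproj X x n) = gproj Y (f x) n"
    using lin_zero[OF grade_module[OF X] grade_module[OF Y] hmorph_lin[OF f]]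
    by (simp add: gproj_homog[OF X xp] gproj_homog[OF Y hmorph_grade[OF f xp]])
qed

text \<open>Made for the fibred product, which is the equalizer of its two projections to the
  shifted unit.\<close>

lemma equalizer_hmod:
  fixes X :: "('k, 'h, 'x, 'm) gmod_scheme" and Y :: "('k, 'h, 'y, 'n) gmod_scheme" and K :: "('k, 'h, 'x, 'l) gmod_scheme"
  assumes X: "hmod k H X" and Y: "hmod k H Y" and f: "hmorph k H X Y f" and g: "hmorph k H X Y g"
    and s: "hsub K X" and K: "carrier K = {x \<in> carrier X. f x = g x}"
  shows "hmod k H K"
proof (rule hsub_hmod[OF X s]; unfold K)
  interpret X: module k X by (rule grade_module[OF X])
  note fl = hmorph_lin[OF f] and gl = hmorph_lin[OF g]
  note [simp] = grade_hact[OF X]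
  show "\<zero>\<^bsub>X\<^esub> \<in> {x \<in> carrier X. f x = g x}"
    using lin_zero[OF _ grade_module[OF Y] fl] lin_zero[OF _ grade_module[OF Y] gl] by simp
  show "x \<oplus>\<^bsub>X\<^esub> y \<in> {x \<in> carrier X. f x = g x}" if "x \<in> {x \<in> carrier X. f x = g x}" "y \<in> {x \<in> carrier X. f x = g x}" for x y
    using that by (simp add: linD(2)[OF fl] linD(2)[OF gl])
  show "c \<odot>\<^bsub>X\<^esub> x \<in> {x \<in> carrier X. f x = g x}" if "c \<in> carrier k" "x \<in> {x \<in> carrier X. f x = g x}" for c x
    using that by (simp add: linD(3)[OF fl] linD(3)[OF gl])
  show "act X h x \<in> {x \<in> carrier X. f x = g x}" if "h \<in> carrier H" "x \<in> {x \<in> carrier X. f x = g x}" for h x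
    using that by (simp add: hmorph_act[OF f] hmorph_act[OF g])
  show "gproj X x n \<in> {x \<in> carrier X. f x = g x}" if "x \<in> {x \<in> carrier X. f x = g x}" for n x
    using that gproj_prop(1)[OF X, THEN grade_carrier[OF X]] by (simp add: gproj_hmorph[OF X Y f] gproj_hmorph[OF X Y g])
qed

section \<open>The differential as a bilinear map\<close>

context
  fixes A :: "('k, 'h, 'a) halg" and d :: "'k \<Rightarrow> 'a \<Rightarrow> 'a"
  assumes A: "hmod k H A" and dm: "hmorph k H (shifted_unit k H 1) (der k H A) d"
begin

private abbreviation "I1 \<equiv> shifted_unit k H 1"
private lemmas I5 = shifted_unit_hmod[of 1]
private lemmas hA5 = grade_hact[OF A]

definition dact :: "'k \<Rightarrow> 'a \<Rightarrow> 'a" where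
  "dact c a = evb A A (d c) a"

private lemma d_hmorph: "hmorph k H I1 (iend k H A) d"
proof -
  have "hsub (der k H A) (iend k H A)"
    using grade_carrier[OF ihom_hmod[OF A A]] by (auto simp: hsub_def der_def ker_obj_def subobj_def)
  from hmorph_comp[OF dm hsub_hmorph[OF this] hmorph_closed[OF dm]] show ?thesis .
qed

lemma dact_hbil: "hbil I1 A A dact"
  unfolding dact_def[abs_def]
  by (rule hbil_morph[OF hbil_evb[OF A A] d_hmorph hmorph_id hmorph_id]) (use hA5 in simp_all)

text \<open>\<open>H\<close> acts on the shifted unit by the counit, and \<open>dact\<close> is
  linear in the constant.\<close>

lemma dact_trivial:
  assumes "h \<in> carrier H" "c \<in> carrier k" "a \<in> carrier A"
  shows "dact (act I1 h c) a = counit H h \<odot>\<^bsub>A\<^esub> dact c a"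
proof -
  have "dact (counit H h \<odot>\<^bsub>I1\<^esub> c) a = counit H h \<odot>\<^bsub>A\<^esub> dact c a"
    by (rule linD(3)[OF bil_lin1[OF hbil_bil[OF dact_hbil] assms(3)]]) (use assms in simp_all)
  then show ?thesis by (simp only: shifted_unit_simps)
qed

section \<open>Connections on a fixed module\<close>

context
  fixes V :: "('k, 'h, 'a, 'v) hbimod"
  assumes V: "lmod A V"
begin

private lemmas Vm5 = lmod_hmod[OF V]
private abbreviation "nE \<equiv> iend k H V"
private abbreviation "nC \<equiv> con_ambient k H V"
private abbreviation "nl \<equiv> lhat k H A V"
private lemmas Em5 = ihom_hmod[OF Vm5 Vm5]
private lemmas hs5 = grade_hact[OF A] grade_hact[OF Vm5]
private lemmas lh5 = lhat_hmorph[OF A V]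
private lemmas Cm5 = gprod_hmod[OF Em5 I5, folded con_ambient_def]
private lemmas hC5 = grade_hact[OF Cm5]
private lemmas br5 = bracket_hbil[OF A V V]

lemma con_ambient_fst: "hmorph k H nC nE fst" and con_ambient_snd: "hmorph k H nC I1 snd"
  unfolding con_ambient_def by (rule hmorph_fst hmorph_snd)+

text \<open>The commutator braids two endomorphisms. Naturality along \<open>lhat\<close> turns this
  into a braiding with \<open>A\<close>, which identifies it with \<open>bracket\<close>.\<close>

lemma end_bracket_pure:
  assumes [simp]: "L \<in> carrier nE" "a \<in> carrier A"
  shows "end_bracket k H A V (tpure k nE A L a) = bracket A V V L a"
proof -
  note [simp] = hs5 hmorph_closed[OF lh5]
  have m: "module k nE" by simp
  have i: "lin (tensor k nE nE) nE (icomp k H V V V)" by (rule icomp_lin) simp_all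
  have cb: "bil nE nE nE (comp V V V)" by (rule comp_bil) simp_all
  have "icomp k H V V V (braid k H nE nE (tpure k nE nE L (nl a))) = Br nE nE nE (comp V V V) L (nl a)"
    unfolding comp_def[abs_def] by (rule braid_Br[OF Em5 Em5 m i]) simp_all
  also have "\<dots> = Br nE A nE (\<lambda>a L. comp V V V (nl a) L) L a"
    by (rule Br_natural[OF Em5 A Em5 Em5 m cb hmorph_id lh5, symmetric]) simp_all
  finally show ?thesis
    by (simp add: end_bracket_def icommutator_def bracket_def[OF A V V] tmap_pure hmorph_lin[OF lh5] lin_id_id comp_def)
qed

definition con_form where
  "con_form x a = bracket A V V (fst x) a \<ominus>\<^bsub>nE\<^esub> nl (dact (snd x) a)"

lemma con_form_hbil: "hbil nC A nE con_form"
proof -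
  note [simp] = hs5
  have 1: "hbil nC A nE (\<lambda>x a. bracket A V V (fst x) a)"
    by (rule hbil_morph[OF br5 con_ambient_fst hmorph_id hmorph_id]) simp_all
  have 2: "hbil nC A nE (\<lambda>x a. nl (dact (snd x) a))"
    by (rule hbil_morph[OF dact_hbil con_ambient_snd hmorph_id lh5]) (simp_all add: grade_hact[OF I5])
  show ?thesis unfolding con_form_def[abs_def] by (rule hbil_minus[OF 1 2 Cm5 A Em5])
qed

lemma con_map_pure:
  assumes x: "x \<in> carrier nC" and a: "a \<in> carrier A"
  shows "con_map k H A d V (tpure k nC A x a) = con_form x a"
proof -
  note [simp] = hs5 hC5
  let ?b = "\<lambda>(L, c) a. end_bracket k H A V (tpure k nE A L a) \<ominus>\<^bsub>nE\<^esub> nl (iev k H A A (tpure k (iend k H A) A (d c) a))"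
  have e: "?b x a = con_form x a" if "x \<in> carrier nC" "a \<in> carrier A" for x a
    using that hmorph_closed[OF d_hmorph]
    by (auto simp: con_ambient_def con_form_def end_bracket_pure dact_def iev_pure)
  have mC: "module k nC" and mA: "module k A" and mE: "module k nE" by simp_all
  have "bil nC A nE ?b"
    by (rule iffD2[OF bil_cong[OF mC mA e] hbil_bil[OF con_form_hbil]])
  from tlift_tpure[OF mC mA mE this x a] show ?thesis
    unfolding con_map_def by (simp only: e[OF x a])
qed

private abbreviation "nK \<equiv> con k H A d V"

lemma con_radical: "carrier nK = radical nC A nE con_form"
  and con_hsub: "hsub nK nC" and con_hmod: "hmod k H nK"
  unfolding con_def by (rule ker_obj_radical[OF Cm5 A Em5 con_form_hbil con_map_pure]; assumption)+

lemma con_form_zero_iff: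
  assumes x: "x \<in> carrier nC" and a: "a \<in> carrier A"
  shows "con_form x a = \<zero>\<^bsub>nE\<^esub> \<longleftrightarrow> comp V V V (fst x) (nl a) =
    Br nE A nE (\<lambda>a L. comp V V V (nl a) L) (fst x) a \<oplus>\<^bsub>nE\<^esub> nl (dact (snd x) a)"
proof -
  note [simp] = hs5 hmorph_closed[OF lh5] a hmorph_closed[OF con_ambient_fst x]
  have mE: "module k nE" by simp
  have lb: "bil A nE nE (\<lambda>a L. comp V V V (nl a) L)" by (rule hbil_bil[OF lhat_comp_hbil(1)[OF A V V]])
  have "dact (snd x) a \<in> carrier A"
    by (rule bil_closed[OF hbil_bil[OF dact_hbil] hmorph_closed[OF con_ambient_snd x] a])
  then show ?thesis
    unfolding con_form_def bracket_def[OF A V V]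
    by (intro minus_minus_zero_iff) (simp_all add: Br_closed[OF Em5 A mE lb])
qed

lemma con_hmorph_fst: "hmorph k H nK nE fst" and con_hmorph_snd: "hmorph k H nK I1 snd"
  using hmorph_comp[OF hsub_hmorph[OF con_hsub] con_ambient_fst] hmorph_comp[OF hsub_hmorph[OF con_hsub] con_ambient_snd]
    hmorph_closed[OF hsub_hmorph[OF con_hsub]] by simp_all

text \<open>The kernel condition at \<open>f x\<close>, with the braiding moved from the
  endomorphisms to the source of the family by naturality; in this form it is the hypothesis
  \<open>gD\<close> of the bracket computations.\<close>

lemma con_connection:
  assumes X: "hmod k H X" and f: "hmorph k H X nK f" and x: "x \<in> carrier X" and a: "a \<in> carrier A"
  shows "comp V V V (fst (f x)) (nl a) =
    Br X A nE (\<lambda>a x. comp V V V (nl a) (fst (f x))) x a \<oplus>\<^bsub>nE\<^esub> nl (dact (snd (f x)) a)"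
proof -
  note [simp] = hs5
  have mE: "module k nE" by simp
  have lb: "bil A nE nE (\<lambda>a L. comp V V V (nl a) L)" by (rule hbil_bil[OF lhat_comp_hbil(1)[OF A V V]])
  have fx: "f x \<in> radical nC A nE con_form" using hmorph_closed[OF f x] by (simp only: con_radical)
  note r = radicalD[OF fx hC5 a]
  have g: "hmorph k H X nE (\<lambda>x. fst (f x))" by (rule hmorph_comp[OF f con_hmorph_fst hmorph_closed[OF f]])
  show ?thesis
    using r(2) unfolding con_form_zero_iff[OF r(1) a] Br_natural[OF X A Em5 A mE lb g hmorph_id x a] .
qed

text \<open>The converse direction: the rule at \<open>act X h x\<close> is the kernel condition at
  the translate of \<open>f x\<close> by \<open>h\<close>.\<close>

lemma con_mem:
  assumes X: "hmod k H X" and f: "hmorph k H X nC f"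
    and e: "\<And>x a. x \<in> carrier X \<Longrightarrow> a \<in> carrier A \<Longrightarrow> comp V V V (fst (f x)) (nl a) =
      Br X A nE (\<lambda>a x. comp V V V (nl a) (fst (f x))) x a \<oplus>\<^bsub>nE\<^esub> nl (dact (snd (f x)) a)"
    and x: "x \<in> carrier X"
  shows "f x \<in> carrier nK"
  unfolding con_radical radical_def
proof (intro CollectI conjI ballI)
  note [simp] = hs5
  have mE: "module k nE" by simp
  have lb: "bil A nE nE (\<lambda>a L. comp V V V (nl a) L)" by (rule hbil_bil[OF lhat_comp_hbil(1)[OF A V V]])
  have g: "hmorph k H X nE (\<lambda>x. fst (f x))" by (rule hmorph_comp[OF f con_ambient_fst hmorph_closed[OF f]])
  show "f x \<in> carrier nC" by (rule hmorph_closed[OF f x])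
  fix h a assume h: "h \<in> carrier H" and a: "a \<in> carrier A"
  have hx: "act X h x \<in> carrier X" using grade_hact[OF X] h x by simp
  have "con_form (f (act X h x)) a = \<zero>\<^bsub>nE\<^esub>"
    unfolding con_form_zero_iff[OF hmorph_closed[OF f hx] a] Br_natural[OF X A Em5 A mE lb g hmorph_id hx a, symmetric]
    by (rule e[OF hx a])
  then show "con_form (act nC h (f x)) a = \<zero>\<^bsub>nE\<^esub>" by (simp only: hmorph_act[OF f h x])
qed

end

end

text \<open>\<open>Lmult\<close> and \<open>Rmult\<close> are curried over the endomorphisms and the
  full internal hom, the adjoint family over \<open>P\<close> and \<open>M\<close>. As
  \<open>gW\<close>, \<open>gV\<close> and the inclusion are morphisms, translates and braidings may
  be formed before or after them.\<close>

lemma ad_cur: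
  fixes V :: "('k, 'h, 'v, 'm) gmod_scheme" and W :: "('k, 'h, 'w, 'n) gmod_scheme"
    and P :: "('k, 'h, 'p, 'l) gmod_scheme" and M :: "('k, 'h, 'v \<Rightarrow> 'w, 'i) gmod_scheme"
  assumes V: "hmod k H V" and W: "hmod k H W" and P: "hmod k H P" and M: "hmod k H M"
    and s: "hsub M (ihom k H V W)"
    and gW: "hmorph k H P (iend k H W) gW" and gV: "hmorph k H P (iend k H V) gV"
    and x: "x \<in> carrier P" and K: "K \<in> carrier M"
  shows "(Lmult k H V W (gW x) \<ominus>\<^bsub>iend k H (ihom k H V W)\<^esub> Rmult k H V W (gV x)) K =
    cur P M M (\<lambda>x K. comp V W W (gW x) K \<ominus>\<^bsub>ihom k H V W\<^esub> Br P M (ihom k H V W) (\<lambda>K x. comp V V W K (gV x)) x K) x K"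
proof -
  let ?N = "ihom k H V W" and ?EW = "iend k H W" and ?EV = "iend k H V"
  note Nm = ihom_hmod[OF V W] and EWm = ihom_hmod[OF W W] and EVm = ihom_hmod[OF V V]
  note [simp] = grade_hact[OF V] grade_hact[OF W] grade_hact[OF P] grade_hact[OF M] x K
  note inc = hsub_hmorph[OF s]
  note [simp] = hmorph_closed[OF gW] hmorph_closed[OF gV] hmorph_closed[OF inc]
  have Nmod: "module k ?N" and NNmod: "module k (iend k H ?N)" by simp_all
  have cW: "hbil ?EW ?N ?N (comp V W W)" by (rule hbil_comp[OF V W W])
  have cV: "hbil ?N ?EV ?N (comp V V W)" by (rule hbil_comp[OF V V W])
  note R = hbil_Br[OF EVm Nm Nm cV]
  note hE = grade_hact[OF EWm] grade_hact[OF EVm] grade_hact[OF Nm]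
  have 1: "Lmult k H V W (gW x) = cur ?EW ?N ?N (comp V W W) (gW x)"
    unfolding Lmult_def by (rule zeta_cur[OF hE(1,3,3) hbil_ebil[OF cW]]) (simp_all add: comp_def)
  have 2: "Rmult k H V W (gV x) = cur ?EV ?N ?N (Br ?EV ?N ?N (comp V V W)) (gV x)"
    unfolding Rmult_def
  proof (rule zeta_cur[OF hE(2,3,3) hbil_ebil[OF R]])
    have i: "lin (tensor k ?N ?EV) ?N (icomp k H V V W)" by (rule icomp_lin) simp_all
    show "icomp k H V V W (braid k H ?EV ?N (tpure k ?EV ?N L J)) = Br ?EV ?N ?N (comp V V W) L J"
      if "L \<in> carrier ?EV" "J \<in> carrier ?N" for L J
      unfolding comp_def[abs_def] by (rule braid_Br[OF EVm Nm Nmod i that])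
  qed simp
  have c: "cur ?EW ?N ?N (comp V W W) (gW x) \<in> carrier (iend k H ?N)"
    "cur ?EV ?N ?N (Br ?EV ?N ?N (comp V V W)) (gV x) \<in> carrier (iend k H ?N)"
    by (rule cur_closed[OF hE(1,3,3) hbil_ebil[OF cW]] cur_closed[OF hE(2,3,3) hbil_ebil[OF R]]; simp)+
  have KN: "K \<in> carrier ?N" by simp
  note Bc = bil_closed[OF hbil_bil[OF R]]
  have neg: "\<ominus>\<^bsub>?N\<^esub> s3 ?N Ps T = s3 ?N Ps (\<lambda>a b c. \<ominus>\<^bsub>?N\<^esub> T a b c)"
    if "\<And>a b c. a \<in> carrier H \<Longrightarrow> b \<in> carrier H \<Longrightarrow> c \<in> carrier H \<Longrightarrow> T a b c \<in> carrier ?N" for T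
    by (rule s3_push[OF lin_uminus[OF _ lin_id]]) (simp_all add: that)
  interpret N: module k ?N by simp
  \<comment> \<open>Naturality is needed at every pair of translates that occurs in the sum defining
    \<open>cur\<close>.\<close>
  have nat: "Br P M ?N (\<lambda>K x. comp V V W K (gV x)) (act P p x) (act ?N q K) =
      Br ?EV ?N ?N (comp V V W) (act ?EV p (gV x)) (act ?N q K)"
    if [simp]: "p \<in> carrier H" "q \<in> carrier H" for p q
  proof -
    have "act P p x \<in> carrier P" "act M q K \<in> carrier M" by simp_all
    from Br_natural[OF P M EVm Nm Nmod hbil_bil[OF cV] gV inc this]
    show ?thesis by (simp add: hmorph_act[OF gV] hmorph_act[OF inc])
  qed
  have "(Lmult k H V W (gW x) \<ominus>\<^bsub>iend k H ?N\<^esub> Rmult k H V W (gV x)) K =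
      cur ?EW ?N ?N (comp V W W) (gW x) K \<ominus>\<^bsub>?N\<^esub> cur ?EV ?N ?N (Br ?EV ?N ?N (comp V V W)) (gV x) K"
    unfolding 1 2 by (rule lin_diff[OF NNmod Nmod ihom_app_lin[OF KN] c])
  also have "\<dots> = s3 ?N Ps (\<lambda>p q r. comp V W W (act ?EW p (gW x)) (act ?N (q \<cdot> beta H \<cdot> antip H r) K)) \<ominus>\<^bsub>?N\<^esub>
      s3 ?N Ps (\<lambda>p q r. Br ?EV ?N ?N (comp V V W) (act ?EV p (gV x)) (act ?N (q \<cdot> beta H \<cdot> antip H r) K))"
    by (simp only: cur_app[OF hE(1,3,3) hbil_ebil[OF cW] KN] cur_app[OF hE(2,3,3) hbil_ebil[OF R] KN])
  also have "\<dots> = s3 ?N Ps (\<lambda>p q r. comp V W W (gW (act P p x)) (act M (q \<cdot> beta H \<cdot> antip H r) K) \<ominus>\<^bsub>?N\<^esub>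
      Br P M ?N (\<lambda>K x. comp V V W K (gV x)) (act P p x) (act M (q \<cdot> beta H \<cdot> antip H r) K))"
    by (simp add: a_minus_def neg Bc s3_add nat hmorph_act[OF gW] hmorph_act[OF gV] hmorph_act[OF inc])
  finally show ?thesis
    by (simp add: cur_def hsub_s(2)[OF s])
qed

text \<open>The equality of the two constants on the fibred product gives both connections the same
  derivative term, so the abstract results apply with a single \<open>D\<close>.\<close>

theorem ad_con_fibre_prod:
  fixes A :: "('k, 'h, 'a) halg" and d :: "'k \<Rightarrow> 'a \<Rightarrow> 'a"
    and V :: "('k, 'h, 'a, 'v) hbimod" and W :: "('k, 'h, 'a, 'w) hbimod"
  assumes DC: "differential_calculus k H A d" and VB: "hm_sym_bimodule k H A V" and WB: "hm_sym_bimodule k H A W"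
  defines "P \<equiv> con_fibre_prod k H A d W V" and "M \<equiv> hom_over k H A V W"
  shows "x \<in> carrier P \<Longrightarrow> fst (ad k H V W x) \<in> carrier M \<rightarrow> carrier M"
    and "x \<in> carrier P \<Longrightarrow> ad_induced k H A V W x \<in> carrier (con k H A d M)"
    and "hmorph k H P (con k H A d M) (ad_induced k H A V W)"
proof -
  have AC: "hm_comm_algebra k H A" by (rule differential_calculus.axioms(1)[OF DC])
  note A = comm_algebra_hmod[OF AC WB]
  note dm = differential_calculus.d_morph[OF DC]
  note V = sym_bimodule_lmod[OF A VB] and W = sym_bimodule_lmod[OF A WB]
  note cW = con_hmod[OF A dm W] and cV = con_hmod[OF A dm V]
  let ?G = "gprod (con k H A d W) (con k H A d V)"
  have G: "hmod k H ?G" by (rule gprod_hmod[OF cW cV])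
  have sP: "hsub P ?G"
    using grade_carrier[OF G] unfolding P_def con_fibre_prod_def subobj_def hsub_def by auto
  have fW: "hmorph k H ?G (con k H A d W) fst" and fV: "hmorph k H ?G (con k H A d V) snd"
    by (rule hmorph_fst hmorph_snd)+
  note I = shifted_unit_hmod[of 1]
  have sW: "hmorph k H ?G (shifted_unit k H 1) (\<lambda>x. snd (fst x))"
    by (rule hmorph_comp[OF fW con_hmorph_snd[OF A dm W] hmorph_closed[OF fW]])
  have sV: "hmorph k H ?G (shifted_unit k H 1) (\<lambda>x. snd (snd x))"
    by (rule hmorph_comp[OF fV con_hmorph_snd[OF A dm V] hmorph_closed[OF fV]])
  have P: "hmod k H P"
    by (rule equalizer_hmod[OF G I sW sV sP]) (simp add: P_def con_fibre_prod_def subobj_def)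
  \<comment> \<open>Oriented so that the constant of the connection on \<open>V\<close> is rewritten
    to that of the connection on \<open>W\<close>, from which \<open>?D\<close> is built.\<close>
  have Peq: "snd (snd x) = snd (fst x)" if "x \<in> carrier P" for x
    using that by (simp add: P_def con_fibre_prod_def subobj_def)
  note iP = hsub_hmorph[OF sP]
  have pW: "hmorph k H P (con k H A d W) fst" by (rule hmorph_comp[OF iP fW hmorph_closed[OF iP]])
  have pV: "hmorph k H P (con k H A d V) snd" by (rule hmorph_comp[OF iP fV hmorph_closed[OF iP]])
  have gW: "hmorph k H P (iend k H W) (\<lambda>x. fst (fst x))"
    by (rule hmorph_comp[OF pW con_hmorph_fst[OF A dm W] hmorph_closed[OF pW]])
  have gV: "hmorph k H P (iend k H V) (\<lambda>x. fst (snd x))"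
    by (rule hmorph_comp[OF pV con_hmorph_fst[OF A dm V] hmorph_closed[OF pV]])
  have sP': "hmorph k H P (shifted_unit k H 1) (\<lambda>x. snd (fst x))"
    by (rule hmorph_comp[OF pW con_hmorph_snd[OF A dm W] hmorph_closed[OF pW]])
  let ?d = "dact A d"
  let ?D = "\<lambda>x a. ?d (snd (fst x)) a"
  have D: "hbil P A A ?D"
    by (rule hbil_morph[OF dact_hbil[OF A dm] sP' hmorph_id hmorph_id]) (simp_all add: grade_hact[OF A] grade_hact[OF I])
  have Dt: "?D (act P h x) a = counit H h \<odot>\<^bsub>A\<^esub> ?D x a" if "h \<in> carrier H" "x \<in> carrier P" "a \<in> carrier A" for h x a
    using dact_trivial[OF A dm that(1) _ that(3), of "snd (fst x)"] hmorph_act[OF sP' that(1,2)] hmorph_closed[OF sP' that(2)] by simp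
  note DW = con_connection[OF A dm W P pW]
  have DV: "comp V V V (fst (snd x)) (lhat k H A V a) =
      Br P A (iend k H V) (\<lambda>a x. comp V V V (lhat k H A V a) (fst (snd x))) x a \<oplus>\<^bsub>iend k H V\<^esub> lhat k H A V (?D x a)"
    if "x \<in> carrier P" "a \<in> carrier A" for x a
    using con_connection[OF A dm V P pV that] Peq[OF that(1)] by simp
  have M: "hsub M (ihom k H V W)" "hmod k H M" unfolding M_def by (rule hom_over_simps(2,3)[OF A V W])+
  have Ml: "lmod A M" unfolding M_def by (rule hom_over_lmod[OF A V W hom_over_closed[OF AC V WB]])
  let ?F = "\<lambda>x K. comp V W W (fst (fst x)) K \<ominus>\<^bsub>ihom k H V W\<^esub> Br P M (ihom k H V W) (\<lambda>K x. comp V V W K (fst (snd x))) x K"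
  let ?C = "cur P M M ?F"
  note adj = AC V WB P gW gV D Dt DW DV
  have C: "hmorph k H P (iend k H M) ?C" unfolding M_def by (rule adjoint_hmorph[OF adj])
  have conn: "comp M M M (?C x) (lhat k H A M a) =
      Br P A (iend k H M) (\<lambda>a x. comp M M M (lhat k H A M a) (?C x)) x a \<oplus>\<^bsub>iend k H M\<^esub> lhat k H A M (?D x a)"
    if "x \<in> carrier P" "a \<in> carrier A" for x a
    unfolding M_def by (rule adjoint_connection[OF adj that])
  have adC: "fst (ad k H V W x) K = ?C x K" if "x \<in> carrier P" "K \<in> carrier M" for x K
    using ad_cur[OF lmod_hmod[OF V] lmod_hmod[OF W] P M(2,1) gW gV that]
    by (simp add: ad_def case_prod_beta)
  have sad: "snd (ad k H V W x) = snd (fst x)" for x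
    by (simp add: ad_def case_prod_beta)
  have ind: "ad_induced k H A V W x = (?C x, snd (fst x))" if "x \<in> carrier P" for x
  proof -
    have "restrict (fst (ad k H V W x)) (carrier M) = restrict (?C x) (carrier M)"
      by (rule restrict_ext) (rule adC[OF that])
    \<comment> \<open>\<open>cur\<close> is already extensional on \<open>carrier M\<close>, so the
      outer restriction changes nothing.\<close>
    also have "\<dots> = ?C x" by (simp add: cur_def)
    finally show ?thesis by (simp add: ad_induced_def sad M_def)
  qed
  have pair: "hmorph k H P (con_ambient k H M) (\<lambda>x. (?C x, snd (fst x)))"
    unfolding con_ambient_def by (rule hmorph_pair[OF C sP'])
  have mem: "(?C x, snd (fst x)) \<in> carrier (con k H A d M)" if "x \<in> carrier P" for x
    by (rule con_mem[OF A dm Ml P pair _ that]) (simp only: fst_conv snd_conv conn)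
  show "x \<in> carrier P \<Longrightarrow> fst (ad k H V W x) \<in> carrier M \<rightarrow> carrier M"
    using ihom_app[OF hmorph_closed[OF C]] adC by auto
  show "x \<in> carrier P \<Longrightarrow> ad_induced k H A V W x \<in> carrier (con k H A d M)"
    by (simp add: ind mem)
  show "hmorph k H P (con k H A d M) (ad_induced k H A V W)"
    by (rule hmorph_cong[OF P hmorph_into_hsub[OF pair con_hsub[OF A dm Ml] mem grade_carrier[OF P]] ind])
qed

end

theorem theorem4p14:
  fixes k :: "'k ring" and H :: "('k, 'h) qhopf"
    and A :: "('k, 'h, 'a) halg" and d :: "'k \<Rightarrow> 'a \<Rightarrow> 'a"
    and V :: "('k, 'h, 'a, 'v) hbimod" and W :: "('k, 'h, 'a, 'w) hbimod"
  assumes "quasitriangular_quasi_hopf k H"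
    and "differential_calculus k H A d"
    and "hm_sym_bimodule k H A V"
    and "hm_sym_bimodule k H A W"
  shows "(\<forall>L' L c. ((L', c), (L, c)) \<in> carrier (con_fibre_prod k H A d W V) \<longrightarrow>
            fst (ad k H V W ((L', c), (L, c)))
              \<in> carrier (hom_over k H A V W) \<rightarrow> carrier (hom_over k H A V W) \<and>
            (restrict (fst (ad k H V W ((L', c), (L, c)))) (carrier (hom_over k H A V W)), c)
              \<in> carrier (con k H A d (hom_over k H A V W))) \<and>
         hmorph k H (con_fibre_prod k H A d W V) (con k H A d (hom_over k H A V W))
           (ad_induced k H A V W)"
proof (intro conjI allI impI)
  note main = quasitriangular_quasi_hopf.ad_con_fibre_prod[OF assms]
  fix L' L c assume x: "((L', c), (L, c)) \<in> carrier (con_fibre_prod k H A d W V)"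
  show "fst (ad k H V W ((L', c), (L, c))) \<in> carrier (hom_over k H A V W) \<rightarrow> carrier (hom_over k H A V W)"
    by (rule main(1)[OF x])
  show "(restrict (fst (ad k H V W ((L', c), (L, c)))) (carrier (hom_over k H A V W)), c)
      \<in> carrier (con k H A d (hom_over k H A V W))"
    using main(2)[OF x] by (simp add: ad_induced_def ad_def)
next
  show "hmorph k H (con_fibre_prod k H A d W V) (con k H A d (hom_over k H A V W)) (ad_induced k H A V W)"
    by (rule quasitriangular_quasi_hopf.ad_con_fibre_prod(3)[OF assms])
qed

end
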